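(* Let $\Omega\subset\mathbb{R}^2$ be one of the following domains: (a) an eccentric circle annular domain; (b) an exterior petal-like domain; (c) an annular domain whose interior and exterior boundaries are equally scaled ellipses. Let $f(u)\ge 0$ be a decreasing and real analytic function, and let $u$ be a non-constant solution of $$\Delta u+f(u)=0\ \text{ in }\Omega,\qquad u=0\ \text{ on }\partial\Omega .$$ Then the critical point set $\mathcal{C}(u)$ of $u$ does not contain any Jordan curve.
   Context: The function $f:\mathbb{R}\to\mathbb{R}$ satisfies $f\ge 0$; "decreasing" is meant in the sense $f'\le 0$ (constants are allowed). Solutions are understood in the classical sense. The critical point set is $\mathcal{C}(u)=\{x\in\Omega:\nabla u(x)=0\}$. An annular domain is a bounded planar domain bounded by two disjoint simple closed curves, the interior boundary $\gamma_I$ and the exterior boundary $\gamma_E$, with $\gamma_I$ lying inside $\gamma_E$. $\Omega_{\gamma_E}$ denotes the domain bounded by $\gamma_E$. Eccentric circle annular domain: up to rigid motion, $\gamma_I$ is the circle of radius $r$ centered at $(a,0)$ with $a>0$, and $\gamma_E$ is the circle of radius $R$ centered at $(0,0)$, with $a+r<R$. Exterior petal-like domain: a concentric annular domain with interior boundary $\gamma_I$ and exterior boundary $\gamma_E$ such that $\gamma_E$ is not a circle and: (1) $\gamma_E$ has $k\ge 2$ symmetry axes $l_1,\dots,l_k$, and these are equiangular; (2) $\Omega_{\gamma_E}$ is $l_i$-convex for every $i=1,\dots,k$, i.e. convex in the direction of $l_i$ (every segment parallel to $l_i$ with endpoints in $\Omega_{\gamma_E}$ lies in $\Omega_{\gamma_E}$);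 (3) $\gamma_E$ satisfies the inner (interior) cone condition; (4) $\gamma_I$ is a circle whose center coincides with the center of $\Omega_{\gamma_E}$. Equally scaled ellipses: $\gamma_I$ and $\gamma_E$ are (non-circular) ellipses with the same center and the same axes, one being a dilation of the other about the common center. *)

theory Defs
  imports "HOL-Analysis.Analysis"
begin

section \<open>Differential operators and classical solutions\<close>

definition partial_deriv :: "'a::euclidean_space \<Rightarrow> ('a \<Rightarrow> real) \<Rightarrow> 'a \<Rightarrow> real" where
  "partial_deriv b u x = frechet_derivative u (at x) b"

definition laplacian :: "('a::euclidean_space \<Rightarrow> real) \<Rightarrow> 'a \<Rightarrow> real" where
  "laplacian u x = (\<Sum>b\<in>Basis. partial_deriv b (partial_deriv b u) x)"

text \<open>Intended for open sets \<open>S\<close>: derivatives are taken at points of \<open>S\<close> in the whole space.\<close>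

primrec C_k_on :: "nat \<Rightarrow> ('a::euclidean_space \<Rightarrow> real) \<Rightarrow> 'a set \<Rightarrow> bool" where
  "C_k_on 0 u S \<longleftrightarrow> continuous_on S u"
| "C_k_on (Suc k) u S \<longleftrightarrow>
     (\<forall>x\<in>S. u differentiable (at x)) \<and> (\<forall>b\<in>Basis. C_k_on k (partial_deriv b u) S)"

definition classical_solution ::
  "(real \<Rightarrow> real) \<Rightarrow> (real ^ 2) set \<Rightarrow> (real ^ 2 \<Rightarrow> real) \<Rightarrow> bool" where
  "classical_solution f \<Omega> u \<longleftrightarrow>
     C_k_on 2 u \<Omega> \<and> continuous_on (closure \<Omega>) u \<and>
     (\<forall>x\<in>\<Omega>. laplacian u x + f (u x) = 0) \<and>
     (\<forall>x\<in>frontier \<Omega>. u x = 0)"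

definition critical_points :: "(real ^ 2) set \<Rightarrow> (real ^ 2 \<Rightarrow> real) \<Rightarrow> (real ^ 2) set" where
  "critical_points \<Omega> u = {x \<in> \<Omega>. GDERIV u x :> 0}"

definition real_analytic :: "(real \<Rightarrow> real) \<Rightarrow> bool" where
  "real_analytic f \<longleftrightarrow>
     (\<forall>t. \<exists>r>0. \<exists>a. \<forall>s. \<bar>s - t\<bar> < r \<longrightarrow> (\<lambda>n. a n * (s - t) ^ n) sums f s)"


section \<open>Annular domains\<close>

definition Jordan_curve :: "(real ^ 2) set \<Rightarrow> bool" where
  "Jordan_curve C \<longleftrightarrow> (\<exists>g. simple_path g \<and> pathfinish g = pathstart g \<and> path_image g = C)"

text \<open>
  The domain bounded by a Jordan curve \<open>\<gamma>\<close> is \<^term>\<open>inside \<gamma>\<close>, the bounded part of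
  its complement.
\<close>

definition annular_domain :: "(real ^ 2) set \<Rightarrow> (real ^ 2) set \<Rightarrow> (real ^ 2) set \<Rightarrow> bool" where
  "annular_domain \<Omega> \<gamma>I \<gamma>E \<longleftrightarrow>
     Jordan_curve \<gamma>I \<and> Jordan_curve \<gamma>E \<and> \<gamma>I \<inter> \<gamma>E = {} \<and> \<gamma>I \<subseteq> inside \<gamma>E \<and>
     open \<Omega> \<and> connected \<Omega> \<and> bounded \<Omega> \<and> frontier \<Omega> = \<gamma>I \<union> \<gamma>E"

text \<open>The rigid motion below is \<open>x \<mapsto> p + A x\<close>.\<close>

definition eccentric_circle_annular_domain :: "(real ^ 2) set \<Rightarrow> bool" where
  "eccentric_circle_annular_domain \<Omega> \<longleftrightarrow>
     (\<exists>\<gamma>I \<gamma>E p a r R. \<exists>A :: real ^ 2 \<Rightarrow> real ^ 2. annular_domain \<Omega> \<gamma>I \<gamma>E \<and>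
        orthogonal_transformation A \<and> 0 < a \<and> 0 < r \<and> a + r < R \<and>
        \<gamma>I = (\<lambda>x. p + A x) ` sphere (vector [a, 0]) r \<and>
        \<gamma>E = (\<lambda>x. p + A x) ` sphere (vector [0, 0]) R)"

definition ellipse ::
  "real ^ 2 \<Rightarrow> real ^ 2 \<Rightarrow> real ^ 2 \<Rightarrow> real \<Rightarrow> real \<Rightarrow> (real ^ 2) set" where
  "ellipse c v w a b = {x. (((x - c) \<bullet> v) / a)\<^sup>2 + (((x - c) \<bullet> w) / b)\<^sup>2 = 1}"

text \<open>
  Here \<open>c\<close> is the center, the orthonormal vectors \<open>v\<close>, \<open>w\<close> span the axes, and
  \<open>a\<close>, \<open>b\<close> are the semi-axes. Since the interior boundary lies inside the exterior
  one, the exterior ellipse is the larger one.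
\<close>

definition scaled_ellipses_annular_domain :: "(real ^ 2) set \<Rightarrow> bool" where
  "scaled_ellipses_annular_domain \<Omega> \<longleftrightarrow>
     (\<exists>\<gamma>I \<gamma>E c v w a b s. annular_domain \<Omega> \<gamma>I \<gamma>E \<and>
        norm v = 1 \<and> norm w = 1 \<and> v \<bullet> w = 0 \<and> 0 < a \<and> 0 < b \<and> a \<noteq> b \<and> 1 < s \<and>
        \<gamma>I = ellipse c v w a b \<and>
        \<gamma>E = (\<lambda>x. c + s *\<^sub>R (x - c)) ` \<gamma>I)"


section \<open>Exterior petal-like domains\<close>

definition direction :: "real \<Rightarrow> real ^ 2" where
  "direction \<phi> = vector [cos \<phi>, sin \<phi>]"

text \<open>Reflection in the line through \<open>c\<close> with unit direction \<open>d\<close>.\<close>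

definition reflect_line :: "real ^ 2 \<Rightarrow> real ^ 2 \<Rightarrow> real ^ 2 \<Rightarrow> real ^ 2" where
  "reflect_line c d x = c + (2 * ((x - c) \<bullet> d)) *\<^sub>R d - (x - c)"

definition symmetry_axis :: "real ^ 2 \<Rightarrow> real ^ 2 \<Rightarrow> (real ^ 2) set \<Rightarrow> bool" where
  "symmetry_axis c d S \<longleftrightarrow> reflect_line c d ` S = S"

definition convex_in_direction :: "real ^ 2 \<Rightarrow> (real ^ 2) set \<Rightarrow> bool" where
  "convex_in_direction d S \<longleftrightarrow>
     (\<forall>x\<in>S. \<forall>y\<in>S. (\<exists>t. y - x = t *\<^sub>R d) \<longrightarrow> closed_segment x y \<subseteq> S)"

text \<open>
  Closed circular cone of height \<open>h\<close> and half-aperture \<open>\<alpha>\<close> with vertex \<open>p\<close> and unit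
  axis direction \<open>d\<close>.
\<close>

definition finite_cone :: "real ^ 2 \<Rightarrow> real ^ 2 \<Rightarrow> real \<Rightarrow> real \<Rightarrow> (real ^ 2) set" where
  "finite_cone p d \<alpha> h = {x. norm (x - p) \<le> h \<and> norm (x - p) * cos \<alpha> \<le> (x - p) \<bullet> d}"

definition interior_cone_condition :: "(real ^ 2) set \<Rightarrow> bool" where
  "interior_cone_condition D \<longleftrightarrow>
     (\<forall>p\<in>frontier D. \<exists>d \<alpha> h. norm d = 1 \<and> 0 < \<alpha> \<and> \<alpha> < pi / 2 \<and> 0 < h \<and>
        finite_cone p d \<alpha> h - {p} \<subseteq> D)"

text \<open>
  The axes of a bounded set are concurrent; \<open>c\<close> is their common point, the center.
  Equiangular means that neighbouring axes meet at the angle \<open>\<pi> / k\<close>, so that the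
  \<open>i\<close>-th axis has direction angle \<open>\<theta> + i \<pi> / k\<close>.
\<close>

definition exterior_petal_like_domain :: "(real ^ 2) set \<Rightarrow> bool" where
  "exterior_petal_like_domain \<Omega> \<longleftrightarrow>
     (\<exists>\<gamma>I \<gamma>E c \<theta> r. \<exists>k::nat. annular_domain \<Omega> \<gamma>I \<gamma>E \<and>
        \<not> (\<exists>q \<rho>. \<gamma>E = sphere q \<rho>) \<and> 2 \<le> k \<and>
        (\<forall>i<k. symmetry_axis c (direction (\<theta> + real i * pi / real k)) \<gamma>E) \<and>
        (\<forall>i<k. convex_in_direction (direction (\<theta> + real i * pi / real k)) (inside \<gamma>E)) \<and>
        interior_cone_condition (inside \<gamma>E) \<and>
        0 < r \<and> \<gamma>I = sphere c r)"

end

theory Submission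
  imports Defs "HOL-Complex_Analysis.Cauchy_Integral_Formula"
begin

text \<open>
  If \<open>f\<close> vanishes somewhere, then it vanishes identically and \<open>u\<close> is constant; so \<open>f > 0\<close>. Let \<open>C\<close> be a
  Jordan curve of critical points. It surrounds the hole, since otherwise every translation
  derivative of \<open>u\<close> would vanish on the region bounded by \<open>C\<close>. Since the gradient vanishes on \<open>C\<close>,
  the part of \<open>\<Omega>\<close> on either side of \<open>C\<close> can be compared with its images under isometries. If \<open>u\<close> is
  at most its value on \<open>C\<close>, then continuing it across \<open>C\<close> by this constant gives a subsolution, and
  images under conformal contractions can be compared as well.

  Circular hole: between the hole and \<open>C\<close> all rotations about the centre give the angular derivative
  zero. By unique continuation \<open>u\<close> is radial up to the largest concentric circle in \<open>\<Omega>\<close>; the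
  boundary condition then holds on this circle, which is therefore the exterior boundary.

  Ellipses: \<open>u\<close> is a constant \<open>c\<close> on \<open>C\<close>. Let \<open>K\<close> be \<open>C\<close> made symmetric, with the outer ellipse
  \<open>E\<^sup>2 x\<^sup>2 + y\<^sup>2 = 1\<close> and the inner one \<open>E\<^sup>2 x\<^sup>2 + y\<^sup>2 = \<beta>\<^sup>2\<close>. Let \<open>K\<close>
  first meet the long axis at distance \<open>n\<close> from the centre, and the short axis first at \<open>mi\<close> and last
  at \<open>m\<close>. Four estimates are incompatible: \<open>n \<le> mi + \<beta> (1 / E - 1)\<close> from a quarter turn of the inner side, a
  lower bound of \<open>n / m\<close> from an inversion-type map on the outer side, a lower bound of \<open>E n\<close> from the
  profile of \<open>u\<close> on the short axis, and \<open>\<beta> \<le> mi exp (1 - 1 / m)\<close> from comparing the profiles of the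
  two sides on that axis.
\<close>

section \<open>Comparison of solutions\<close>

text \<open>The curve \<open>C\<close> is only continuous, so no normal derivative and no boundary
  point lemma is available on it. The substitute: near \<open>C\<close> the gradient is below any
  \<epsilon>, so an isometry that displaces points by at most \<eta> changes \<open>u\<close> on
  \<open>C\<close> by at most \<epsilon> \<eta>. The comparison principle carries this error into
  the region, and division by \<eta> removes it. For derivatives along isometries \<open>C\<close>
  thus does not count as a boundary; only the other boundary component has to be respected. A circle
  is invariant under a full group of rotations, which yields an identity. An ellipse yields only
  signs, and this forces the last case to be quantitative. Its limit \<open>E\<close> = 1 is the
  concentric annulus, whose radial solutions do have critical circles. Hence the upper and the lower
  bound of n / m - 1 both vanish to first order in 1 - E, and the constants matter: the
  inversion-type map decides for \<open>E\<close> close to 1, the profile on the short axis for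
  small \<open>E\<close>.\<close>

text \<open>A Laplacian at one point: first derivatives near \<open>p\<close>, second ones only at
  \<open>p\<close>. The relational form lets it be attached to a smooth function that merely touches
  a rougher one at \<open>p\<close>. The plane is \<open>complex\<close> so that conformal maps can
  be composed.\<close>

definition has_lap :: "(complex \<Rightarrow> real) \<Rightarrow> real \<Rightarrow> complex \<Rightarrow> bool" where
  "has_lap u L p \<longleftrightarrow> (\<exists>ux uy a b b' d.
     (\<forall>\<^sub>F z in nhds p. (u has_derivative (\<lambda>h. ux z * Re h + uy z * Im h)) (at z)) \<and>
     (ux has_derivative (\<lambda>h. a * Re h + b * Im h)) (at p) \<and>
     (uy has_derivative (\<lambda>h. b' * Re h + d * Im h)) (at p) \<and> L = a + d)"

lemma has_lapI:
  assumes "\<forall>\<^sub>F z in nhds p. (u has_derivative (\<lambda>h. ux z * Re h + uy z * Im h)) (at z)"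
    and "(ux has_derivative (\<lambda>h. a * Re h + b * Im h)) (at p)"
    and "(uy has_derivative (\<lambda>h. b' * Re h + d * Im h)) (at p)" and "L = a + d"
  shows "has_lap u L p"
  unfolding has_lap_def using assms
  by (intro exI[of _ ux] exI[of _ uy] exI[of _ a] exI[of _ b] exI[of _ b'] exI[of _ d]) simp

text \<open>If \<open>k > 0\<close>, then \<open>\<phi>'\<close> is positive just to the right of
  its zero at 0, so \<open>\<phi>\<close> would increase strictly there.\<close>

lemma second_derivative_local_max:
  fixes \<phi> \<phi>' :: "real \<Rightarrow> real"
  assumes d1: "\<forall>\<^sub>F t in nhds 0. (\<phi> has_real_derivative \<phi>' t) (at t)"
    and d2: "(\<phi>' has_real_derivative k) (at 0)"
    and mx: "\<forall>\<^sub>F t in nhds 0. \<phi> t \<le> \<phi> 0"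
  shows "k \<le> 0"
proof (rule ccontr)
  assume "\<not> k \<le> 0" then have k: "k > 0" by simp
  obtain e1 where e1: "e1 > 0" "\<And>t. \<bar>t\<bar> < e1 \<Longrightarrow> (\<phi> has_real_derivative \<phi>' t) (at t)"
    using d1 unfolding eventually_nhds_metric dist_real_def by auto
  obtain e2 where e2: "e2 > 0" "\<And>t. \<bar>t\<bar> < e2 \<Longrightarrow> \<phi> t \<le> \<phi> 0"
    using mx unfolding eventually_nhds_metric dist_real_def by auto
  have z: "\<phi>' 0 = 0"
    by (rule DERIV_local_max[of \<phi> _ 0 e2]) (use e1 e2 in auto)
  obtain d where d: "d > 0" "\<And>h. h > 0 \<Longrightarrow> h < d \<Longrightarrow> \<phi>' 0 < \<phi>' (0 + h)"
    using DERIV_pos_inc_right[OF d2 k] by auto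
  define t where "t = min (min e1 e2) d / 2"
  have t: "t > 0" "t < e1" "t < e2" "t < d" using e1 e2 d unfolding t_def by auto
  have "\<phi> 0 < \<phi> t"
  proof (rule DERIV_pos_imp_increasing_open[OF t(1)])
    fix x :: real assume x: "0 < x" "x < t"
    show "\<exists>y. (\<phi> has_real_derivative y) (at x) \<and> 0 < y"
      using e1(2)[of x] d(2)[of x] x t z by (intro exI[of _ "\<phi>' x"]) auto
  next
    show "continuous_on {0..t} \<phi>"
      using e1(2) t by (intro DERIV_atLeastAtMost_imp_continuous_on) force
  qed
  with e2(2)[of t] t show False by auto
qed

lemma has_derivative_line:
  fixes u :: "complex \<Rightarrow> real"
  assumes "(u has_derivative D) (at (p + of_real t * e))"
  shows "((\<lambda>s. u (p + of_real s * e)) has_real_derivative D e) (at t)"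
proof -
  have l: "((\<lambda>s::real. p + of_real s * e) has_derivative (\<lambda>h. of_real h * e)) (at t)"
    by (auto intro!: derivative_eq_intros)
  have lin: "linear D" using assms by (rule has_derivative_linear)
  have "((\<lambda>s. u (p + of_real s * e)) has_derivative (\<lambda>h. D (of_real h * e))) (at t)"
    using has_derivative_compose[OF l assms] by simp
  moreover have "(\<lambda>h. D (of_real h * e)) = (\<lambda>h. D e * h)"
    using linear_scale[OF lin, of _ e] by (simp add: scaleR_conv_of_real fun_eq_iff)
  ultimately show ?thesis by (simp add: has_field_derivative_def)
qed

lemma has_lap_local_max:
  assumes L: "has_lap u L p" and mx: "\<forall>\<^sub>F z in nhds p. u z \<le> u p"
  shows "L \<le> 0"
proof -
  obtain ux uy a b b' d where
    u: "\<forall>\<^sub>F z in nhds p. (u has_derivative (\<lambda>h. ux z * Re h + uy z * Im h)) (at z)" and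
    ux: "(ux has_derivative (\<lambda>h. a * Re h + b * Im h)) (at p)" and
    uy: "(uy has_derivative (\<lambda>h. b' * Re h + d * Im h)) (at p)" and Lad: "L = a + d"
    using L unfolding has_lap_def by blast
  have lim: "filterlim (\<lambda>t::real. p + of_real t * e) (nhds p) (nhds 0)" for e
  proof -
    have "((\<lambda>t::real. p + of_real t * e) \<longlongrightarrow> p + of_real 0 * e) (nhds 0)"
      by (intro tendsto_intros filterlim_ident tendsto_of_real)
    then show ?thesis by simp
  qed
  have ux': "(ux has_derivative (\<lambda>h. a * Re h + b * Im h)) (at (p + of_real 0 * 1))"
    and uy': "(uy has_derivative (\<lambda>h. b' * Re h + d * Im h)) (at (p + of_real 0 * \<i>))"
    using ux uy by auto
  have "a \<le> 0"
  proof (rule second_derivative_local_max)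
    show "\<forall>\<^sub>F t in nhds 0. ((\<lambda>t. u (p + of_real t * 1)) has_real_derivative ux (p + of_real t * 1)) (at t)"
      using eventually_compose_filterlim[OF u lim[of 1]]
      by eventually_elim (drule has_derivative_line, simp)
    show "((\<lambda>t. ux (p + of_real t * 1)) has_real_derivative a) (at 0)"
      using has_derivative_line[OF ux'] by simp
    show "\<forall>\<^sub>F t in nhds 0. u (p + of_real t * 1) \<le> u (p + of_real 0 * 1)"
      using eventually_compose_filterlim[OF mx lim[of 1]] by simp
  qed
  moreover have "d \<le> 0"
  proof (rule second_derivative_local_max)
    show "\<forall>\<^sub>F t in nhds 0. ((\<lambda>t. u (p + of_real t * \<i>)) has_real_derivative uy (p + of_real t * \<i>)) (at t)"
      using eventually_compose_filterlim[OF u lim[of \<i>]]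
      by eventually_elim (drule has_derivative_line, simp)
    show "((\<lambda>t. uy (p + of_real t * \<i>)) has_real_derivative d) (at 0)"
      using has_derivative_line[OF uy'] by simp
    show "\<forall>\<^sub>F t in nhds 0. u (p + of_real t * \<i>) \<le> u (p + of_real 0 * \<i>)"
      using eventually_compose_filterlim[OF mx lim[of \<i>]] by simp
  qed
  ultimately show ?thesis using Lad by simp
qed

lemma has_lap_const: "has_lap (\<lambda>_. k) 0 p"
  unfolding has_lap_def
  by (rule exI[of _ "\<lambda>_. 0"], rule exI[of _ "\<lambda>_. 0"], rule exI[of _ 0], rule exI[of _ 0],
      rule exI[of _ 0], rule exI[of _ 0]) auto

lemma has_lap_lincomb:
  assumes "has_lap u L p" "has_lap v M p"
  shows "has_lap (\<lambda>z. r * u z + s * v z) (r * L + s * M) p"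
proof -
  obtain ux uy a b b' d where
    u: "\<forall>\<^sub>F z in nhds p. (u has_derivative (\<lambda>h. ux z * Re h + uy z * Im h)) (at z)" and
    ux: "(ux has_derivative (\<lambda>h. a * Re h + b * Im h)) (at p)" and
    uy: "(uy has_derivative (\<lambda>h. b' * Re h + d * Im h)) (at p)" and Lad: "L = a + d"
    using assms(1) unfolding has_lap_def by blast
  obtain vx vy k l l' m where
    v: "\<forall>\<^sub>F z in nhds p. (v has_derivative (\<lambda>h. vx z * Re h + vy z * Im h)) (at z)" and
    vx: "(vx has_derivative (\<lambda>h. k * Re h + l * Im h)) (at p)" and
    vy: "(vy has_derivative (\<lambda>h. l' * Re h + m * Im h)) (at p)" and Mkm: "M = k + m"
    using assms(2) unfolding has_lap_def by blast
  have 1: "\<forall>\<^sub>F z in nhds p. ((\<lambda>z. r * u z + s * v z) has_derivative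
      (\<lambda>h. (r * ux z + s * vx z) * Re h + (r * uy z + s * vy z) * Im h)) (at z)"
    using u v
  proof eventually_elim
    case (elim z)
    show ?case
      by (rule has_derivative_eq_rhs, rule has_derivative_add,
          rule has_derivative_mult_right[OF elim(1)], rule has_derivative_mult_right[OF elim(2)])
         (simp add: algebra_simps)
  qed
  have 2: "((\<lambda>z. r * ux z + s * vx z) has_derivative
      (\<lambda>h. (r * a + s * k) * Re h + (r * b + s * l) * Im h)) (at p)"
    by (rule has_derivative_eq_rhs, rule has_derivative_add,
        rule has_derivative_mult_right[OF ux], rule has_derivative_mult_right[OF vx])
       (simp add: algebra_simps)
  have 3: "((\<lambda>z. r * uy z + s * vy z) has_derivative
      (\<lambda>h. (r * b' + s * l') * Re h + (r * d + s * m) * Im h)) (at p)"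
    by (rule has_derivative_eq_rhs, rule has_derivative_add,
        rule has_derivative_mult_right[OF uy], rule has_derivative_mult_right[OF vy])
       (simp add: algebra_simps)
  show ?thesis unfolding has_lap_def using 1 2 3 Lad Mkm
    by (intro exI[of _ "\<lambda>z. r * ux z + s * vx z"] exI[of _ "\<lambda>z. r * uy z + s * vy z"] exI[of _ "r * a + s * k"]
        exI[of _ "r * b + s * l"] exI[of _ "r * b' + s * l'"] exI[of _ "r * d + s * m"])
      (auto simp: algebra_simps)
qed

lemma has_lap_norm2: "has_lap (\<lambda>z. (cmod z)\<^sup>2) 4 p"
proof -
  have "((\<lambda>z. (Re z)\<^sup>2 + (Im z)\<^sup>2) has_derivative (\<lambda>h. (2 * Re z) * Re h + (2 * Im z) * Im h)) (at z)" for z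
    by (auto intro!: derivative_eq_intros)
  moreover have "((\<lambda>z. 2 * Re z) has_derivative (\<lambda>h. 2 * Re h + 0 * Im h)) (at p)"
    "((\<lambda>z. 2 * Im z) has_derivative (\<lambda>h. 0 * Re h + 2 * Im h)) (at p)"
    by (auto intro!: derivative_eq_intros)
  ultimately show ?thesis unfolding has_lap_def cmod_power2
    by (intro exI[of _ "\<lambda>z. 2 * Re z"] exI[of _ "\<lambda>z. 2 * Im z"] exI[of _ 2] exI[of _ 0]) auto
qed

text \<open>Conformal covariance of the Laplacian. By the Cauchy-Riemann equations the terms
  containing the second derivative of \<open>\<sigma>\<close> cancel in the trace, and the others
  combine to the square of \<open>cmod (\<sigma>' p)\<close>.\<close>

lemma has_lap_compose_holomorphic:
  fixes \<sigma> \<sigma>' :: "complex \<Rightarrow> complex"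
  assumes L: "has_lap u L (\<sigma> p)"
    and s1: "\<forall>\<^sub>F z in nhds p. (\<sigma> has_field_derivative \<sigma>' z) (at z)"
    and s2: "(\<sigma>' has_field_derivative k) (at p)"
  shows "has_lap (\<lambda>z. u (\<sigma> z)) ((cmod (\<sigma>' p))\<^sup>2 * L) p"
proof -
  obtain ux uy a b b' d where
    u: "\<forall>\<^sub>F z in nhds (\<sigma> p). (u has_derivative (\<lambda>h. ux z * Re h + uy z * Im h)) (at z)" and
    ux: "(ux has_derivative (\<lambda>h. a * Re h + b * Im h)) (at (\<sigma> p))" and
    uy: "(uy has_derivative (\<lambda>h. b' * Re h + d * Im h)) (at (\<sigma> p))" and Lad: "L = a + d"
    using L unfolding has_lap_def by blast
  have s1p: "(\<sigma> has_field_derivative \<sigma>' p) (at p)" using eventually_nhds_x_imp_x[OF s1] .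
  have "filterlim \<sigma> (nhds (\<sigma> p)) (nhds p)"
    using DERIV_isCont[OF s1p] by (simp add: isCont_def tendsto_at_iff_tendsto_nhds)
  from eventually_compose_filterlim[OF u this] s1
  have 1: "\<forall>\<^sub>F z in nhds p. ((\<lambda>z. u (\<sigma> z)) has_derivative
     (\<lambda>h. (ux (\<sigma> z) * Re (\<sigma>' z) + uy (\<sigma> z) * Im (\<sigma>' z)) * Re h
        + (uy (\<sigma> z) * Re (\<sigma>' z) - ux (\<sigma> z) * Im (\<sigma>' z)) * Im h)) (at z)"
  proof eventually_elim
    case (elim z)
    have "(\<sigma> has_derivative (\<lambda>h. \<sigma>' z * h)) (at z)" using elim(2) by (simp add: has_field_derivative_def)
    from has_derivative_compose[OF this elim(1)]
    show ?case by (rule has_derivative_eq_rhs) (auto simp: algebra_simps)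
  qed
  have sd: "(\<sigma> has_derivative (\<lambda>h. \<sigma>' p * h)) (at p)" "(\<sigma>' has_derivative (\<lambda>h. k * h)) (at p)"
    using s1p s2 by (auto simp: has_field_derivative_def)
  note c = has_derivative_compose[OF sd(1) ux] has_derivative_compose[OF sd(1) uy]
  define \<alpha> \<beta> where "\<alpha> = Re (\<sigma>' p)" "\<beta> = Im (\<sigma>' p)"
  have r: "((\<lambda>z. Re (\<sigma>' z)) has_derivative (\<lambda>h. Re (k * h))) (at p)"
    and i: "((\<lambda>z. Im (\<sigma>' z)) has_derivative (\<lambda>h. Im (k * h))) (at p)"
    using sd(2) by (auto intro!: derivative_eq_intros)
  let ?A = "a * \<alpha> + b * \<beta>" and ?B = "b * \<alpha> - a * \<beta>" and ?C = "b' * \<alpha> + d * \<beta>" and ?D = "d * \<alpha> - b' * \<beta>"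
  let ?x = "ux (\<sigma> p)" and ?y = "uy (\<sigma> p)"
  have 2: "((\<lambda>z. ux (\<sigma> z) * Re (\<sigma>' z) + uy (\<sigma> z) * Im (\<sigma>' z)) has_derivative
     (\<lambda>h. (?A * \<alpha> + ?x * Re k + ?C * \<beta> + ?y * Im k) * Re h
        + (?B * \<alpha> - ?x * Im k + ?D * \<beta> + ?y * Re k) * Im h)) (at p)"
    by (rule has_derivative_eq_rhs,
        rule has_derivative_add[OF has_derivative_mult[OF c(1) r] has_derivative_mult[OF c(2) i]])
       (auto simp: \<alpha>_\<beta>_def algebra_simps)
  have 3: "((\<lambda>z. uy (\<sigma> z) * Re (\<sigma>' z) - ux (\<sigma> z) * Im (\<sigma>' z)) has_derivative
     (\<lambda>h. (?C * \<alpha> + ?y * Re k - ?A * \<beta> - ?x * Im k) * Re h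
        + (?D * \<alpha> - ?y * Im k - ?B * \<beta> - ?x * Re k) * Im h)) (at p)"
    by (rule has_derivative_eq_rhs,
        rule has_derivative_diff[OF has_derivative_mult[OF c(2) r] has_derivative_mult[OF c(1) i]])
       (auto simp: \<alpha>_\<beta>_def algebra_simps)
  have "(cmod (\<sigma>' p))\<^sup>2 * L = (?A * \<alpha> + ?x * Re k + ?C * \<beta> + ?y * Im k) + (?D * \<alpha> - ?y * Im k - ?B * \<beta> - ?x * Re k)"
    unfolding cmod_power2 Lad \<alpha>_\<beta>_def by (simp add: algebra_simps power2_eq_square)
  with 1 2 3 show ?thesis by (intro has_lapI)
qed

lemma has_lap_compose_cnj:
  assumes L: "has_lap u L (cnj p)"
  shows "has_lap (\<lambda>z. u (cnj z)) L p"
proof -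
  obtain ux uy a b b' d where
    u: "\<forall>\<^sub>F z in nhds (cnj p). (u has_derivative (\<lambda>h. ux z * Re h + uy z * Im h)) (at z)" and
    ux: "(ux has_derivative (\<lambda>h. a * Re h + b * Im h)) (at (cnj p))" and
    uy: "(uy has_derivative (\<lambda>h. b' * Re h + d * Im h)) (at (cnj p))" and Lad: "L = a + d"
    using L unfolding has_lap_def by blast
  have c: "(cnj has_derivative cnj) (at z)" for z
    by (rule bounded_linear_imp_has_derivative[OF bounded_linear_cnj])
  have "filterlim cnj (nhds (cnj p)) (nhds p)"
    by (intro tendsto_intros filterlim_ident)
  from eventually_compose_filterlim[OF u this]
  have 1: "\<forall>\<^sub>F z in nhds p. ((\<lambda>z. u (cnj z)) has_derivative
     (\<lambda>h. ux (cnj z) * Re h + (- uy (cnj z)) * Im h)) (at z)"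
  proof eventually_elim
    case (elim z)
    from has_derivative_compose[OF c elim(1)]
    show ?case by (rule has_derivative_eq_rhs) auto
  qed
  have 2: "((\<lambda>z. ux (cnj z)) has_derivative (\<lambda>h. a * Re h + (- b) * Im h)) (at p)"
    using has_derivative_compose[OF c ux] by simp
  have 3: "((\<lambda>z. - uy (cnj z)) has_derivative (\<lambda>h. (- b') * Re h + d * Im h)) (at p)"
    by (rule has_derivative_eq_rhs, rule has_derivative_minus[OF has_derivative_compose[OF c uy]]) auto
  show ?thesis unfolding has_lap_def using 1 2 3 Lad
    by (intro exI[of _ "\<lambda>z. ux (cnj z)"] exI[of _ "\<lambda>z. - uy (cnj z)"] exI conjI)
qed

text \<open>The subsolution property of \<open>v\<close> is asked in the viscosity sense, through a
  smooth \<open>v0\<close> touching \<open>v\<close> from below, because capped functions are not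
  twice differentiable across a critical curve. It is asked only where \<open>v\<close> exceeds
  \<open>U + \<epsilon>\<close>; there a decreasing nonlinearity has the right sign. A small
  multiple of the squared norm makes the Laplacian of the difference positive, which a maximum point
  excludes.\<close>

lemma comparison_principle:
  fixes v U :: "complex \<Rightarrow> real"
  assumes W: "open W" "bounded W"
    and cont: "continuous_on (closure W) v" "continuous_on (closure W) U"
    and fr: "\<And>p. p \<in> closure W \<Longrightarrow> p \<notin> W \<Longrightarrow> v p \<le> U p + \<epsilon>"
    and int: "\<And>p. p \<in> W \<Longrightarrow> v p > U p + \<epsilon> \<Longrightarrow>
      \<exists>v0 L M. (\<forall>\<^sub>F z in nhds p. v0 z \<le> v z) \<and> v0 p = v p \<and> has_lap v0 L p \<and> has_lap U M p \<and> L \<ge> M"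
    and z: "z \<in> W"
  shows "v z \<le> U z + \<epsilon>"
proof (rule ccontr)
  assume "\<not> v z \<le> U z + \<epsilon>"
  define \<eta> where "\<eta> = v z - U z - \<epsilon>"
  have \<eta>: "\<eta> > 0" using \<open>\<not> _\<close> unfolding \<eta>_def by simp
  obtain B where B: "B > 0" "\<And>x. x \<in> closure W \<Longrightarrow> cmod x \<le> B"
    using bounded_closure[OF W(2)] bounded_pos by blast
  \<comment> \<open>Small enough that the added term is at most half of the excess
    \<open>\<eta>\<close> on the closure, so the maximum of \<open>\<Phi>\<close> cannot lie on the
    boundary.\<close>
  define \<delta> where "\<delta> = \<eta> / (2 * B\<^sup>2)"
  have \<delta>: "\<delta> > 0" using \<eta> B unfolding \<delta>_def by simp
  have \<delta>B: "\<delta> * (cmod x)\<^sup>2 \<le> \<eta> / 2" if "x \<in> closure W" for x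
  proof -
    have "(cmod x)\<^sup>2 \<le> B\<^sup>2" using B(2)[OF that] by (intro power_mono) auto
    then have "\<delta> * (cmod x)\<^sup>2 \<le> \<delta> * B\<^sup>2" using \<delta> by (intro mult_left_mono) auto
    then show ?thesis using B unfolding \<delta>_def by simp
  qed
  define \<Phi> where "\<Phi> x = v x - U x + \<delta> * (cmod x)\<^sup>2" for x
  have "compact (closure W)" using W by (simp add: compact_closure)
  moreover have "closure W \<noteq> {}" using z by auto
  moreover have "continuous_on (closure W) \<Phi>"
    unfolding \<Phi>_def using cont by (intro continuous_intros)
  ultimately obtain p where p: "p \<in> closure W" "\<And>x. x \<in> closure W \<Longrightarrow> \<Phi> x \<le> \<Phi> p"
    using continuous_attains_sup by meson
  have zW: "z \<in> closure W" using z closure_subset by blast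
  have "\<Phi> z \<ge> \<eta> + \<epsilon>" unfolding \<Phi>_def \<eta>_def using \<delta> by simp
  with p(2)[OF zW] have "v p - U p \<ge> \<eta> / 2 + \<epsilon>" using \<delta>B[OF p(1)] unfolding \<Phi>_def by linarith
  then have vp: "v p > U p + \<epsilon>" using \<eta> by linarith
  then have pW: "p \<in> W" using fr[OF p(1)] by force
  from int[OF pW vp] obtain v0 L M where v0: "\<forall>\<^sub>F z in nhds p. v0 z \<le> v z" "v0 p = v p"
     "has_lap v0 L p" "has_lap U M p" "L \<ge> M" by blast
  have l: "has_lap (\<lambda>x. v0 x - U x + \<delta> * (cmod x)\<^sup>2) (L - M + 4 * \<delta>) p"
    using has_lap_lincomb[OF has_lap_lincomb[OF v0(3,4), of 1 "-1"] has_lap_norm2, of 1 \<delta>] by (simp add: algebra_simps)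
  have "\<forall>\<^sub>F x in nhds p. x \<in> W" using W pW by (simp add: eventually_nhds_in_open)
  with v0(1) have "\<forall>\<^sub>F x in nhds p. v0 x - U x + \<delta> * (cmod x)\<^sup>2 \<le> v0 p - U p + \<delta> * (cmod p)\<^sup>2"
  proof eventually_elim
    case (elim x)
    then have "\<Phi> x \<le> \<Phi> p" using p(2) closure_subset by blast
    then show ?case using elim v0(2) unfolding \<Phi>_def by simp
  qed
  from has_lap_local_max[OF l this] v0(5) \<delta> show False by linarith
qed

section \<open>Positive solutions and their finite differences along isometries\<close>

text \<open>\<open>u\<close> is the solution extended by zero to the plane; its continuity on
  \<open>UNIV\<close> encodes the boundary condition, and \<open>u\<close> can be evaluated at
  images of points under any map. The derivatives are parameters, so that they can be named without
  choosing them.\<close>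

locale elliptic_solution =
  fixes u ux uy a b b' d :: "complex \<Rightarrow> real" and g :: "real \<Rightarrow> real" and \<Omega> :: "complex set"
  assumes open_dom: "open \<Omega>" and bounded_dom: "bounded \<Omega>"
    and cont_u: "continuous_on UNIV u"
    and outside_zero: "\<And>z. z \<notin> \<Omega> \<Longrightarrow> u z = 0"
    and du: "\<And>z. z \<in> \<Omega> \<Longrightarrow> (u has_derivative (\<lambda>h. ux z * Re h + uy z * Im h)) (at z)"
    and dux: "\<And>z. z \<in> \<Omega> \<Longrightarrow> (ux has_derivative (\<lambda>h. a z * Re h + b z * Im h)) (at z)"
    and duy: "\<And>z. z \<in> \<Omega> \<Longrightarrow> (uy has_derivative (\<lambda>h. b' z * Re h + d z * Im h)) (at z)"
    and cont2: "continuous_on \<Omega> a" "continuous_on \<Omega> b" "continuous_on \<Omega> b'" "continuous_on \<Omega> d"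
    and eqn: "\<And>z. z \<in> \<Omega> \<Longrightarrow> a z + d z = - g (u z)"
    and g_pos: "\<And>t. 0 < g t" and g_antimono: "\<And>s t. s \<le> t \<Longrightarrow> g t \<le> g s"
begin

lemma has_lap_u:
  assumes "z \<in> \<Omega>" shows "has_lap u (- g (u z)) z"
proof (rule has_lapI[OF _ dux[OF assms] duy[OF assms]])
  show "\<forall>\<^sub>F z in nhds z. (u has_derivative (\<lambda>h. ux z * Re h + uy z * Im h)) (at z)"
    using eventually_nhds_in_open[OF open_dom assms] by eventually_elim (rule du)
qed (simp add: eqn[OF assms])

lemma no_local_min:
  assumes z: "z \<in> \<Omega>" and "\<forall>\<^sub>F w in nhds z. u z \<le> u w" shows False
proof -
  have "has_lap (\<lambda>w. (-1) * u w + 0 * 0) ((-1) * (- g (u z)) + 0 * 0) z"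
    by (rule has_lap_lincomb[OF has_lap_u[OF z] has_lap_const])
  from has_lap_local_max[OF this] assms(2) have "g (u z) \<le> 0" by simp
  then show False using g_pos[of "u z"] by linarith
qed

lemma not_locally_const:
  assumes "open W" "z \<in> W" "z \<in> \<Omega>" "\<And>w. w \<in> W \<Longrightarrow> w \<in> \<Omega> \<Longrightarrow> u w = k" shows False
proof (rule no_local_min[OF assms(3)])
  show "\<forall>\<^sub>F w in nhds z. u z \<le> u w"
    by (rule eventually_mono[OF eventually_nhds_in_open[of "W \<inter> \<Omega>" z]]) (use assms open_dom in auto)
qed

lemma u_pos: assumes z: "z \<in> \<Omega>" shows "0 < u z"
proof -
  have nn: "0 \<le> u w" if "w \<in> \<Omega>" for w
  proof -
    have "(\<lambda>_. 0) w \<le> u w + 0"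
    proof (rule comparison_principle[OF open_dom bounded_dom _ _ _ _ that])
      show "continuous_on (closure \<Omega>) u" using cont_u continuous_on_subset by blast
      show "\<exists>v0 L M. (\<forall>\<^sub>F z in nhds p. v0 z \<le> 0) \<and> v0 p = 0 \<and> has_lap v0 L p \<and> has_lap u M p \<and> M \<le> L"
        if "p \<in> \<Omega>" for p
        using has_lap_u[OF that] has_lap_const[of 0 p] g_pos[of "u p"]
        by (intro exI[of _ "\<lambda>_. 0"] exI[of _ 0] exI[of _ "- g (u p)"]) auto
    qed (use outside_zero in auto)
    then show ?thesis by simp
  qed
  have "u z \<noteq> 0"
  proof
    assume "u z = 0"
    then have "\<forall>\<^sub>F w in nhds z. u z \<le> u w"
      by (intro eventually_mono[OF eventually_nhds_in_open[OF open_dom z]]) (use nn in auto)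
    then show False using no_local_min[OF z] by blast
  qed
  then show ?thesis using nn[OF z] by simp
qed

lemma u_nonneg: "0 \<le> u z"
  by (cases "z \<in> \<Omega>") (auto simp: outside_zero dest: u_pos)

lemma cont_grad: "continuous_on \<Omega> ux" "continuous_on \<Omega> uy"
  by (rule continuous_at_imp_continuous_on, use has_derivative_continuous[OF dux] in blast)
     (rule continuous_at_imp_continuous_on, use has_derivative_continuous[OF duy] in blast)

text \<open>The set where the gradient is below \<open>\<epsilon>\<close> is an open neighbourhood
  of the compact set \<open>C\<close>, hence contains a uniform one; each of its discs is convex, so
  the mean value inequality applies.\<close>

lemma small_gradient_near_critical:
  assumes C: "compact C" "C \<subseteq> \<Omega>" "\<And>z. z \<in> C \<Longrightarrow> ux z = 0 \<and> uy z = 0" and \<epsilon>: "\<epsilon> > 0"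
  obtains \<rho> where "\<rho> > 0" "\<And>p z z'. p \<in> C \<Longrightarrow> dist p z < \<rho> \<Longrightarrow> dist p z' < \<rho> \<Longrightarrow> \<bar>u z - u z'\<bar> \<le> \<epsilon> * cmod (z - z')"
proof -
  define B where "B = {z \<in> \<Omega>. \<bar>ux z\<bar> + \<bar>uy z\<bar> < \<epsilon>}"
  have "continuous_on \<Omega> (\<lambda>z. \<bar>ux z\<bar> + \<bar>uy z\<bar>)" using cont_grad by (intro continuous_intros)
  from continuous_open_preimage[OF this open_dom open_lessThan[of \<epsilon>]]
  have "open (\<Omega> \<inter> (\<lambda>z. \<bar>ux z\<bar> + \<bar>uy z\<bar>) -` {..<\<epsilon>})" .
  moreover have "\<Omega> \<inter> (\<lambda>z. \<bar>ux z\<bar> + \<bar>uy z\<bar>) -` {..<\<epsilon>} = B" unfolding B_def by auto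
  ultimately have "open B" by simp
  moreover have "C \<subseteq> B" using C \<epsilon> unfolding B_def by auto
  ultimately obtain \<rho> where \<rho>: "\<rho> > 0" "(\<Union>x\<in>C. ball x \<rho>) \<subseteq> B"
    using compact_subset_open_imp_ball_epsilon_subset[OF C(1)] by blast
  show thesis
  proof (rule that[OF \<rho>(1)])
    fix p z z' assume p: "p \<in> C" "dist p z < \<rho>" "dist p z' < \<rho>"
    have sub: "ball p \<rho> \<subseteq> B" using \<rho>(2) p(1) by blast
    have "norm (u z - u z') \<le> \<epsilon> * norm (z - z')"
    proof (rule differentiable_bound[OF convex_ball[of p \<rho>]])
      fix x assume x: "x \<in> ball p \<rho>"
      then have xB: "x \<in> \<Omega>" "\<bar>ux x\<bar> + \<bar>uy x\<bar> < \<epsilon>" using sub unfolding B_def by auto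
      show "(u has_derivative (\<lambda>h. ux x * Re h + uy x * Im h)) (at x within ball p \<rho>)"
        using du[OF xB(1)] has_derivative_at_withinI by blast
      show "onorm (\<lambda>h. ux x * Re h + uy x * Im h) \<le> \<epsilon>"
      proof (rule onorm_bound)
        fix h :: complex
        have "norm (ux x * Re h + uy x * Im h) \<le> \<bar>ux x\<bar> * \<bar>Re h\<bar> + \<bar>uy x\<bar> * \<bar>Im h\<bar>"
          using abs_triangle_ineq[of "ux x * Re h" "uy x * Im h"] by (simp add: abs_mult)
        also have "\<dots> \<le> \<bar>ux x\<bar> * cmod h + \<bar>uy x\<bar> * cmod h"
          by (intro add_mono mult_left_mono abs_Re_le_cmod abs_Im_le_cmod) auto
        also have "\<dots> = (\<bar>ux x\<bar> + \<bar>uy x\<bar>) * cmod h" by (simp add: algebra_simps)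
        also have "\<dots> \<le> \<epsilon> * cmod h" using xB by (intro mult_right_mono) auto
        finally show "norm (ux x * Re h + uy x * Im h) \<le> \<epsilon> * norm h" .
      qed (use \<epsilon> in auto)
    qed (use p in auto)
    then show "\<bar>u z - u z'\<bar> \<le> \<epsilon> * cmod (z - z')" by simp
  qed
qed

text \<open>The isometry is \<open>S p = e * p + f\<close>. Comparison takes place on the part of
  \<open>E \<inter> H\<close> that \<open>S\<close> maps into \<open>E\<close>, with slack
  \<open>\<epsilon> * \<eta>\<close>. On \<open>C\<close> and on its preimage the small gradient
  gives the bound; the hypotheses settle \<open>G\<close> and the frontier of \<open>H\<close>, a
  cut along which a symmetry usually gives equality. \<open>\<rho>\<close> is fixed before the
  isometry, so \<open>\<eta>\<close> may tend to 0 for fixed \<open>\<epsilon>\<close>.\<close>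

lemma finite_difference_bound:
  assumes C: "compact C" "C \<subseteq> \<Omega>" "\<And>z. z \<in> C \<Longrightarrow> ux z = 0 \<and> uy z = 0"
    and E: "open E" "E \<subseteq> \<Omega>" "frontier E \<subseteq> C \<union> G" "G \<inter> \<Omega> = {}" and \<epsilon>: "\<epsilon> > 0"
  obtains \<rho> where "\<rho> > 0"
    "\<And>e f H \<eta> z. cmod e = 1 \<Longrightarrow> \<eta> < \<rho> \<Longrightarrow> open H \<Longrightarrow>
       (\<And>p. p \<in> \<Omega> \<Longrightarrow> cmod (e * p + f - p) \<le> \<eta>) \<Longrightarrow>
       (\<And>p. p \<in> closure H \<Longrightarrow> p \<notin> H \<Longrightarrow> u (e * p + f) \<le> u p) \<Longrightarrow>
       (\<And>p. p \<in> G \<Longrightarrow> p \<in> H \<Longrightarrow> e * p + f \<in> closure E \<Longrightarrow> u (e * p + f) \<le> 0) \<Longrightarrow>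
       z \<in> E \<Longrightarrow> z \<in> H \<Longrightarrow> e * z + f \<in> E \<Longrightarrow> u (e * z + f) \<le> u z + \<epsilon> * \<eta>"
proof -
  obtain \<rho> where \<rho>: "\<rho> > 0" "\<And>p z z'. p \<in> C \<Longrightarrow> dist p z < \<rho> \<Longrightarrow> dist p z' < \<rho> \<Longrightarrow> \<bar>u z - u z'\<bar> \<le> \<epsilon> * cmod (z - z')"
    using small_gradient_near_critical[OF C \<epsilon>] by blast
  show thesis
  proof (rule that[OF \<rho>(1)])
    fix e f H \<eta> z
    assume e: "cmod e = 1" and \<eta>: "\<eta> < \<rho>" and H: "open H"
      and disp: "\<And>p. p \<in> \<Omega> \<Longrightarrow> cmod (e * p + f - p) \<le> \<eta>"
      and HA: "\<And>p. p \<in> closure H \<Longrightarrow> p \<notin> H \<Longrightarrow> u (e * p + f) \<le> u p"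
      and HB: "\<And>p. p \<in> G \<Longrightarrow> p \<in> H \<Longrightarrow> e * p + f \<in> closure E \<Longrightarrow> u (e * p + f) \<le> 0"
      and z: "z \<in> E" "z \<in> H" "e * z + f \<in> E"
    define S where "S p = e * p + f" for p
    define W where "W = E \<inter> H \<inter> S -` E"
    have contS: "continuous_on A S" for A unfolding S_def by (intro continuous_intros)
    have "\<eta> \<ge> 0" using disp[of z] z E norm_ge_zero order_trans by (metis subsetD)
    have "open (S -` E)" using open_vimage[OF E(1) contS] .
    then have W: "open W" unfolding W_def using E(1) H by auto
    have bW: "bounded W" unfolding W_def using bounded_dom E(2) by (meson bounded_subset inf_le1 order_trans)
    have fC: "\<bar>u (S p) - u p\<bar> \<le> \<epsilon> * \<eta>" if "p \<in> closure E" "p \<in> C \<or> S p \<in> C" for p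
    proof -
      have disp': "cmod (S p - p) \<le> \<eta>"
      proof -
        have "closed {p. cmod (S p - p) \<le> \<eta>}" unfolding S_def by (intro closed_Collect_le continuous_intros)
        moreover have "E \<subseteq> {p. cmod (S p - p) \<le> \<eta>}" using disp E(2) unfolding S_def by auto
        ultimately have "closure E \<subseteq> {p. cmod (S p - p) \<le> \<eta>}" by (rule closure_minimal[rotated])
        then show ?thesis using that(1) by auto
      qed
      have "\<bar>u (S p) - u p\<bar> \<le> \<epsilon> * cmod (S p - p)"
        using that(2)
      proof
        assume "p \<in> C" then show ?thesis using \<rho>(2)[of p "S p" p] \<rho>(1) disp' \<eta> by (simp add: dist_norm norm_minus_commute)
      next
        assume "S p \<in> C" then show ?thesis using \<rho>(2)[of "S p" "S p" p] \<rho>(1) disp' \<eta> by (simp add: dist_norm)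
      qed
      also have "\<dots> \<le> \<epsilon> * \<eta>" using disp' \<epsilon> by (intro mult_left_mono) auto
      finally show ?thesis .
    qed
    have "(\<lambda>p. u (S p)) z \<le> u z + \<epsilon> * \<eta>"
    proof (rule comparison_principle[OF W bW])
      show "continuous_on (closure W) (\<lambda>p. u (S p))"
        by (rule continuous_on_compose2[OF cont_u contS]) auto
      show "continuous_on (closure W) u" using cont_u continuous_on_subset by blast
      show "z \<in> W" using z unfolding W_def S_def by auto
    next
      fix p assume p: "p \<in> closure W" "p \<notin> W"
      have clE: "p \<in> closure E" "p \<in> closure H"
        using p(1) closure_mono[of W E] closure_mono[of W H] unfolding W_def by auto
      have clS: "S p \<in> closure E"
      proof -
        have "S ` closure W \<subseteq> closure (S ` W)" by (rule image_closure_subset[OF contS closed_closure closure_subset])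
        also have "\<dots> \<subseteq> closure E" by (rule closure_mono) (auto simp: W_def)
        finally show ?thesis using p(1) by blast
      qed
      have pos: "\<epsilon> * \<eta> \<ge> 0" using \<epsilon> \<open>\<eta> \<ge> 0\<close> by simp
      show "u (S p) \<le> u p + \<epsilon> * \<eta>"
      proof (cases "p \<in> H")
        case False
        then show ?thesis using HA[OF clE(2) False] pos unfolding S_def by linarith
      next
        case True
        have fr: "x \<in> C \<union> G" if "x \<in> closure E" "x \<notin> E" for x
          using that E(1,3) unfolding frontier_def by (auto simp: interior_open)
        \<comment> \<open>Since \<open>p\<close> is in \<open>H\<close> but not in \<open>W\<close>,
          either \<open>p\<close> or its image is on the frontier of \<open>E\<close>.\<close>
        consider "p \<in> C" | "p \<in> G" | "S p \<in> C" | "S p \<in> G"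
          using p(2) True fr clE(1) clS unfolding W_def by blast
        then show ?thesis
        proof cases
          case 1 then show ?thesis using fC[OF clE(1)] by force
        next
          case 2 then show ?thesis using HB[OF 2 True] clS u_nonneg[of p] pos unfolding S_def by linarith
        next
          case 3 then show ?thesis using fC[OF clE(1)] by force
        next
          case 4
          then have "u (S p) = 0" using E(4) by (intro outside_zero) auto
          then show ?thesis using u_nonneg[of p] pos by linarith
        qed
      qed
    next
      fix p assume p: "p \<in> W" "u p + \<epsilon> * \<eta> < u (S p)"
      have pO: "p \<in> \<Omega>" "S p \<in> \<Omega>" using p(1) E(2) unfolding W_def by auto
      have l: "has_lap (\<lambda>z. u (S z)) ((cmod e)\<^sup>2 * (- g (u (S p)))) p"
      proof (rule has_lap_compose_holomorphic[where \<sigma>=S and \<sigma>'="\<lambda>_. e" and k=0, OF has_lap_u[OF pO(2)]])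
        show "\<forall>\<^sub>F z in nhds p. (S has_field_derivative e) (at z)" unfolding S_def by (auto intro!: derivative_eq_intros always_eventually)
        show "((\<lambda>_. e) has_field_derivative 0) (at p)" by auto
      qed
      have "\<epsilon> * \<eta> \<ge> 0" using \<epsilon> \<open>\<eta> \<ge> 0\<close> by simp
      then have "g (u (S p)) \<le> g (u p)" using p(2) by (intro g_antimono) linarith
      then show "\<exists>v0 L M. (\<forall>\<^sub>F z in nhds p. v0 z \<le> u (S z)) \<and> v0 p = u (S p) \<and> has_lap v0 L p \<and> has_lap u M p \<and> M \<le> L"
        using l has_lap_u[OF pO(1)] e
        by (intro exI[of _ "\<lambda>z. u (S z)"] exI[of _ "(cmod e)\<^sup>2 * (- g (u (S p)))"] exI[of _ "- g (u p)"]) auto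
    qed
    then show "u (e * z + f) \<le> u z + \<epsilon> * \<eta>" unfolding S_def .
  qed
qed

end

lemma derivative_le_of_right_bound:
  fixes \<phi> :: "real \<Rightarrow> real"
  assumes d: "(\<phi> has_real_derivative k) (at 0)" and h0: "h0 > 0"
    and le: "\<And>h. 0 < h \<Longrightarrow> h < h0 \<Longrightarrow> \<phi> h \<le> \<phi> 0 + c * h"
  shows "k \<le> c"
proof (rule ccontr)
  assume "\<not> k \<le> c"
  have "((\<lambda>h. \<phi> h - c * h) has_real_derivative (k - c)) (at 0)"
    using d by (auto intro!: derivative_eq_intros)
  from DERIV_pos_inc_right[OF this] \<open>\<not> k \<le> c\<close> obtain \<delta> where
    \<delta>: "\<delta> > 0" "\<And>h. h > 0 \<Longrightarrow> h < \<delta> \<Longrightarrow> \<phi> 0 - c * 0 < \<phi> (0 + h) - c * (0 + h)" by auto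
  define h where "h = min \<delta> h0 / 2"
  have "h > 0" "h < \<delta>" "h < h0" using \<delta> h0 unfolding h_def by auto
  with \<delta>(2)[of h] le[of h] show False by simp
qed

context elliptic_solution begin

text \<open>For a translation by \<open>h\<close> the displacement is \<open>\<eta> = h\<close>, so
  the difference quotient is at most any given positive number. The cut \<open>H h\<close> may move
  with \<open>h\<close>; \<open>hmax\<close> keeps \<open>z\<close> on the right side of it.\<close>

lemma translation_derivative_nonpos:
  assumes C: "compact C" "C \<subseteq> \<Omega>" "\<And>z. z \<in> C \<Longrightarrow> ux z = 0 \<and> uy z = 0"
    and E: "open E" "E \<subseteq> \<Omega>" "frontier E \<subseteq> C \<union> G" "G \<inter> \<Omega> = {}"
    and e: "cmod e = 1" and z: "z \<in> E" and hmax: "hmax > 0"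
    and H: "\<And>h. h > 0 \<Longrightarrow> open (H h)" "\<And>h. h > 0 \<Longrightarrow> h < hmax \<Longrightarrow> z \<in> H h"
    and HA: "\<And>h p. h > 0 \<Longrightarrow> p \<in> closure (H h) \<Longrightarrow> p \<notin> H h \<Longrightarrow> u (p + of_real h * e) \<le> u p"
    and HB: "\<And>h p. h > 0 \<Longrightarrow> p \<in> G \<Longrightarrow> p \<in> H h \<Longrightarrow> p + of_real h * e \<in> closure E \<Longrightarrow> u (p + of_real h * e) \<le> 0"
  shows "ux z * Re e + uy z * Im e \<le> 0"
proof (rule field_le_epsilon)
  fix \<epsilon> :: real assume \<epsilon>: "\<epsilon> > 0"
  obtain \<rho> where \<rho>: "\<rho> > 0"
    "\<And>e f H \<eta> z. cmod e = 1 \<Longrightarrow> \<eta> < \<rho> \<Longrightarrow> open H \<Longrightarrow>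
       (\<And>p. p \<in> \<Omega> \<Longrightarrow> cmod (e * p + f - p) \<le> \<eta>) \<Longrightarrow>
       (\<And>p. p \<in> closure H \<Longrightarrow> p \<notin> H \<Longrightarrow> u (e * p + f) \<le> u p) \<Longrightarrow>
       (\<And>p. p \<in> G \<Longrightarrow> p \<in> H \<Longrightarrow> e * p + f \<in> closure E \<Longrightarrow> u (e * p + f) \<le> 0) \<Longrightarrow>
       z \<in> E \<Longrightarrow> z \<in> H \<Longrightarrow> e * z + f \<in> E \<Longrightarrow> u (e * z + f) \<le> u z + \<epsilon> * \<eta>"
    using finite_difference_bound[OF C E \<epsilon>] by blast
  obtain r where r: "r > 0" "ball z r \<subseteq> E" using E(1) z open_contains_ball by blast
  have "ux z * Re e + uy z * Im e \<le> \<epsilon>"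
  proof (rule derivative_le_of_right_bound)
    have "(u has_derivative (\<lambda>h. ux z * Re h + uy z * Im h)) (at (z + of_real 0 * e))"
      using du z E(2) by auto
    from has_derivative_line[OF this]
    show "((\<lambda>h. u (z + of_real h * e)) has_real_derivative ux z * Re e + uy z * Im e) (at 0)" .
    show "min hmax (min \<rho> r) > 0" using \<rho> r hmax by simp
    fix h :: real assume h: "0 < h" "h < min hmax (min \<rho> r)"
    have "z + of_real h * e \<in> E" using r h e by (intro subsetD[OF r(2)]) (simp add: dist_norm norm_mult)
    with \<rho>(2)[of 1 h "H h" "of_real h * e" z] h e z H(1)[OF h(1)] H(2)[of h] HA[OF h(1)] HB[OF h(1)]
    show "u (z + of_real h * e) \<le> u (z + of_real 0 * e) + \<epsilon> * h"
      by (simp add: norm_mult add.commute)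
  qed
  then show "ux z * Re e + uy z * Im e \<le> 0 + \<epsilon>" by simp
qed

text \<open>Without a further boundary component all translations are admissible. The directions 1,
  -1, \<i>, -\<i> make the gradient vanish on \<open>E\<close>, so the Laplacian would be 0 instead
  of \<open>- g (u p)\<close>.\<close>

lemma no_region_bounded_by_critical:
  assumes C: "compact C" "C \<subseteq> \<Omega>" "\<And>z. z \<in> C \<Longrightarrow> ux z = 0 \<and> uy z = 0"
    and E: "open E" "E \<subseteq> \<Omega>" "frontier E \<subseteq> C" "E \<noteq> {}"
  shows False
proof -
  have t: "ux z * Re e + uy z * Im e \<le> 0" if "z \<in> E" "cmod e = 1" for z e
    using that E by (intro translation_derivative_nonpos[OF C, where E=E and G="{}" and H="\<lambda>_. UNIV" and hmax=1]) auto
  have z: "ux z = 0" "uy z = 0" if "z \<in> E" for z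
    using t[OF that, of 1] t[OF that, of "-1"] t[OF that, of \<i>] t[OF that, of "-\<i>"] by auto
  obtain p where p: "p \<in> E" using E by auto
  then have pO: "p \<in> \<Omega>" using E by auto
  have ev: "\<forall>\<^sub>F z in nhds p. z \<in> E" using E p by (simp add: eventually_nhds_in_open)
  have "has_lap (\<lambda>z. u z) 0 p"
  proof (rule has_lapI)
    show "\<forall>\<^sub>F z in nhds p. ((\<lambda>z. u z) has_derivative (\<lambda>h. (\<lambda>_. 0) z * Re h + (\<lambda>_. 0) z * Im h)) (at z)"
      using ev by eventually_elim (use du z E(2) in \<open>fastforce\<close>)
    show "((\<lambda>_. 0) has_derivative (\<lambda>h. 0 * Re h + 0 * Im h)) (at p)" by simp
    show "((\<lambda>_. 0) has_derivative (\<lambda>h. 0 * Re h + 0 * Im h)) (at p)" by simp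
  qed simp
  from has_lap_local_max[OF has_lap_lincomb[OF has_lap_u[OF pO] this, of "-1" 1]]
  have "g (u p) \<le> 0" by simp
  then show False using g_pos[of "u p"] by linarith
qed

end

section \<open>Unique continuation and circular holes\<close>

text \<open>No equation is included, so that differences of two transformed solutions are covered as
  well.\<close>

definition C2_data where
  "C2_data (u :: complex \<Rightarrow> real) ux uy a b b' d S \<longleftrightarrow> open S \<and>
     (\<forall>z\<in>S. (u has_derivative (\<lambda>h. ux z * Re h + uy z * Im h)) (at z) \<and>
       (ux has_derivative (\<lambda>h. a z * Re h + b z * Im h)) (at z) \<and>
       (uy has_derivative (\<lambda>h. b' z * Re h + d z * Im h)) (at z)) \<and>
     continuous_on S a \<and> continuous_on S b \<and> continuous_on S b' \<and> continuous_on S d"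

lemma C2_dataD:
  assumes "C2_data u ux uy a b b' d S"
  shows "open S" "z \<in> S \<Longrightarrow> (u has_derivative (\<lambda>h. ux z * Re h + uy z * Im h)) (at z)"
    "z \<in> S \<Longrightarrow> (ux has_derivative (\<lambda>h. a z * Re h + b z * Im h)) (at z)"
    "z \<in> S \<Longrightarrow> (uy has_derivative (\<lambda>h. b' z * Re h + d z * Im h)) (at z)"
    "continuous_on S a" "continuous_on S b" "continuous_on S b'" "continuous_on S d"
  using assms unfolding C2_data_def by auto

lemma C2_data_continuous:
  assumes "C2_data u ux uy a b b' d S"
  shows "continuous_on S u" "continuous_on S ux" "continuous_on S uy"
  by (rule continuous_at_imp_continuous_on, use has_derivative_continuous[OF C2_dataD(2)[OF assms]] in blast)
     (rule continuous_at_imp_continuous_on, use has_derivative_continuous[OF C2_dataD(3)[OF assms]] in blast,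
      rule continuous_at_imp_continuous_on, use has_derivative_continuous[OF C2_dataD(4)[OF assms]] in blast)

lemma C2_data_has_lap:
  assumes "C2_data u ux uy a b b' d S" "z \<in> S"
  shows "has_lap u (a z + d z) z"
  by (rule has_lapI[OF eventually_mono[OF eventually_nhds_in_open[OF C2_dataD(1)[OF assms(1)] assms(2)]]
        C2_dataD(3)[OF assms] C2_dataD(4)[OF assms] refl])
     (rule C2_dataD(2)[OF assms(1)])

text \<open>Schwarz's theorem: the second difference of \<open>u\<close> over a small square is
  evaluated with the mean value theorem in both orders of the variables.\<close>

lemma mixed_partials_eq:
  assumes C: "C2_data u ux uy a b b' d S" and z: "z \<in> S"
  shows "b z = b' z"
proof (rule ccontr)
  assume ne: "b z \<noteq> b' z"
  define \<delta> where "\<delta> = \<bar>b z - b' z\<bar> / 3"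
  have \<delta>: "\<delta> > 0" using ne unfolding \<delta>_def by simp
  note D = C2_dataD[OF C]
  have cb: "isCont b z" "isCont b' z"
    using D(1,6,7) z by (auto simp: continuous_on_eq_continuous_at)
  obtain r1 where r1: "r1 > 0" "\<And>w. dist w z < r1 \<Longrightarrow> dist (b w) (b z) < \<delta>"
    using cb(1) \<delta> unfolding continuous_at_eps_delta by (auto simp: dist_norm)
  obtain r2 where r2: "r2 > 0" "\<And>w. dist w z < r2 \<Longrightarrow> dist (b' w) (b' z) < \<delta>"
    using cb(2) \<delta> unfolding continuous_at_eps_delta by (auto simp: dist_norm)
  obtain r3 where r3: "r3 > 0" "ball z r3 \<subseteq> S" using D(1) z open_contains_ball by blast
  define h where "h = Min {r1, r2, r3} / 3"
  have h: "h > 0" "2 * h < r1" "2 * h < r2" "2 * h < r3" using r1 r2 r3 unfolding h_def by auto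
  have near: "cmod (of_real s + \<i> * of_real t) \<le> 2 * h" if "0 \<le> s" "s \<le> h" "0 \<le> t" "t \<le> h" for s t
    using norm_triangle_ineq[of "of_real s" "\<i> * of_real t"] that by (simp add: norm_mult)
  have inS: "z + of_real s + \<i> * of_real t \<in> S" if "0 \<le> s" "s \<le> h" "0 \<le> t" "t \<le> h" for s t
  proof -
    have "dist z (z + of_real s + \<i> * of_real t) = cmod (of_real s + \<i> * of_real t)"
      using norm_minus_cancel[of "of_real s + \<i> * of_real t"] by (simp add: dist_norm)
    then have "z + of_real s + \<i> * of_real t \<in> ball z r3" using near[OF that] h by simp
    then show ?thesis using r3(2) by blast
  qed
  have xl: "((\<lambda>s. v (z + \<i> * of_real t + of_real s * 1)) has_real_derivative k 1) (at s)"
    if "(v has_derivative k) (at (z + of_real s + \<i> * of_real t))" for v s t k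
    by (rule has_derivative_line) (use that in \<open>simp add: algebra_simps\<close>)
  have yl: "((\<lambda>t. v (z + of_real s + of_real t * \<i>)) has_real_derivative k \<i>) (at t)"
    if "(v has_derivative k) (at (z + of_real s + \<i> * of_real t))" for v s t k
    by (rule has_derivative_line) (use that in \<open>simp add: algebra_simps\<close>)
  let ?Z = "\<lambda>s t. z + of_real s + \<i> * of_real t"
  let ?D = "u (?Z h h) - u (?Z h 0) - (u (?Z 0 h) - u (?Z 0 0))"
  have "\<exists>\<xi>>0. \<xi> < h \<and> (u (?Z h h) - u (?Z h 0)) - (u (?Z 0 h) - u (?Z 0 0)) = (h - 0) * (ux (?Z \<xi> h) - ux (?Z \<xi> 0))"
  proof (rule MVT2[OF h(1)])
    fix s assume s: "0 \<le> s" "s \<le> h"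
    show "((\<lambda>s. u (?Z s h) - u (?Z s 0)) has_real_derivative ux (?Z s h) - ux (?Z s 0)) (at s)"
      using xl[OF D(2)[OF inS[of s h]]] xl[OF D(2)[OF inS[of s 0]]] s h
      by (intro DERIV_diff) (simp_all add: algebra_simps)
  qed
  then obtain \<xi> where \<xi>: "0 < \<xi>" "\<xi> < h" "?D = h * (ux (?Z \<xi> h) - ux (?Z \<xi> 0))" by auto
  have "\<exists>\<eta>>0. \<eta> < h \<and> ux (?Z \<xi> h) - ux (?Z \<xi> 0) = (h - 0) * b (?Z \<xi> \<eta>)"
  proof (rule MVT2[OF h(1)])
    fix t assume t: "0 \<le> t" "t \<le> h"
    show "((\<lambda>t. ux (?Z \<xi> t)) has_real_derivative b (?Z \<xi> t)) (at t)"
      using yl[OF D(3)[OF inS[of \<xi> t]]] t \<xi> by (simp add: algebra_simps)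
  qed
  then obtain \<eta> where \<eta>: "0 < \<eta>" "\<eta> < h" "?D = h * (h * b (?Z \<xi> \<eta>))" using \<xi>(3) by auto
  have "\<exists>\<xi>>0. \<xi> < h \<and> (u (?Z h h) - u (?Z 0 h)) - (u (?Z h 0) - u (?Z 0 0)) = (h - 0) * (uy (?Z h \<xi>) - uy (?Z 0 \<xi>))"
  proof (rule MVT2[OF h(1)])
    fix t assume t: "0 \<le> t" "t \<le> h"
    show "((\<lambda>t. u (?Z h t) - u (?Z 0 t)) has_real_derivative uy (?Z h t) - uy (?Z 0 t)) (at t)"
      using yl[OF D(2)[OF inS[of h t]]] yl[OF D(2)[OF inS[of 0 t]]] t h
      by (intro DERIV_diff) (simp_all add: algebra_simps)
  qed
  then obtain \<xi>' where \<xi>': "0 < \<xi>'" "\<xi>' < h" "?D = h * (uy (?Z h \<xi>') - uy (?Z 0 \<xi>'))" by auto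
  have "\<exists>\<eta>>0. \<eta> < h \<and> uy (?Z h \<xi>') - uy (?Z 0 \<xi>') = (h - 0) * b' (?Z \<eta> \<xi>')"
  proof (rule MVT2[OF h(1)])
    fix s assume s: "0 \<le> s" "s \<le> h"
    show "((\<lambda>s. uy (?Z s \<xi>')) has_real_derivative b' (?Z s \<xi>')) (at s)"
      using xl[OF D(4)[OF inS[of s \<xi>']]] s \<xi>' by (simp add: algebra_simps)
  qed
  then obtain \<eta>' where \<eta>': "0 < \<eta>'" "\<eta>' < h" "?D = h * (h * b' (?Z \<eta>' \<xi>'))" using \<xi>'(3) by auto
  have eq: "b (?Z \<xi> \<eta>) = b' (?Z \<eta>' \<xi>')" using \<eta>(3) \<eta>'(3) h(1) by simp
  have "dist (?Z \<xi> \<eta>) z < r1" "dist (?Z \<eta>' \<xi>') z < r2"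
    using near[of \<xi> \<eta>] near[of \<eta>' \<xi>'] \<xi> \<eta> \<xi>' \<eta>' h by (auto simp: dist_norm add.assoc)
  from r1(2)[OF this(1)] r2(2)[OF this(2)] eq \<delta> show False
    unfolding \<delta>_def dist_real_def by (auto simp: abs_if split: if_splits)
qed

lemma C2_data_lincomb:
  assumes U: "C2_data u ux uy a b b' d S" and V: "C2_data v vx vy k l l' m S"
  shows "C2_data (\<lambda>z. r * u z + s * v z) (\<lambda>z. r * ux z + s * vx z) (\<lambda>z. r * uy z + s * vy z)
    (\<lambda>z. r * a z + s * k z) (\<lambda>z. r * b z + s * l z) (\<lambda>z. r * b' z + s * l' z) (\<lambda>z. r * d z + s * m z) S"
proof -
  have comb: "((\<lambda>z. r * f z + s * f' z) has_derivative (\<lambda>h. (r * p + s * p') * Re h + (r * q + s * q') * Im h)) (at z)"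
    if "(f has_derivative (\<lambda>h. p * Re h + q * Im h)) (at z)" "(f' has_derivative (\<lambda>h. p' * Re h + q' * Im h)) (at z)"
    for f f' p q p' q' z
    by (rule has_derivative_eq_rhs, rule has_derivative_add,
        rule has_derivative_mult_right[OF that(1)], rule has_derivative_mult_right[OF that(2)])
       (simp add: algebra_simps)
  show ?thesis unfolding C2_data_def
    using C2_dataD[OF U] C2_dataD[OF V] by (auto intro!: comb continuous_intros)
qed

lemma C2_data_compose:
  assumes U: "C2_data u ux uy a b b' d S" and T: "open T" "\<And>z. z \<in> T \<Longrightarrow> \<sigma> z \<in> S"
    and s1: "\<And>z. z \<in> T \<Longrightarrow> (\<sigma> has_field_derivative \<sigma>' z) (at z)"
    and s2: "\<And>z. z \<in> T \<Longrightarrow> (\<sigma>' has_field_derivative \<sigma>'' z) (at z)"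
    and s3: "continuous_on T \<sigma>''"
  shows "\<exists>vx vy k l l' m. C2_data (\<lambda>z. u (\<sigma> z)) vx vy k l l' m T \<and>
    (\<forall>z\<in>T. k z + m z = (cmod (\<sigma>' z))\<^sup>2 * (a (\<sigma> z) + d (\<sigma> z)))"
proof -
  note D = C2_dataD[OF U]
  define vx where "vx z = ux (\<sigma> z) * Re (\<sigma>' z) + uy (\<sigma> z) * Im (\<sigma>' z)" for z
  define vy where "vy z = uy (\<sigma> z) * Re (\<sigma>' z) - ux (\<sigma> z) * Im (\<sigma>' z)" for z
  define A where "A z = a (\<sigma> z) * Re (\<sigma>' z) + b (\<sigma> z) * Im (\<sigma>' z)" for z
  define B where "B z = b (\<sigma> z) * Re (\<sigma>' z) - a (\<sigma> z) * Im (\<sigma>' z)" for z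
  define K where "K z = b' (\<sigma> z) * Re (\<sigma>' z) + d (\<sigma> z) * Im (\<sigma>' z)" for z
  define M where "M z = d (\<sigma> z) * Re (\<sigma>' z) - b' (\<sigma> z) * Im (\<sigma>' z)" for z
  define k where "k z = A z * Re (\<sigma>' z) + ux (\<sigma> z) * Re (\<sigma>'' z) + K z * Im (\<sigma>' z) + uy (\<sigma> z) * Im (\<sigma>'' z)" for z
  define l where "l z = B z * Re (\<sigma>' z) - ux (\<sigma> z) * Im (\<sigma>'' z) + M z * Im (\<sigma>' z) + uy (\<sigma> z) * Re (\<sigma>'' z)" for z
  define l' where "l' z = K z * Re (\<sigma>' z) + uy (\<sigma> z) * Re (\<sigma>'' z) - A z * Im (\<sigma>' z) - ux (\<sigma> z) * Im (\<sigma>'' z)" for z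
  define m where "m z = M z * Re (\<sigma>' z) - uy (\<sigma> z) * Im (\<sigma>'' z) - B z * Im (\<sigma>' z) - ux (\<sigma> z) * Re (\<sigma>'' z)" for z
  have cs: "continuous_on T \<sigma>" "continuous_on T \<sigma>'"
    using s1 s2 by (auto intro!: continuous_at_imp_continuous_on DERIV_isCont)
  have cc: "continuous_on T (\<lambda>z. f (\<sigma> z))" if "continuous_on S f" for f :: "complex \<Rightarrow> real"
    by (rule continuous_on_compose2[OF that cs(1)]) (use T(2) in auto)
  note cu = cc[OF C2_data_continuous(2)[OF U]] cc[OF C2_data_continuous(3)[OF U]]
    cc[OF D(5)] cc[OF D(6)] cc[OF D(7)] cc[OF D(8)]
  have "C2_data (\<lambda>z. u (\<sigma> z)) vx vy k l l' m T"
    unfolding C2_data_def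
  proof (intro conjI ballI)
    fix z assume z: "z \<in> T"
    have sd: "(\<sigma> has_derivative (\<lambda>h. \<sigma>' z * h)) (at z)" "(\<sigma>' has_derivative (\<lambda>h. \<sigma>'' z * h)) (at z)"
      using s1[OF z] s2[OF z] by (auto simp: has_field_derivative_def)
    note c = has_derivative_compose[OF sd(1) D(2)[OF T(2)[OF z]]]
      has_derivative_compose[OF sd(1) D(3)[OF T(2)[OF z]]] has_derivative_compose[OF sd(1) D(4)[OF T(2)[OF z]]]
    have r: "((\<lambda>z. Re (\<sigma>' z)) has_derivative (\<lambda>h. Re (\<sigma>'' z * h))) (at z)"
      and i: "((\<lambda>z. Im (\<sigma>' z)) has_derivative (\<lambda>h. Im (\<sigma>'' z * h))) (at z)"
      by (rule has_derivative_Re[OF sd(2)], rule has_derivative_Im[OF sd(2)])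
    show "((\<lambda>z. u (\<sigma> z)) has_derivative (\<lambda>h. vx z * Re h + vy z * Im h)) (at z)"
      by (rule has_derivative_eq_rhs[OF c(1)]) (auto simp: vx_def vy_def algebra_simps)
    show "(vx has_derivative (\<lambda>h. k z * Re h + l z * Im h)) (at z)"
      unfolding vx_def
      by (rule has_derivative_eq_rhs,
          rule has_derivative_add[OF has_derivative_mult[OF c(2) r] has_derivative_mult[OF c(3) i]])
         (auto simp: k_def l_def A_def B_def K_def M_def algebra_simps)
    show "(vy has_derivative (\<lambda>h. l' z * Re h + m z * Im h)) (at z)"
      unfolding vy_def
      by (rule has_derivative_eq_rhs,
          rule has_derivative_diff[OF has_derivative_mult[OF c(3) r] has_derivative_mult[OF c(2) i]])
         (auto simp: l'_def m_def A_def B_def K_def M_def algebra_simps)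
  qed (use T cu cs s3 in \<open>auto simp: k_def l_def l'_def m_def A_def B_def K_def M_def intro!: continuous_intros\<close>)
  moreover have "k z + m z = (cmod (\<sigma>' z))\<^sup>2 * (a (\<sigma> z) + d (\<sigma> z))" for z
    unfolding cmod_power2 k_def m_def A_def B_def K_def M_def by (simp add: algebra_simps power2_eq_square)
  ultimately show ?thesis by blast
qed

section \<open>Unique continuation in a periodic strip\<close>

lemma integral_nonneg_continuous_zero:
  fixes f :: "real \<Rightarrow> real"
  assumes "c < e" "continuous_on {c..e} f" "\<And>x. x \<in> {c..e} \<Longrightarrow> 0 \<le> f x" "integral {c..e} f \<le> 0" "x \<in> {c..e}"
  shows "f x = 0"
proof -
  have "f integrable_on {c..e}" using assms(2) by (rule integrable_continuous_interval)
  then have "(f has_integral integral {c..e} f) (cbox c e)" by (simp add: integrable_integral)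
  moreover have "integral {c..e} f = 0"
    using integral_nonneg[OF \<open>f integrable_on _\<close>] assms(3,4) by (intro antisym) auto
  ultimately have "(f has_integral 0) (cbox c e)" by simp
  then show ?thesis
    using has_integral_0_cbox_imp_0[of c e f x] assms by auto
qed

text \<open>
  The multiplier \<open>X\<^sub>t - \<tau> X\<close> with the weight \<open>e\<^sup>-\<^sup>2\<^sup>\<tau>\<^sup>t\<close> gives a Carleman-type bound
  \<open>\<tau>\<^sup>2 \<integral>X\<^sup>2 \<le> \<integral>X\<^sub>\<theta>\<^sup>2\<close> for all large \<open>\<tau>\<close>.
\<close>

lemma unique_continuation_strip:
  assumes C: "C2_data X Xt Xh a b b' d S" and S: "S = {z. t0 < Re z \<and> Re z < T}"
    and per: "\<And>z. z \<in> S \<Longrightarrow> X (z + 2 * of_real pi * \<i>) = X z"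
      "\<And>z. z \<in> S \<Longrightarrow> Xt (z + 2 * of_real pi * \<i>) = Xt z" "\<And>z. z \<in> S \<Longrightarrow> Xh (z + 2 * of_real pi * \<i>) = Xh z"
    and lap: "\<And>z. z \<in> S \<Longrightarrow> \<bar>a z + d z\<bar> \<le> M * \<bar>X z\<bar>"
    and t1: "t0 < t1" and zero: "\<And>z. z \<in> S \<Longrightarrow> Re z \<le> t1 \<Longrightarrow> X z = 0"
    and z: "z \<in> S"
  shows "X z = 0"
proof (cases "Re z \<le> t1")
  case True then show ?thesis using zero z by blast
next
  case False
  \<comment> \<open>Strictly between \<open>t0\<close> and \<open>t1\<close>: \<open>X\<close>
    vanishes in a neighbourhood of the line at \<open>s0\<close>, so its gradient does too, and the
    energy \<open>V\<close> starts with the value 0.\<close>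
  define s0 where "s0 = (t0 + t1) / 2"
  define T1 where "T1 = Re z"
  define c where "c = Im z"
  have s0: "t0 < s0" "s0 < t1" "s0 < T1" "T1 < T" using t1 False z S unfolding s0_def T1_def by auto
  note D = C2_dataD[OF C]
  have inS: "Complex t \<theta> \<in> S" if "t \<in> {s0..T1}" for t \<theta> using that s0 S by auto
  have M0: "M \<ge> 0 \<or> X z = 0" using order_trans[OF abs_ge_zero lap[OF z]] by (auto simp: zero_le_mult_iff)
  show ?thesis
  proof (cases "M \<ge> 0")
    case False then show ?thesis using M0 by blast
  next
    case M: True
    have l1: "of_real \<theta> * \<i> + of_real s * 1 = Complex s \<theta>" and l2: "of_real s + of_real \<theta> * \<i> = Complex s \<theta>" for s \<theta>
      by (simp_all add: complex_eq_iff)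
    have dt: "((\<lambda>t. v (Complex t \<theta>)) has_real_derivative k 1) (at t within A)"
      if "(v has_derivative k) (at (Complex t \<theta>))" for v t \<theta> k A
      using has_derivative_line[of v k "of_real \<theta> * \<i>" t 1] that unfolding l1 by (auto intro: has_field_derivative_at_within)
    have dh: "((\<lambda>\<theta>. v (Complex t \<theta>)) has_real_derivative k \<i>) (at \<theta> within A)"
      if "(v has_derivative k) (at (Complex t \<theta>))" for v t \<theta> k A
      using has_derivative_line[of v k "of_real t" \<theta> \<i>] that unfolding l2 by (auto intro: has_field_derivative_at_within)
    have cCx: "continuous_on UNIV (\<lambda>x. Complex (fst x) (snd x))" "continuous_on UNIV (Complex t)" for t
      unfolding Complex_eq by (intro continuous_intros)+
    have cont: "continuous_on ({s0..T1} \<times> J) (\<lambda>(t, \<theta>). f (Complex t \<theta>))" if "continuous_on S f" for f :: "complex \<Rightarrow> real" and J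
      unfolding split_beta
      by (rule continuous_on_compose2[OF that]) (use inS continuous_on_subset[OF cCx(1)] in auto)
    have cont1: "continuous_on J (\<lambda>\<theta>. f (Complex t \<theta>))" if "continuous_on S f" "t \<in> {s0..T1}" for f :: "complex \<Rightarrow> real" and t J
      by (rule continuous_on_compose2[OF that(1)]) (use inS[OF that(2)] continuous_on_subset[OF cCx(2)] in auto)
    note cX = C2_data_continuous[OF C] D(5-8)
    define I where "I = {c..c + 2 * pi}"
    have main: "\<tau>\<^sup>2 * integral I (\<lambda>\<theta>. (X (Complex T1 \<theta>))\<^sup>2) \<le> integral I (\<lambda>\<theta>. (Xh (Complex T1 \<theta>))\<^sup>2)"
      if \<tau>: "\<tau> > 0" "\<tau> \<ge> (M / 2) * exp (2 * (T1 - s0))" for \<tau>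
    proof -
      \<comment> \<open>An extra weight with derivative \<open>- 2 * \<sigma> t\<close> and
        \<open>M / 2 \<le> \<sigma> t \<le> \<tau>\<close>. Its decay contributes the negative
        multiple of the square of \<open>X\<close> that absorbs the product of \<open>Y\<close> with
        the Laplacian.\<close>
      define \<sigma> where "\<sigma> t = \<tau> * exp (- 2 * (t - s0))" for t
      define Y where "Y z = Xt z - \<tau> * X z" for z
      define Yh where "Yh z = b z - \<tau> * Xh z" for z
      define p where "p t \<theta> = exp (- 2 * \<tau> * t) * (((Y (Complex t \<theta>))\<^sup>2 + \<tau>\<^sup>2 * (X (Complex t \<theta>))\<^sup>2 - (Xh (Complex t \<theta>))\<^sup>2) / 2
          + \<sigma> t * (X (Complex t \<theta>))\<^sup>2)" for t \<theta>
      define q where "q t z = - 2 * \<tau> * (Y z)\<^sup>2 + Y z * (a z + d z) + \<sigma> t * (2 * X z * Y z - 2 * (X z)\<^sup>2)" for t z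
      \<comment> \<open>This is the derivative of \<open>Xh * Y\<close> in the periodic direction,
        so its integral over a period is 0. The rest \<open>q\<close> of the derivative of the
        energy density is nonpositive pointwise.\<close>
      define r where "r z = d z * Y z + Xh z * Yh z" for z
      define p' where "p' t \<theta> = exp (- 2 * \<tau> * t) * (q t (Complex t \<theta>) - r (Complex t \<theta>))" for t \<theta>
      have cY: "continuous_on S Y" "continuous_on S Yh" "continuous_on S r"
        unfolding r_def Y_def Yh_def using cX by (auto intro!: continuous_intros)
      have pder: "((\<lambda>t. p t \<theta>) has_real_derivative p' t \<theta>) (at t within {s0..T1})" if t: "t \<in> {s0..T1}" for t \<theta>
      proof -
        have b': "b' (Complex t \<theta>) = b (Complex t \<theta>)" using mixed_partials_eq[OF C inS[OF t]] by simp
        have dX: "((\<lambda>t. X (Complex t \<theta>)) has_real_derivative Xt (Complex t \<theta>)) (at t within {s0..T1})"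
          "((\<lambda>t. Xt (Complex t \<theta>)) has_real_derivative a (Complex t \<theta>)) (at t within {s0..T1})"
          "((\<lambda>t. Xh (Complex t \<theta>)) has_real_derivative b (Complex t \<theta>)) (at t within {s0..T1})"
          using dt[OF D(2)[OF inS[OF t]]] dt[OF D(3)[OF inS[OF t]]] dt[OF D(4)[OF inS[OF t]]] by (simp_all add: b'[symmetric])
        have dY: "((\<lambda>t. Y (Complex t \<theta>)) has_real_derivative a (Complex t \<theta>) - \<tau> * Xt (Complex t \<theta>)) (at t within {s0..T1})"
          unfolding Y_def using dX by (auto intro!: derivative_eq_intros)
        have d\<sigma>: "(\<sigma> has_real_derivative (- 2 * \<sigma> t)) (at t within {s0..T1})"
          unfolding \<sigma>_def by (auto intro!: derivative_eq_intros)
        have de: "((\<lambda>t. exp (- 2 * \<tau> * t)) has_real_derivative (- 2 * \<tau> * exp (- 2 * \<tau> * t))) (at t within {s0..T1})"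
          by (auto intro!: derivative_eq_intros)
        have Xt: "Xt z = Y z + \<tau> * X z" for z unfolding Y_def by simp
        show ?thesis unfolding p_def
          by (rule DERIV_cong, rule DERIV_mult[OF de], rule DERIV_add, rule DERIV_cdivide,
              rule DERIV_diff, rule DERIV_add, rule DERIV_power[OF dY], rule DERIV_cmult, rule DERIV_power[OF dX(1)],
              rule DERIV_power[OF dX(3)], rule DERIV_mult[OF d\<sigma>], rule DERIV_power[OF dX(1)])
             (simp add: p'_def q_def r_def Yh_def Xt field_simps power2_eq_square)
      qed
      define V where "V t = integral (cbox c (c + 2 * pi)) (p t)" for t
      have cp: "continuous_on (cbox c (c + 2 * pi)) (p t)" if "t \<in> {s0..T1}" for t
        unfolding p_def using cont1[OF cX(1) that] cont1[OF cX(3) that] cont1[OF cY(1) that] by (auto intro!: continuous_intros)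
      have c\<sigma>: "continuous_on A \<sigma>" for A unfolding \<sigma>_def by (intro continuous_intros)
      have cp': "continuous_on ({s0..T1} \<times> cbox c (c + 2 * pi)) (\<lambda>(t, \<theta>). p' t \<theta>)"
      proof -
        have "continuous_on ({s0..T1} \<times> cbox c (c + 2 * pi)) (\<lambda>x. \<sigma> (fst x))"
          by (rule continuous_on_compose2[OF c\<sigma>[of UNIV]]) (auto intro!: continuous_intros)
        then show ?thesis unfolding p'_def q_def split_beta
          using cont[OF cX(1), unfolded split_beta] cont[OF cX(4), unfolded split_beta] cont[OF cX(7), unfolded split_beta]
            cont[OF cY(1), unfolded split_beta] cont[OF cY(3), unfolded split_beta]
          by (auto intro!: continuous_intros)
      qed
      have Vder: "(V has_real_derivative integral (cbox c (c + 2 * pi)) (p' t)) (at t within {s0..T1})" if "t \<in> {s0..T1}" for t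
        unfolding V_def
        by (rule leibniz_rule_field_derivative[OF pder _ cp' that])
           (assumption, rule integrable_continuous[OF cp], assumption, simp)
      have rint: "integral (cbox c (c + 2 * pi)) (\<lambda>\<theta>. r (Complex t \<theta>)) = 0" if t: "t \<in> {s0..T1}" for t
      proof -
        have "((\<lambda>\<theta>. r (Complex t \<theta>)) has_integral (Xh (Complex t (c + 2 * pi)) * Y (Complex t (c + 2 * pi)) - Xh (Complex t c) * Y (Complex t c))) {c..c + 2 * pi}"
        proof (rule fundamental_theorem_of_calculus)
          fix \<theta> assume "\<theta> \<in> {c..c + 2 * pi}"
          have dX: "((\<lambda>\<theta>. X (Complex t \<theta>)) has_real_derivative Xh (Complex t \<theta>)) (at \<theta> within {c..c + 2 * pi})"
            "((\<lambda>\<theta>. Xt (Complex t \<theta>)) has_real_derivative b (Complex t \<theta>)) (at \<theta> within {c..c + 2 * pi})"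
            "((\<lambda>\<theta>. Xh (Complex t \<theta>)) has_real_derivative d (Complex t \<theta>)) (at \<theta> within {c..c + 2 * pi})"
            using dh[OF D(2)[OF inS[OF t]]] dh[OF D(3)[OF inS[OF t]]] dh[OF D(4)[OF inS[OF t]]] by simp_all
          have "((\<lambda>\<theta>. Xh (Complex t \<theta>) * Y (Complex t \<theta>)) has_real_derivative r (Complex t \<theta>)) (at \<theta> within {c..c + 2 * pi})"
            unfolding Y_def r_def Yh_def using dX by (auto intro!: derivative_eq_intros simp: algebra_simps)
          then show "((\<lambda>\<theta>. Xh (Complex t \<theta>) * Y (Complex t \<theta>)) has_vector_derivative r (Complex t \<theta>)) (at \<theta> within {c..c + 2 * pi})"
            by (simp add: has_real_derivative_iff_has_vector_derivative)
        qed simp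
        moreover have "Complex t (c + 2 * pi) = Complex t c + 2 * of_real pi * \<i>" by (simp add: complex_eq_iff)
        ultimately show ?thesis using per(1-3)[OF inS[OF t, of c]] by (simp add: Y_def integral_unique)
      qed
      have qneg: "q t z \<le> 0" if t: "t \<in> {s0..T1}" and z: "z \<in> S" for t z
      proof -
        have \<sigma>1: "\<sigma> t \<le> \<tau>" unfolding \<sigma>_def using t \<tau> by (simp add: mult_le_cancel_left1)
        have "exp (2 * (t - s0)) \<le> exp (2 * (T1 - s0))" using t by simp
        then have "(M / 2) * exp (2 * (t - s0)) \<le> \<tau>" using \<tau>(2) M by (smt (verit) mult_left_mono divide_nonneg_nonneg)
        from mult_right_mono[OF this exp_ge_zero[of "- 2 * (t - s0)"]]
        have \<sigma>2: "M / 2 \<le> \<sigma> t" unfolding \<sigma>_def by (simp add: mult.assoc flip: exp_add)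
        have "Y z * (a z + d z) \<le> \<bar>Y z\<bar> * \<bar>a z + d z\<bar>" by (metis abs_ge_self abs_mult)
        also have "\<dots> \<le> \<bar>Y z\<bar> * (M * \<bar>X z\<bar>)" using lap[OF z] by (intro mult_left_mono) auto
        also have "\<dots> = M * (\<bar>Y z\<bar> * \<bar>X z\<bar>)" by simp
        also have "\<dots> \<le> M * (((Y z)\<^sup>2 + (X z)\<^sup>2) / 2)"
          using sum_squares_bound[of "\<bar>Y z\<bar>" "\<bar>X z\<bar>"] M by (intro mult_left_mono) auto
        finally have 1: "Y z * (a z + d z) \<le> M / 2 * (Y z)\<^sup>2 + M / 2 * (X z)\<^sup>2" by (simp add: algebra_simps)
        have 2: "\<sigma> t * (2 * X z * Y z - 2 * (X z)\<^sup>2) \<le> \<sigma> t * ((Y z)\<^sup>2 - (X z)\<^sup>2)"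
          using sum_squares_bound[of "X z" "Y z"] \<tau>(1) unfolding \<sigma>_def by (intro mult_left_mono) (auto simp: algebra_simps)
        have 3: "M / 2 * (X z)\<^sup>2 \<le> \<sigma> t * (X z)\<^sup>2" using \<sigma>2 by (intro mult_right_mono) auto
        have 4: "M / 2 * (Y z)\<^sup>2 \<le> \<tau> * (Y z)\<^sup>2" "\<sigma> t * (Y z)\<^sup>2 \<le> \<tau> * (Y z)\<^sup>2"
          by (rule mult_right_mono[OF order_trans[OF \<sigma>2 \<sigma>1]], simp, rule mult_right_mono[OF \<sigma>1], simp)
        show ?thesis unfolding q_def using 1 2 3 4 by (simp add: algebra_simps)
      qed
      have ip: "integral (cbox c (c + 2 * pi)) (p' t) \<le> 0" if t: "t \<in> {s0..T1}" for t
      proof -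
        have cq: "continuous_on (cbox c (c + 2 * pi)) (\<lambda>\<theta>. q t (Complex t \<theta>))"
          unfolding q_def using cont1[OF cX(1) t] cont1[OF cX(4) t] cont1[OF cX(7) t] cont1[OF cY(1) t] by (auto intro!: continuous_intros)
        have iq: "(\<lambda>\<theta>. q t (Complex t \<theta>)) integrable_on cbox c (c + 2 * pi)" "(\<lambda>\<theta>. r (Complex t \<theta>)) integrable_on cbox c (c + 2 * pi)"
          by (rule integrable_continuous[OF cq], rule integrable_continuous[OF cont1[OF cY(3) t]])
        have "integral (cbox c (c + 2 * pi)) (p' t) = exp (- 2 * \<tau> * t) * (integral (cbox c (c + 2 * pi)) (\<lambda>\<theta>. q t (Complex t \<theta>)) - integral (cbox c (c + 2 * pi)) (\<lambda>\<theta>. r (Complex t \<theta>)))"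
          unfolding p'_def integral_mult_right by (subst Henstock_Kurzweil_Integration.integral_diff[OF iq]) simp
        also have "\<dots> \<le> 0"
          using rint[OF t] integral_le[OF iq(1) integrable_0] qneg[OF t inS[OF t]] by (simp add: mult_nonneg_nonpos)
        finally show ?thesis .
      qed
      have "V T1 \<le> V s0"
      proof (rule DERIV_nonpos_imp_decreasing_open[where f=V and a=s0 and b=T1])
        show "s0 \<le> T1" using s0 by simp
        show "\<exists>y. DERIV V t :> y \<and> y \<le> 0" if "s0 < t" "t < T1" for t
          using Vder[of t] ip[of t] that at_within_Icc_at[of s0 t T1] by (intro exI[of _ "integral (cbox c (c + 2 * pi)) (p' t)"]) auto
        show "continuous_on {s0..T1} V" using Vder by (intro DERIV_continuous_on) auto
      qed
      moreover have "V s0 = 0"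
      proof -
        have "p s0 \<theta> = 0" for \<theta>
        proof -
          have sS: "Complex s0 \<theta> \<in> S" using inS s0 by auto
          have ev: "\<forall>\<^sub>F w in nhds (Complex s0 \<theta>). X w = 0"
          proof -
            have "open {z. t0 < Re z \<and> Re z < t1}" by (intro open_Collect_conj open_Collect_less continuous_intros)
            then have "\<forall>\<^sub>F w in nhds (Complex s0 \<theta>). w \<in> {z. t0 < Re z \<and> Re z < t1}"
              using s0 by (intro eventually_nhds_in_open) auto
            then show ?thesis by (rule eventually_mono) (use zero S s0 False in \<open>auto simp: T1_def\<close>)
          qed
          have "(X has_derivative (\<lambda>_. 0)) (at (Complex s0 \<theta>))"
          proof -
            obtain W where W: "open W" "Complex s0 \<theta> \<in> W" "\<And>w. w \<in> W \<Longrightarrow> X w = 0"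
              using ev unfolding eventually_nhds by blast
            show ?thesis
              by (rule has_derivative_transform_within_open[OF has_derivative_const W(1,2)]) (simp add: W(3))
          qed
          from has_derivative_unique[OF D(2)[OF sS] this]
          have e: "(\<lambda>h. Xt (Complex s0 \<theta>) * Re h + Xh (Complex s0 \<theta>) * Im h) = (\<lambda>_. 0)" .
          have "Xt (Complex s0 \<theta>) = 0" "Xh (Complex s0 \<theta>) = 0" using fun_cong[OF e, of 1] fun_cong[OF e, of \<i>] by auto
          moreover have "X (Complex s0 \<theta>) = 0" using eventually_nhds_x_imp_x[OF ev] .
          ultimately show ?thesis unfolding p_def Y_def by simp
        qed
        then have "p s0 = (\<lambda>_. 0)" by (rule ext)
        then show ?thesis unfolding V_def by simp
      qed
      ultimately have V: "V T1 \<le> 0" by simp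
      have T1: "T1 \<in> {s0..T1}" using s0 by simp
      let ?l = "\<lambda>\<theta>. exp (- 2 * \<tau> * T1) / 2 * (\<tau>\<^sup>2 * (X (Complex T1 \<theta>))\<^sup>2 - (Xh (Complex T1 \<theta>))\<^sup>2)"
      have i2: "(\<lambda>\<theta>. (X (Complex T1 \<theta>))\<^sup>2) integrable_on cbox c (c + 2 * pi)" "(\<lambda>\<theta>. (Xh (Complex T1 \<theta>))\<^sup>2) integrable_on cbox c (c + 2 * pi)"
        using cont1[OF cX(1) T1] cont1[OF cX(3) T1] by (intro integrable_continuous continuous_intros; blast)+
      have cl: "continuous_on (cbox c (c + 2 * pi)) ?l"
        using cont1[OF cX(1) T1] cont1[OF cX(3) T1] by (auto intro!: continuous_intros)
      have "integral (cbox c (c + 2 * pi)) ?l \<le> V T1"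
        unfolding V_def
      proof (rule integral_le[OF integrable_continuous[OF cl] integrable_continuous[OF cp[OF T1]]])
        fix \<theta>
        have "0 \<le> exp (- 2 * \<tau> * T1) * ((Y (Complex T1 \<theta>))\<^sup>2 / 2 + \<sigma> T1 * (X (Complex T1 \<theta>))\<^sup>2)"
          using \<tau> unfolding \<sigma>_def by auto
        also have "\<dots> = p T1 \<theta> - ?l \<theta>" unfolding p_def by (simp add: field_simps)
        finally show "?l \<theta> \<le> p T1 \<theta>" by simp
      qed
      also note V
      also have "integral (cbox c (c + 2 * pi)) ?l = exp (- 2 * \<tau> * T1) / 2 * (\<tau>\<^sup>2 * integral I (\<lambda>\<theta>. (X (Complex T1 \<theta>))\<^sup>2) - integral I (\<lambda>\<theta>. (Xh (Complex T1 \<theta>))\<^sup>2))"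
        unfolding integral_mult_right using i2
        by (subst Henstock_Kurzweil_Integration.integral_diff) (auto simp: I_def intro!: integrable_on_mult_right)
      finally have "\<tau>\<^sup>2 * integral I (\<lambda>\<theta>. (X (Complex T1 \<theta>))\<^sup>2) - integral I (\<lambda>\<theta>. (Xh (Complex T1 \<theta>))\<^sup>2) \<le> 0"
        by (simp add: mult_le_0_iff)
      then show ?thesis by simp
    qed
    have T1: "T1 \<in> {s0..T1}" using s0 by simp
    define P where "P = integral I (\<lambda>\<theta>. (X (Complex T1 \<theta>))\<^sup>2)"
    define R where "R = integral I (\<lambda>\<theta>. (Xh (Complex T1 \<theta>))\<^sup>2)"
    have cX2: "continuous_on I (\<lambda>\<theta>. (X (Complex T1 \<theta>))\<^sup>2)" using cont1[OF cX(1) T1] by (intro continuous_intros)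
    have "P \<le> 0"
    proof (rule ccontr)
      assume "\<not> P \<le> 0" then have P: "P > 0" by simp
      \<comment> \<open>Large enough for the estimate \<open>main\<close>, and such that its left
        side exceeds \<open>\<bar>R\<bar>\<close>.\<close>
      define \<tau> where "\<tau> = max ((M / 2) * exp (2 * (T1 - s0))) (max 1 ((\<bar>R\<bar> + 1) / P))"
      have \<tau>: "\<tau> \<ge> 1" "\<tau> \<ge> (M / 2) * exp (2 * (T1 - s0))" "(\<bar>R\<bar> + 1) / P \<le> \<tau>" unfolding \<tau>_def by auto
      have "\<tau>\<^sup>2 * P \<le> R" using main[of \<tau>] \<tau> unfolding P_def R_def by auto
      moreover have "\<bar>R\<bar> + 1 \<le> \<tau> * P" using \<tau>(3) P by (simp add: field_simps)
      moreover have "\<tau> * P \<le> \<tau>\<^sup>2 * P" using \<tau>(1) P by (simp add: power2_eq_square)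
      ultimately show False by linarith
    qed
    then have "(X (Complex T1 c))\<^sup>2 = 0"
      unfolding P_def I_def using cX2 unfolding I_def
      by (intro integral_nonneg_continuous_zero[of c "c + 2 * pi" "\<lambda>\<theta>. (X (Complex T1 \<theta>))\<^sup>2" c]) auto
    then show ?thesis unfolding T1_def c_def by simp
  qed
qed

lemma C2_data_periodic:
  assumes C: "C2_data u ux uy a b b' d S" and S: "\<And>z. z \<in> S \<Longrightarrow> z + w \<in> S"
    and per: "\<And>z. u (z + w) = u z" and z: "z \<in> S"
  shows "ux (z + w) = ux z" "uy (z + w) = uy z"
proof -
  note D = C2_dataD[OF C]
  have "((\<lambda>z. z + w) has_derivative (\<lambda>h. h)) (at z)" by (auto intro!: derivative_eq_intros)
  from has_derivative_compose[OF this D(2)[OF S[OF z]]]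
  have "(u has_derivative (\<lambda>h. ux (z + w) * Re h + uy (z + w) * Im h)) (at z)" by (simp add: per)
  from has_derivative_unique[OF this D(2)[OF z]]
  have e: "(\<lambda>h. ux (z + w) * Re h + uy (z + w) * Im h) = (\<lambda>h. ux z * Re h + uy z * Im h)" .
  show "ux (z + w) = ux z" "uy (z + w) = uy z" using fun_cong[OF e, of 1] fun_cong[OF e, of \<i>] by auto
qed

lemma has_derivative_exp_line:
  fixes w v :: complex
  shows "((\<lambda>h::real. exp (w + v * of_real h)) has_derivative (\<lambda>h. exp (w + v * of_real t) * (v * of_real h))) (at t)"
proof -
  have 1: "((\<lambda>h::real. w + v * of_real h) has_derivative (\<lambda>h. v * of_real h)) (at t)"
    by (auto intro!: derivative_eq_intros)
  have 2: "(exp has_derivative (*) (exp (w + v * of_real t))) (at (w + v * of_real t))"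
    using DERIV_exp unfolding has_field_derivative_def .
  show ?thesis by (rule has_derivative_compose[OF 1 2])
qed

section \<open>Rotations about the centre of a circular hole\<close>

context elliptic_solution begin

lemma C2_data_u: "C2_data u ux uy a b b' d \<Omega>"
  unfolding C2_data_def using open_dom du dux duy cont2 by auto

text \<open>Rotations about \<open>q\<close> in either sense preserve the sphere, which gives both
  signs. A rotation by the angle \<open>h\<close> displaces points of the domain by at most
  \<open>h * K\<close>, hence the precision \<open>\<epsilon> / K\<close>.\<close>

lemma angular_derivative_zero:
  assumes C: "compact C" "C \<subseteq> \<Omega>" "\<And>z. z \<in> C \<Longrightarrow> ux z = 0 \<and> uy z = 0"
    and E: "open E" "E \<subseteq> \<Omega>" "frontier E \<subseteq> C \<union> sphere q r" and q: "sphere q r \<inter> \<Omega> = {}" and z: "z \<in> E"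
  shows "uy z * Re (z - q) - ux z * Im (z - q) = 0"
proof -
  obtain K where K: "K > 0" "\<And>p. p \<in> \<Omega> \<Longrightarrow> cmod (p - q) \<le> K"
  proof -
    have "bounded ((\<lambda>p. p - q) ` \<Omega>)" using bounded_dom by (rule bounded_translation_minus)
    then show ?thesis using that unfolding bounded_pos by auto
  qed
  have main: "uy z * (s * Re (z - q)) - ux z * (s * Im (z - q)) \<le> 0" if s: "s = 1 \<or> s = -1" for s :: real
  proof (rule field_le_epsilon)
    fix \<epsilon> :: real assume \<epsilon>: "\<epsilon> > 0"
    then have \<epsilon>': "\<epsilon> / K > 0" using K by simp
    obtain \<rho> where \<rho>: "\<rho> > 0"
    "\<And>e f H \<eta> z. cmod e = 1 \<Longrightarrow> \<eta> < \<rho> \<Longrightarrow> open H \<Longrightarrow>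
       (\<And>p. p \<in> \<Omega> \<Longrightarrow> cmod (e * p + f - p) \<le> \<eta>) \<Longrightarrow>
       (\<And>p. p \<in> closure H \<Longrightarrow> p \<notin> H \<Longrightarrow> u (e * p + f) \<le> u p) \<Longrightarrow>
       (\<And>p. p \<in> sphere q r \<Longrightarrow> p \<in> H \<Longrightarrow> e * p + f \<in> closure E \<Longrightarrow> u (e * p + f) \<le> 0) \<Longrightarrow>
       z \<in> E \<Longrightarrow> z \<in> H \<Longrightarrow> e * z + f \<in> E \<Longrightarrow> u (e * z + f) \<le> u z + \<epsilon> / K * \<eta>"
      using finite_difference_bound[OF C E q \<epsilon>'] by blast
    let ?\<phi> = "\<lambda>h::real. u (q + cis (s * h) * (z - q))"
    have "((\<lambda>h::real. q + cis (s * h) * (z - q)) has_derivative (\<lambda>h. of_real (s * h) * \<i> * (z - q))) (at 0)"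
      using has_derivative_add[OF has_derivative_const[of q] has_derivative_mult_left[OF has_derivative_exp_line[of 0 "\<i> * of_real s" 0], of "z - q"]]
      by (simp add: cis_conv_exp mult_ac)
    from has_derivative_compose[OF this, of u "\<lambda>h. ux z * Re h + uy z * Im h"]
    have "(?\<phi> has_derivative (\<lambda>h. ux z * Re (of_real (s * h) * \<i> * (z - q)) + uy z * Im (of_real (s * h) * \<i> * (z - q)))) (at 0)"
      using du[of z] z E by auto
    then have d: "(?\<phi> has_real_derivative (uy z * (s * Re (z - q)) - ux z * (s * Im (z - q)))) (at 0)"
      unfolding has_field_derivative_def by (rule has_derivative_eq_rhs) (auto simp: algebra_simps)
    have "continuous_on UNIV (\<lambda>h::real. q + cis (s * h) * (z - q))" by (auto intro!: continuous_intros)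
    then have "isCont (\<lambda>h::real. q + cis (s * h) * (z - q)) 0" by (simp add: continuous_on_eq_continuous_at)
    moreover obtain e where e: "e > 0" "ball z e \<subseteq> E" using E z open_contains_ball by blast
    ultimately obtain \<delta> where \<delta>: "\<delta> > 0" "\<And>h. \<bar>h\<bar> < \<delta> \<Longrightarrow> q + cis (s * h) * (z - q) \<in> E"
      unfolding continuous_at_eps_delta by (force simp: dist_norm norm_minus_commute)
    have "uy z * (s * Re (z - q)) - ux z * (s * Im (z - q)) \<le> \<epsilon>"
    proof (rule derivative_le_of_right_bound[OF d])
      show "min \<delta> (\<rho> / K) > 0" using \<delta> \<rho> K by simp
      fix h assume h: "0 < h" "h < min \<delta> (\<rho> / K)"
      have "u (cis (s * h) * z + (q - cis (s * h) * q)) \<le> u z + \<epsilon> / K * (h * K)"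
      proof (rule \<rho>(2)[where H=UNIV])
        show "h * K < \<rho>" using h K by (simp add: pos_less_divide_eq)
        show "cmod (cis (s * h) * p + (q - cis (s * h) * q) - p) \<le> h * K" if "p \<in> \<Omega>" for p
        proof -
          have eq: "cmod (cis (s * h) * p + (q - cis (s * h) * q) - p) = cmod (cis (s * h) - 1) * cmod (p - q)"
            by (simp add: norm_mult[symmetric] algebra_simps)
          have "cmod (cis (s * h) - 1) \<le> \<bar>s * h\<bar>"
            using dist_exp_i_1[of "s * h"] abs_sin_x_le_abs_x[of "s * h / 2"] by (simp add: cis_conv_exp)
          also have "\<bar>s * h\<bar> = h" using s h by auto
          finally have "cmod (cis (s * h) - 1) \<le> h" .
          from mult_mono[OF this K(2)[OF that]] have "cmod (cis (s * h) - 1) * cmod (p - q) \<le> h * K" using h by simp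
          then show ?thesis using eq by simp
        qed
        show "u (cis (s * h) * p + (q - cis (s * h) * q)) \<le> 0" if "p \<in> sphere q r" for p
        proof -
          have "dist q (cis (s * h) * p + (q - cis (s * h) * q)) = cmod (cis (s * h) * (q - p))"
            by (simp add: dist_norm algebra_simps)
          also have "\<dots> = r" using that by (simp add: norm_mult dist_norm)
          finally have "cis (s * h) * p + (q - cis (s * h) * q) \<in> sphere q r" by simp
          then show ?thesis using q outside_zero by fastforce
        qed
      qed (use z \<delta>(2)[of h] h in \<open>auto simp: algebra_simps\<close>)
      then show "?\<phi> h \<le> ?\<phi> 0 + \<epsilon> * h" using K by (simp add: algebra_simps)
    qed
    then show "uy z * (s * Re (z - q)) - ux z * (s * Im (z - q)) \<le> 0 + \<epsilon>" by simp
  qed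
  show ?thesis using main[of 1] main[of "-1"] by (simp add: algebra_simps)
qed

text \<open>In the coordinate \<zeta> of \<open>q + exp \<zeta>\<close> the annulus is a strip and
  rotations are vertical translations. The difference \<open>X\<close> of \<open>u\<close> and a
  rotated copy satisfies a linear differential inequality because \<open>g\<close> is Lipschitz on
  the range of \<open>u\<close>, and it vanishes near the hole, hence everywhere in the strip. Along
  radii the boundary value 0 at \<open>p\<close> then spreads to the whole circle of radius
  \<open>R\<close>, while \<open>u\<close> is positive in the domain.\<close>

lemma circular_hole_forces_circle:
  assumes C: "compact C" "C \<subseteq> \<Omega>" "\<And>z. z \<in> C \<Longrightarrow> ux z = 0 \<and> uy z = 0"
    and E: "open E" "E \<subseteq> \<Omega>" "frontier E \<subseteq> C \<union> sphere q r"
    and r: "0 < r" "r < R" and hole: "sphere q r \<inter> \<Omega> = {}"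
    and ann: "\<And>z. r < dist q z \<Longrightarrow> dist q z < R \<Longrightarrow> z \<in> \<Omega>"
    and \<epsilon>: "\<epsilon> > 0" and thin: "\<And>z. r < dist q z \<Longrightarrow> dist q z < r + \<epsilon> \<Longrightarrow> z \<in> E"
    and p: "p \<notin> \<Omega>" "dist q p = R"
    and lip: "\<And>B. \<exists>M. \<forall>s\<in>{0..B}. \<forall>t\<in>{0..B}. \<bar>g s - g t\<bar> \<le> M * \<bar>s - t\<bar>"
    and z: "dist q z = R"
  shows "z \<notin> \<Omega>"
proof -
  obtain B where B: "\<And>w. w \<in> \<Omega> \<Longrightarrow> u w \<le> B"
  proof -
    have "compact (u ` closure \<Omega>)"
      using bounded_dom cont_u by (auto intro!: compact_continuous_image intro: continuous_on_subset simp: compact_closure)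
    then have "bounded (u ` closure \<Omega>)" by (rule compact_imp_bounded)
    then obtain B where "\<And>w. w \<in> closure \<Omega> \<Longrightarrow> \<bar>u w\<bar> \<le> B" unfolding bounded_iff by auto
    then show ?thesis using that[of B] closure_subset by (smt (verit) subset_iff)
  qed
  obtain M0 where M0: "\<And>s t. s \<in> {0..B} \<Longrightarrow> t \<in> {0..B} \<Longrightarrow> \<bar>g s - g t\<bar> \<le> M0 * \<bar>s - t\<bar>"
    using lip by blast
  define M where "M = max M0 0"
  have M: "M \<ge> 0" "\<bar>g s - g t\<bar> \<le> M * \<bar>s - t\<bar>" if "s \<in> {0..B}" "t \<in> {0..B}" for s t
  proof -
    have "M0 * \<bar>s - t\<bar> \<le> M * \<bar>s - t\<bar>" by (rule mult_right_mono) (auto simp: M_def)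
    then show "\<bar>g s - g t\<bar> \<le> M * \<bar>s - t\<bar>" using M0[OF that] by linarith
  qed (simp add: M_def)
  define S where "S = {\<zeta>. ln r < Re \<zeta> \<and> Re \<zeta> < ln R}"
  have oS: "open S" unfolding S_def by (intro open_Collect_conj open_Collect_less continuous_intros)
  have expS: "q + exp \<zeta> \<in> \<Omega>" "cmod (exp \<zeta>) < R" if "\<zeta> \<in> S" for \<zeta>
  proof -
    have "exp (ln r) < exp (Re \<zeta>)" "exp (Re \<zeta>) < exp (ln R)" using that unfolding S_def by auto
    then have "r < cmod (exp \<zeta>)" "cmod (exp \<zeta>) < R" using r by (auto simp: norm_exp_eq_Re)
    then show "q + exp \<zeta> \<in> \<Omega>" "cmod (exp \<zeta>) < R" by (auto intro!: ann simp: dist_norm)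
  qed
  have rot: "u (q + exp (\<zeta> + \<i> * of_real \<alpha>)) = u (q + exp \<zeta>)" if \<zeta>: "\<zeta> \<in> S" for \<zeta> \<alpha>
  proof -
    have sh: "\<zeta> + \<i> * of_real \<alpha> \<in> S" if "\<zeta> \<in> S" for \<zeta> using that unfolding S_def by simp
    have d1: "((\<lambda>\<zeta>. q + exp (\<zeta> + \<i> * of_real \<alpha>)) has_field_derivative exp (\<zeta> + \<i> * of_real \<alpha>)) (at \<zeta>)"
      "((\<lambda>\<zeta>. exp (\<zeta> + \<i> * of_real \<alpha>)) has_field_derivative exp (\<zeta> + \<i> * of_real \<alpha>)) (at \<zeta>)" for \<zeta> \<alpha>
      by (auto intro!: derivative_eq_intros)
    have cexp: "continuous_on S (\<lambda>\<zeta>. exp (\<zeta> + \<i> * of_real \<alpha>))" for \<alpha> by (intro continuous_intros)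
    have "\<exists>vx vy k l l' m. C2_data (\<lambda>\<zeta>. u (q + exp (\<zeta> + \<i> * of_real \<alpha>))) vx vy k l l' m S \<and>
      (\<forall>\<zeta>\<in>S. k \<zeta> + m \<zeta> = (cmod (exp (\<zeta> + \<i> * of_real \<alpha>)))\<^sup>2 *
         (a (q + exp (\<zeta> + \<i> * of_real \<alpha>)) + d (q + exp (\<zeta> + \<i> * of_real \<alpha>))))"
      by (rule C2_data_compose[OF C2_data_u oS _ d1(1) d1(2) cexp]) (use expS(1)[OF sh] in simp)
    then obtain vx vy k l l' m where V: "C2_data (\<lambda>\<zeta>. u (q + exp (\<zeta> + \<i> * of_real \<alpha>))) vx vy k l l' m S"
      "\<forall>\<zeta>\<in>S. k \<zeta> + m \<zeta> = (cmod (exp (\<zeta> + \<i> * of_real \<alpha>)))\<^sup>2 *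
         (a (q + exp (\<zeta> + \<i> * of_real \<alpha>)) + d (q + exp (\<zeta> + \<i> * of_real \<alpha>)))"
      by (elim exE conjE) (rule that)
    have "\<exists>wx wy k2 l2 l2' m2. C2_data (\<lambda>\<zeta>. u (q + exp (\<zeta> + \<i> * of_real 0))) wx wy k2 l2 l2' m2 S \<and>
      (\<forall>\<zeta>\<in>S. k2 \<zeta> + m2 \<zeta> = (cmod (exp (\<zeta> + \<i> * of_real 0)))\<^sup>2 *
         (a (q + exp (\<zeta> + \<i> * of_real 0)) + d (q + exp (\<zeta> + \<i> * of_real 0))))"
      by (rule C2_data_compose[OF C2_data_u oS _ d1(1) d1(2) cexp]) (use expS(1) in simp)
    then obtain wx wy k2 l2 l2' m2 where W: "C2_data (\<lambda>\<zeta>. u (q + exp (\<zeta> + \<i> * of_real 0))) wx wy k2 l2 l2' m2 S"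
      "\<forall>\<zeta>\<in>S. k2 \<zeta> + m2 \<zeta> = (cmod (exp (\<zeta> + \<i> * of_real 0)))\<^sup>2 *
         (a (q + exp (\<zeta> + \<i> * of_real 0)) + d (q + exp (\<zeta> + \<i> * of_real 0)))"
      by (elim exE conjE) (rule that)
    define X where "X \<zeta> = 1 * u (q + exp (\<zeta> + \<i> * of_real \<alpha>)) + (-1) * u (q + exp (\<zeta> + \<i> * of_real 0))" for \<zeta>
    note CX = C2_data_lincomb[OF V(1) W(1), of 1 "-1", folded X_def]
    have perS: "\<zeta> + 2 * of_real pi * \<i> \<in> S" if "\<zeta> \<in> S" for \<zeta> using that unfolding S_def by simp
    have e2pi: "exp (\<zeta> + 2 * of_real pi * \<i> + w) = exp (\<zeta> + w)" for \<zeta> w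
      by (simp add: exp_add)
    have perX: "X (\<zeta> + 2 * of_real pi * \<i>) = X \<zeta>" for \<zeta> unfolding X_def e2pi ..
    have zero: "X \<zeta> = 0" if \<zeta>: "\<zeta> \<in> S" "Re \<zeta> \<le> ln (min R (r + \<epsilon> / 2))" for \<zeta>
    proof -
      have inE: "q + exp (\<zeta> + \<i> * of_real h) \<in> E" for h
      proof -
        have "exp (ln r) < exp (Re \<zeta>)" "exp (Re \<zeta>) \<le> exp (ln (min R (r + \<epsilon> / 2)))"
          using \<zeta> unfolding S_def by auto
        moreover have "exp (ln r) = r" "exp (ln (min R (r + \<epsilon> / 2))) = min R (r + \<epsilon> / 2)" using r \<epsilon> by auto
        ultimately show ?thesis using \<epsilon> by (intro thin) (auto simp: dist_norm norm_exp_eq_Re)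
      qed
      have "((\<lambda>h::real. u (q + exp (\<zeta> + \<i> * of_real h))) has_real_derivative 0) (at h)" for h
      proof -
        let ?w = "exp (\<zeta> + \<i> * of_real h)"
        have "((\<lambda>h::real. q + exp (\<zeta> + \<i> * of_real h)) has_derivative (\<lambda>s. of_real s * \<i> * ?w)) (at h)"
          using has_derivative_add[OF has_derivative_const[of q] has_derivative_exp_line[of \<zeta> \<i> h]] by (simp add: mult_ac)
        from has_derivative_compose[OF this, of u "\<lambda>s. ux (q + ?w) * Re s + uy (q + ?w) * Im s"]
        have "((\<lambda>h::real. u (q + exp (\<zeta> + \<i> * of_real h))) has_derivative (\<lambda>s. ux (q + ?w) * Re (of_real s * \<i> * ?w) + uy (q + ?w) * Im (of_real s * \<i> * ?w))) (at h)"
          using du[of "q + ?w"] inE[of h] E by auto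
        note dd = this
        have "uy (q + ?w) * Re ?w - ux (q + ?w) * Im ?w = 0"
          using angular_derivative_zero[OF C E hole inE[of h]] by simp
        then have "ux (q + ?w) * Re (of_real s * \<i> * ?w) + uy (q + ?w) * Im (of_real s * \<i> * ?w) = 0 * s" for s
          by (simp add: algebra_simps)
        then show ?thesis unfolding has_field_derivative_def
          by (intro has_derivative_eq_rhs[OF dd] ext)
      qed
      then show ?thesis unfolding X_def
        using DERIV_isconst_all[of "\<lambda>h::real. u (q + exp (\<zeta> + \<i> * of_real h))" \<alpha> 0] by simp
    qed
    have "X \<zeta> = 0"
    proof (rule unique_continuation_strip[OF CX S_def perX])
      show "ln r < ln (min R (r + \<epsilon> / 2))" using r \<epsilon> by simp
      fix \<zeta> assume \<zeta>: "\<zeta> \<in> S"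
      let ?p = "q + exp (\<zeta> + \<i> * of_real \<alpha>)" and ?q = "q + exp (\<zeta> + \<i> * of_real 0)"
      have pq: "?p \<in> \<Omega>" "?q \<in> \<Omega>" using expS(1)[OF sh[OF \<zeta>]] expS(1)[OF \<zeta>] by auto
      have n: "cmod (exp (\<zeta> + \<i> * of_real \<alpha>)) = cmod (exp \<zeta>)" by (simp add: norm_exp_eq_Re)
      have "1 * k \<zeta> + - 1 * k2 \<zeta> + (1 * m \<zeta> + - 1 * m2 \<zeta>) = (k \<zeta> + m \<zeta>) - (k2 \<zeta> + m2 \<zeta>)" by simp
      also have "\<dots> = (cmod (exp \<zeta>))\<^sup>2 * (g (u ?q) - g (u ?p))"
        unfolding bspec[OF V(2) \<zeta>] bspec[OF W(2) \<zeta>] eqn[OF pq(1)] eqn[OF pq(2)] n by (simp add: algebra_simps)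
      finally have "\<bar>1 * k \<zeta> + - 1 * k2 \<zeta> + (1 * m \<zeta> + - 1 * m2 \<zeta>)\<bar> = (cmod (exp \<zeta>))\<^sup>2 * \<bar>g (u ?q) - g (u ?p)\<bar>" by (simp add: abs_mult)
      also have "\<dots> \<le> R\<^sup>2 * (M * \<bar>u ?q - u ?p\<bar>)"
        using pq B u_nonneg expS(2)[OF \<zeta>] by (intro mult_mono M power_mono) (auto intro: less_imp_le)
      also have "\<dots> = (R\<^sup>2 * M) * \<bar>X \<zeta>\<bar>" unfolding X_def by (simp add: abs_minus_commute)
      finally show "\<bar>1 * k \<zeta> + - 1 * k2 \<zeta> + (1 * m \<zeta> + - 1 * m2 \<zeta>)\<bar> \<le> (R\<^sup>2 * M) * \<bar>X \<zeta>\<bar>" .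
    qed (use C2_data_periodic[OF CX perS perX] zero \<zeta> in auto)
    then show ?thesis unfolding X_def by simp
  qed
  have "u z = 0"
  proof -
    define \<alpha> where "\<alpha> = Arg ((z - q) / (p - q))"
    have R: "R > 0" using r by simp
    have pq: "p - q \<noteq> 0" "z - q \<noteq> 0" using p(2) z R by auto
    have zp: "z - q = cis \<alpha> * (p - q)"
    proof -
      have "cmod ((z - q) / (p - q)) = 1" using p(2) z R by (simp add: norm_divide dist_norm norm_minus_commute)
      then have "(z - q) / (p - q) = cis \<alpha>" unfolding \<alpha>_def using pq cis_Arg[of "(z - q) / (p - q)"] by (simp add: sgn_eq)
      then show ?thesis using pq by (simp add: divide_eq_eq)
    qed
    have eq: "u (q + of_real s * (z - q)) = u (q + of_real s * (p - q))" if s: "r / R < s" "s < 1" for s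
    proof -
      have s0: "s > 0" using s r by (meson divide_pos_pos less_trans R)
      define \<zeta> where "\<zeta> = Ln (of_real s * (p - q))"
      have nz: "of_real s * (p - q) \<noteq> 0" using s0 pq by simp
      have ex: "exp \<zeta> = of_real s * (p - q)" unfolding \<zeta>_def using nz by simp
      have "Re \<zeta> = ln (s * R)" unfolding \<zeta>_def using nz p(2) s0 by (simp add: norm_mult dist_norm norm_minus_commute)
      moreover have "r < s * R" "s * R < R" using s R by (auto simp: field_simps)
      ultimately have "\<zeta> \<in> S" unfolding S_def using r R by simp
      from rot[OF this, of \<alpha>] show ?thesis
        unfolding exp_add ex zp by (simp add: cis_conv_exp mult_ac)
    qed
    have c: "continuous_on UNIV (\<lambda>s::real. u (q + of_real s * (z - q)) - u (q + of_real s * (p - q)))"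
      by (intro continuous_intros continuous_on_compose2[OF cont_u]) auto
    have "(\<lambda>s::real. u (q + of_real s * (z - q)) - u (q + of_real s * (p - q))) 1 = 0"
    proof (rule continuous_constant_on_closure[where S="{r / R<..<1}" and x=1 and a=0 and
          f="\<lambda>s::real. u (q + of_real s * (z - q)) - u (q + of_real s * (p - q))"])
      have "r / R < 1" using r R by simp
      then have cl: "closure {r / R<..<1} = {r / R..1}" by (rule closure_greaterThanLessThan)
      show "1 \<in> closure {r / R<..<1::real}" using \<open>r / R < 1\<close> unfolding cl by simp
    qed (use c eq in \<open>auto intro: continuous_on_subset\<close>)
    then show ?thesis using outside_zero[OF p(1)] by simp
  qed
  then show ?thesis using u_pos by force
qed

end

section \<open>Critical curves in elliptical annuli\<close>

lemma segment_mvt: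
  fixes v :: "complex \<Rightarrow> real"
  assumes "convex S" "z1 \<in> S" "z2 \<in> S" "\<And>z. z \<in> S \<Longrightarrow> (v has_derivative D z) (at z)"
  obtains \<xi> where "\<xi> \<in> S" "v z2 - v z1 = D \<xi> (z2 - z1)"
proof -
  have inS: "z1 + of_real t * (z2 - z1) \<in> S" if "0 \<le> t" "t \<le> 1" for t
  proof -
    have "(1 - t) *\<^sub>R z1 + t *\<^sub>R z2 \<in> S" using assms(1-3) that by (auto simp: convex_alt)
    then show ?thesis by (simp add: scaleR_conv_of_real algebra_simps)
  qed
  have "\<exists>t>0. t < 1 \<and> v (z1 + of_real 1 * (z2 - z1)) - v (z1 + of_real 0 * (z2 - z1)) = (1 - 0) * D (z1 + of_real t * (z2 - z1)) (z2 - z1)"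
    by (rule MVT2, simp, rule has_derivative_line, rule assms(4), rule inS)
  then obtain t where t: "0 < t" "t < 1" "v z2 - v z1 = D (z1 + of_real t * (z2 - z1)) (z2 - z1)" by auto
  show thesis using that[OF inS t(3)] t by simp
qed

text \<open>A quantitative implicit function theorem: near \<open>p\<close> a level set of
  \<open>v\<close> is a Lipschitz graph over the coordinate \<open>R\<close>. The coordinates
  \<open>P\<close> and \<open>R\<close> are the real and the imaginary part in either order.\<close>

lemma level_set_projection:
  fixes v \<alpha> \<beta> P R :: "complex \<Rightarrow> real"
  assumes S: "open S" "p \<in> S" "\<And>z. z \<in> S \<Longrightarrow> (v has_derivative (\<lambda>h. \<alpha> z * P h + \<beta> z * R h)) (at z)"
    and cont: "continuous_on S \<alpha>" "continuous_on S \<beta>" and ne: "\<alpha> p \<noteq> 0"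
    and norm: "\<And>h. cmod h \<le> \<bar>P h\<bar> + \<bar>R h\<bar>"
  obtains r L where "r > 0" "\<And>z1 z2. z1 \<in> ball p r \<Longrightarrow> z2 \<in> ball p r \<Longrightarrow> v z1 = v z2 \<Longrightarrow> cmod (z2 - z1) \<le> L * \<bar>R (z2 - z1)\<bar>"
proof -
  define k where "k = \<bar>\<alpha> p\<bar> / 2"
  define M where "M = \<bar>\<beta> p\<bar> + 1"
  have k: "k > 0" using ne unfolding k_def by simp
  have M: "M > 0" unfolding M_def by simp
  have "isCont \<alpha> p" "isCont \<beta> p" using cont S(1,2) by (auto simp: continuous_on_eq_continuous_at)
  then have "(\<alpha> \<longlongrightarrow> \<alpha> p) (nhds p)" "(\<beta> \<longlongrightarrow> \<beta> p) (nhds p)"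
    by (simp_all add: isCont_def tendsto_at_iff_tendsto_nhds)
  then have "\<forall>\<^sub>F z in nhds p. dist (\<alpha> z) (\<alpha> p) < k" "\<forall>\<^sub>F z in nhds p. dist (\<beta> z) (\<beta> p) < 1"
    using tendstoD[of \<alpha> "\<alpha> p" "nhds p" k] tendstoD[of \<beta> "\<beta> p" "nhds p" 1] k by auto
  then have "\<forall>\<^sub>F z in nhds p. z \<in> S \<and> \<bar>\<alpha> z\<bar> \<ge> k \<and> \<bar>\<beta> z\<bar> \<le> M"
    using eventually_nhds_in_open[OF S(1,2)]
    by eventually_elim (auto simp: k_def M_def dist_real_def abs_if split: if_splits)
  then obtain r where r: "r > 0" "\<And>z. z \<in> ball p r \<Longrightarrow> z \<in> S \<and> \<bar>\<alpha> z\<bar> \<ge> k \<and> \<bar>\<beta> z\<bar> \<le> M"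
    unfolding eventually_nhds_metric by (auto simp: dist_commute)
  show thesis
  proof (rule that[OF r(1)])
    fix z1 z2 assume z: "z1 \<in> ball p r" "z2 \<in> ball p r" "v z1 = v z2"
    obtain \<xi> where \<xi>: "\<xi> \<in> ball p r" "v z2 - v z1 = \<alpha> \<xi> * P (z2 - z1) + \<beta> \<xi> * R (z2 - z1)"
      by (rule segment_mvt[OF convex_ball z(1,2), of v "\<lambda>z h. \<alpha> z * P h + \<beta> z * R h"]) (use S(3) r(2) in blast)+
    have "\<bar>\<alpha> \<xi>\<bar> * \<bar>P (z2 - z1)\<bar> = \<bar>\<beta> \<xi>\<bar> * \<bar>R (z2 - z1)\<bar>"
      using \<xi>(2) z(3) by (simp add: eq_neg_iff_add_eq_0[symmetric] flip: abs_mult)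
    moreover have "k * \<bar>P (z2 - z1)\<bar> \<le> \<bar>\<alpha> \<xi>\<bar> * \<bar>P (z2 - z1)\<bar>" "\<bar>\<beta> \<xi>\<bar> * \<bar>R (z2 - z1)\<bar> \<le> M * \<bar>R (z2 - z1)\<bar>"
      using r(2)[OF \<xi>(1)] by (auto intro!: mult_right_mono)
    ultimately have "\<bar>P (z2 - z1)\<bar> \<le> M / k * \<bar>R (z2 - z1)\<bar>" using k by (simp add: field_simps)
    then show "cmod (z2 - z1) \<le> (M / k + 1) * \<bar>R (z2 - z1)\<bar>" using norm[of "z2 - z1"] by (simp add: algebra_simps)
  qed
qed

context elliptic_solution begin

lemma quadratic_bound_at_critical:
  assumes p: "p \<in> \<Omega>"
  obtains r K where "r > 0" "ball p r \<subseteq> \<Omega>"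
    "\<And>z1 z2. z1 \<in> ball p r \<Longrightarrow> z2 \<in> ball p r \<Longrightarrow> ux z1 = 0 \<Longrightarrow> uy z1 = 0 \<Longrightarrow> \<bar>u z2 - u z1\<bar> \<le> K * (cmod (z2 - z1))\<^sup>2"
proof -
  obtain r where r: "r > 0" "cball p r \<subseteq> \<Omega>" using p open_dom open_contains_cball by blast
  have "\<exists>B. \<forall>z\<in>cball p r. \<bar>f z\<bar> \<le> B" if "continuous_on \<Omega> f" for f :: "complex \<Rightarrow> real"
  proof -
    have "compact (f ` cball p r)"
      using continuous_on_subset[OF that r(2)] compact_cball by (rule compact_continuous_image)
    from compact_imp_bounded[OF this] show ?thesis by (auto simp: bounded_iff)
  qed
  from this[OF cont2(1)] this[OF cont2(2)] this[OF cont2(3)] this[OF cont2(4)]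
  obtain B1 B2 B3 B4 where B: "\<And>z. z \<in> cball p r \<Longrightarrow> \<bar>a z\<bar> \<le> B1 \<and> \<bar>b z\<bar> \<le> B2 \<and> \<bar>b' z\<bar> \<le> B3 \<and> \<bar>d z\<bar> \<le> B4" by metis
  have D: "D \<in> \<Omega>" if "D \<in> ball p r" for D using that r(2) ball_subset_cball by blast
  have lin: "\<bar>s * Re h + t * Im h\<bar> \<le> (S + T) * cmod h" if "\<bar>s\<bar> \<le> S" "\<bar>t\<bar> \<le> T" for s t S T h
  proof -
    have "\<bar>s * Re h\<bar> \<le> S * cmod h" "\<bar>t * Im h\<bar> \<le> T * cmod h"
      unfolding abs_mult using that by (auto intro!: mult_mono abs_Re_le_cmod abs_Im_le_cmod)
    then show ?thesis by (simp add: algebra_simps)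
  qed
  show thesis
  proof (rule that[OF r(1)])
    show "ball p r \<subseteq> \<Omega>" using D by blast
    fix z1 z2 assume z: "z1 \<in> ball p r" "z2 \<in> ball p r" "ux z1 = 0" "uy z1 = 0"
    \<comment> \<open>The second disc keeps the intermediate point \<open>\<xi>\<close> no farther
      from \<open>z1\<close> than \<open>z2\<close>, so the gradient there is linear in the distance
      of \<open>z1\<close> and \<open>z2\<close>.\<close>
    define S where "S = ball p r \<inter> cball z1 (cmod (z2 - z1))"
    have cS: "convex S" "z1 \<in> S" "z2 \<in> S" unfolding S_def using z by (auto intro!: convex_Int simp: dist_norm norm_minus_commute)
    obtain \<xi> where \<xi>: "\<xi> \<in> S" "u z2 - u z1 = ux \<xi> * Re (z2 - z1) + uy \<xi> * Im (z2 - z1)"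
      by (rule segment_mvt[OF cS, of u "\<lambda>z h. ux z * Re h + uy z * Im h"]) (use du D S_def in auto)
    obtain \<eta>1 where \<eta>1: "\<eta>1 \<in> S" "ux \<xi> - ux z1 = a \<eta>1 * Re (\<xi> - z1) + b \<eta>1 * Im (\<xi> - z1)"
      by (rule segment_mvt[OF cS(1,2) \<xi>(1), of ux "\<lambda>z h. a z * Re h + b z * Im h"]) (use dux D S_def in auto)
    obtain \<eta>2 where \<eta>2: "\<eta>2 \<in> S" "uy \<xi> - uy z1 = b' \<eta>2 * Re (\<xi> - z1) + d \<eta>2 * Im (\<xi> - z1)"
      by (rule segment_mvt[OF cS(1,2) \<xi>(1), of uy "\<lambda>z h. b' z * Re h + d z * Im h"]) (use duy D S_def in auto)
    have B12: "B1 + B2 \<ge> 0" "B3 + B4 \<ge> 0" using B[of p] r(1) by auto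
    have \<xi>n: "cmod (\<xi> - z1) \<le> cmod (z2 - z1)" using \<xi>(1) unfolding S_def by (simp add: dist_norm norm_minus_commute)
    have "\<bar>ux \<xi>\<bar> \<le> (B1 + B2) * cmod (\<xi> - z1)"
      using lin[of "a \<eta>1" B1 "b \<eta>1" B2 "\<xi> - z1"] \<eta>1 z(3) B[of \<eta>1] by (auto simp: S_def)
    also have "\<dots> \<le> (B1 + B2) * cmod (z2 - z1)" using \<xi>n B12 by (intro mult_left_mono)
    finally have 1: "\<bar>ux \<xi>\<bar> \<le> (B1 + B2) * cmod (z2 - z1)" .
    have "\<bar>uy \<xi>\<bar> \<le> (B3 + B4) * cmod (\<xi> - z1)"
      using lin[of "b' \<eta>2" B3 "d \<eta>2" B4 "\<xi> - z1"] \<eta>2 z(4) B[of \<eta>2] by (auto simp: S_def)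
    also have "\<dots> \<le> (B3 + B4) * cmod (z2 - z1)" using \<xi>n B12 by (intro mult_left_mono)
    finally have 2: "\<bar>uy \<xi>\<bar> \<le> (B3 + B4) * cmod (z2 - z1)" .
    show "\<bar>u z2 - u z1\<bar> \<le> (B1 + B2 + (B3 + B4)) * (cmod (z2 - z1))\<^sup>2"
      unfolding \<xi>(2) using lin[OF 1 2, of "z2 - z1"] by (simp add: power2_eq_square algebra_simps)
  qed
qed

text \<open>A once differentiable function may vary along a connected set of critical points
  (Whitney), so second derivatives must enter. The Laplacian is nonzero, hence \<open>a\<close> or
  \<open>d\<close> is, and the zero set of \<open>ux\<close> or \<open>uy\<close>, which contains
  the path, is locally a Lipschitz graph over one coordinate. As a function of that coordinate
  \<open>u\<close> changes at most quadratically, so its derivative is 0.\<close>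

lemma critical_path_locally_constant:
  assumes \<gamma>: "path \<gamma>" "path_image \<gamma> \<subseteq> \<Omega>" "\<And>z. z \<in> path_image \<gamma> \<Longrightarrow> ux z = 0 \<and> uy z = 0" and t0: "t0 \<in> {0..1}"
  shows "\<forall>\<^sub>F t in at t0 within {0..1}. u (\<gamma> t0) = u (\<gamma> t)"
proof -
  define p where "p = \<gamma> t0"
  have p: "p \<in> \<Omega>" "ux p = 0" "uy p = 0" using \<gamma> t0 unfolding p_def path_image_def by auto
  obtain r1 K where K: "r1 > 0" "ball p r1 \<subseteq> \<Omega>"
    "\<And>z1 z2. z1 \<in> ball p r1 \<Longrightarrow> z2 \<in> ball p r1 \<Longrightarrow> ux z1 = 0 \<Longrightarrow> uy z1 = 0 \<Longrightarrow> \<bar>u z2 - u z1\<bar> \<le> K * (cmod (z2 - z1))\<^sup>2"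
    using quadratic_bound_at_critical[OF p(1)] by blast
  have "a p \<noteq> 0 \<or> d p \<noteq> 0" using eqn[OF p(1)] g_pos[of "u p"] by auto
  then obtain r2 L R where L: "r2 > 0" "R = Re \<or> R = Im"
    "\<And>z1 z2. z1 \<in> ball p r2 \<Longrightarrow> z2 \<in> ball p r2 \<Longrightarrow> ux z1 = ux z2 \<Longrightarrow> uy z1 = uy z2 \<Longrightarrow> cmod (z2 - z1) \<le> L * \<bar>R (z2 - z1)\<bar>"
  proof
    assume "a p \<noteq> 0"
    from level_set_projection[OF open_dom p(1) dux cont2(1,2) this cmod_le]
    show thesis using that[of _ Im] by metis
  next
    assume "d p \<noteq> 0"
    have *: "cmod h \<le> \<bar>Im h\<bar> + \<bar>Re h\<bar>" for h using cmod_le[of h] by simp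
    have "(uy has_derivative (\<lambda>h. d z * Im h + b' z * Re h)) (at z)" if "z \<in> \<Omega>" for z
      using duy[OF that] by (simp add: add.commute)
    from level_set_projection[OF open_dom p(1) this cont2(4,3) \<open>d p \<noteq> 0\<close> *]
    show thesis using that[of _ Re] by metis
  qed
  define r where "r = min r1 r2"
  have c\<gamma>: "continuous_on {0..1} \<gamma>" using \<gamma>(1) unfolding path_def .
  then obtain \<delta> where \<delta>: "\<delta> > 0" "\<And>t. t \<in> {0..1} \<Longrightarrow> dist t t0 < \<delta> \<Longrightarrow> dist (\<gamma> t) (\<gamma> t0) < r"
    unfolding continuous_on_iff using t0 K(1) L(1) by (metis r_def min_less_iff_conj)
  define T where "T = {0..1} \<inter> ball t0 \<delta>"
  have T: "\<gamma> t \<in> ball p r" "ux (\<gamma> t) = 0" "uy (\<gamma> t) = 0" if "t \<in> T" for t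
    using \<delta>(2)[of t] \<gamma>(3)[of "\<gamma> t"] that unfolding T_def p_def path_image_def by (auto simp: dist_commute)
  have cT: "connected T" unfolding T_def by (auto intro!: convex_connected convex_Int)
  have cR: "continuous_on UNIV R" using L(2) by (auto intro!: continuous_intros)
  have Rdiff: "R (z2 - z1) = R z2 - R z1" for z1 z2 using L(2) by auto
  define J where "J = (\<lambda>t. R (\<gamma> t)) ` T"
  have "connected J" unfolding J_def
    by (rule connected_continuous_image[OF _ cT], rule continuous_on_compose2[OF cR])
       (use c\<gamma> in \<open>auto simp: T_def intro: continuous_on_subset\<close>)
  then have J: "convex J" by (simp add: connected_convex_1)
  \<comment> \<open>By \<open>inj\<close> below, points of the path with equal coordinate have equal
    values of \<open>u\<close>, so the choice does not matter.\<close>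
  define \<phi> where "\<phi> s = u (\<gamma> (SOME t. t \<in> T \<and> R (\<gamma> t) = s))" for s
  have inj: "\<bar>u (\<gamma> t2) - u (\<gamma> t1)\<bar> \<le> \<bar>K\<bar> * L\<^sup>2 * \<bar>R (\<gamma> t2) - R (\<gamma> t1)\<bar>\<^sup>2" if "t1 \<in> T" "t2 \<in> T" for t1 t2
  proof -
    have "\<bar>u (\<gamma> t2) - u (\<gamma> t1)\<bar> \<le> K * (cmod (\<gamma> t2 - \<gamma> t1))\<^sup>2"
      using T that by (intro K(3)) (auto simp: r_def)
    also have "\<dots> \<le> \<bar>K\<bar> * (cmod (\<gamma> t2 - \<gamma> t1))\<^sup>2" by (intro mult_right_mono) auto
    also have "\<dots> \<le> \<bar>K\<bar> * (L * \<bar>R (\<gamma> t2 - \<gamma> t1)\<bar>)\<^sup>2"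
      using T that by (intro mult_left_mono power_mono L(3)) (auto simp: r_def)
    finally show ?thesis unfolding Rdiff by (simp add: power_mult_distrib mult.assoc)
  qed
  have \<phi>: "\<phi> (R (\<gamma> t)) = u (\<gamma> t)" if "t \<in> T" for t
  proof -
    have "(SOME t'. t' \<in> T \<and> R (\<gamma> t') = R (\<gamma> t)) \<in> T \<and> R (\<gamma> (SOME t'. t' \<in> T \<and> R (\<gamma> t') = R (\<gamma> t))) = R (\<gamma> t)"
      using that by (intro someI[of "\<lambda>t'. t' \<in> T \<and> R (\<gamma> t') = R (\<gamma> t)"]) auto
    then show ?thesis unfolding \<phi>_def using inj[OF that, of "SOME t'. t' \<in> T \<and> R (\<gamma> t') = R (\<gamma> t)"] by simp
  qed
  have \<phi>K: "\<bar>\<phi> y - \<phi> x\<bar> \<le> \<bar>K\<bar> * L\<^sup>2 * \<bar>y - x\<bar>\<^sup>2" if "x \<in> J" "y \<in> J" for x y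
    using that inj \<phi> unfolding J_def by auto
  have "(\<phi> has_derivative (\<lambda>_. 0)) (at x within J)" if x: "x \<in> J" for x
    unfolding has_derivative_within_alt
  proof (intro conjI allI impI)
    fix e :: real assume e: "0 < e"
    define M where "M = \<bar>K\<bar> * L\<^sup>2 + 1"
    have M: "M > 0" unfolding M_def by (simp add: add_nonneg_pos)
    show "\<exists>dd>0. \<forall>y\<in>J. norm (y - x) < dd \<longrightarrow> norm (\<phi> y - \<phi> x - 0) \<le> e * norm (y - x)"
    proof (intro exI[of _ "e / M"] conjI ballI impI)
      fix y assume y: "y \<in> J" "norm (y - x) < e / M"
      have "\<bar>\<phi> y - \<phi> x\<bar> \<le> M * \<bar>y - x\<bar>\<^sup>2"
        using \<phi>K[OF x y(1)] by (simp add: M_def distrib_right) (smt (verit) zero_le_power2)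
      also have "\<dots> = (M * \<bar>y - x\<bar>) * \<bar>y - x\<bar>" by (simp add: power2_eq_square)
      also have "\<dots> \<le> e * \<bar>y - x\<bar>" using y(2) M by (intro mult_right_mono) (auto simp: field_simps)
      finally show "norm (\<phi> y - \<phi> x - 0) \<le> e * norm (y - x)" by simp
    qed (use e M in simp)
  qed (rule bounded_linear_zero)
  from has_derivative_zero_constant[OF J this] obtain k where k: "\<And>x. x \<in> J \<Longrightarrow> \<phi> x = k" by blast
  have "u (\<gamma> t) = k" if "t \<in> T" for t using \<phi>[OF that] k[of "R (\<gamma> t)"] that unfolding J_def by auto
  moreover have "t0 \<in> T" using t0 \<delta>(1) unfolding T_def by auto
  ultimately have *: "u (\<gamma> t0) = u (\<gamma> t)" if "t \<in> T" for t using that by auto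
  have "\<forall>\<^sub>F t in at t0 within {0..1}. t \<in> {0..1} \<and> dist t t0 < \<delta>"
    unfolding eventually_at using \<delta>(1) by blast
  then show ?thesis by eventually_elim (use * in \<open>auto simp: T_def dist_commute\<close>)
qed

lemma critical_path_constant:
  assumes \<gamma>: "path \<gamma>" "path_image \<gamma> \<subseteq> \<Omega>" "\<And>z. z \<in> path_image \<gamma> \<Longrightarrow> ux z = 0 \<and> uy z = 0"
    and "z \<in> path_image \<gamma>" "w \<in> path_image \<gamma>"
  shows "u z = u w"
proof -
  obtain s t where st: "s \<in> {0..1}" "t \<in> {0..1}" "z = \<gamma> s" "w = \<gamma> t"
    using assms(4,5) unfolding path_image_def by blast
  have "\<forall>t\<in>{0..1}. \<forall>\<^sub>F s in at t within {0..1}. u (\<gamma> t) = u (\<gamma> s)"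
    by (intro ballI critical_path_locally_constant[OF \<gamma>])
  from connected_local_const[of "{0..1}" s t "\<lambda>t. u (\<gamma> t)", OF _ st(1,2) this]
  show ?thesis unfolding st(3,4) by simp
qed

end

section \<open>Comparison for a solution capped at its critical value\<close>

locale capped_solution = elliptic_solution +
  fixes c :: real and K S T :: "complex set"
  assumes open_S: "open S" and open_T: "open T" and disjoint: "S \<inter> T = {}" and cover: "S \<union> T = - K"
    and K_dom: "K \<subseteq> \<Omega>" and u_K: "\<And>z. z \<in> K \<Longrightarrow> u z = c" and u_le: "\<And>z. u z \<le> c"
begin

text \<open>A subsolution in the sense of \<open>comparison_principle\<close>: at points outside
  \<open>T\<close> the function \<open>u\<close> touches it from below, since \<open>K\<close> lies
  in the domain and \<open>u \<le> c\<close>; at points of \<open>T\<close> the constant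
  \<open>c\<close> does, whose Laplacian 0 exceeds the negative right side.\<close>

definition cap :: "complex \<Rightarrow> real" where "cap z = (if z \<in> S then u z else c)"

lemma cap_le: "cap z \<le> c" and u_le_cap: "u z \<le> cap z" and cap_notin: "z \<notin> S \<Longrightarrow> cap z = c"
  and cap_in: "z \<notin> T \<Longrightarrow> cap z = u z"
proof -
  show "z \<notin> T \<Longrightarrow> cap z = u z" using u_K[of z] cover unfolding cap_def by auto
qed (auto simp: cap_def u_le)

lemma cap_T: "z \<in> T \<Longrightarrow> cap z = c"
  using disjoint by (auto intro: cap_notin)

lemma cap_nonneg: "0 \<le> cap z"
  using u_nonneg u_le_cap order_trans by blast

lemma closure_S: "z \<in> closure S \<Longrightarrow> z \<notin> T"
  using open_T disjoint by (metis IntI disjoint_iff_not_equal open_Int_closure_eq_empty)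

lemma continuous_cap: "continuous_on A cap"
proof -
  have "continuous_on (closure S \<union> - S) (\<lambda>z. if z \<in> S then u z else c)"
  proof (rule continuous_on_cases)
    show "closed (- S)" by (rule closed_Compl[OF open_S])
    show "continuous_on (closure S) u" using cont_u continuous_on_subset by blast
    show "\<forall>x. x \<in> closure S \<and> x \<notin> S \<or> x \<in> - S \<and> x \<in> S \<longrightarrow> u x = c"
      using closure_S cover u_K by blast
  qed auto
  moreover have "closure S \<union> - S = UNIV" using closure_subset by auto
  ultimately have "continuous_on UNIV cap" by (simp add: cap_def[abs_def])
  then show ?thesis using continuous_on_subset by blast
qed

text \<open>As an upper bound \<open>cap\<close> needs attention only in \<open>S\<close>, because
  it equals \<open>c\<close> elsewhere and \<open>v \<le> c\<close>. Inside \<open>S\<close> it is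
  \<open>u\<close>, and the ordinary comparison with \<open>u\<close> applies.\<close>

lemma cap_comparison:
  assumes G: "open G" and v: "continuous_on (closure G) v" "\<And>z. v z \<le> c"
    and fr: "\<And>p. p \<in> closure G \<Longrightarrow> p \<notin> G \<Longrightarrow> v p \<le> cap p"
    and out: "\<And>z. z \<in> G \<Longrightarrow> z \<in> S \<Longrightarrow> z \<notin> \<Omega> \<Longrightarrow> v z \<le> 0"
    and loc: "\<And>p. p \<in> G \<Longrightarrow> p \<in> S \<Longrightarrow> p \<in> \<Omega> \<Longrightarrow> u p < v p \<Longrightarrow>
      \<exists>v0 L. (\<forall>\<^sub>F z in nhds p. v0 z \<le> v z) \<and> v0 p = v p \<and> has_lap v0 L p \<and> - g (v p) \<le> L"
    and z: "z \<in> G"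
  shows "v z \<le> cap z"
proof (cases "z \<in> S")
  case False then show ?thesis using v(2) by (simp add: cap_notin)
next
  case zS: True
  show ?thesis
  proof (cases "z \<in> \<Omega>")
    case False then show ?thesis using out[OF z zS] cap_nonneg[of z] by linarith
  next
    case True
    define W where "W = G \<inter> S \<inter> \<Omega>"
    have oW: "open W" unfolding W_def using G open_S open_dom by (intro open_Int)
    have bW: "bounded W" unfolding W_def by (rule bounded_subset[OF bounded_dom]) auto
    have clW: "p \<in> closure G" "p \<in> closure S" if "p \<in> closure W" for p
      using that closure_mono[of W G] closure_mono[of W S] unfolding W_def by blast+
    have "v z \<le> u z + 0"
    proof (rule comparison_principle[OF oW bW])
      show "continuous_on (closure W) v" using v(1) clW by (meson continuous_on_subset subsetI)
      show "continuous_on (closure W) u" using cont_u continuous_on_subset by blast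
      show "z \<in> W" using z zS True unfolding W_def by blast
    next
      fix p assume p: "p \<in> closure W" "p \<notin> W"
      have cu: "cap p = u p" using cap_in closure_S clW(2)[OF p(1)] by blast
      show "v p \<le> u p + 0"
      proof (cases "p \<in> G")
        case False then show ?thesis using fr[OF clW(1)[OF p(1)]] cu by simp
      next
        case pG: True
        show ?thesis
        proof (cases "p \<in> S")
          case False then show ?thesis using v(2)[of p] cu cap_notin by simp
        next
          case True then show ?thesis using out[OF pG True] u_nonneg[of p] p(2) pG unfolding W_def by auto
        qed
      qed
    next
      fix p assume p: "p \<in> W" "u p + 0 < v p"
      then obtain v0 L where L: "\<forall>\<^sub>F z in nhds p. v0 z \<le> v z" "v0 p = v p" "has_lap v0 L p" "- g (v p) \<le> L"
        using loc[of p] unfolding W_def by auto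
      have "g (v p) \<le> g (u p)" using p(2) by (intro g_antimono) simp
      then show "\<exists>v0 L M. (\<forall>\<^sub>F z in nhds p. v0 z \<le> v z) \<and> v0 p = v p \<and> has_lap v0 L p \<and> has_lap u M p \<and> M \<le> L"
        using L has_lap_u[of p] p(1) unfolding W_def
        by (intro exI[of _ v0] exI[of _ L] exI[of _ "- g (u p)"]) auto
    qed
    then show ?thesis using u_le_cap[of z] by simp
  qed
qed

text \<open>A conformal map with derivative at most 1 in modulus keeps the subsolution property
  because \<open>g\<close> is positive. Where the image is in \<open>T\<close>, the constant
  \<open>c\<close> touches from below instead; where it is outside both \<open>T\<close> and the
  domain, the value is 0 and cannot exceed \<open>u\<close>. Hence the restriction on the derivative
  is asked only at the remaining points. The map may be given by a different branch at each
  \<open>p\<close>.\<close>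

lemma cap_compose_comparison:
  assumes G: "open G" and v: "continuous_on (closure G) v" "\<And>z. v z \<le> c"
    and fr: "\<And>p. p \<in> closure G \<Longrightarrow> p \<notin> G \<Longrightarrow> v p \<le> cap p"
    and out: "\<And>z. z \<in> G \<Longrightarrow> z \<in> S \<Longrightarrow> z \<notin> \<Omega> \<Longrightarrow> v z \<le> 0"
    and loc: "\<And>p. p \<in> G \<Longrightarrow> p \<in> S \<Longrightarrow> p \<in> \<Omega> \<Longrightarrow>
      \<exists>\<sigma> \<sigma>' k. (\<forall>\<^sub>F z in nhds p. (\<sigma> has_field_derivative \<sigma>' z) (at z) \<and> v z = cap (\<sigma> z)) \<and>
        (\<sigma>' has_field_derivative k) (at p) \<and> (\<sigma> p \<in> \<Omega> \<longrightarrow> \<sigma> p \<notin> T \<longrightarrow> cmod (\<sigma>' p) \<le> 1)"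
    and z: "z \<in> G"
  shows "v z \<le> cap z"
proof (rule cap_comparison[OF G v fr out _ z])
  fix p assume p: "p \<in> G" "p \<in> S" "p \<in> \<Omega>" "u p < v p"
  obtain \<sigma> \<sigma>' k where \<sigma>: "\<forall>\<^sub>F z in nhds p. (\<sigma> has_field_derivative \<sigma>' z) (at z) \<and> v z = cap (\<sigma> z)"
    "(\<sigma>' has_field_derivative k) (at p)" "\<sigma> p \<in> \<Omega> \<Longrightarrow> \<sigma> p \<notin> T \<Longrightarrow> cmod (\<sigma>' p) \<le> 1"
    using loc[OF p(1-3)] by blast
  have \<sigma>1: "\<forall>\<^sub>F z in nhds p. (\<sigma> has_field_derivative \<sigma>' z) (at z)" "\<forall>\<^sub>F z in nhds p. v z = cap (\<sigma> z)"
    using \<sigma>(1) by (auto elim: eventually_mono)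
  have vp: "v p = cap (\<sigma> p)" using eventually_nhds_x_imp_x[OF \<sigma>1(2)] .
  have "isCont \<sigma> p" using eventually_nhds_x_imp_x[OF \<sigma>1(1)] DERIV_isCont by blast
  then have lim: "(\<sigma> \<longlongrightarrow> \<sigma> p) (nhds p)" by (simp add: isCont_def tendsto_at_iff_tendsto_nhds)
  show "\<exists>v0 L. (\<forall>\<^sub>F z in nhds p. v0 z \<le> v z) \<and> v0 p = v p \<and> has_lap v0 L p \<and> - g (v p) \<le> L"
  proof (cases "\<sigma> p \<in> T")
    case True
    have "\<forall>\<^sub>F z in nhds p. \<sigma> z \<in> T" using topological_tendstoD[OF lim open_T True] .
    then have "\<forall>\<^sub>F z in nhds p. c \<le> v z"
      using \<sigma>1(2) by eventually_elim (simp add: cap_T)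
    moreover have "v p = c" using vp cap_T[OF True] by simp
    ultimately show ?thesis using has_lap_const[of c p] g_pos[of "v p"]
      by (intro exI[of _ "\<lambda>_. c"] exI[of _ 0]) auto
  next
    case False
    then have vu: "v p = u (\<sigma> p)" using vp cap_in by simp
    then have "u (\<sigma> p) > 0" using p(4) u_nonneg[of p] by simp
    then have s\<Omega>: "\<sigma> p \<in> \<Omega>" using outside_zero by force
    have "has_lap (\<lambda>z. u (\<sigma> z)) ((cmod (\<sigma>' p))\<^sup>2 * (- g (u (\<sigma> p)))) p"
      by (rule has_lap_compose_holomorphic[where \<sigma>=\<sigma> and \<sigma>'=\<sigma>' and k=k, OF has_lap_u[OF s\<Omega>] \<sigma>1(1) \<sigma>(2)])
    moreover have "(cmod (\<sigma>' p))\<^sup>2 * g (u (\<sigma> p)) \<le> 1 * g (u (\<sigma> p))"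
      using \<sigma>(3)[OF s\<Omega> False] g_pos[of "u (\<sigma> p)"] by (intro mult_right_mono) (auto simp: power_le_one)
    moreover have "\<forall>\<^sub>F z in nhds p. u (\<sigma> z) \<le> v z" using \<sigma>1(2) by (rule eventually_mono) (simp add: u_le_cap)
    ultimately show ?thesis using vu
      by (intro exI[of _ "\<lambda>z. u (\<sigma> z)"] exI[of _ "(cmod (\<sigma>' p))\<^sup>2 * (- g (u (\<sigma> p)))"]) auto
  qed
qed

lemma cap_isometry_comparison:
  assumes G: "open G" and e: "cmod e = 1"
    and fr: "\<And>p. p \<in> closure G \<Longrightarrow> p \<notin> G \<Longrightarrow> cap (e * p + f) \<le> cap p"
    and out: "\<And>z. z \<in> G \<Longrightarrow> z \<in> S \<Longrightarrow> z \<notin> \<Omega> \<Longrightarrow> e * z + f \<in> S \<and> e * z + f \<notin> \<Omega>"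
    and z: "z \<in> G"
  shows "cap (e * z + f) \<le> cap z"
proof (rule cap_compose_comparison[OF G _ cap_le fr _ _ z])
  show "continuous_on (closure G) (\<lambda>z. cap (e * z + f))"
    by (rule continuous_on_compose2[OF continuous_cap[of UNIV]]) (auto intro!: continuous_intros)
  show "cap (e * z + f) \<le> 0" if "z \<in> G" "z \<in> S" "z \<notin> \<Omega>" for z
    using out[OF that] by (simp add: cap_def outside_zero)
  show "\<exists>\<sigma> \<sigma>' k. (\<forall>\<^sub>F z in nhds p. (\<sigma> has_field_derivative \<sigma>' z) (at z) \<and> cap (e * z + f) = cap (\<sigma> z)) \<and>
        (\<sigma>' has_field_derivative k) (at p) \<and> (\<sigma> p \<in> \<Omega> \<longrightarrow> \<sigma> p \<notin> T \<longrightarrow> cmod (\<sigma>' p) \<le> 1)" for p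
    using e by (intro exI[of _ "\<lambda>z. e * z + f"] exI[of _ "\<lambda>_. e"] exI[of _ 0])
      (auto intro!: derivative_eq_intros always_eventually)
qed

end

text \<open>The least parameter outside the open set \<open>S\<close> is a limit of parameters in
  \<open>S\<close>, so it cannot be in the open set \<open>T\<close> either. When \<open>S\<close>
  and \<open>T\<close> are the two sides of \<open>K\<close>, the exit point is therefore on
  \<open>K\<close>.\<close>

lemma first_exit:
  fixes h :: "real \<Rightarrow> complex"
  assumes h: "continuous_on {0..r} h" and S: "open S" "h 0 \<in> S" "h r \<notin> S" and T: "open T" "S \<inter> T = {}" and r: "0 \<le> r"
  obtains s where "0 < s" "s \<le> r" "h s \<notin> S" "h s \<notin> T" "\<And>t. 0 \<le> t \<Longrightarrow> t < s \<Longrightarrow> h t \<in> S"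
proof -
  define A where "A = {0..r} \<inter> h -` (- S)"
  have "closed A" unfolding A_def using h S(1) by (intro continuous_closed_preimage) auto
  moreover have "bounded A" unfolding A_def by (rule bounded_subset[of "{0..r}"]) auto
  ultimately have "compact A" by (simp add: compact_eq_bounded_closed)
  moreover have "A \<noteq> {}" using S(3) r unfolding A_def by auto
  ultimately obtain s where s: "s \<in> A" "\<And>t. t \<in> A \<Longrightarrow> s \<le> t" using compact_attains_inf[of A] by metis
  have s1: "0 \<le> s" "s \<le> r" "h s \<notin> S" using s(1) unfolding A_def by auto
  have s0: "s > 0" using s1 S(2) by (cases "s = 0") auto
  have before: "h t \<in> S" if "0 \<le> t" "t < s" for t
    using s(2)[of t] that s1 unfolding A_def by force
  have "h s \<notin> T"
  proof
    assume T1: "h s \<in> T"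
    have "continuous_on {0..s} h" using h s1 continuous_on_subset by fastforce
    then have "(h \<longlongrightarrow> h s) (at s within {0..s})" using s1(1) by (auto simp: continuous_on_def)
    from topological_tendstoD[OF this T(1) T1] obtain e where e: "e > 0"
      "\<And>t. t \<in> {0..s} \<Longrightarrow> t \<noteq> s \<Longrightarrow> dist t s < e \<Longrightarrow> h t \<in> T"
      unfolding eventually_at by auto
    define t where "t = max 0 (s - e / 2)"
    have t: "0 \<le> t" "t < s" "dist t s < e" using s0 e(1) unfolding t_def dist_real_def by auto
    then show False using e(2)[of t] before[of t] T(2) by auto
  qed
  then show thesis using that s0 s1 before by blast
qed

section \<open>Symmetry and monotonicity of the solution in an elliptical annulus\<close>

definition ellq :: "real \<Rightarrow> complex \<Rightarrow> real" where "ellq E z = (E * Re z)\<^sup>2 + (Im z)\<^sup>2"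

lemma ellq_symm: "ellq E (cnj z) = ellq E z" "ellq E (- z) = ellq E z"
  by (simp_all add: ellq_def)

lemma ellq_mono: "\<bar>Re z\<bar> \<le> \<bar>Re w\<bar> \<Longrightarrow> \<bar>Im z\<bar> \<le> \<bar>Im w\<bar> \<Longrightarrow> ellq E z \<le> ellq E w"
  unfolding ellq_def power_mult_distrib by (intro add_mono mult_left_mono) (simp_all add: abs_le_square_iff)

lemma continuous_ellq: "continuous_on A (ellq E)"
  unfolding ellq_def by (intro continuous_intros)

locale ellipse_solution = elliptic_solution +
  fixes E \<beta> :: real
  assumes E: "0 < E" "E < 1" and \<beta>: "0 < \<beta>" "\<beta> < 1" and dom: "\<Omega> = {z. \<beta>\<^sup>2 < ellq E z \<and> ellq E z < 1}"
begin

text \<open>Uniqueness for the boundary value problem: the mirror image solves the same problem, and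
  comparison works in both directions.\<close>

lemma u_cnj: "u (cnj z) = u z"
proof -
  have le: "u (cnj z) \<le> u z" for z
  proof (cases "z \<in> \<Omega>")
    case True
    have "u (cnj z) \<le> u z + 0"
    proof (rule comparison_principle[OF open_dom bounded_dom _ _ _ _ True])
      show "continuous_on (closure \<Omega>) (\<lambda>z. u (cnj z))"
        by (rule continuous_on_compose2[OF cont_u]) (auto intro!: continuous_intros)
      show "continuous_on (closure \<Omega>) u" using cont_u continuous_on_subset by blast
      show "u (cnj p) \<le> u p + 0" if "p \<notin> \<Omega>" for p using that by (simp add: outside_zero dom ellq_symm)
      show "\<exists>v0 L M. (\<forall>\<^sub>F z in nhds p. v0 z \<le> u (cnj z)) \<and> v0 p = u (cnj p) \<and> has_lap v0 L p \<and> has_lap u M p \<and> M \<le> L"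
        if p: "p \<in> \<Omega>" "u p + 0 < u (cnj p)" for p
      proof -
        have "cnj p \<in> \<Omega>" using p(1) by (simp add: dom ellq_symm)
        from has_lap_compose_cnj[OF has_lap_u[OF this]] g_antimono[of "u p" "u (cnj p)"] p has_lap_u[OF p(1)]
        show ?thesis by (intro exI[of _ "\<lambda>z. u (cnj z)"] exI[of _ "- g (u (cnj p))"] exI[of _ "- g (u p)"]) auto
      qed
    qed
    then show ?thesis by simp
  qed (simp add: outside_zero dom ellq_symm)
  from le[of z] le[of "cnj z"] show ?thesis by simp
qed

lemma u_neg: "u (- z) = u z"
proof -
  have le: "u (- z) \<le> u z" for z
  proof (cases "z \<in> \<Omega>")
    case True
    have "u (- z) \<le> u z + 0"
    proof (rule comparison_principle[OF open_dom bounded_dom _ _ _ _ True])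
      show "continuous_on (closure \<Omega>) (\<lambda>z. u (- z))"
        by (rule continuous_on_compose2[OF cont_u]) (auto intro!: continuous_intros)
      show "continuous_on (closure \<Omega>) u" using cont_u continuous_on_subset by blast
      show "u (- p) \<le> u p + 0" if "p \<notin> \<Omega>" for p using that by (simp add: outside_zero dom ellq_symm)
      show "\<exists>v0 L M. (\<forall>\<^sub>F z in nhds p. v0 z \<le> u (- z)) \<and> v0 p = u (- p) \<and> has_lap v0 L p \<and> has_lap u M p \<and> M \<le> L"
        if p: "p \<in> \<Omega>" "u p + 0 < u (- p)" for p
      proof -
        have np: "- p \<in> \<Omega>" using p(1) by (simp add: dom ellq_symm)
        have "has_lap (\<lambda>z. u (- z)) ((cmod (-1))\<^sup>2 * (- g (u (- p)))) p"
          by (rule has_lap_compose_holomorphic[where \<sigma>=uminus and \<sigma>'="\<lambda>_. - 1" and k=0, OF has_lap_u[OF np]])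
             (auto intro!: derivative_eq_intros always_eventually)
        with g_antimono[of "u p" "u (- p)"] p has_lap_u[OF p(1)]
        show ?thesis by (intro exI[of _ "\<lambda>z. u (- z)"] exI[of _ "- g (u (- p))"] exI[of _ "- g (u p)"]) auto
      qed
    qed
    then show ?thesis by simp
  qed (simp add: outside_zero dom ellq_symm)
  from le[of z] le[of "- z"] show ?thesis by simp
qed

lemma grad_cnj: assumes "z \<in> \<Omega>" shows "ux (cnj z) = ux z" "uy (cnj z) = - uy z"
proof -
  have "cnj z \<in> \<Omega>" using assms by (simp add: dom ellq_symm)
  from has_derivative_compose[OF bounded_linear_imp_has_derivative[OF bounded_linear_cnj] du[OF this]]
  have "(u has_derivative (\<lambda>h. ux (cnj z) * Re (cnj h) + uy (cnj z) * Im (cnj h))) (at z)" by (simp add: u_cnj)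
  from has_derivative_unique[OF this du[OF assms]]
  have e: "(\<lambda>h. ux (cnj z) * Re (cnj h) + uy (cnj z) * Im (cnj h)) = (\<lambda>h. ux z * Re h + uy z * Im h)" .
  show "ux (cnj z) = ux z" "uy (cnj z) = - uy z" using fun_cong[OF e, of 1] fun_cong[OF e, of \<i>] by auto
qed

lemma grad_neg: assumes "z \<in> \<Omega>" shows "ux (- z) = - ux z" "uy (- z) = - uy z"
proof -
  have "- z \<in> \<Omega>" using assms by (simp add: dom ellq_symm)
  from has_derivative_compose[OF has_derivative_minus[OF has_derivative_ident] du[OF this]]
  have "(u has_derivative (\<lambda>h. ux (- z) * Re (- h) + uy (- z) * Im (- h))) (at z)" by (simp add: u_neg)
  from has_derivative_unique[OF this du[OF assms]]
  have e: "(\<lambda>h. ux (- z) * Re (- h) + uy (- z) * Im (- h)) = (\<lambda>h. ux z * Re h + uy z * Im h)" .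
  show "ux (- z) = - ux z" "uy (- z) = - uy z" using fun_cong[OF e, of 1] fun_cong[OF e, of \<i>] by auto
qed

end

lemma closure_greater:
  fixes \<phi> :: "'a::topological_space \<Rightarrow> real"
  assumes "continuous_on UNIV \<phi>" "p \<in> closure {w. k < \<phi> w}" shows "k \<le> \<phi> p"
proof -
  have "closed {w. k \<le> \<phi> w}" by (rule closed_Collect_le[OF continuous_on_const assms(1)])
  then have "closure {w. k < \<phi> w} \<subseteq> {w. k \<le> \<phi> w}" by (intro closure_minimal) auto
  then show ?thesis using assms(2) by auto
qed

definition quad :: "complex \<Rightarrow> complex" where "quad z = Complex \<bar>Re z\<bar> \<bar>Im z\<bar>"

lemma quad_invariant:
  assumes "\<And>z. f (cnj z) = f z" "\<And>z. f (- z) = f z"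
  shows "f (quad z) = f z"
proof -
  have "quad z = z \<or> quad z = cnj z \<or> quad z = - z \<or> quad z = - cnj z"
    unfolding quad_def complex_eq_iff by (auto simp: abs_if)
  then show ?thesis using assms by metis
qed

lemma Re_Im_quad [simp]: "Re (quad z) = \<bar>Re z\<bar>" "Im (quad z) = \<bar>Im z\<bar>"
  by (simp_all add: quad_def)

text \<open>\<open>Si\<close> and \<open>So\<close> are the sides of \<open>K\<close> towards the inner and the outer ellipse.\<close>

locale critical_ellipse = ellipse_solution +
  fixes c :: real and K Si So :: "complex set"
  assumes K: "compact K" "K \<subseteq> \<Omega>" "\<And>z. z \<in> K \<Longrightarrow> ux z = 0 \<and> uy z = 0"
    and u_K: "\<And>z. z \<in> K \<Longrightarrow> u z = c" and c_pos: "0 < c"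
    and K_symm: "\<And>z. z \<in> K \<Longrightarrow> cnj z \<in> K" "\<And>z. z \<in> K \<Longrightarrow> - z \<in> K"
    and interior_K: "interior K = {}"
    and Si: "open Si" "\<And>z. ellq E z \<le> \<beta>\<^sup>2 \<Longrightarrow> z \<in> Si"
    and Si_symm: "\<And>z. z \<in> Si \<Longrightarrow> cnj z \<in> Si" "\<And>z. z \<in> Si \<Longrightarrow> - z \<in> Si"
    and So: "open So" "\<And>z. 1 \<le> ellq E z \<Longrightarrow> z \<in> So"
    and disj: "Si \<inter> So = {}" and cov: "Si \<union> So = - K"
begin

lemma Si_symm_iff: "cnj z \<in> Si \<longleftrightarrow> z \<in> Si" "- z \<in> Si \<longleftrightarrow> z \<in> Si"
  using Si_symm by (metis complex_cnj_cnj, metis minus_minus)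

lemma K_symm_iff: "cnj z \<in> K \<longleftrightarrow> z \<in> K" "- z \<in> K \<longleftrightarrow> z \<in> K"
  using K_symm by (metis complex_cnj_cnj, metis minus_minus)

lemma So_eq: "So = - (Si \<union> K)" using disj cov by blast

lemma So_symm_iff: "cnj z \<in> So \<longleftrightarrow> z \<in> So" "- z \<in> So \<longleftrightarrow> z \<in> So"
  unfolding So_eq using Si_symm_iff K_symm_iff by auto

lemma So_dom: "z \<in> So \<Longrightarrow> ellq E z < 1 \<Longrightarrow> z \<in> \<Omega>" and So_out: "z \<in> So \<Longrightarrow> z \<notin> \<Omega> \<Longrightarrow> 1 \<le> ellq E z"
  using Si(2)[of z] disj unfolding dom by (auto simp: not_less) 

lemma Si_dom: "z \<in> Si \<Longrightarrow> \<beta>\<^sup>2 < ellq E z \<Longrightarrow> z \<in> \<Omega>" and Si_out: "z \<in> Si \<Longrightarrow> z \<notin> \<Omega> \<Longrightarrow> ellq E z \<le> \<beta>\<^sup>2"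
  using So(2)[of z] disj unfolding dom by (auto simp: not_less not_le)

lemma zero_Si: "0 \<in> Si" by (rule Si(2)) (simp add: ellq_def)

lemma u_zero: "ellq E z \<le> \<beta>\<^sup>2 \<or> 1 \<le> ellq E z \<Longrightarrow> u z = 0"
  by (rule outside_zero) (auto simp: dom)

lemma closure_dom: "z \<in> closure \<Omega> \<Longrightarrow> z \<notin> \<Omega> \<Longrightarrow> ellq E z = \<beta>\<^sup>2 \<or> ellq E z = 1"
proof -
  assume z: "z \<in> closure \<Omega>" "z \<notin> \<Omega>"
  have "closed ({z. \<beta>\<^sup>2 \<le> ellq E z} \<inter> {z. ellq E z \<le> 1})"
    by (intro closed_Int closed_Collect_le continuous_on_const continuous_ellq)
  then have "closure \<Omega> \<subseteq> {z. \<beta>\<^sup>2 \<le> ellq E z} \<inter> {z. ellq E z \<le> 1}" by (rule closure_minimal[rotated]) (auto simp: dom)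
  then show ?thesis using z by (auto simp: dom)
qed

lemma frontier_out: "frontier (So \<inter> \<Omega>) \<subseteq> K \<union> {z. ellq E z = 1}"
proof
  fix p assume "p \<in> frontier (So \<inter> \<Omega>)"
  then have p: "p \<in> closure So" "p \<in> closure \<Omega>" "p \<notin> So \<inter> \<Omega>"
    using closure_mono[of "So \<inter> \<Omega>" So] closure_mono[of "So \<inter> \<Omega>" \<Omega>] So(1) open_dom
    by (auto simp: frontier_def interior_open open_Int)
  have "p \<notin> Si" using p(1) disj Si(1) by (metis IntI disjoint_iff_not_equal open_Int_closure_eq_empty inf_commute)
  then show "p \<in> K \<union> {z. ellq E z = 1}" using p(2,3) closure_dom[of p] Si(2)[of p] So_eq by auto
qed

lemma frontier_in: "frontier (Si \<inter> \<Omega>) \<subseteq> K \<union> {z. ellq E z = \<beta>\<^sup>2}"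
proof
  fix p assume "p \<in> frontier (Si \<inter> \<Omega>)"
  then have p: "p \<in> closure Si" "p \<in> closure \<Omega>" "p \<notin> Si \<inter> \<Omega>"
    using closure_mono[of "Si \<inter> \<Omega>" Si] closure_mono[of "Si \<inter> \<Omega>" \<Omega>] Si(1) open_dom
    by (auto simp: frontier_def interior_open open_Int)
  have "p \<notin> So" using p(1) disj So(1) by (metis IntI disjoint_iff_not_equal open_Int_closure_eq_empty inf_commute)
  then show "p \<in> K \<union> {z. ellq E z = \<beta>\<^sup>2}" using p(2,3) closure_dom[of p] So(2)[of p] So_eq by auto
qed

text \<open>Translation by \<open>h\<close>, to the right of the line \<open>Re w = - h / 2\<close>.
  On this line it coincides with the reflection in the imaginary axis, so the symmetry of
  \<open>u\<close> gives equality; to the right of it \<open>\<bar>Re p\<bar>\<close> does not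
  decrease, so points of the outer ellipse are moved to points where \<open>u\<close> is 0. Likewise
  for the other coordinate.\<close>

lemma grad_out:
  assumes z: "z \<in> So" "z \<in> \<Omega>"
  shows "0 \<le> Re z \<Longrightarrow> ux z \<le> 0" "0 \<le> Im z \<Longrightarrow> uy z \<le> 0"
proof -
  note T = translation_derivative_nonpos[OF K open_Int[OF So(1) open_dom] Int_lower2 frontier_out, of _ z 1]
  assume Re: "0 \<le> Re z"
  have "ux z * Re 1 + uy z * Im 1 \<le> 0"
  proof (rule T[where H="\<lambda>h. {w. - h / 2 < Re w}"])
    fix h :: real and p assume h: "0 < h"
    show "open {w. - h / 2 < Re w}" by (intro open_Collect_less continuous_intros)
    show "z \<in> {w. - h / 2 < Re w}" using Re h by simp
    show "u (p + of_real h * 1) \<le> u p" if "p \<in> closure {w. - h / 2 < Re w}" "p \<notin> {w. - h / 2 < Re w}"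
    proof -
      have "- h / 2 \<le> Re p" by (rule closure_greater[OF _ that(1)]) (intro continuous_intros)
      then have "p + of_real h * 1 = - cnj p" using that(2) by (simp add: complex_eq_iff)
      then show ?thesis using u_neg u_cnj by simp
    qed
    show "u (p + of_real h * 1) \<le> 0" if "p \<in> {z. ellq E z = 1}" "p \<in> {w. - h / 2 < Re w}"
    proof -
      have "ellq E p \<le> ellq E (p + of_real h * 1)" using that h by (intro ellq_mono) auto
      then show ?thesis using that u_zero[of "p + of_real h * 1"] by simp
    qed
  qed (use z in \<open>auto simp: dom\<close>)
  then show "ux z \<le> 0" by simp
next
  note T = translation_derivative_nonpos[OF K open_Int[OF So(1) open_dom] Int_lower2 frontier_out, of \<i> z 1]
  assume Re: "0 \<le> Im z"
  have "ux z * Re \<i> + uy z * Im \<i> \<le> 0"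
  proof (rule T[where H="\<lambda>h. {w. - h / 2 < Im w}"])
    fix h :: real and p assume h: "0 < h"
    show "open {w. - h / 2 < Im w}" by (intro open_Collect_less continuous_intros)
    show "z \<in> {w. - h / 2 < Im w}" using Re h by simp
    show "u (p + of_real h * \<i>) \<le> u p" if "p \<in> closure {w. - h / 2 < Im w}" "p \<notin> {w. - h / 2 < Im w}"
    proof -
      have "- h / 2 \<le> Im p" by (rule closure_greater[OF _ that(1)]) (intro continuous_intros)
      then have "p + of_real h * \<i> = cnj p" using that(2) by (simp add: complex_eq_iff)
      then show ?thesis using u_cnj by simp
    qed
    show "u (p + of_real h * \<i>) \<le> 0" if "p \<in> {z. ellq E z = 1}" "p \<in> {w. - h / 2 < Im w}"
    proof -
      have "ellq E p \<le> ellq E (p + of_real h * \<i>)" using that h by (intro ellq_mono) auto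
      then show ?thesis using that u_zero[of "p + of_real h * \<i>"] by simp
    qed
  qed (use z in \<open>auto simp: dom\<close>)
  then show "uy z \<le> 0" by simp
qed

text \<open>Translation in the opposite direction, to the right of \<open>Re w = h / 2\<close>:
  points of the inner ellipse are moved into the hole. Here \<open>z\<close> has to stay beyond the
  cut, hence the strict sign and the limit \<open>2 * Re z\<close> for \<open>h\<close>.\<close>

lemma grad_in:
  assumes z: "z \<in> Si" "z \<in> \<Omega>"
  shows "0 < Re z \<Longrightarrow> 0 \<le> ux z" "0 < Im z \<Longrightarrow> 0 \<le> uy z"
proof -
  assume Re: "0 < Re z"
  note T = translation_derivative_nonpos[OF K open_Int[OF Si(1) open_dom] Int_lower2 frontier_in, of "-1" z "2 * Re z"]
  have "ux z * Re (-1) + uy z * Im (-1) \<le> 0"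
  proof (rule T[where H="\<lambda>h. {w. h / 2 < Re w}"])
    fix h :: real and p assume h: "0 < h"
    show "open {w. h / 2 < Re w}" by (intro open_Collect_less continuous_intros)
    show "z \<in> {w. h / 2 < Re w}" if "h < 2 * Re z" using that by simp
    show "u (p + of_real h * -1) \<le> u p" if "p \<in> closure {w. h / 2 < Re w}" "p \<notin> {w. h / 2 < Re w}"
    proof -
      have "h / 2 \<le> Re p" by (rule closure_greater[OF _ that(1)]) (intro continuous_intros)
      then have "p + of_real h * -1 = - cnj p" using that(2) by (simp add: complex_eq_iff)
      then show ?thesis using u_neg u_cnj by simp
    qed
    show "u (p + of_real h * -1) \<le> 0" if "p \<in> {z. ellq E z = \<beta>\<^sup>2}" "p \<in> {w. h / 2 < Re w}"
    proof -
      have "ellq E (p + of_real h * -1) \<le> ellq E p" using that h by (intro ellq_mono) auto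
      then show ?thesis using that u_zero[of "p + of_real h * -1"] by simp
    qed
  qed (use z Re in \<open>auto simp: dom\<close>)
  then show "0 \<le> ux z" by simp
next
  assume Re: "0 < Im z"
  note T = translation_derivative_nonpos[OF K open_Int[OF Si(1) open_dom] Int_lower2 frontier_in, of "-\<i>" z "2 * Im z"]
  have "ux z * Re (-\<i>) + uy z * Im (-\<i>) \<le> 0"
  proof (rule T[where H="\<lambda>h. {w. h / 2 < Im w}"])
    fix h :: real and p assume h: "0 < h"
    show "open {w. h / 2 < Im w}" by (intro open_Collect_less continuous_intros)
    show "z \<in> {w. h / 2 < Im w}" if "h < 2 * Im z" using that by simp
    show "u (p + of_real h * -\<i>) \<le> u p" if "p \<in> closure {w. h / 2 < Im w}" "p \<notin> {w. h / 2 < Im w}"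
    proof -
      have "h / 2 \<le> Im p" by (rule closure_greater[OF _ that(1)]) (intro continuous_intros)
      then have "p + of_real h * -\<i> = cnj p" using that(2) by (simp add: complex_eq_iff)
      then show ?thesis using u_cnj by simp
    qed
    show "u (p + of_real h * -\<i>) \<le> 0" if "p \<in> {z. ellq E z = \<beta>\<^sup>2}" "p \<in> {w. h / 2 < Im w}"
    proof -
      have "ellq E (p + of_real h * -\<i>) \<le> ellq E p" using that h by (intro ellq_mono) auto
      then show ?thesis using that u_zero[of "p + of_real h * -\<i>"] by simp
    qed
  qed (use z Re in \<open>auto simp: dom\<close>)
  then show "0 \<le> uy z" by simp
qed

lemma line_mono:
  assumes "0 \<le> s" and dir: "\<And>t. 0 < t \<Longrightarrow> t < s \<Longrightarrow> z + of_real t * e \<in> \<Omega> \<and>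
    0 \<le> ux (z + of_real t * e) * Re e + uy (z + of_real t * e) * Im e"
  shows "u z \<le> u (z + of_real s * e)"
proof -
  have "u (z + of_real 0 * e) \<le> u (z + of_real s * e)"
  proof (rule DERIV_nonneg_imp_increasing_open[where f="\<lambda>t. u (z + of_real t * e)"])
    show "continuous_on {0..s} (\<lambda>t. u (z + of_real t * e))"
      by (rule continuous_on_compose2[OF cont_u]) (auto intro!: continuous_intros)
    fix t assume t: "0 < t" "t < s"
    have "((\<lambda>t. u (z + of_real t * e)) has_real_derivative ux (z + of_real t * e) * Re e + uy (z + of_real t * e) * Im e) (at t)"
      using dir[OF t] by (intro has_derivative_line du) simp
    then show "\<exists>y. ((\<lambda>t. u (z + of_real t * e)) has_real_derivative y) (at t) \<and> 0 \<le> y" using dir[OF t] by blast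
  qed (use assms in auto)
  then show ?thesis by simp
qed

lemma out_descend_x:
  assumes "0 \<le> s" "s \<le> Re z" "ellq E z < 1" "\<And>t. 0 \<le> t \<Longrightarrow> t < s \<Longrightarrow> z - of_real t \<in> So"
  shows "u z \<le> u (z - of_real s)"
proof -
  have "u z \<le> u (z + of_real s * (-1))"
  proof (rule line_mono[OF assms(1)])
    fix t assume t: "0 < t" "t < s"
    have "ellq E (z - of_real t) \<le> ellq E z" using t assms(2) by (intro ellq_mono) auto
    then have "z - of_real t \<in> \<Omega>" using assms(3) assms(4)[of t] t by (intro So_dom) auto
    with grad_out(1)[of "z - of_real t"] assms(2) assms(4)[of t] t
    show "z + of_real t * (-1) \<in> \<Omega> \<and> 0 \<le> ux (z + of_real t * (-1)) * Re (-1) + uy (z + of_real t * (-1)) * Im (-1)" by simp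
  qed
  then show ?thesis by simp
qed

lemma out_descend_y:
  assumes "0 \<le> s" "s \<le> Im z" "ellq E z < 1" "\<And>t. 0 \<le> t \<Longrightarrow> t < s \<Longrightarrow> z - of_real t * \<i> \<in> So"
  shows "u z \<le> u (z - of_real s * \<i>)"
proof -
  have "u z \<le> u (z + of_real s * (-\<i>))"
  proof (rule line_mono[OF assms(1)])
    fix t assume t: "0 < t" "t < s"
    have "ellq E (z - of_real t * \<i>) \<le> ellq E z" using t assms(2) by (intro ellq_mono) auto
    then have "z - of_real t * \<i> \<in> \<Omega>" using assms(3) assms(4)[of t] t by (intro So_dom) auto
    with grad_out(2)[of "z - of_real t * \<i>"] assms(2) assms(4)[of t] t
    show "z + of_real t * (-\<i>) \<in> \<Omega> \<and> 0 \<le> ux (z + of_real t * (-\<i>)) * Re (-\<i>) + uy (z + of_real t * (-\<i>)) * Im (-\<i>)" by simp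
  qed
  then show ?thesis by simp
qed

lemma in_ascend_x:
  assumes "0 \<le> s" "0 \<le> Re z" "\<beta>\<^sup>2 < ellq E z" "\<And>t. 0 \<le> t \<Longrightarrow> t < s \<Longrightarrow> z + of_real t \<in> Si"
  shows "u z \<le> u (z + of_real s)"
proof -
  have "u z \<le> u (z + of_real s * 1)"
  proof (rule line_mono[OF assms(1)])
    fix t assume t: "0 < t" "t < s"
    have "ellq E z \<le> ellq E (z + of_real t)" using t assms(2) by (intro ellq_mono) auto
    then have "z + of_real t \<in> \<Omega>" using assms(3) assms(4)[of t] t by (intro Si_dom) auto
    with grad_in(1)[of "z + of_real t"] assms(2) assms(4)[of t] t
    show "z + of_real t * 1 \<in> \<Omega> \<and> 0 \<le> ux (z + of_real t * 1) * Re 1 + uy (z + of_real t * 1) * Im 1" by simp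
  qed
  then show ?thesis by simp
qed

lemma in_ascend_y:
  assumes "0 \<le> s" "0 \<le> Im z" "\<beta>\<^sup>2 < ellq E z" "\<And>t. 0 \<le> t \<Longrightarrow> t < s \<Longrightarrow> z + of_real t * \<i> \<in> Si"
  shows "u z \<le> u (z + of_real s * \<i>)"
proof (rule line_mono[OF assms(1)])
  fix t assume t: "0 < t" "t < s"
  have "ellq E z \<le> ellq E (z + of_real t * \<i>)" using t assms(2) by (intro ellq_mono) auto
  then have "z + of_real t * \<i> \<in> \<Omega>" using assms(3) assms(4)[of t] t by (intro Si_dom) auto
  with grad_in(2)[of "z + of_real t * \<i>"] assms(2) assms(4)[of t] t
  show "z + of_real t * \<i> \<in> \<Omega> \<and> 0 \<le> ux (z + of_real t * \<i>) * Re \<i> + uy (z + of_real t * \<i>) * Im \<i>" by simp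
qed

text \<open>From a point of \<open>Si\<close> one moves away from the short axis, from a point of
  \<open>So\<close> towards it, until \<open>K\<close> is hit; \<open>u\<close> does not decrease on
  the way. If no point of \<open>K\<close> is met before the imaginary axis, one continues along
  this axis towards 0, which is in \<open>Si\<close>, so that \<open>K\<close> must be
  crossed.\<close>

lemma u_le_c_quadrant:
  assumes z: "0 \<le> Re z" "0 \<le> Im z" "z \<in> \<Omega>" shows "u z \<le> c"
proof -
  have q: "ellq E z < 1" "\<beta>\<^sup>2 < ellq E z" using z(3) unfolding dom by auto
  consider "z \<in> K" | "z \<in> Si" | "z \<in> So" using cov by blast
  then show ?thesis
  proof cases
    case 1 then show ?thesis using u_K by simp
  next
    case 2
    have "ellq E (z + of_real (1 / E)) \<ge> 1"
    proof -
      have "1 \<le> (E * Re (z + of_real (1 / E)))\<^sup>2"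
        using z(1) E by (intro one_le_power) (simp add: algebra_simps)
      then show ?thesis unfolding ellq_def by (simp add: add_increasing2)
    qed
    then have ex: "z + of_real (1 / E) \<notin> Si" using So(2) disj by blast
    obtain s where s: "0 < s" "s \<le> 1 / E" "z + of_real s \<notin> Si" "z + of_real s \<notin> So" "\<And>t. 0 \<le> t \<Longrightarrow> t < s \<Longrightarrow> z + of_real t \<in> Si"
    proof -
      have "continuous_on {0..1 / E} (\<lambda>t. z + of_real t)" by (intro continuous_intros)
      moreover have "z + of_real 0 \<in> Si" "0 \<le> 1 / E" using 2 E by auto
      ultimately show ?thesis using first_exit[of "1 / E" "\<lambda>t. z + of_real t", OF _ Si(1) _ ex So(1) disj] that by blast
    qed
    have "u z \<le> u (z + of_real s)" using s z q by (intro in_ascend_x) auto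
    also have "\<dots> = c" using s cov by (intro u_K) auto
    finally show ?thesis .
  next
    case 3
    have axis: "u w \<le> c" if w: "Re w = 0" "0 \<le> Im w" "ellq E w < 1" "w \<in> So" for w
    proof -
      have w0: "w - of_real (Im w) * \<i> = 0" using w(1) by (simp add: complex_eq_iff)
      have ex: "w - of_real (Im w) * \<i> \<notin> So" using w0 zero_Si disj by auto
      obtain s where s: "0 < s" "s \<le> Im w" "w - of_real s * \<i> \<notin> So" "w - of_real s * \<i> \<notin> Si" "\<And>t. 0 \<le> t \<Longrightarrow> t < s \<Longrightarrow> w - of_real t * \<i> \<in> So"
      proof -
        have "continuous_on {0..Im w} (\<lambda>t. w - of_real t * \<i>)" by (intro continuous_intros)
        moreover have "w - of_real 0 * \<i> \<in> So" using w by simp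
        moreover have "So \<inter> Si = {}" using disj by blast
        ultimately show ?thesis using first_exit[of "Im w" "\<lambda>t. w - of_real t * \<i>", OF _ So(1) _ ex Si(1) _ w(2)] that by blast
      qed
      have "u w \<le> u (w - of_real s * \<i>)" using s w by (intro out_descend_y) auto
      also have "\<dots> = c" using s cov by (intro u_K) auto
      finally show ?thesis .
    qed
    show ?thesis
    proof (cases "\<forall>t. 0 \<le> t \<longrightarrow> t \<le> Re z \<longrightarrow> z - of_real t \<in> So")
      case True
      have "u z \<le> u (z - of_real (Re z))" using True z q by (intro out_descend_x) auto
      also have "\<dots> \<le> c"
      proof (rule axis)
        have "ellq E (z - of_real (Re z)) \<le> ellq E z" by (rule ellq_mono) auto
        then show "ellq E (z - of_real (Re z)) < 1" using q by simp
      qed (use True z in auto)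
      finally show ?thesis .
    next
      case False
      then obtain t where t: "0 \<le> t" "t \<le> Re z" "z - of_real t \<notin> So" by blast
      obtain s where s: "0 < s" "s \<le> t" "z - of_real s \<notin> So" "z - of_real s \<notin> Si" "\<And>t. 0 \<le> t \<Longrightarrow> t < s \<Longrightarrow> z - of_real t \<in> So"
      proof -
        have "continuous_on {0..t} (\<lambda>t. z - of_real t)" by (intro continuous_intros)
        moreover have "z - of_real 0 \<in> So" using 3 by simp
        moreover have "So \<inter> Si = {}" using disj by blast
        ultimately show ?thesis using first_exit[of t "\<lambda>t. z - of_real t", OF _ So(1) _ t(3) Si(1) _ t(1)] that by blast
      qed
      have "u z \<le> u (z - of_real s)" using s t q by (intro out_descend_x) auto
      also have "\<dots> = c" using s cov by (intro u_K) auto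
      finally show ?thesis .
    qed
  qed
qed

lemma dom_symm: "cnj z \<in> \<Omega> \<longleftrightarrow> z \<in> \<Omega>" "- z \<in> \<Omega> \<longleftrightarrow> z \<in> \<Omega>"
  by (simp_all add: dom ellq_symm)

lemma quad_symm: "u (quad z) = u z" "quad z \<in> \<Omega> \<longleftrightarrow> z \<in> \<Omega>" "quad z \<in> Si \<longleftrightarrow> z \<in> Si" "quad z \<in> So \<longleftrightarrow> z \<in> So"
  using quad_invariant[of u] quad_invariant[of "\<lambda>z. z \<in> \<Omega>"] quad_invariant[of "\<lambda>z. z \<in> Si"] quad_invariant[of "\<lambda>z. z \<in> So"]
    u_cnj u_neg dom_symm Si_symm_iff So_symm_iff by auto

lemma u_le_c: "u z \<le> c"
proof (cases "z \<in> \<Omega>")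
  case True then show ?thesis using u_le_c_quadrant[of "quad z"] quad_symm by simp
next
  case False then show ?thesis using c_pos by (simp add: outside_zero)
qed

text \<open>If the maximal value were attained at \<open>p\<close> in \<open>Si\<close>, then by
  monotonicity in both coordinates \<open>u\<close> would equal \<open>c\<close> on a small open
  piece of a quadrant at \<open>p\<close>, but \<open>u\<close> is nowhere locally constant.\<close>

lemma u_less_c: assumes z: "z \<in> Si" shows "u z < c"
proof (rule ccontr)
  assume "\<not> u z < c"
  then have uc: "u (quad z) = c" using u_le_c[of z] quad_symm by simp
  define p where "p = quad z"
  have p: "p \<in> Si" "u p = c" "0 \<le> Re p" "0 \<le> Im p" using z quad_symm uc unfolding p_def by auto
  have "p \<in> \<Omega>" using p(2) c_pos outside_zero by force
  then obtain e where e: "e > 0" "ball p e \<subseteq> Si \<inter> \<Omega>"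
    using p(1) open_Int[OF Si(1) open_dom] open_contains_ball by blast
  define W where "W = ball p e \<inter> {w. Re p < Re w} \<inter> {w. Im p < Im w}"
  have oW: "open W" unfolding W_def by (intro open_Int open_Collect_less continuous_intros open_ball)
  have uW: "u w = c" if w: "w \<in> W" for w
  proof -
    define q where "q = p + of_real (Re w - Re p)"
    have wq: "w = q + of_real (Im w - Im p) * \<i>" unfolding q_def by (simp add: complex_eq_iff)
    have near: "v \<in> ball p e" if "\<bar>Re v - Re p\<bar> \<le> \<bar>Re w - Re p\<bar>" "\<bar>Im v - Im p\<bar> \<le> \<bar>Im w - Im p\<bar>" for v
    proof -
      have "cmod (v - p) \<le> cmod (w - p)" unfolding cmod_def using that
        by (intro real_sqrt_le_mono add_mono) (auto simp: abs_le_square_iff)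
      then show ?thesis using w unfolding W_def by (simp add: dist_norm norm_minus_commute)
    qed
    have r: "Re p < Re w" "Im p < Im w" using w unfolding W_def by auto
    have \<beta>p: "\<beta>\<^sup>2 < ellq E p" using \<open>p \<in> \<Omega>\<close> unfolding dom by auto
    have "u p \<le> u q" unfolding q_def
      using r p \<beta>p e(2) near by (intro in_ascend_x) (auto intro!: subsetD[OF e(2), THEN IntD1])
    also have "u q \<le> u (q + of_real (Im w - Im p) * \<i>)"
    proof (rule in_ascend_y)
      have "q \<in> \<Omega>" using near[of q] e(2) unfolding q_def by auto
      then show "\<beta>\<^sup>2 < ellq E q" unfolding dom by auto
      show "q + of_real t * \<i> \<in> Si" if "0 \<le> t" "t < Im w - Im p" for t
        using near[of "q + of_real t * \<i>"] e(2) that unfolding q_def by auto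
    qed (use r p in \<open>auto simp: q_def\<close>)
    finally show ?thesis using p(2) u_le_c[of w] wq by simp
  qed
  define w where "w = p + of_real (e / 3) + of_real (e / 3) * \<i>"
  have "cmod (w - p) \<le> e / 3 + e / 3"
    using norm_triangle_ineq[of "of_real (e / 3)" "of_real (e / 3) * \<i>"] e(1) unfolding w_def by (simp add: norm_mult)
  then have "w \<in> W" using e(1) unfolding W_def by (simp add: dist_norm norm_minus_commute) (simp add: w_def)
  then have "w \<in> \<Omega>" using e(2) unfolding W_def by auto
  then show False using not_locally_const[OF oW \<open>w \<in> W\<close> _ uW] by blast
qed

end

section \<open>Reflections and rotations of the two capped solutions\<close>

text \<open>Both sides are capped: \<open>outer.cap\<close> keeps \<open>u\<close> on
  \<open>So\<close>, and \<open>inner.cap\<close> below keeps it on \<open>Si\<close>; each is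
  continued by \<open>c\<close> across \<open>K\<close>.\<close>

sublocale critical_ellipse \<subseteq> outer: capped_solution u ux uy a b b' d g \<Omega> c K So Si
  using So(1) Si(1) disj cov K(2) u_K u_le_c by unfold_locales auto

sublocale critical_ellipse \<subseteq> inner: capped_solution u ux uy a b b' d g \<Omega> c K Si So
  using So(1) Si(1) disj cov K(2) u_K u_le_c by unfold_locales auto

context critical_ellipse begin

lemma cap_symm: "outer.cap (cnj z) = outer.cap z" "outer.cap (- z) = outer.cap z"
    "inner.cap (cnj z) = inner.cap z" "inner.cap (- z) = inner.cap z"
  by (simp_all add: outer.cap_def inner.cap_def u_cnj u_neg Si_symm_iff So_symm_iff)

lemma So_expand: "z \<in> So \<Longrightarrow> z \<notin> \<Omega> \<Longrightarrow> ellq E z \<le> ellq E w \<Longrightarrow> w \<in> So \<and> w \<notin> \<Omega>"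
  using So_out[of z] So(2)[of w] by (auto simp: dom)

lemma Si_shrink: "z \<in> Si \<Longrightarrow> z \<notin> \<Omega> \<Longrightarrow> ellq E w \<le> ellq E z \<Longrightarrow> w \<in> Si \<and> w \<notin> \<Omega>"
  using Si_out[of z] Si(2)[of w] by (auto simp: dom)

text \<open>By the symmetry of the solution, translation by \<open>- 2 * of_real l\<close> acts as
  the reflection in the line \<open>Re z = l\<close>. This gives a moving plane inequality while
  only orientation preserving isometries are compared.\<close>

lemma outer_reflect_x:
  assumes "0 < l" "Re z < l" shows "outer.cap (z - 2 * of_real l) \<le> outer.cap z"
proof -
  have "outer.cap (1 * z + (- 2 * of_real l)) \<le> outer.cap z"
  proof (rule outer.cap_isometry_comparison[where G="{z. Re z < l}"])
    show "open {z. Re z < l}" by (intro open_Collect_less continuous_intros)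
    show "outer.cap (1 * p + - 2 * of_real l) \<le> outer.cap p" if "p \<in> closure {z. Re z < l}" "p \<notin> {z. Re z < l}" for p
    proof -
      have "- l \<le> - Re p" using that by (intro closure_greater[where \<phi>="\<lambda>z. - Re z"]) (auto intro!: continuous_intros)
      then have "1 * p + - 2 * of_real l = - cnj p" using that(2) by (simp add: complex_eq_iff)
      then show ?thesis by (simp only: cap_symm order_refl)
    qed
    show "1 * z + - 2 * of_real l \<in> So \<and> 1 * z + - 2 * of_real l \<notin> \<Omega>"
      if "z \<in> {z. Re z < l}" "z \<in> So" "z \<notin> \<Omega>" for z
      using that assms(1) by (intro So_expand[OF that(2,3)] ellq_mono) auto
  qed (use assms in auto)
  then show ?thesis by simp
qed

lemma outer_reflect_y:
  assumes "0 < l" "Im z < l" shows "outer.cap (z - 2 * of_real l * \<i>) \<le> outer.cap z"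
proof -
  have "outer.cap (1 * z + (- 2 * of_real l * \<i>)) \<le> outer.cap z"
  proof (rule outer.cap_isometry_comparison[where G="{z. Im z < l}"])
    show "open {z. Im z < l}" by (intro open_Collect_less continuous_intros)
    show "outer.cap (1 * p + - 2 * of_real l * \<i>) \<le> outer.cap p" if "p \<in> closure {z. Im z < l}" "p \<notin> {z. Im z < l}" for p
    proof -
      have "- l \<le> - Im p" using that by (intro closure_greater[where \<phi>="\<lambda>z. - Im z"]) (auto intro!: continuous_intros)
      then have "1 * p + - 2 * of_real l * \<i> = cnj p" using that(2) by (simp add: complex_eq_iff)
      then show ?thesis by (simp only: cap_symm order_refl)
    qed
    show "1 * z + - 2 * of_real l * \<i> \<in> So \<and> 1 * z + - 2 * of_real l * \<i> \<notin> \<Omega>"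
      if "z \<in> {z. Im z < l}" "z \<in> So" "z \<notin> \<Omega>" for z
      using that assms(1) by (intro So_expand[OF that(2,3)] ellq_mono) auto
  qed (use assms in auto)
  then show ?thesis by simp
qed

lemma inner_reflect_x:
  assumes "0 < l" "l < Re z" shows "inner.cap (z - 2 * of_real l) \<le> inner.cap z"
proof -
  have "inner.cap (1 * z + (- 2 * of_real l)) \<le> inner.cap z"
  proof (rule inner.cap_isometry_comparison[where G="{z. l < Re z}"])
    show "open {z. l < Re z}" by (intro open_Collect_less continuous_intros)
    show "inner.cap (1 * p + - 2 * of_real l) \<le> inner.cap p" if "p \<in> closure {z. l < Re z}" "p \<notin> {z. l < Re z}" for p
    proof -
      have "l \<le> Re p" using that by (intro closure_greater[where \<phi>=Re]) (auto intro!: continuous_intros)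
      then have "1 * p + - 2 * of_real l = - cnj p" using that(2) by (simp add: complex_eq_iff)
      then show ?thesis by (simp only: cap_symm order_refl)
    qed
    show "1 * z + - 2 * of_real l \<in> Si \<and> 1 * z + - 2 * of_real l \<notin> \<Omega>"
      if "z \<in> {z. l < Re z}" "z \<in> Si" "z \<notin> \<Omega>" for z
      using that assms(1) by (intro Si_shrink[OF that(2,3)] ellq_mono) auto
  qed (use assms in auto)
  then show ?thesis by simp
qed

lemma inner_reflect_y:
  assumes "0 < l" "l < Im z" shows "inner.cap (z - 2 * of_real l * \<i>) \<le> inner.cap z"
proof -
  have "inner.cap (1 * z + (- 2 * of_real l * \<i>)) \<le> inner.cap z"
  proof (rule inner.cap_isometry_comparison[where G="{z. l < Im z}"])
    show "open {z. l < Im z}" by (intro open_Collect_less continuous_intros)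
    show "inner.cap (1 * p + - 2 * of_real l * \<i>) \<le> inner.cap p" if "p \<in> closure {z. l < Im z}" "p \<notin> {z. l < Im z}" for p
    proof -
      have "l \<le> Im p" using that by (intro closure_greater[where \<phi>=Im]) (auto intro!: continuous_intros)
      then have "1 * p + - 2 * of_real l * \<i> = cnj p" using that(2) by (simp add: complex_eq_iff)
      then show ?thesis by (simp only: cap_symm order_refl)
    qed
    show "1 * z + - 2 * of_real l * \<i> \<in> Si \<and> 1 * z + - 2 * of_real l * \<i> \<notin> \<Omega>"
      if "z \<in> {z. l < Im z}" "z \<in> Si" "z \<notin> \<Omega>" for z
      using that assms(1) by (intro Si_shrink[OF that(2,3)] ellq_mono) auto
  qed (use assms in auto)
  then show ?thesis by simp
qed

lemma cap_quad: "outer.cap (quad z) = outer.cap z" "inner.cap (quad z) = inner.cap z"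
  using quad_invariant[of outer.cap] quad_invariant[of inner.cap] cap_symm by auto

lemma outer_mono:
  assumes "\<bar>Re z\<bar> \<le> \<bar>Re w\<bar>" "\<bar>Im z\<bar> \<le> \<bar>Im w\<bar>" shows "outer.cap w \<le> outer.cap z"
proof -
  have x: "outer.cap (Complex x2 y) \<le> outer.cap (Complex x1 y)" if "0 \<le> x1" "x1 \<le> x2" for x1 x2 y
  proof (cases "x1 = x2")
    case False
    have "outer.cap (Complex x1 y - 2 * of_real ((x1 + x2) / 2)) \<le> outer.cap (Complex x1 y)"
      by (rule outer_reflect_x) (use that False in auto)
    moreover have "Complex x1 y - 2 * of_real ((x1 + x2) / 2) = - cnj (Complex x2 y)" by (simp add: complex_eq_iff field_simps)
    ultimately show ?thesis by (simp only: cap_symm)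
  qed simp
  have y: "outer.cap (Complex x y2) \<le> outer.cap (Complex x y1)" if "0 \<le> y1" "y1 \<le> y2" for x y1 y2
  proof (cases "y1 = y2")
    case False
    have "outer.cap (Complex x y1 - 2 * of_real ((y1 + y2) / 2) * \<i>) \<le> outer.cap (Complex x y1)"
      by (rule outer_reflect_y) (use that False in auto)
    moreover have "Complex x y1 - 2 * of_real ((y1 + y2) / 2) * \<i> = cnj (Complex x y2)" by (simp add: complex_eq_iff field_simps)
    ultimately show ?thesis by (simp only: cap_symm)
  qed simp
  have "outer.cap (quad w) \<le> outer.cap (quad z)"
    unfolding quad_def using x[of "\<bar>Re z\<bar>" "\<bar>Re w\<bar>" "\<bar>Im w\<bar>"] y[of "\<bar>Im z\<bar>" "\<bar>Im w\<bar>" "\<bar>Re z\<bar>"] assms by simp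
  then show ?thesis by (simp only: cap_quad)
qed

lemma inner_mono:
  assumes "\<bar>Re z\<bar> \<le> \<bar>Re w\<bar>" "\<bar>Im z\<bar> \<le> \<bar>Im w\<bar>" shows "inner.cap z \<le> inner.cap w"
proof -
  have x: "inner.cap (Complex x1 y) \<le> inner.cap (Complex x2 y)" if "0 \<le> x1" "x1 \<le> x2" for x1 x2 y
  proof (cases "x1 = x2")
    case False
    have "inner.cap (Complex x2 y - 2 * of_real ((x1 + x2) / 2)) \<le> inner.cap (Complex x2 y)"
      by (rule inner_reflect_x) (use that False in auto)
    moreover have "Complex x2 y - 2 * of_real ((x1 + x2) / 2) = - cnj (Complex x1 y)" by (simp add: complex_eq_iff field_simps)
    ultimately show ?thesis by (simp only: cap_symm)
  qed simp
  have y: "inner.cap (Complex x y1) \<le> inner.cap (Complex x y2)" if "0 \<le> y1" "y1 \<le> y2" for x y1 y2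
  proof (cases "y1 = y2")
    case False
    have "inner.cap (Complex x y2 - 2 * of_real ((y1 + y2) / 2) * \<i>) \<le> inner.cap (Complex x y2)"
      by (rule inner_reflect_y) (use that False in auto)
    moreover have "Complex x y2 - 2 * of_real ((y1 + y2) / 2) * \<i> = cnj (Complex x y1)" by (simp add: complex_eq_iff field_simps)
    ultimately show ?thesis by (simp only: cap_symm)
  qed simp
  have "inner.cap (quad z) \<le> inner.cap (quad w)"
    unfolding quad_def using x[of "\<bar>Re z\<bar>" "\<bar>Re w\<bar>" "\<bar>Im w\<bar>"] y[of "\<bar>Im z\<bar>" "\<bar>Im w\<bar>" "\<bar>Re z\<bar>"] assms by simp
  then show ?thesis by (simp only: cap_quad)
qed

lemma ellq_rotate:
  assumes "0 \<le> Re w" "0 \<le> Im w" "0 < \<phi>" "\<phi> < pi / 2"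
  shows "ellq E (cis (- \<phi>) * w) \<le> ellq E (cis \<phi> * w)"
proof -
  have "ellq E (cis \<phi> * w) - ellq E (cis (- \<phi>) * w) = (1 - E\<^sup>2) * (4 * (sin \<phi> * cos \<phi>) * (Re w * Im w))"
    unfolding ellq_def by (simp add: power2_eq_square algebra_simps)
  also have "\<dots> \<ge> 0"
    using assms E sin_gt_zero[of \<phi>] cos_gt_zero_pi[of \<phi>] by (intro mult_nonneg_nonneg) (auto simp: power_le_one)
  finally show ?thesis by simp
qed

text \<open>The rotation by \<open>2 * \<phi>\<close> is applied on the sector whose points enter
  the open first quadrant after half of it. On the sides of the sector the half-rotated point is on
  an axis, so the fully rotated point is a mirror image of the original one. By
  \<open>ellq_rotate\<close> points beyond the outer ellipse stay beyond it.\<close>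

lemma outer_rotate:
  assumes w: "0 < Re w" "0 < Im w" and \<phi>: "0 < \<phi>" "\<phi> < pi / 2"
  shows "outer.cap (cis \<phi> * w) \<le> outer.cap (cis (- \<phi>) * w)"
proof -
  let ?G = "{z. 0 < Re (cis \<phi> * z)} \<inter> {z. 0 < Im (cis \<phi> * z)}"
  have cc: "cis (2 * \<phi>) * z + 0 = cis \<phi> * (cis \<phi> * z)" "z = cis (- \<phi>) * (cis \<phi> * z)" for z
    by (simp_all add: mult.assoc[symmetric] cis_mult)
  have "outer.cap (cis (2 * \<phi>) * (cis (- \<phi>) * w) + 0) \<le> outer.cap (cis (- \<phi>) * w)"
  proof (rule outer.cap_isometry_comparison[where G="?G"])
    show "open ?G" by (intro open_Int open_Collect_less continuous_intros)
    show "outer.cap (cis (2 * \<phi>) * p + 0) \<le> outer.cap p" if p: "p \<in> closure ?G" "p \<notin> ?G" for p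
    proof -
      define q where "q = cis \<phi> * p"
      have "0 \<le> Re q" "0 \<le> Im q" unfolding q_def
        using p(1) closure_mono[of ?G "{z. 0 < Re (cis \<phi> * z)}"] closure_mono[of ?G "{z. 0 < Im (cis \<phi> * z)}"]
        by (intro closure_greater[where \<phi>="\<lambda>z. Re (cis \<phi> * z)"] closure_greater[where \<phi>="\<lambda>z. Im (cis \<phi> * z)"] continuous_intros; blast)+
      then have "Re q = 0 \<or> Im q = 0" using p(2) unfolding q_def by auto
      then have "cis \<phi> * q = - cnj (cis (- \<phi>) * q) \<or> cis \<phi> * q = cnj (cis (- \<phi>) * q)"
        by (auto simp: complex_eq_iff)
      then show ?thesis unfolding cc(1) q_def[symmetric] using cap_symm cc(2)[of p] unfolding q_def[symmetric]
        by (metis order_refl)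
    qed
    show "cis (2 * \<phi>) * z + 0 \<in> So \<and> cis (2 * \<phi>) * z + 0 \<notin> \<Omega>" if "z \<in> ?G" "z \<in> So" "z \<notin> \<Omega>" for z
    proof (rule So_expand[OF that(2,3)])
      show "ellq E z \<le> ellq E (cis (2 * \<phi>) * z + 0)"
        using ellq_rotate[of "cis \<phi> * z", OF _ _ \<phi>] that(1) unfolding cc(1) cc(2)[symmetric] by auto
    qed
    have "cis \<phi> * (cis (- \<phi>) * w) = w" by (simp add: mult.assoc[symmetric] cis_mult)
    then show "cis (- \<phi>) * w \<in> ?G" using w unfolding Int_iff mem_Collect_eq by presburger
  qed simp
  then show ?thesis unfolding cc(1) by (simp add: mult.assoc[symmetric] cis_mult)
qed

lemma inner_rotate:
  assumes w: "0 < Re w" "0 < Im w" and \<phi>: "0 < \<phi>" "\<phi> < pi / 2"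
  shows "inner.cap (cis (- \<phi>) * w) \<le> inner.cap (cis \<phi> * w)"
proof -
  let ?G = "{z. 0 < Re (cis (- \<phi>) * z)} \<inter> {z. 0 < Im (cis (- \<phi>) * z)}"
  have cc: "cis (- 2 * \<phi>) * z + 0 = cis (- \<phi>) * (cis (- \<phi>) * z)" "z = cis \<phi> * (cis (- \<phi>) * z)" for z
    by (simp_all add: mult.assoc[symmetric] cis_mult)
  have "inner.cap (cis (- 2 * \<phi>) * (cis \<phi> * w) + 0) \<le> inner.cap (cis \<phi> * w)"
  proof (rule inner.cap_isometry_comparison[where G="?G"])
    show "open ?G" by (intro open_Int open_Collect_less continuous_intros)
    show "inner.cap (cis (- 2 * \<phi>) * p + 0) \<le> inner.cap p" if p: "p \<in> closure ?G" "p \<notin> ?G" for p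
    proof -
      define q where "q = cis (- \<phi>) * p"
      have "0 \<le> Re q" "0 \<le> Im q" unfolding q_def
        using p(1) closure_mono[of ?G "{z. 0 < Re (cis (- \<phi>) * z)}"] closure_mono[of ?G "{z. 0 < Im (cis (- \<phi>) * z)}"]
        by (intro closure_greater[where \<phi>="\<lambda>z. Re (cis (- \<phi>) * z)"] closure_greater[where \<phi>="\<lambda>z. Im (cis (- \<phi>) * z)"] continuous_intros; blast)+
      then have "Re q = 0 \<or> Im q = 0" using p(2) unfolding q_def by auto
      then have "cis (- \<phi>) * q = - cnj (cis \<phi> * q) \<or> cis (- \<phi>) * q = cnj (cis \<phi> * q)"
        by (auto simp: complex_eq_iff)
      then show ?thesis unfolding cc(1) q_def[symmetric] using cap_symm cc(2)[of p] unfolding q_def[symmetric]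
        by (metis order_refl)
    qed
    show "cis (- 2 * \<phi>) * z + 0 \<in> Si \<and> cis (- 2 * \<phi>) * z + 0 \<notin> \<Omega>" if "z \<in> ?G" "z \<in> Si" "z \<notin> \<Omega>" for z
    proof (rule Si_shrink[OF that(2,3)])
      show "ellq E (cis (- 2 * \<phi>) * z + 0) \<le> ellq E z"
        using ellq_rotate[of "cis (- \<phi>) * z", OF _ _ \<phi>] that(1) unfolding cc(1) cc(2)[symmetric] by auto
    qed
    have "cis (- \<phi>) * (cis \<phi> * w) = w" by (simp add: mult.assoc[symmetric] cis_mult)
    then show "cis \<phi> * w \<in> ?G" using w unfolding Int_iff mem_Collect_eq by presburger
  qed simp
  then show ?thesis unfolding cc(1) by (simp add: mult.assoc[symmetric] cis_mult)
qed

text \<open>\<open>w\<close> has the modulus of \<open>z\<close> and bisects the angle between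
  \<open>z\<close> and the imaginary axis.\<close>

lemma rotate_decomposition:
  assumes "0 < Re z" "0 \<le> Im z"
  obtains w \<phi> where "0 < Re w" "0 < Im w" "0 < \<phi>" "\<phi> < pi / 2" "cis \<phi> * w = \<i> * of_real (cmod z)" "cis (- \<phi>) * w = z"
proof -
  define \<psi> where "\<psi> = Arg z"
  have z: "z = of_real (cmod z) * cis \<psi>" "cmod z > 0" using assms rcis_cmod_Arg[of z] unfolding \<psi>_def rcis_def by auto
  have \<psi>: "0 \<le> \<psi>" "\<psi> < pi / 2"
    using assms Arg_Re_pos[of z] Arg_neg_iff[of z] unfolding \<psi>_def by auto
  define \<theta> where "\<theta> = (pi / 2 + \<psi>) / 2"
  define \<phi> where "\<phi> = (pi / 2 - \<psi>) / 2"
  have \<theta>: "0 < \<theta>" "\<theta> < pi / 2" using \<psi> unfolding \<theta>_def by auto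
  show thesis
  proof (rule that[of "of_real (cmod z) * cis \<theta>" \<phi>])
    show "0 < Re (of_real (cmod z) * cis \<theta>)" "0 < Im (of_real (cmod z) * cis \<theta>)"
      using z(2) \<theta> by (auto intro!: mult_pos_pos cos_gt_zero_pi sin_gt_zero)
    show "0 < \<phi>" "\<phi> < pi / 2" using \<psi> unfolding \<phi>_def by auto
    have "cis \<phi> * cis \<theta> = cis (pi / 2)" unfolding cis_mult \<phi>_def \<theta>_def by (simp add: field_simps)
    then show "cis \<phi> * (of_real (cmod z) * cis \<theta>) = \<i> * of_real (cmod z)" by (simp add: mult_ac)
    have "cis (- \<phi>) * cis \<theta> = cis \<psi>" unfolding cis_mult \<phi>_def \<theta>_def by (simp add: field_simps)
    then show "cis (- \<phi>) * (of_real (cmod z) * cis \<theta>) = z" using z(1) by (metis mult.left_commute)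
  qed
qed

text \<open>On each circle about 0 the short axis carries the minimum of \<open>outer.cap\<close>
  and the maximum of \<open>inner.cap\<close>: rotating towards it raises
  \<open>ellq\<close>.\<close>

lemma cap_radial: "outer.cap (\<i> * of_real (cmod z)) \<le> outer.cap z" "inner.cap z \<le> inner.cap (\<i> * of_real (cmod z))"
proof -
  have n: "cmod (quad z) = cmod z" by (simp add: cmod_def)
  have "outer.cap (\<i> * of_real (cmod (quad z))) \<le> outer.cap (quad z) \<and> inner.cap (quad z) \<le> inner.cap (\<i> * of_real (cmod (quad z)))"
  proof (cases "Re z = 0")
    case True
    then have "\<i> * of_real (cmod (quad z)) = quad z" by (simp add: complex_eq_iff cmod_def)
    then show ?thesis by simp
  next
    case False
    then obtain w \<phi> where "0 < Re w" "0 < Im w" "0 < \<phi>" "\<phi> < pi / 2" "cis \<phi> * w = \<i> * of_real (cmod (quad z))" "cis (- \<phi>) * w = quad z"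
      using rotate_decomposition[of "quad z"] by auto
    then show ?thesis using outer_rotate[of w \<phi>] inner_rotate[of w \<phi>] by simp
  qed
  then show "outer.cap (\<i> * of_real (cmod z)) \<le> outer.cap z" "inner.cap z \<le> inner.cap (\<i> * of_real (cmod z))"
    unfolding n cap_quad by auto
qed

text \<open>The shift is the difference of the semi-axes \<open>\<beta> / E\<close> and
  \<open>\<beta>\<close> of the inner ellipse, so the map takes the vertex on the long axis to the
  one on the short axis. The line where the real part equals the shift goes to the real axis, where
  \<open>cap_radial\<close> and \<open>inner_mono\<close> give the boundary inequality; the part of
  the hole beyond this line is mapped into the hole.\<close>

lemma inner_quarter_turn:
  assumes z: "\<beta> * (1 / E - 1) < Re z"
  shows "inner.cap (\<i> * (z - of_real (\<beta> * (1 / E - 1)))) \<le> inner.cap z"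
proof -
  define d where "d = \<beta> * (1 / E - 1)"
  have d: "d > 0" unfolding d_def using E \<beta> by (simp add: field_simps)
  have dE: "d + \<beta> = \<beta> / E" unfolding d_def using E by (simp add: field_simps)
  have "inner.cap (\<i> * z + (- \<i> * of_real d)) \<le> inner.cap z"
  proof (rule inner.cap_isometry_comparison[where G="{z. d < Re z}"])
    show "open {z. d < Re z}" by (intro open_Collect_less continuous_intros)
    show "inner.cap (\<i> * p + - \<i> * of_real d) \<le> inner.cap p" if p: "p \<in> closure {z. d < Re z}" "p \<notin> {z. d < Re z}" for p
    proof -
      have "d \<le> Re p" using p by (intro closure_greater[where \<phi>=Re]) (auto intro!: continuous_intros)
      then have rp: "Re p = d" using p(2) by simp
      then have e: "\<i> * p + - \<i> * of_real d = of_real (- Im p)" by (simp add: complex_eq_iff)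
      have "inner.cap (of_real (- Im p)) \<le> inner.cap (\<i> * of_real (cmod (of_real (- Im p))))" by (rule cap_radial)
      also have "\<dots> \<le> inner.cap p" by (rule inner_mono) auto
      finally show ?thesis unfolding e .
    qed
    show "\<i> * z + - \<i> * of_real d \<in> Si \<and> \<i> * z + - \<i> * of_real d \<notin> \<Omega>" if zz: "z \<in> {z. d < Re z}" "z \<in> Si" "z \<notin> \<Omega>" for z
    proof -
      define x y where "x = Re z" and "y = Im z"
      have el: "(E * x)\<^sup>2 + y\<^sup>2 \<le> \<beta>\<^sup>2" using Si_out[OF zz(2,3)] unfolding ellq_def x_def y_def by simp
      have dx: "d < x" using zz unfolding x_def by simp
      have "(E * x)\<^sup>2 \<le> \<beta>\<^sup>2" using el by (smt (verit) zero_le_power2)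
      then have "E * x \<le> \<beta>" using \<beta> by (simp add: power2_le_iff_abs_le)
      then have xb: "x \<le> d + \<beta>" unfolding dE using E by (simp add: field_simps)
      have "(x - d)\<^sup>2 - (E * E * x)\<^sup>2 \<le> (1 - E\<^sup>2) * \<beta>\<^sup>2"
      proof -
        define b where "b = \<beta> / E"
        have b: "\<beta> = E * b" "d = (1 - E) * b" "b > 0" using E \<beta> unfolding b_def d_def by (auto simp: field_simps)
        have xb: "x \<le> b" using xb unfolding dE b_def .
        \<comment> \<open>The first factor is nonnegative by \<open>xb\<close>. The second is linear
          and increasing in \<open>x\<close>, so it suffices to examine it at
          \<open>x = d\<close>.\<close>
        have "(1 - E\<^sup>2) * \<beta>\<^sup>2 - ((x - d)\<^sup>2 - (E * E * x)\<^sup>2) = (b - x) * ((1 - E ^ 4) * x - ((1 - E)\<^sup>2 - (1 - E\<^sup>2) * E\<^sup>2) * b)"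
          unfolding b(1,2) by algebra
        moreover have "(1 - E ^ 4) * x - ((1 - E)\<^sup>2 - (1 - E\<^sup>2) * E\<^sup>2) * b \<ge> 0"
        proof -
          have "(1 - E ^ 4) * d \<le> (1 - E ^ 4) * x" using dx E by (intro mult_left_mono) (auto simp: power_le_one)
          moreover have "(1 - E ^ 4) * d - ((1 - E)\<^sup>2 - (1 - E\<^sup>2) * E\<^sup>2) * b = (1 - E) * b * E * (1 - E ^ 3 + E + E\<^sup>2)"
            unfolding b(2) by algebra
          moreover have "(1 - E) * b * E * (1 - E ^ 3 + E + E\<^sup>2) \<ge> 0"
            using E b(3) power_le_one[of E 3] by (intro mult_nonneg_nonneg) auto
          ultimately show ?thesis by linarith
        qed
        ultimately show ?thesis using xb by (smt (verit) mult_nonneg_nonneg)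
      qed
      moreover have "ellq E (\<i> * z + - \<i> * of_real d) = E\<^sup>2 * y\<^sup>2 + (x - d)\<^sup>2"
        unfolding ellq_def x_def y_def by (simp add: power_mult_distrib)
      moreover have "E\<^sup>2 * y\<^sup>2 \<le> E\<^sup>2 * (\<beta>\<^sup>2 - (E * x)\<^sup>2)" using el by (intro mult_left_mono) auto
      ultimately have "ellq E (\<i> * z + - \<i> * of_real d) \<le> \<beta>\<^sup>2"
        by (simp add: power_mult_distrib algebra_simps power2_eq_square)
      then show ?thesis using Si(2) by (auto simp: dom)
    qed
    show "z \<in> {z. d < Re z}" using z unfolding d_def by simp
  qed simp
  then show ?thesis unfolding d_def by (simp add: algebra_simps)
qed

text \<open>\<open>K\<close> has empty interior, so points off \<open>K\<close> exist in
  \<open>W\<close> slightly farther along the long axis. They are not in \<open>Si\<close>, since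
  \<open>inner.cap\<close> has already reached \<open>c\<close> at \<open>n\<close>; so they are in
  \<open>So\<close>, where \<open>u\<close> would be locally constant.\<close>

lemma near_K_positive_axis:
  assumes n: "of_real n \<in> K" "0 < n" and W: "open W" "of_real n \<in> W" and const: "\<And>z. z \<in> W \<Longrightarrow> outer.cap z = c"
  shows False
proof -
  have nO: "of_real n \<in> \<Omega>" using n K by auto
  obtain e where e: "e > 0" "ball (of_real n) e \<subseteq> W \<inter> \<Omega>"
    using open_Int[OF W(1) open_dom] W(2) nO open_contains_ball by blast
  define V where "V = ball (of_real n) e \<inter> {w. n < Re w}"
  have "open V" unfolding V_def by (intro open_Int open_Collect_less continuous_intros open_ball)
  moreover have "of_real (n + e / 2) \<in> V" using e(1) unfolding V_def by (auto simp: dist_norm simp flip: of_real_diff)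
  ultimately have "\<not> V \<subseteq> K" using interior_K interior_maximal by blast
  then obtain z where z: "z \<in> V" "z \<notin> K" by blast
  have "z \<notin> Si"
  proof
    assume zi: "z \<in> Si"
    have "inner.cap (of_real n) \<le> inner.cap z" using z(1) n unfolding V_def by (intro inner_mono) auto
    moreover have "of_real n \<notin> Si" using n cov by blast
    ultimately show False using u_less_c[OF zi] zi unfolding inner.cap_def by simp
  qed
  then have zo: "z \<in> So" using z(2) cov by blast
  show False
  proof (rule not_locally_const[of "W \<inter> So" z c])
    show "open (W \<inter> So)" using W(1) So(1) by blast
    show "z \<in> W \<inter> So" "z \<in> \<Omega>" using z zo e(2) unfolding V_def by auto
    show "u w = c" if "w \<in> W \<inter> So" for w using const[of w] that unfolding outer.cap_def by simp
  qed
qed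

end

section \<open>Estimates on the axes of the ellipses\<close>

lemma exp_partial_sum_le:
  fixes x :: real assumes "0 \<le> x" shows "(\<Sum>j<k. x ^ j / fact j) \<le> exp x"
proof -
  have "(\<Sum>j<k. x ^ j /\<^sub>R fact j) \<le> (\<Sum>j. x ^ j /\<^sub>R fact j)"
    using assms by (intro sum_le_suminf summable_exp_generic) auto
  then show ?thesis by (simp add: exp_def divide_inverse mult.commute)
qed

text \<open>Right side minus left side increases with \<open>P\<close>, because the factor
  \<open>(1 + x) * (2 + P + Q)\<close> from the quadratic term dominates \<open>x\<close>, and it
  decreases in \<open>E\<close>.\<close>

lemma small_E_mono:
  fixes x P Q E E' :: real
  assumes x: "0 < x" and P: "0 \<le> Q" "Q \<le> P" and E: "0 \<le> E" "E \<le> E'"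
    and base: "E'\<^sup>2 * x * (1 + Q) < (1 + x) * (2 * Q + Q\<^sup>2)" and E1: "E' \<le> 1"
  shows "E\<^sup>2 * x * (1 + P) < (1 + x) * (2 * P + P\<^sup>2)"
proof -
  have "E\<^sup>2 * (x * (1 + Q)) \<le> E'\<^sup>2 * (x * (1 + Q))" using E x P by (intro mult_right_mono power_mono) auto
  then have 1: "E\<^sup>2 * x * (1 + Q) < (1 + x) * (2 * Q + Q\<^sup>2)" using base by (simp add: mult.assoc)
  have "E\<^sup>2 \<le> 1" using E E1 by (intro power_le_one) auto
  then have "E\<^sup>2 * x \<le> 1 * x" using x by (intro mult_right_mono) auto
  also have "1 * x \<le> (1 + x) * (2 + P + Q)" 
    using x P mult_mono[of "x" "1 + x" 1 "2 + P + Q"] by simp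
  finally have "E\<^sup>2 * x * (P - Q) \<le> ((1 + x) * (2 + P + Q)) * (P - Q)"
    using P by (intro mult_right_mono) auto
  then show ?thesis using 1 by (simp add: algebra_simps power2_eq_square)
qed

text \<open>With \<open>x = 1 / m - 1\<close>, one alternative holds for \<open>E\<close> below and the other one for \<open>E\<close> above the
  curve \<open>E = \<alpha> / (\<alpha> + x)\<close>, where \<open>\<alpha> = 2\<close> for \<open>x \<le> 1\<close> and \<open>\<alpha> = 3\<close> for \<open>x \<ge> 1\<close>. Both are monotone
  in \<open>E\<close>, which reduces them to polynomial inequalities on this curve.\<close>

lemma small_E:
  fixes x \<nu> E \<alpha> :: real
  assumes x: "0 < x" and \<nu>: "\<nu> * (6 + 6 * x + 3 * x\<^sup>2 + x ^ 3) \<le> 6" and E: "0 < E" "E * (\<alpha> + x) \<le> \<alpha>"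
    and \<alpha>: "x \<le> 1 \<and> \<alpha> = 2 \<or> 1 \<le> x \<and> \<alpha> = 3"
  defines "P \<equiv> (1 - E) * ((1 - \<nu>) / x)"
  shows "E\<^sup>2 * x * (1 + P) < (1 + x) * (2 * P + P\<^sup>2)"
proof -
  define V where "V = 6 + 6 * x + 3 * x\<^sup>2 + x ^ 3"
  \<comment> \<open>\<open>V / 6\<close> is the cubic Taylor polynomial of \<open>exp x\<close>, and
    \<open>\<nu>\<close> will be \<open>exp (- x)\<close>. \<open>U\<close> is chosen with
    \<open>x * U = V - 6\<close>, so that \<open>U / V\<close> is a lower bound of
    \<open>(1 - \<nu>) / x\<close>.\<close>
  define U where "U = 6 + 3 * x + x\<^sup>2"
  have V: "V > 0" "U > 0" unfolding V_def U_def using x by (auto intro!: add_pos_pos)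
  have \<alpha>0: "\<alpha> > 0" using \<alpha> by auto
  have VU: "V = 6 + x * U" unfolding V_def U_def by (simp add: algebra_simps power2_eq_square power3_eq_cube)
  have "\<nu> * V \<le> 6" using \<nu> unfolding V_def .
  then have "x * U / V \<le> 1 - \<nu>" using V unfolding VU by (simp add: field_simps)
  then have q: "U / V \<le> (1 - \<nu>) / x" using x by (simp add: field_simps)
  have E': "E \<le> \<alpha> / (\<alpha> + x)" using E x \<alpha>0 by (simp add: field_simps)
  then have E1: "x / (\<alpha> + x) \<le> 1 - E" using x \<alpha>0 by (simp add: field_simps)
  moreover have "0 \<le> x / (\<alpha> + x)" using x \<alpha>0 by simp
  ultimately have "0 \<le> 1 - E" by linarith
  then have P: "x / (\<alpha> + x) * (U / V) \<le> P" unfolding P_def using E1 q x V \<alpha>0 by (intro mult_mono) auto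
  define N D where "N = x * U" and "D = (\<alpha> + x) * V"
  have D: "D > 0" "N > 0" unfolding N_def D_def using x V \<alpha>0 by auto
  have key: "\<alpha>\<^sup>2 * V * (D + N) < (1 + x) * U * (2 * D + N) * (\<alpha> + x)"
    using \<alpha>
  proof
    assume a: "x \<le> 1 \<and> \<alpha> = 2"
    have "(1 + x) * U * (2 * D + N) * (\<alpha> + x) - \<alpha>\<^sup>2 * V * (D + N) =
      216 * x + 660 * x ^ 2 + 798 * x ^ 3 + 579 * x ^ 4 + 283 * x ^ 5 + 91 * x ^ 6 + 19 * x ^ 7 + 2 * x ^ 8"
      unfolding D_def N_def V_def U_def conjunct2[OF a] by algebra
    also have "\<dots> > 0" using x by (intro add_pos_pos) auto
    finally show ?thesis by simp
  next
    assume a: "1 \<le> x \<and> \<alpha> = 3"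
    \<comment> \<open>Expanded about 1, the polynomial has only positive coefficients, which settles
      the range from 1 onwards.\<close>
    define t where "t = x - 1"
    have t: "t \<ge> 0" "x = 1 + t" using a unfolding t_def by auto
    have "(1 + x) * U * (2 * D + N) * (\<alpha> + x) - \<alpha>\<^sup>2 * V * (D + N) =
      384 + 4066 * t + 7283 * t ^ 2 + 6375 * t ^ 3 + 3389 * t ^ 4 + 1165 * t ^ 5 + 258 * t ^ 6 + 34 * t ^ 7 + 2 * t ^ 8"
      unfolding D_def N_def V_def U_def conjunct2[OF a] t(2) by algebra
    also have "\<dots> > 0" using t by (intro add_pos_nonneg) auto
    finally show ?thesis by simp
  qed
  show ?thesis
  proof (rule small_E_mono[OF x _ P _ E'])
    have e: "x / (\<alpha> + x) * (U / V) = N / D" unfolding N_def D_def by simp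
    have "(\<alpha> / (\<alpha> + x))\<^sup>2 * x * (1 + N / D) = x * V * (\<alpha>\<^sup>2 * V * (D + N)) / ((\<alpha> + x) * D\<^sup>2) / V"
      using D V x \<alpha>0 by (simp add: divide_simps D_def) (simp add: power2_eq_square algebra_simps)
    also have "\<dots> < x * V * ((1 + x) * U * (2 * D + N) * (\<alpha> + x)) / ((\<alpha> + x) * D\<^sup>2) / V"
      using key D V x \<alpha>0 by (intro divide_strict_right_mono mult_strict_left_mono) auto
    also have "\<dots> = (1 + x) * (2 * (N / D) + (N / D)\<^sup>2)"
      using D V x \<alpha>0 by (simp add: divide_simps) (simp add: power2_eq_square algebra_simps N_def)
    finally show "(\<alpha> / (\<alpha> + x))\<^sup>2 * x * (1 + x / (\<alpha> + x) * (U / V)) < (1 + x) * (2 * (x / (\<alpha> + x) * (U / V)) + (x / (\<alpha> + x) * (U / V))\<^sup>2)"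
      unfolding e .
  qed (use x V E \<alpha>0 in auto)
qed

text \<open>\<open>A + B * E\<^sup>2\<close> is
  \<open>(1 - E\<^sup>2) * (\<delta> - 2 * m\<^sup>2)\<close> for the \<delta> of
  \<open>inversion_bound\<close>. The last inequality says that the upper bound
  \<open>m * (1 + \<nu> * (1 / E - 1))\<close> of \<open>n\<close> is too small for the lower bound
  given there, after the common factor \<open>1 - E\<close> has been removed. The coefficients in
  the bound on \<open>\<nu>\<close> are those of the Taylor polynomial of degree 5.\<close>

lemma large_E:
  fixes m x \<nu> E \<alpha> :: real
  assumes m: "m = 1 / (1 + x)" and x: "0 < x" and \<nu>: "0 < \<nu>" "\<nu> * (120 + 120 * x + 60 * x\<^sup>2 + 20 * x ^ 3 + 5 * x ^ 4 + x ^ 5) \<le> 120"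
    and E: "0 < E" "E < 1" "\<alpha> \<le> E * (\<alpha> + x)" and \<alpha>: "x \<le> 1 \<and> \<alpha> = 2 \<or> 1 \<le> x \<and> \<alpha> = 3"
  defines "A \<equiv> 3 + 3 * m ^ 4 - 2 * m\<^sup>2" and "B \<equiv> 3 * m ^ 4 + 2 * m\<^sup>2 - 1"
  shows "0 < A + B * E\<^sup>2" "(2 * \<nu> + \<nu>\<^sup>2 * (1 / E - 1)) * (A + B * E\<^sup>2) < 8 * m\<^sup>2 * (E * (1 + E))"
proof -
  have m0: "0 < m" "m < 1" unfolding m using x by auto
  have \<alpha>0: "\<alpha> > 0" using \<alpha> by auto
  have m2: "m\<^sup>2 < 1" using m0 by (simp add: power_less_one_iff)
  have AB: "0 < A" "B \<le> A" "- A \<le> B" unfolding A_def B_def 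
  proof -
    have "0 \<le> m ^ 4" using m0 by simp
    then show "0 < 3 + 3 * m ^ 4 - 2 * m\<^sup>2" "3 * m ^ 4 + 2 * m\<^sup>2 - 1 \<le> 3 + 3 * m ^ 4 - 2 * m\<^sup>2"
      "- (3 + 3 * m ^ 4 - 2 * m\<^sup>2) \<le> 3 * m ^ 4 + 2 * m\<^sup>2 - 1" using m2 by linarith+
  qed
  have pos: "0 < A + B * e\<^sup>2" if "0 \<le> e" "e < 1" for e
  proof -
    have "e\<^sup>2 < 1" using that by (simp add: power_less_one_iff)
    then have "A * e\<^sup>2 < A" using AB by simp
    moreover have "- A * e\<^sup>2 \<le> B * e\<^sup>2" using AB by (intro mult_right_mono) auto
    ultimately show ?thesis by simp
  qed
  show "0 < A + B * E\<^sup>2" using pos E by simp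
  define e where "e = \<alpha> / (\<alpha> + x)"
  have e: "0 < e" "e < 1" "e \<le> E" unfolding e_def using \<alpha>0 x E by (auto simp: field_simps)
  define T where "T = 120 + 120 * x + 60 * x\<^sup>2 + 20 * x ^ 3 + 5 * x ^ 4 + x ^ 5"
  have T: "T > 0" unfolding T_def using x by (intro add_pos_pos) auto
  have \<nu>T: "\<nu> \<le> 120 / T" using \<nu>(2) T by (simp add: T_def field_simps)
  have ix: "1 / e - 1 = x / \<alpha>" unfolding e_def using \<alpha>0 x by (simp add: field_simps)
  have "2 * \<nu> + \<nu>\<^sup>2 * (1 / E - 1) \<le> 2 * \<nu> + \<nu>\<^sup>2 * (1 / e - 1)"
    using e by (intro add_left_mono mult_left_mono) (auto simp: frac_le)
  also have "\<dots> \<le> 2 * (120 / T) + (120 / T)\<^sup>2 * (x / \<alpha>)"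
    unfolding ix using \<nu>T \<nu>(1) x \<alpha>0 by (intro add_mono mult_mono power_mono) auto
  finally have 1: "2 * \<nu> + \<nu>\<^sup>2 * (1 / E - 1) \<le> 2 * (120 / T) + (120 / T)\<^sup>2 * (x / \<alpha>)" .
  \<comment> \<open>The quotient of \<open>A + B * E\<^sup>2\<close> by \<open>E * (1 + E)\<close>
    decreases in \<open>E\<close>, so only the boundary value \<open>e\<close> of the range has to
    be examined.\<close>
  have 2: "(A + B * E\<^sup>2) * (e * (1 + e)) \<le> (A + B * e\<^sup>2) * (E * (1 + E))"
  proof -
    have "(A + B * e\<^sup>2) * (E * (1 + E)) - (A + B * E\<^sup>2) * (e * (1 + e)) = (E - e) * (A + A * (E + e) - B * (E * e))"
      by (simp add: algebra_simps power2_eq_square)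
    moreover have "A + A * (E + e) - B * (E * e) \<ge> 0"
    proof -
      have "E * e \<le> 1" using e E by (simp add: mult_le_one)
      then have "A * (E * e) \<le> A" using AB by simp
      moreover have "B * (E * e) \<le> A * (E * e)" using AB e E by (intro mult_right_mono) auto
      moreover have "A * (E + e) \<ge> 0" using AB e E by simp
      ultimately show ?thesis by linarith
    qed
    ultimately show ?thesis using e by (smt (verit) mult_nonneg_nonneg)
  qed
  have key: "(2 * (120 / T) + (120 / T)\<^sup>2 * (x / \<alpha>)) * (A + B * e\<^sup>2) < 8 * m\<^sup>2 * (e * (1 + e))"
  proof -
    define M where "M = 1 + x"
    have M: "M > 0" "m = 1 / M" unfolding M_def m using x by auto
    define A' B' where "A' = 3 * M ^ 4 + 3 - 2 * M\<^sup>2" and "B' = 3 + 2 * M\<^sup>2 - M ^ 4"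
    have A': "A = A' / M ^ 4" "B = B' / M ^ 4"
      unfolding A_def B_def A'_def B'_def M(2) using M by (simp_all add: field_simps)
    have poly: "(240 * \<alpha> * T + 14400 * x) * (A' * (\<alpha> + x)\<^sup>2 + B' * \<alpha>\<^sup>2) < 8 * M\<^sup>2 * T\<^sup>2 * \<alpha>\<^sup>2 * (2 * \<alpha> + x)"
      using \<alpha>
    proof
      assume a: "1 \<le> x \<and> \<alpha> = 3"
      have "8 * M\<^sup>2 * T\<^sup>2 * \<alpha>\<^sup>2 * (2 * \<alpha> + x) - (240 * \<alpha> * T + 14400 * x) * (A' * (\<alpha> + x)\<^sup>2 + B' * \<alpha>\<^sup>2) =
        14400 * (720 * x + 1464 * x ^ 2 + 1136 * x ^ 3 + 370 * x ^ 4 + 68 / 5 * x ^ 5 + 114 / 5 * x ^ 7 + 69 / 4 * x ^ 8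
          + 309 / 40 * x ^ 9 + 263 / 100 * x ^ 10 + 16 / 25 * x ^ 11 + 9 / 100 * x ^ 12 + 1 / 200 * x ^ 13)"
        unfolding A'_def B'_def M_def T_def conjunct2[OF a] by algebra
      also have "\<dots> > 0" using x by (intro add_pos_pos mult_pos_pos) auto
      finally show ?thesis by simp
    next
      assume a: "x \<le> 1 \<and> \<alpha> = 2"
      \<comment> \<open>For \<open>x \<le> 1\<close> the negative terms of degree 4 to 8 are
        outweighed by those of degree 1 and 2.\<close>
      have le: "x ^ (2 + k) \<le> x\<^sup>2" for k using x a by (intro power_decreasing) auto
      have "8 * M\<^sup>2 * T\<^sup>2 * \<alpha>\<^sup>2 * (2 * \<alpha> + x) - (240 * \<alpha> * T + 14400 * x) * (A' * (\<alpha> + x)\<^sup>2 + B' * \<alpha>\<^sup>2) =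
        2764800 * x + 5529600 * x ^ 2 + 3014400 * x ^ 3 - 1382400 * x ^ 4 - 2634240 * x ^ 5 - 1475200 * x ^ 6
          - 445760 * x ^ 7 - 78080 * x ^ 8 + 160 * x ^ 9 + 7008 * x ^ 10 + 2848 * x ^ 11 + 512 * x ^ 12 + 32 * x ^ 13"
        unfolding A'_def B'_def M_def T_def conjunct2[OF a] by algebra
      moreover have "0 \<le> 160 * x ^ 9 + 7008 * x ^ 10 + 2848 * x ^ 11 + 512 * x ^ 12 + 32 * x ^ 13 + 3014400 * x ^ 3"
        using x by (intro add_nonneg_nonneg) auto
      moreover have "0 < x\<^sup>2" "x\<^sup>2 \<le> x" using x a by (auto simp: power2_eq_square mult_le_cancel_left1)
      moreover have "x ^ 4 \<le> x\<^sup>2" "x ^ 5 \<le> x\<^sup>2" "x ^ 6 \<le> x\<^sup>2" "x ^ 7 \<le> x\<^sup>2" "x ^ 8 \<le> x\<^sup>2"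
        using le[of 2] le[of 3] le[of 4] le[of 5] le[of 6] by simp_all
      ultimately show ?thesis by linarith
    qed
    define P where "P = \<alpha> * T\<^sup>2 * M ^ 4 * (\<alpha> + x)\<^sup>2"
    have P: "P > 0" unfolding P_def using \<alpha>0 T M x by simp
    have "(2 * (120 / T) + (120 / T)\<^sup>2 * (x / \<alpha>)) * (A + B * e\<^sup>2) =
        ((240 * \<alpha> * T + 14400 * x) / (\<alpha> * T\<^sup>2)) * ((A' * (\<alpha> + x)\<^sup>2 + B' * \<alpha>\<^sup>2) / (M ^ 4 * (\<alpha> + x)\<^sup>2))"
    proof -
      have "2 * (120 / T) + (120 / T)\<^sup>2 * (x / \<alpha>) = (240 * \<alpha> * T + 14400 * x) / (\<alpha> * T\<^sup>2)"
        using T \<alpha>0 by (simp add: field_simps power2_eq_square)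
      moreover have "A + B * e\<^sup>2 = (A' * (\<alpha> + x)\<^sup>2 + B' * \<alpha>\<^sup>2) / (M ^ 4 * (\<alpha> + x)\<^sup>2)"
        unfolding A' e_def using M \<alpha>0 x by (simp add: divide_simps power_divide)
      ultimately show ?thesis by simp
    qed
    also have "\<dots> = ((240 * \<alpha> * T + 14400 * x) * (A' * (\<alpha> + x)\<^sup>2 + B' * \<alpha>\<^sup>2)) / P" unfolding P_def by (simp add: mult_ac)
    also have "\<dots> < (8 * M\<^sup>2 * T\<^sup>2 * \<alpha>\<^sup>2 * (2 * \<alpha> + x)) / P" using poly P by (intro divide_strict_right_mono)
    also have "\<dots> = 8 * m\<^sup>2 * (e * (1 + e))"
    proof -
      have "e * (1 + e) = \<alpha> * (2 * \<alpha> + x) / (\<alpha> + x)\<^sup>2"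
        unfolding e_def using \<alpha>0 x by (simp add: field_simps power2_eq_square)
      then show ?thesis unfolding M(2) P_def using \<alpha>0 x T M by (simp add: divide_simps) (simp add: eval_nat_numeral)
    qed
    finally show ?thesis .
  qed
  have "(2 * \<nu> + \<nu>\<^sup>2 * (1 / E - 1)) * (A + B * E\<^sup>2) * (e * (1 + e))
      \<le> (2 * \<nu> + \<nu>\<^sup>2 * (1 / E - 1)) * ((A + B * e\<^sup>2) * (E * (1 + E)))"
    unfolding mult.assoc using 2 \<nu> E by (intro mult_left_mono) (auto simp: mult.assoc)
  also have "\<dots> \<le> (2 * (120 / T) + (120 / T)\<^sup>2 * (x / \<alpha>)) * ((A + B * e\<^sup>2) * (E * (1 + E)))"
    using 1 pos[of e] e E by (intro mult_right_mono) auto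
  also have "\<dots> = (2 * (120 / T) + (120 / T)\<^sup>2 * (x / \<alpha>)) * (A + B * e\<^sup>2) * (E * (1 + E))" by simp
  also have "\<dots> < 8 * m\<^sup>2 * (e * (1 + e)) * (E * (1 + E))"
    using key E by (intro mult_strict_right_mono) auto
  also have "\<dots> = 8 * m\<^sup>2 * (E * (1 + E)) * (e * (1 + e))" by simp
  finally show "(2 * \<nu> + \<nu>\<^sup>2 * (1 / E - 1)) * (A + B * E\<^sup>2) < 8 * m\<^sup>2 * (E * (1 + E))"
    using e by (simp add: mult_less_cancel_right)
qed

section \<open>An inversion in the squared variable\<close>

text \<open>Across its branch cut \<open>csqrt\<close> changes only its sign, to which an even
  function is blind. On the left half-plane the branch \<open>\<i> * csqrt (- w)\<close>, continuous
  there, is used.\<close>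

lemma even_csqrt_continuous:
  fixes f :: "complex \<Rightarrow> real"
  assumes f: "continuous_on UNIV f" "\<And>z. f (- z) = f z"
  shows "continuous_on A (\<lambda>w. f (csqrt w))"
proof -
  have "isCont csqrt w" if "0 \<le> Re w" for w
  proof (cases "w = 0")
    case True
    have "((\<lambda>w. sqrt (cmod w)) \<longlongrightarrow> sqrt (cmod 0)) (at 0)" by (intro tendsto_intros)
    moreover have "cmod (csqrt w) = sqrt (cmod w)" for w
      by (metis norm_ge_zero norm_power power2_csqrt real_sqrt_unique)
    ultimately have "((\<lambda>w. cmod (csqrt w)) \<longlongrightarrow> 0) (at 0)" by simp
    from tendsto_norm_zero_cancel[OF this] show ?thesis using True by (simp add: isCont_def)
  next
    case False
    then show ?thesis using that by (intro continuous_at_csqrt) (auto simp: complex_nonpos_Reals_iff complex_eq_iff)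
  qed
  then have ccs: "continuous_on {w. 0 \<le> Re w} csqrt" by (auto intro: continuous_at_imp_continuous_on)
  then have 1: "continuous_on {w. 0 \<le> Re w} (\<lambda>w. f (csqrt w))"
    by (rule continuous_on_compose2[OF f(1)]) auto
  have eq: "f (csqrt w) = f (\<i> * csqrt (- w))" for w
  proof -
    have "(csqrt w)\<^sup>2 = (\<i> * csqrt (- w))\<^sup>2" by (simp add: power_mult_distrib)
    then show ?thesis unfolding power2_eq_iff using f(2) by metis
  qed
  have "continuous_on {w. Re w \<le> 0} (\<lambda>w. csqrt (- w))"
    by (rule continuous_on_compose2[OF ccs]) (auto intro!: continuous_intros)
  then have 2: "continuous_on {w. Re w \<le> 0} (\<lambda>w. f (csqrt w))"
    unfolding eq by (intro continuous_on_compose2[OF f(1)] continuous_intros) auto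
  have "continuous_on ({w. 0 \<le> Re w} \<union> {w. Re w \<le> 0}) (\<lambda>w. f (csqrt w))"
    by (rule continuous_on_closed_Un[OF _ _ 1 2]) (auto intro!: closed_Collect_le continuous_intros)
  moreover have "{w. 0 \<le> Re w} \<union> {w. Re w \<le> 0} = UNIV" by auto
  ultimately show ?thesis using continuous_on_subset by fastforce
qed

text \<open>A holomorphic branch of the square root at any nonzero point: \<open>csqrt\<close> off
  the branch cut and \<open>\<i> * csqrt (- w)\<close> on it.\<close>

lemma local_sqrt:
  assumes w0: "w0 \<noteq> (0::complex)"
  obtains s where "\<forall>\<^sub>F w in nhds w0. s w \<noteq> 0 \<and> (s has_field_derivative 1 / (2 * s w)) (at w) \<and> (s w = csqrt w \<or> s w = - csqrt w)"
    "cmod (s w0) ^ 2 = cmod w0"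
proof (cases "w0 \<in> \<real>\<^sub>\<le>\<^sub>0")
  case False
  have "open (- \<real>\<^sub>\<le>\<^sub>0 :: complex set)" by auto
  then have "\<forall>\<^sub>F w in nhds w0. w \<in> - \<real>\<^sub>\<le>\<^sub>0" using False by (intro eventually_nhds_in_open) auto
  then have "\<forall>\<^sub>F w in nhds w0. csqrt w \<noteq> 0 \<and> (csqrt has_field_derivative 1 / (2 * csqrt w)) (at w) \<and> (csqrt w = csqrt w \<or> csqrt w = - csqrt w)"
  proof (rule eventually_mono, intro conjI)
    fix w :: complex assume w: "w \<in> - \<real>\<^sub>\<le>\<^sub>0"
    show "csqrt w \<noteq> 0" using w by auto
    show "(csqrt has_field_derivative 1 / (2 * csqrt w)) (at w)"
      using has_field_derivative_csqrt[of w] w by (simp add: inverse_eq_divide)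
  qed simp
  then show thesis by (rule that) (metis norm_power power2_csqrt)
next
  case True
  then have w0r: "- w0 \<notin> \<real>\<^sub>\<le>\<^sub>0" using w0 by (auto simp: complex_nonpos_Reals_iff complex_eq_iff)
  have "open (uminus ` (- \<real>\<^sub>\<le>\<^sub>0 :: complex set))" by (rule open_negations) auto
  then have "\<forall>\<^sub>F w in nhds w0. w \<in> uminus ` (- \<real>\<^sub>\<le>\<^sub>0 :: complex set)"
    using w0r by (intro eventually_nhds_in_open) (auto intro!: image_eqI[of _ _ "- w0"])
  then have ev: "\<forall>\<^sub>F w in nhds w0. - w \<notin> \<real>\<^sub>\<le>\<^sub>0" by (rule eventually_mono) auto
  show thesis
  proof (rule that[of "\<lambda>w. \<i> * csqrt (- w)"])
    show "\<forall>\<^sub>F w in nhds w0. \<i> * csqrt (- w) \<noteq> 0 \<and> ((\<lambda>w. \<i> * csqrt (- w)) has_field_derivative 1 / (2 * (\<i> * csqrt (- w)))) (at w) \<and>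
        (\<i> * csqrt (- w) = csqrt w \<or> \<i> * csqrt (- w) = - csqrt w)"
      using ev
    proof (rule eventually_mono, intro conjI)
      fix w :: complex assume w: "- w \<notin> \<real>\<^sub>\<le>\<^sub>0"
      show nz: "\<i> * csqrt (- w) \<noteq> 0" using w by auto
      have "((\<lambda>w. csqrt (- w)) has_field_derivative (inverse (2 * csqrt (- w)) * (- 1))) (at w)"
        by (rule DERIV_chain2[where f=csqrt and g=uminus, OF has_field_derivative_csqrt[OF w]]) (auto intro!: derivative_eq_intros)
      from DERIV_cmult[OF this, of \<i>]
      show "((\<lambda>w. \<i> * csqrt (- w)) has_field_derivative 1 / (2 * (\<i> * csqrt (- w)))) (at w)"
        by (rule DERIV_cong) (use nz in \<open>simp add: field_simps\<close>)
      have "(\<i> * csqrt (- w))\<^sup>2 = (csqrt w)\<^sup>2" by (simp add: power_mult_distrib)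
      then show "\<i> * csqrt (- w) = csqrt w \<or> \<i> * csqrt (- w) = - csqrt w" unfolding power2_eq_iff .
    qed
    show "(cmod (\<i> * csqrt (- w0)))\<^sup>2 = cmod w0" by (simp add: norm_mult)
  qed
qed

text \<open>The parameters of the map \<open>w \<mapsto> N / w\<close> in the variable \<open>w = 2 z\<^sup>2 + \<delta>\<close>; \<open>q = m\<^sup>4\<close>.\<close>

lemma inversion_weight:
  fixes w :: complex and \<delta> N q :: real
  assumes N: "N = \<delta>\<^sup>2 + 12 * q" "0 < N" and q: "0 \<le> q" and w: "N \<le> (cmod w)\<^sup>2"
    and T: "4 * q * (cmod w)\<^sup>2 \<le> (cmod (of_real N - of_real \<delta> * w))\<^sup>2"
  shows "N ^ 4 * (cmod (w - of_real \<delta>))\<^sup>2 \<le> (cmod w) ^ 6 * (cmod (of_real N - of_real \<delta> * w))\<^sup>2"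
proof -
  define x where "x = (cmod w)\<^sup>2 / N"
  define R where "R = 2 * \<delta> * Re w"
  have x: "1 \<le> x" "(cmod w)\<^sup>2 = x * N" unfolding x_def using w N by auto
  have n1: "(cmod (w - of_real \<delta>))\<^sup>2 = x * N - R + \<delta>\<^sup>2"
    unfolding x(2)[symmetric] R_def cmod_power2 by (simp add: power2_eq_square algebra_simps)
  have n2: "(cmod (of_real N - of_real \<delta> * w))\<^sup>2 = N * (N - R + \<delta>\<^sup>2 * x)"
  proof -
    have "(cmod (of_real N - of_real \<delta> * w))\<^sup>2 = N\<^sup>2 - N * R + \<delta>\<^sup>2 * (cmod w)\<^sup>2"
      unfolding R_def cmod_power2 by (simp add: power2_eq_square algebra_simps)
    then show ?thesis unfolding x(2) by (simp add: power2_eq_square algebra_simps)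
  qed
  have "4 * q * x * N \<le> (N - R + \<delta>\<^sup>2 * x) * N" using T unfolding n2 x(2) by (simp add: mult_ac)
  then have R: "R \<le> N + \<delta>\<^sup>2 * x - 4 * q * x" using N(2) by simp
  have "x * N - R + \<delta>\<^sup>2 \<le> x ^ 3 * (N - R + \<delta>\<^sup>2 * x)"
  proof -
    have x3: "1 \<le> x ^ 3" "1 \<le> x ^ 2" using x(1) by (auto intro: one_le_power)
    have "(x ^ 3 - 1) * R \<le> (x ^ 3 - 1) * (N + \<delta>\<^sup>2 * x - 4 * q * x)" using R x3 by (intro mult_left_mono) auto
    moreover have "x ^ 3 * (N + \<delta>\<^sup>2 * x) - (x * N + \<delta>\<^sup>2) - (x ^ 3 - 1) * (N + \<delta>\<^sup>2 * x - 4 * q * x)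
        = 4 * q * ((x - 1) * (x ^ 3 + x ^ 2 + x - 3))"
      unfolding N(1) by algebra
    moreover have "0 \<le> 4 * q * ((x - 1) * (x ^ 3 + x ^ 2 + x - 3))"
      using q x(1) add_mono[OF add_mono[OF x3] x(1)] by (intro mult_nonneg_nonneg) auto
    ultimately show ?thesis by (simp add: algebra_simps)
  qed
  then have "N ^ 4 * (x * N - R + \<delta>\<^sup>2) \<le> N ^ 4 * (x ^ 3 * (N - R + \<delta>\<^sup>2 * x))" using N(2) by (intro mult_left_mono) auto
  moreover have "(cmod w) ^ 6 = x ^ 3 * N ^ 3" 
  proof -
    have "(cmod w) ^ 6 = ((cmod w)\<^sup>2) ^ 3" by (simp flip: power_mult)
    then show ?thesis unfolding x(2) by (simp add: power_mult_distrib)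
  qed
  ultimately show ?thesis unfolding n1 n2 by (simp add: algebra_simps eval_nat_numeral)
qed

text \<open>Squaring turns the centred ellipse into an ellipse with a focus at 0, and \<mu>, \<nu>
  will be (1 + E^2) / 2 and (1 - E^2) / 2. With \<open>w = 2 z\<^sup>2 + \<delta>\<close> the focus
  is at \<open>\<delta>\<close>, and \<open>out\<close> says that \<open>z\<close> is not inside the
  outer ellipse. So points outside the ellipse and with squared modulus of \<open>w\<close> above
  \<open>N\<close> stay outside under the inversion.\<close>

lemma inversion_domain:
  fixes w :: complex and \<delta> N \<kappa> \<mu> \<nu> :: real
  assumes N: "N = \<delta>\<^sup>2 + 4 * \<kappa>" and \<kappa>: "0 \<le> \<kappa>" and \<mu>: "0 < \<mu>" "0 < \<nu>" "\<mu> + \<nu> = 1"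
    and \<delta>: "\<delta> = \<mu> * (1 + \<kappa>) / \<nu> + 2" and w: "N < (cmod w)\<^sup>2"
    and out: "2 + \<nu> * (Re w - \<delta>) \<le> \<mu> * cmod (w - of_real \<delta>)"
  shows "2 + \<nu> * (Re (of_real N / w) - \<delta>) \<le> \<mu> * cmod (of_real N / w - of_real \<delta>)"
proof (rule ccontr)
  assume "\<not> ?thesis"
  then have p2: "\<mu> * cmod (of_real N / w - of_real \<delta>) < 2 + \<nu> * (Re (of_real N / w) - \<delta>)" by simp
  define h where "h = \<mu> * (1 + \<kappa>) / \<nu>"
  have h: "0 < h" "\<delta> = h + 2" "\<nu> * h = \<mu> * (1 + \<kappa>)" unfolding h_def \<delta> using \<mu> \<kappa> by auto
  have N0: "N > 0" unfolding N using h \<kappa> by (simp add: add_pos_nonneg)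
  define x where "x = (cmod w)\<^sup>2 / N"
  have x: "1 < x" "(cmod w)\<^sup>2 = x * N" unfolding x_def using w N0 by auto
  have w0: "w \<noteq> 0" using w N0 by auto
  define \<Xi> where "\<Xi> = Re w"
  have o: "2 - \<nu> * \<delta> = \<mu> * (1 - \<kappa>)" using h(2,3) \<mu>(3) by (simp add: algebra_simps) 
  have rN: "Re (of_real N / w) = \<Xi> / x"
    unfolding \<Xi>_def x_def using w0 N0 by (simp add: Re_divide cmod_power2)
  have n1: "(cmod (w - of_real \<delta>))\<^sup>2 = x * N - 2 * \<delta> * \<Xi> + \<delta>\<^sup>2"
    unfolding x(2)[symmetric] \<Xi>_def cmod_power2 by (simp add: power2_eq_square algebra_simps)
  have nN: "(cmod (of_real N / w))\<^sup>2 = N / x" unfolding norm_divide power_divide x(2) using N0 by (simp add: power2_eq_square)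
  have n2: "(cmod (of_real N / w - of_real \<delta>))\<^sup>2 = N / x - 2 * \<delta> * (\<Xi> / x) + \<delta>\<^sup>2"
    unfolding nN[symmetric] rN[symmetric] cmod_power2 by (simp add: power2_eq_square algebra_simps)
  have p1: "\<mu> * (1 - \<kappa>) + \<nu> * \<Xi> \<le> \<mu> * cmod (w - of_real \<delta>)" using out o unfolding \<Xi>_def by (simp add: algebra_simps)
  have p2: "\<mu> * cmod (of_real N / w - of_real \<delta>) < \<mu> * (1 - \<kappa>) + \<nu> * (\<Xi> / x)" using p2 o unfolding rN by (simp add: algebra_simps)
  have \<Xi>0: "\<Xi> > 0"
  proof (rule ccontr)
    assume "\<not> \<Xi> > 0"
    then have s: "\<Xi> / x \<le> 0" using x by (simp add: divide_nonpos_pos)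
    have "\<delta> \<le> cmod (of_real N / w - of_real \<delta>)"
      using abs_Re_le_cmod[of "of_real N / w - of_real \<delta>"] s unfolding minus_complex.sel rN by simp
    then have "\<mu> * \<delta> \<le> \<mu> * cmod (of_real N / w - of_real \<delta>)" using \<mu> by simp
    moreover have "\<nu> * (\<Xi> / x) \<le> 0" using s \<mu>(2) by (intro mult_nonneg_nonpos) auto
    ultimately have "\<mu> * \<delta> < \<mu> * (1 - \<kappa>)" using p2 by linarith
    then show False using \<mu> h \<kappa> by simp
  qed
  have pos2: "0 < \<mu> * (1 - \<kappa>) + \<nu> * (\<Xi> / x)" using p2 \<mu> by (smt (verit) mult_nonneg_nonneg norm_ge_zero)
  have F2: "\<mu>\<^sup>2 * (N / x - 2 * \<delta> * (\<Xi> / x) + \<delta>\<^sup>2) < (\<mu> * (1 - \<kappa>) + \<nu> * (\<Xi> / x))\<^sup>2"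
    unfolding n2[symmetric] power_mult_distrib[symmetric] using p2 \<mu> by (intro power_strict_mono) auto
  \<comment> \<open>Combining the squared inequalities of \<open>w\<close> and of its image leaves
    \<open>(x - 1)\<close> times a difference whose sign depends on \<open>\<Xi>\<close>; this
    settles large \<open>\<Xi>\<close>. For small \<open>\<Xi>\<close> the image is at distance at
    least 2 from \<open>\<delta>\<close>, which is too far for \<open>p2\<close>.\<close>
  show False
  proof (cases "\<nu>\<^sup>2 * \<Xi>\<^sup>2 / x < \<mu>\<^sup>2 * (1 + \<kappa>)\<^sup>2")
    case False
    have "\<Xi> / x \<le> \<Xi>" using \<Xi>0 x by (simp add: field_simps)
    then have "\<nu> * (\<Xi> / x) \<le> \<nu> * \<Xi>" using \<mu>(2) by (intro mult_left_mono) auto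
    then have pos1: "0 < \<mu> * (1 - \<kappa>) + \<nu> * \<Xi>" using pos2 by linarith
    have "(\<mu> * (1 - \<kappa>) + \<nu> * \<Xi>)\<^sup>2 \<le> (\<mu> * cmod (w - of_real \<delta>))\<^sup>2" using p1 pos1 by (intro power_mono) auto
    then have F1: "(\<mu> * (1 - \<kappa>) + \<nu> * \<Xi>)\<^sup>2 \<le> \<mu>\<^sup>2 * (x * N - 2 * \<delta> * \<Xi> + \<delta>\<^sup>2)" unfolding power_mult_distrib n1 .
    have "(\<mu>\<^sup>2 * (x * N - 2 * \<delta> * \<Xi> + \<delta>\<^sup>2) - (\<mu> * (1 - \<kappa>) + \<nu> * \<Xi>)\<^sup>2)
       - x * (\<mu>\<^sup>2 * (N / x - 2 * \<delta> * (\<Xi> / x) + \<delta>\<^sup>2) - (\<mu> * (1 - \<kappa>) + \<nu> * (\<Xi> / x))\<^sup>2)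
       = (x - 1) * (\<mu>\<^sup>2 * (1 + \<kappa>)\<^sup>2 - \<nu>\<^sup>2 * \<Xi>\<^sup>2 / x)"
      unfolding N using x by (simp add: field_simps power2_eq_square)
    moreover have "(x - 1) * (\<mu>\<^sup>2 * (1 + \<kappa>)\<^sup>2 - \<nu>\<^sup>2 * \<Xi>\<^sup>2 / x) \<le> 0" using False x by (intro mult_nonneg_nonpos) auto
    moreover have "x * (\<mu>\<^sup>2 * (N / x - 2 * \<delta> * (\<Xi> / x) + \<delta>\<^sup>2) - (\<mu> * (1 - \<kappa>) + \<nu> * (\<Xi> / x))\<^sup>2) < 0"
      using F2 x by (intro mult_pos_neg) auto
    ultimately show False using F1 by linarith
  next
    case True
    define s where "s = sqrt x"
    have s: "1 < s" "x = s\<^sup>2" using x unfolding s_def by auto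
    define \<rho> where "\<rho> = \<Xi> / s"
    have \<rho>: "0 < \<rho>" "\<Xi> = \<rho> * s" unfolding \<rho>_def using \<Xi>0 s by auto
    have "\<nu>\<^sup>2 * \<Xi>\<^sup>2 / x = (\<nu> * \<rho>)\<^sup>2" unfolding \<rho>(2) s(2) using s(1) by (simp add: power_mult_distrib)
    then have "(\<nu> * \<rho>)\<^sup>2 < (\<nu> * h)\<^sup>2" using True unfolding h(3) by (simp add: power_mult_distrib)
    then have "\<nu> * \<rho> < \<nu> * h" by (rule power_less_imp_less_base) (use \<mu>(2) h(1) in simp)
    then have \<rho>h: "\<rho> < h" using \<mu> by simp
    have "(\<delta> * s - h)\<^sup>2 \<le> (cmod (of_real N / w - of_real \<delta>) * s)\<^sup>2"
    proof -
      have "(cmod (of_real N / w - of_real \<delta>) * s)\<^sup>2 = N - 2 * \<delta> * (\<rho> * s) + \<delta>\<^sup>2 * s\<^sup>2"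
        unfolding power_mult_distrib n2 \<rho>(2) s(2) using s(1) by (simp add: field_simps power2_eq_square)
      moreover have "\<rho> * s \<le> h * s" using \<rho>h s by simp
      then have "2 * \<delta> * (\<rho> * s) \<le> 2 * \<delta> * (h * s)" using h by (intro mult_left_mono) auto
      moreover have "h\<^sup>2 \<le> N" unfolding N h(2) using h(1) \<kappa> by (simp add: power2_eq_square algebra_simps)
      ultimately show ?thesis by (simp add: power2_eq_square algebra_simps)
    qed
    then have a: "\<delta> * s - h \<le> cmod (of_real N / w - of_real \<delta>) * s" by (rule power2_le_imp_le) (use s(1) in simp)
    have "(h + 2) * s - h = h * (s - 1) + 2 * s" by (simp add: algebra_simps)
    moreover have "0 \<le> h * (s - 1)" using h s by simp
    ultimately have b: "2 * s \<le> \<delta> * s - h" unfolding h(2) by simp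
    have "\<mu> * (2 * s) \<le> \<mu> * (cmod (of_real N / w - of_real \<delta>) * s)" using a b \<mu> by (intro mult_left_mono) auto
    also have "\<dots> = (\<mu> * cmod (of_real N / w - of_real \<delta>)) * s" by simp
    also have "\<dots> < (\<mu> * (1 - \<kappa>) + \<nu> * (\<Xi> / x)) * s" using p2 s by simp
    also have "\<dots> = \<mu> * (1 - \<kappa>) * s + \<nu> * \<rho>" unfolding \<rho>(2) s(2) using s(1) by (simp add: field_simps power2_eq_square)
    also have "\<dots> < \<mu> * (1 - \<kappa>) * s + \<mu> * (1 + \<kappa>)" using \<open>\<nu> * \<rho> < \<nu> * h\<close> unfolding h(3) by simp
    finally have "\<mu> * (2 * s) < \<mu> * ((1 - \<kappa>) * s + (1 + \<kappa>))" by (simp add: algebra_simps)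
    then have "2 * s < (1 - \<kappa>) * s + (1 + \<kappa>)" using \<mu> by simp
    moreover have "0 \<le> \<kappa> * (s - 1)" using \<kappa> s by simp
    ultimately show False using s by (simp add: algebra_simps)
  qed
qed

locale critical_axis = critical_ellipse +
  fixes n mi m :: real
  assumes n: "0 < n" "of_real n \<in> K" "\<And>t. 0 \<le> t \<Longrightarrow> t < n \<Longrightarrow> of_real t \<in> Si"
    and mi: "0 < mi" "\<i> * of_real mi \<in> K" "\<And>t. 0 \<le> t \<Longrightarrow> t < mi \<Longrightarrow> \<i> * of_real t \<in> Si"
    and m: "m < 1" "\<i> * of_real m \<in> K" "\<And>t. m < t \<Longrightarrow> \<i> * of_real t \<in> So"
begin

lemma m_pos: "0 < m" "mi \<le> m"
proof -
  show "mi \<le> m" using m(3)[of mi] mi(2) cov by force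
  then show "0 < m" using mi(1) by simp
qed

text \<open>The value \<open>c\<close> at \<open>\<i> * of_real m\<close> is the minimum over its
  circle, and \<open>outer.cap\<close> does not decrease towards 0 along the short axis.\<close>

lemma outer_center: assumes "cmod z \<le> m" shows "outer.cap z = c"
proof -
  have "c = outer.cap (\<i> * of_real m)" using m(2) cov outer.cap_notin by fastforce
  also have "\<dots> \<le> outer.cap (\<i> * of_real (cmod z))" using assms by (intro outer_mono) auto
  also have "\<dots> \<le> outer.cap z" by (rule cap_radial)
  finally show ?thesis using outer.cap_le[of z] by simp
qed

lemma m_le_n: "m \<le> n"
proof (rule ccontr)
  assume "\<not> m \<le> n"
  then show False using near_K_positive_axis[OF n(2,1), of "ball 0 m"] n(1) outer_center by auto
qed

text \<open>The quarter turn takes the point \<open>mi + d\<close> of the long axis to the point of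
  \<open>K\<close> on the short axis. If it came before \<open>n\<close>, it would be in
  \<open>Si\<close> and carry the value \<open>c\<close>, against \<open>u_less_c\<close>.\<close>

lemma n_le: "n \<le> mi + \<beta> * (1 / E - 1)"
proof (rule ccontr)
  assume a: "\<not> n \<le> mi + \<beta> * (1 / E - 1)"
  define d where "d = \<beta> * (1 / E - 1)"
  have d: "0 < d" unfolding d_def using E \<beta> by (simp add: field_simps)
  let ?z = "of_real (mi + d) :: complex"
  have "inner.cap (\<i> * (?z - of_real d)) \<le> inner.cap ?z"
    unfolding d_def by (rule inner_quarter_turn) (use mi(1) in simp)
  then have "inner.cap (\<i> * of_real mi) \<le> inner.cap ?z" by simp
  moreover have "inner.cap (\<i> * of_real mi) = c" using mi(2) cov inner.cap_notin by fastforce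
  moreover have "?z \<in> Si" using a mi(1) d by (intro n(3)) (auto simp: d_def)
  ultimately show False using u_less_c[of ?z] inner.cap_def[of ?z] by simp
qed

text \<open>Comparison along \<open>z \<mapsto> \<surd>T(z\<^sup>2)\<close>, where \<open>2 T(y) + \<delta> = N / (2 y + \<delta>)\<close>; on \<open>\<bar>2 z\<^sup>2 + \<delta>\<bar>\<^sup>2 = N\<close>
  this is \<open>z \<mapsto> \<plusminus>cnj z\<close>. The constant \<open>\<kappa> = 3 m\<^sup>4\<close> is the smallest one for which the map contracts
  wherever its image stays outside the disc of radius \<open>m\<close>, and \<open>\<delta>\<close> is chosen such that the map
  respects the outer ellipse.\<close>

lemma inversion_comparison:
  fixes \<mu> \<nu> \<kappa> \<delta> N :: real
  assumes \<mu>: "\<mu> = (1 + E\<^sup>2) / 2" and \<nu>: "\<nu> = (1 - E\<^sup>2) / 2" and \<kappa>: "\<kappa> = 3 * m ^ 4"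
    and \<delta>: "\<delta> = \<mu> * (1 + \<kappa>) / \<nu> + 2" and N: "N = \<delta>\<^sup>2 + 4 * \<kappa>"
    and z: "N < (cmod (2 * z\<^sup>2 + of_real \<delta>))\<^sup>2"
  shows "outer.cap (csqrt ((of_real N / (2 * z\<^sup>2 + of_real \<delta>) - of_real \<delta>) / 2)) \<le> outer.cap z"
proof -
  have E2: "E\<^sup>2 < 1" "0 < E\<^sup>2" using E by (auto simp: power_less_one_iff)
  have pos: "0 < \<mu>" "0 < \<nu>" "\<mu> + \<nu> = 1" "0 < \<kappa>" using E2 m_pos unfolding \<mu> \<nu> \<kappa> by (auto simp: add_pos_pos field_simps)
  have \<delta>2: "2 < \<delta>" unfolding \<delta> using pos by simp
  have N0: "0 < N" unfolding N using \<delta>2 pos by (simp add: add_pos_pos)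
  define w where "w z = 2 * z\<^sup>2 + of_real \<delta>" for z :: complex
  define T where "T z = (of_real N / w z - of_real \<delta>) / 2" for z :: complex
  define G where "G = {z. N < (cmod (w z))\<^sup>2}"
  have cw: "continuous_on A (\<lambda>z. (cmod (w z))\<^sup>2)" for A unfolding w_def by (intro continuous_intros)
  have oG: "open G" unfolding G_def by (rule open_Collect_less[OF continuous_on_const cw])
  have clG: "N \<le> (cmod (w z))\<^sup>2" if "z \<in> closure G" for z
    by (rule closure_greater[OF cw]) (use that G_def in simp)
  have wnz: "w z \<noteq> 0" if "z \<in> closure G" for z using clG[OF that] N0 by auto
  have cT: "continuous_on (closure G) T"
    unfolding T_def using wnz by (intro continuous_intros) (auto simp: w_def intro!: continuous_intros)
  have even: "continuous_on A (\<lambda>w. outer.cap (csqrt w))" for A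
    by (rule even_csqrt_continuous[OF outer.continuous_cap cap_symm(2)])
  have ellq_sq: "ellq E z = \<mu> * cmod (z\<^sup>2) - \<nu> * Re (z\<^sup>2)" for z
    unfolding ellq_def \<mu> \<nu> norm_power cmod_power2 by (simp add: power2_eq_square field_simps)
  have "outer.cap (csqrt (T z)) \<le> outer.cap z"
  proof (rule outer.cap_compose_comparison[OF oG])
    show "continuous_on (closure G) (\<lambda>z. outer.cap (csqrt (T z)))"
      by (rule continuous_on_compose2[OF even[of UNIV] cT]) auto
    show "outer.cap (csqrt (T p)) \<le> outer.cap p" if p: "p \<in> closure G" "p \<notin> G" for p
    proof -
      have nw: "(cmod (w p))\<^sup>2 = N" using clG[OF p(1)] p(2) unfolding G_def by simp
      then have "of_real N = w p * cnj (w p)" by (metis complex_norm_square)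
      then have "T p = (cnj p)\<^sup>2" unfolding T_def using wnz[OF p(1)] by (simp add: w_def)
      then have "csqrt (T p) = cnj p \<or> csqrt (T p) = - cnj p" by (metis power2_csqrt power2_eq_iff)
      then show ?thesis using cap_symm by (metis order_refl)
    qed
    show "outer.cap (csqrt (T z)) \<le> 0" if zz: "z \<in> G" "z \<in> So" "z \<notin> \<Omega>" for z
    proof -
      have "1 \<le> ellq E z" using So_out[OF zz(2,3)] .
      moreover have e: "cmod (w z - of_real \<delta>) = 2 * cmod (z\<^sup>2)" "Re (w z) - \<delta> = 2 * Re (z\<^sup>2)"
        unfolding w_def by (simp_all add: norm_mult)
      ultimately have "2 + \<nu> * (Re (w z) - \<delta>) \<le> \<mu> * cmod (w z - of_real \<delta>)"
        unfolding e ellq_sq by linarith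
      then have "2 + \<nu> * (Re (of_real N / w z) - \<delta>) \<le> \<mu> * cmod (of_real N / w z - of_real \<delta>)"
        using zz(1) pos unfolding G_def by (intro inversion_domain[OF N _ pos(1-3) \<delta>]) auto
      moreover have e2: "Re (of_real N / w z) - \<delta> = 2 * Re (T z)" "cmod (of_real N / w z - of_real \<delta>) = 2 * cmod (T z)"
        unfolding T_def by (simp_all add: norm_divide)
      ultimately have "1 \<le> \<mu> * cmod (T z) - \<nu> * Re (T z)" unfolding e2 by linarith
      then have "1 \<le> ellq E (csqrt (T z))" unfolding ellq_sq by simp
      then show ?thesis using So(2)[of "csqrt (T z)"] u_zero[of "csqrt (T z)"] by (simp add: outer.cap_def)
    qed
    show "\<exists>\<sigma> \<sigma>' k. (\<forall>\<^sub>F z in nhds p. (\<sigma> has_field_derivative \<sigma>' z) (at z) \<and> outer.cap (csqrt (T z)) = outer.cap (\<sigma> z)) \<and>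
        (\<sigma>' has_field_derivative k) (at p) \<and> (\<sigma> p \<in> \<Omega> \<longrightarrow> \<sigma> p \<notin> Si \<longrightarrow> cmod (\<sigma>' p) \<le> 1)" if p: "p \<in> G" for p
    proof -
      have pc: "p \<in> closure G" using p closure_subset by blast
      have "isCont T p" using cT oG p by (meson closure_subset continuous_on_eq_continuous_at continuous_on_subset)
      then have lim: "(T \<longlongrightarrow> T p) (nhds p)" by (simp add: isCont_def tendsto_at_iff_tendsto_nhds)
      \<comment> \<open>The square root is not holomorphic where \<open>T\<close> vanishes. But as
        long as \<open>T\<close> is below \<open>m\<^sup>2\<close> in modulus, the composite is the
        constant \<open>c\<close> by \<open>outer_center\<close>, so a constant map serves as the
        local branch. Otherwise \<open>inversion_weight\<close> bounds the derivative.\<close>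
      show ?thesis
      proof (cases "cmod (T p) < m\<^sup>2")
        case True
        have "\<forall>\<^sub>F z in nhds p. T z \<in> ball 0 (m\<^sup>2)" by (rule topological_tendstoD[OF lim]) (use True in auto)
        then have "\<forall>\<^sub>F z in nhds p. outer.cap (csqrt (T z)) = outer.cap 0"
        proof (rule eventually_mono)
          fix z assume "T z \<in> ball 0 (m\<^sup>2)"
          then have "(cmod (csqrt (T z)))\<^sup>2 < m\<^sup>2" by (simp flip: norm_power)
          then have "cmod (csqrt (T z)) \<le> m" using m_pos by (meson less_imp_le power2_le_imp_le)
          then show "outer.cap (csqrt (T z)) = outer.cap 0" using m_pos by (simp add: outer_center)
        qed
        then show ?thesis by (intro exI[of _ "\<lambda>_. 0"] exI[of _ 0]) (auto elim: eventually_mono)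
      next
        case False
        then have "T p \<noteq> 0" using m_pos by auto
        then obtain s where s: "\<forall>\<^sub>F v in nhds (T p). s v \<noteq> 0 \<and> (s has_field_derivative 1 / (2 * s v)) (at v) \<and> (s v = csqrt v \<or> s v = - csqrt v)"
          "(cmod (s (T p)))\<^sup>2 = cmod (T p)" using local_sqrt by blast
        define \<sigma> where "\<sigma> z = s (T z)" for z
        define \<sigma>' where "\<sigma>' z = (1 / (2 * \<sigma> z)) * (- 2 * of_real N * z / (w z)\<^sup>2)" for z
        have ev: "\<forall>\<^sub>F z in nhds p. z \<in> G \<and> \<sigma> z \<noteq> 0 \<and> (s has_field_derivative 1 / (2 * \<sigma> z)) (at (T z)) \<and> (\<sigma> z = csqrt (T z) \<or> \<sigma> z = - csqrt (T z))"
          using eventually_nhds_in_open[OF oG p] eventually_compose_filterlim[OF s(1) lim] unfolding \<sigma>_def by (rule eventually_conj)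
        have dT: "(T has_field_derivative (- 2 * of_real N * z / (w z)\<^sup>2)) (at z)" if "z \<in> G" for z
        proof -
          have "w z \<noteq> 0" using wnz that closure_subset by blast
          then show ?thesis unfolding T_def[abs_def] w_def
            by (auto intro!: derivative_eq_intros simp: power2_eq_square)
        qed
        have d\<sigma>: "(\<sigma> has_field_derivative \<sigma>' z) (at z)" if "z \<in> G" "(s has_field_derivative 1 / (2 * \<sigma> z)) (at (T z))" for z
          using DERIV_chain2[OF that(2) dT[OF that(1)]] unfolding \<sigma>_def[abs_def] \<sigma>'_def by (simp add: \<sigma>_def)
        note evp = eventually_nhds_x_imp_x[OF ev]
        have wp: "w p \<noteq> 0" using wnz[OF pc] .
        have \<sigma>p: "\<sigma> p \<noteq> 0" using evp by blast
        have "(w has_field_derivative 4 * p) (at p)" unfolding w_def[abs_def] by (auto intro!: derivative_eq_intros)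
        moreover have "(\<sigma> has_field_derivative \<sigma>' p) (at p)" using evp d\<sigma> by blast
        ultimately have "\<exists>k. (\<sigma>' has_field_derivative k) (at p)"
          unfolding \<sigma>'_def[abs_def] using wp \<sigma>p
          by (intro exI) (rule derivative_intros refl | simp)+
        then obtain k where k: "(\<sigma>' has_field_derivative k) (at p)" by blast
        have "cmod (\<sigma>' p) \<le> 1"
        proof -
          define A where "A = of_real N - of_real \<delta> * w p"
          have TA: "T p = A / (2 * w p)" unfolding T_def A_def using wp by (simp add: field_simps)
          then have nT: "cmod (T p) = cmod A / (2 * cmod (w p))" by (simp add: norm_divide norm_mult)
          have wp0: "cmod (w p) > 0" using wp by simp
          have "2 * m\<^sup>2 * cmod (w p) \<le> cmod A" using False wp0 unfolding nT by (simp add: field_simps)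
          then have "(2 * m\<^sup>2 * cmod (w p))\<^sup>2 \<le> (cmod A)\<^sup>2" by (intro power_mono) auto
          then have "4 * m ^ 4 * (cmod (w p))\<^sup>2 \<le> (cmod A)\<^sup>2" by (simp add: power_mult_distrib flip: power_mult)
          then have "N ^ 4 * (cmod (w p - of_real \<delta>))\<^sup>2 \<le> (cmod (w p)) ^ 6 * (cmod A)\<^sup>2"
            unfolding A_def using p N0 N unfolding G_def \<kappa> by (intro inversion_weight[where q="m ^ 4"]) auto
          then have "(N\<^sup>2 * cmod (w p - of_real \<delta>))\<^sup>2 \<le> ((cmod (w p)) ^ 3 * cmod A)\<^sup>2" by (simp add: power_mult_distrib flip: power_mult)
          then have le: "N\<^sup>2 * cmod (w p - of_real \<delta>) \<le> (cmod (w p)) ^ 3 * cmod A" by (rule power2_le_imp_le) simp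
          have p2: "cmod (w p - of_real \<delta>) = 2 * (cmod p)\<^sup>2" unfolding w_def by (simp add: norm_mult norm_power)
          have "(cmod (\<sigma>' p))\<^sup>2 = N\<^sup>2 * (cmod p)\<^sup>2 / ((cmod (w p)) ^ 4 * cmod (T p))"
            unfolding \<sigma>'_def s(2)[symmetric] \<sigma>_def using N0
            by (simp add: norm_divide norm_mult norm_power power_divide power_mult_distrib flip: power_mult)
          also have "\<dots> = (N\<^sup>2 * cmod (w p - of_real \<delta>)) / ((cmod (w p)) ^ 3 * cmod A)"
            unfolding p2 nT using wp0 by (simp add: eval_nat_numeral mult_ac)
          also have "\<dots> \<le> 1" using le wp0 by (cases "A = 0") (auto simp: divide_le_eq_1)
          finally show ?thesis by (simp add: power_le_one_iff abs_square_le_1)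
        qed
        moreover have "\<forall>\<^sub>F z in nhds p. (\<sigma> has_field_derivative \<sigma>' z) (at z) \<and> outer.cap (csqrt (T z)) = outer.cap (\<sigma> z)"
          using ev by (rule eventually_mono) (use d\<sigma> cap_symm(2) in auto)
        ultimately show ?thesis using k by blast
      qed
    qed
    show "z \<in> G" using z unfolding G_def w_def by simp
  qed (rule outer.cap_le)
  then show ?thesis unfolding T_def w_def .
qed

text \<open>On the long axis \<open>T\<close> is real, and equality in the bound means that it takes
  \<open>n\<^sup>2\<close> to \<open>- m\<^sup>2\<close>. If \<open>n\<close> were smaller,
  \<open>T\<close> would have modulus below \<open>m\<^sup>2\<close> in a neighbourhood of
  \<open>n\<close>, so the comparison would force \<open>outer.cap\<close> to be \<open>c\<close>
  there, against \<open>near_K_positive_axis\<close>.\<close>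

lemma inversion_bound:
  fixes \<delta> :: real
  assumes \<delta>: "\<delta> = (1 + E\<^sup>2) * (1 + 3 * m ^ 4) / (1 - E\<^sup>2) + 2"
  shows "m\<^sup>2 * (\<delta> + 6 * m\<^sup>2) / (\<delta> - 2 * m\<^sup>2) \<le> n\<^sup>2"
proof (rule ccontr)
  assume a: "\<not> ?thesis"
  have E2: "E\<^sup>2 < 1" using E by (simp add: power_less_one_iff)
  have m2: "m\<^sup>2 < 1" "0 < m\<^sup>2" using m m_pos by (auto simp: power_less_one_iff)
  have "0 < (1 + E\<^sup>2) * (1 + 3 * m ^ 4) / (1 - E\<^sup>2)" using E2 m_pos by (auto intro!: divide_pos_pos mult_pos_pos add_pos_nonneg)
  then have \<delta>2: "2 < \<delta>" unfolding \<delta> by simp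
  define N where "N = \<delta>\<^sup>2 + 4 * (3 * m ^ 4)"
  have N0: "0 < N" unfolding N_def using \<delta>2 m_pos by (intro add_pos_pos) auto
  define y where "y = n\<^sup>2"
  have y: "m\<^sup>2 \<le> y" unfolding y_def using m_le_n m_pos by (intro power_mono) auto
  have yX: "y * (\<delta> - 2 * m\<^sup>2) < m\<^sup>2 * (\<delta> + 6 * m\<^sup>2)" using a \<delta>2 m2 unfolding y_def by (simp add: field_simps)
  define w where "w z = 2 * z\<^sup>2 + of_real \<delta>" for z :: complex
  define G where "G = {z. N < (cmod (w z))\<^sup>2}"
  have cw: "continuous_on A (\<lambda>z. (cmod (w z))\<^sup>2)" "continuous_on A w" for A unfolding w_def by (intro continuous_intros)+
  have oG: "open G" unfolding G_def by (rule open_Collect_less[OF continuous_on_const cw(1)])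
  define T where "T z = (of_real N / w z - of_real \<delta>) / 2" for z :: complex
  have cT: "continuous_on G T" unfolding T_def using cw N0 by (intro continuous_intros) (auto simp: G_def)
  define W where "W = G \<inter> T -` ball 0 (m\<^sup>2)"
  have oW: "open W" unfolding W_def by (rule continuous_open_preimage[OF cT oG open_ball])
  have wn: "w (of_real n) = of_real (2 * y + \<delta>)" unfolding w_def y_def by simp
  have y0: "0 < 2 * y + \<delta>" using y m2 \<delta>2 by linarith
  have "N < (2 * y + \<delta>)\<^sup>2"
  proof -
    have "N < (2 * m\<^sup>2 + \<delta>)\<^sup>2"
    proof -
      have "m\<^sup>2 * (2 * m\<^sup>2) < m\<^sup>2 * \<delta>" using m2 \<delta>2 by (intro mult_strict_left_mono) auto
      then show ?thesis unfolding N_def by (simp add: power2_eq_square algebra_simps eval_nat_numeral)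
    qed
    also have "\<dots> \<le> (2 * y + \<delta>)\<^sup>2" using y m2 \<delta>2 by (intro power_mono) auto
    finally show ?thesis .
  qed
  then have nG: "of_real n \<in> G" unfolding G_def wn mem_Collect_eq norm_of_real by simp
  have "T (of_real n) = of_real ((N / (2 * y + \<delta>) - \<delta>) / 2)" unfolding T_def wn by simp
  moreover have "\<bar>(N / (2 * y + \<delta>) - \<delta>) / 2\<bar> < m\<^sup>2"
  proof -
    have e: "(N / (2 * y + \<delta>) - \<delta>) / 2 = (6 * (m\<^sup>2 * m\<^sup>2) - \<delta> * y) / (2 * y + \<delta>)"
      unfolding N_def using y0 by (simp add: field_simps power2_eq_square eval_nat_numeral)
    have "6 * (m\<^sup>2 * m\<^sup>2) - \<delta> * y < m\<^sup>2 * (2 * y + \<delta>)"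
    proof -
      have "m\<^sup>2 * (2 * m\<^sup>2) < m\<^sup>2 * \<delta>" using m2 \<delta>2 by (intro mult_strict_left_mono) auto
      moreover have "(\<delta> + 2 * m\<^sup>2) * m\<^sup>2 \<le> (\<delta> + 2 * m\<^sup>2) * y" using y m2 \<delta>2 by (intro mult_left_mono) auto
      ultimately show ?thesis by (simp add: algebra_simps)
    qed
    moreover have "- (m\<^sup>2 * (2 * y + \<delta>)) < 6 * (m\<^sup>2 * m\<^sup>2) - \<delta> * y" using yX by (simp add: algebra_simps)
    ultimately show ?thesis unfolding e using y0 by (simp add: abs_less_iff field_simps)
  qed
  ultimately have "of_real n \<in> W" unfolding W_def using nG by (simp del: of_real_divide of_real_diff)
  then show False
  proof (rule near_K_positive_axis[OF n(2,1) oW])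
    fix z assume z: "z \<in> W"
    have "(cmod (csqrt (T z)))\<^sup>2 < m\<^sup>2" using z unfolding W_def by (simp flip: norm_power)
    then have "cmod (csqrt (T z)) \<le> m" using m_pos by (meson less_imp_le power2_le_imp_le)
    then have "outer.cap (csqrt (T z)) = c" by (rule outer_center)
    moreover have "outer.cap (csqrt (T z)) \<le> outer.cap z"
      unfolding T_def w_def
    proof (rule inversion_comparison[OF refl refl refl _ N_def])
      show "\<delta> = (1 + E\<^sup>2) / 2 * (1 + 3 * m ^ 4) / ((1 - E\<^sup>2) / 2) + 2" unfolding \<delta> using E2 by (simp add: field_simps)
      show "N < (cmod (2 * z\<^sup>2 + of_real \<delta>))\<^sup>2" using z unfolding W_def G_def w_def by simp
    qed
    ultimately show "outer.cap z = c" using outer.cap_le[of z] by simp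
  qed
qed

end

section \<open>The profile on the short axis as a barrier\<close>

text \<open>The two signs sustain each other: up to the first zero of \<open>w\<close> the function
  \<open>F\<close> decreases and stays negative, and therefore \<open>w\<close> decreases
  too.\<close>

lemma no_crossing:
  fixes w F :: "real \<Rightarrow> real"
  assumes w: "continuous_on {p..q} w" "w p < 0" and F: "continuous_on {p..q} F" "F p < 0"
    and dw: "\<And>r. p < r \<Longrightarrow> r < q \<Longrightarrow> F r < 0 \<Longrightarrow> \<exists>y. (w has_real_derivative y) (at r) \<and> y \<le> 0"
    and dF: "\<And>r. p < r \<Longrightarrow> r < q \<Longrightarrow> w r < 0 \<Longrightarrow> \<exists>y. (F has_real_derivative y) (at r) \<and> y \<le> 0"
    and r: "p \<le> r" "r \<le> q"
  shows "w r < 0"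
proof (rule ccontr)
  assume nw: "\<not> w r < 0"
  define A where "A = {p..q} \<inter> w -` {0..}"
  have "closed A" unfolding A_def using w(1) by (intro continuous_closed_preimage) auto
  moreover have "bounded A" unfolding A_def by (rule bounded_subset[of "{p..q}"]) auto
  ultimately have "compact A" by (simp add: compact_eq_bounded_closed)
  moreover have "A \<noteq> {}" using nw r unfolding A_def by auto
  ultimately obtain s where s: "s \<in> A" "\<And>t. t \<in> A \<Longrightarrow> s \<le> t" using compact_attains_inf[of A] by metis
  have s1: "p \<le> s" "s \<le> q" "0 \<le> w s" using s(1) unfolding A_def by auto
  have neg: "w t < 0" if "p \<le> t" "t < s" for t
    using s(2)[of t] that s1 unfolding A_def by force
  have Fneg: "F t < 0" if t: "p < t" "t < s" for t
  proof -
    have "F t \<le> F p"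
    proof (rule DERIV_nonpos_imp_decreasing_open[of p t F])
      show "continuous_on {p..t} F" using F(1) t s1 by (elim continuous_on_subset) auto
    qed (use t s1 dF neg in auto)
    then show ?thesis using F(2) by simp
  qed
  have "w s \<le> w p"
  proof (rule DERIV_nonpos_imp_decreasing_open[of p s w])
    show "continuous_on {p..s} w" using w(1) s1 by (elim continuous_on_subset) auto
  qed (use s1 dw Fneg in auto)
  then show False using w(2) s1 by simp
qed

lemma has_lap_compose_real:
  assumes t: "\<forall>\<^sub>F z in nhds p. (\<tau> has_derivative (\<lambda>h. tx z * Re h + ty z * Im h)) (at z)"
    and tx: "(tx has_derivative (\<lambda>h. a * Re h + b * Im h)) (at p)"
    and ty: "(ty has_derivative (\<lambda>h. b' * Re h + d * Im h)) (at p)"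
    and f: "\<forall>\<^sub>F y in nhds (\<tau> p). (f has_real_derivative f1 y) (at y)"
    and f1: "(f1 has_real_derivative f2) (at (\<tau> p))"
  shows "has_lap (\<lambda>z. f (\<tau> z)) (f2 * ((tx p)\<^sup>2 + (ty p)\<^sup>2) + f1 (\<tau> p) * (a + d)) p"
proof -
  have tp: "(\<tau> has_derivative (\<lambda>h. tx p * Re h + ty p * Im h)) (at p)" using eventually_nhds_x_imp_x[OF t] .
  have lim: "(\<tau> \<longlongrightarrow> \<tau> p) (nhds p)"
    using has_derivative_continuous[OF tp] by (simp add: continuous_def tendsto_at_iff_tendsto_nhds[symmetric])
  have f1': "((\<lambda>z. f1 (\<tau> z)) has_derivative (\<lambda>h. f2 * (tx p * Re h + ty p * Im h))) (at p)"
    using has_derivative_compose[OF tp f1[unfolded has_field_derivative_def]] .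
  show ?thesis
  proof (rule has_lapI)
    show "\<forall>\<^sub>F z in nhds p. ((\<lambda>z. f (\<tau> z)) has_derivative (\<lambda>h. (f1 (\<tau> z) * tx z) * Re h + (f1 (\<tau> z) * ty z) * Im h)) (at z)"
      using eventually_compose_filterlim[OF f lim] t
    proof eventually_elim
      fix z assume "(f has_real_derivative f1 (\<tau> z)) (at (\<tau> z))" "(\<tau> has_derivative (\<lambda>h. tx z * Re h + ty z * Im h)) (at z)"
      from has_derivative_compose[OF this(2) this(1)[unfolded has_field_derivative_def]]
      show "((\<lambda>z. f (\<tau> z)) has_derivative (\<lambda>h. (f1 (\<tau> z) * tx z) * Re h + (f1 (\<tau> z) * ty z) * Im h)) (at z)"
        by (rule has_derivative_eq_rhs) (simp add: algebra_simps)
    qed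
    show "((\<lambda>z. f1 (\<tau> z) * tx z) has_derivative (\<lambda>h. (f2 * (tx p)\<^sup>2 + f1 (\<tau> p) * a) * Re h + (f2 * tx p * ty p + f1 (\<tau> p) * b) * Im h)) (at p)"
      by (rule has_derivative_eq_rhs[OF has_derivative_mult[OF f1' tx]]) (simp add: algebra_simps power2_eq_square)
    show "((\<lambda>z. f1 (\<tau> z) * ty z) has_derivative (\<lambda>h. (f2 * tx p * ty p + f1 (\<tau> p) * b') * Re h + (f2 * (ty p)\<^sup>2 + f1 (\<tau> p) * d) * Im h)) (at p)"
      by (rule has_derivative_eq_rhs[OF has_derivative_mult[OF f1' ty]]) (simp add: algebra_simps power2_eq_square)
  qed (simp add: algebra_simps)
qed

text \<open>\<open>S\<close> is the squared length of the gradient of the square root of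
  \<open>ellq E\<close>, and \<open>(1 + E\<^sup>2 - S) / sqrt (ellq E z)\<close> is its Laplacian;
  the rest is the chain rule.\<close>

lemma has_lap_sqrt_ellq:
  assumes z: "z \<noteq> 0" and E: "0 < E"
    and f: "\<forall>\<^sub>F y in nhds (sqrt (ellq E z)). (f has_real_derivative f1 y) (at y)"
    and f1: "(f1 has_real_derivative f2) (at (sqrt (ellq E z)))"
  defines "S \<equiv> (E ^ 4 * (Re z)\<^sup>2 + (Im z)\<^sup>2) / ellq E z"
  shows "has_lap (\<lambda>z. f (sqrt (ellq E z))) (f2 * S + f1 (sqrt (ellq E z)) * ((1 + E\<^sup>2 - S) / sqrt (ellq E z))) z"
proof -
  define \<tau> where "\<tau> z = sqrt (ellq E z)" for z
  have pos: "0 < ellq E z" if "z \<noteq> 0" for z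
    using that E unfolding ellq_def by (auto simp: complex_eq_iff sum_power2_gt_zero_iff)
  have \<tau>0: "0 < \<tau> z" "(\<tau> z)\<^sup>2 = ellq E z" if "z \<noteq> 0" for z using pos[OF that] unfolding \<tau>_def by auto
  have dt: "(\<tau> has_derivative (\<lambda>h. (E\<^sup>2 * Re z / \<tau> z) * Re h + (Im z / \<tau> z) * Im h)) (at z)" if "z \<noteq> 0" for z
  proof -
    have "((\<lambda>z. (E * Re z)\<^sup>2 + (Im z)\<^sup>2) has_derivative (\<lambda>h. 2 * (E\<^sup>2 * Re z * Re h + Im z * Im h))) (at z)"
      by (auto intro!: derivative_eq_intros simp: power2_eq_square algebra_simps)
    then have "(ellq E has_derivative (\<lambda>h. 2 * (E\<^sup>2 * Re z * Re h + Im z * Im h))) (at z)"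
      unfolding ellq_def[abs_def] .
    from DERIV_compose_FDERIV[OF DERIV_real_sqrt[OF pos[OF that]] this] show ?thesis
      unfolding \<tau>_def[abs_def] by (rule has_derivative_eq_rhs) (use pos[OF that] in \<open>simp add: fun_eq_iff field_simps\<close>)
  qed
  have quot: "((\<lambda>z. k * P z / \<tau> z) has_derivative (\<lambda>h. (k * P h * \<tau> z - k * P z * ((E\<^sup>2 * Re z / \<tau> z) * Re h + (Im z / \<tau> z) * Im h)) / (\<tau> z * \<tau> z))) (at z)"
    if "bounded_linear P" for k and P :: "complex \<Rightarrow> real"
    using \<tau>0(1)[OF z] by (intro has_derivative_divide' has_derivative_mult_right bounded_linear_imp_has_derivative that dt z) simp
  have 1: "((\<lambda>z. E\<^sup>2 * Re z / \<tau> z) has_derivative (\<lambda>h. (E\<^sup>2 / \<tau> z - E ^ 4 * (Re z)\<^sup>2 / \<tau> z ^ 3) * Re h + (- E\<^sup>2 * Re z * Im z / \<tau> z ^ 3) * Im h)) (at z)"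
    by (rule has_derivative_eq_rhs[OF quot[OF bounded_linear_Re]])
       (use \<tau>0(1)[OF z] in \<open>simp add: fun_eq_iff field_simps eval_nat_numeral\<close>)
  have 2: "((\<lambda>z. 1 * Im z / \<tau> z) has_derivative (\<lambda>h. (- E\<^sup>2 * Re z * Im z / \<tau> z ^ 3) * Re h + (1 / \<tau> z - (Im z)\<^sup>2 / \<tau> z ^ 3) * Im h)) (at z)"
    by (rule has_derivative_eq_rhs[OF quot[OF bounded_linear_Im]])
       (use \<tau>0(1)[OF z] in \<open>simp add: fun_eq_iff field_simps eval_nat_numeral\<close>)
  have ev: "\<forall>\<^sub>F z in nhds z. (\<tau> has_derivative (\<lambda>h. (E\<^sup>2 * Re z / \<tau> z) * Re h + (1 * Im z / \<tau> z) * Im h)) (at z)"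
    by (rule eventually_mono[OF eventually_nhds_in_open[of "- {0}" z]]) (use z dt in \<open>auto intro: open_Compl\<close>)
  have "has_lap (\<lambda>z. f (\<tau> z)) (f2 * ((E\<^sup>2 * Re z / \<tau> z)\<^sup>2 + (1 * Im z / \<tau> z)\<^sup>2)
      + f1 (\<tau> z) * ((E\<^sup>2 / \<tau> z - E ^ 4 * (Re z)\<^sup>2 / \<tau> z ^ 3) + (1 / \<tau> z - (Im z)\<^sup>2 / \<tau> z ^ 3))) z"
    by (rule has_lap_compose_real[OF ev 1 2]) (use f f1 in \<open>simp_all add: \<tau>_def\<close>)
  moreover have "(E\<^sup>2 * Re z / \<tau> z)\<^sup>2 + (1 * Im z / \<tau> z)\<^sup>2 = S"
    unfolding S_def \<tau>0(2)[OF z, symmetric] by (simp add: power_divide power_mult_distrib add_divide_distrib flip: power_mult)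
  moreover have "(E\<^sup>2 / \<tau> z - E ^ 4 * (Re z)\<^sup>2 / \<tau> z ^ 3) + (1 / \<tau> z - (Im z)\<^sup>2 / \<tau> z ^ 3) = (1 + E\<^sup>2 - S) / \<tau> z"
    unfolding S_def \<tau>0(2)[OF z, symmetric] using \<tau>0(1)[OF z] by (simp add: field_simps eval_nat_numeral)
  ultimately show ?thesis unfolding \<tau>_def by simp
qed

context critical_ellipse begin

lemma u_axis_derivs:
  assumes "\<i> * of_real y \<in> \<Omega>"
  shows "((\<lambda>y. u (\<i> * of_real y)) has_real_derivative uy (\<i> * of_real y)) (at y)"
    "((\<lambda>y. uy (\<i> * of_real y)) has_real_derivative d (\<i> * of_real y)) (at y)"
  using has_derivative_line[of u "\<lambda>h. ux (\<i> * of_real y) * Re h + uy (\<i> * of_real y) * Im h" 0 y \<i>]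
    has_derivative_line[of uy "\<lambda>h. b' (\<i> * of_real y) * Re h + d (\<i> * of_real y) * Im h" 0 y \<i>]
    du[OF assms] duy[OF assms] by (simp_all add: mult.commute)

text \<open>The bracket is the second derivative of \<open>u\<close> in the polar angle at the point
  of the imaginary axis; \<open>k\<close> selects a maximum or a minimum on the circle.\<close>

lemma angular_second_derivative:
  assumes z: "\<i> * of_real s \<in> \<Omega>" and k: "k = 1 \<or> k = - 1"
    and mx: "\<forall>\<^sub>F z in nhds (\<i> * of_real s). cmod z = \<bar>s\<bar> \<longrightarrow> k * u z \<le> k * u (\<i> * of_real s)"
  shows "k * (s\<^sup>2 * a (\<i> * of_real s) - s * uy (\<i> * of_real s)) \<le> 0"
proof -
  define \<gamma> where "\<gamma> \<theta> = exp (0 + \<i> * of_real \<theta>) * (\<i> * of_real s)" for \<theta> :: real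
  have \<gamma>0: "\<gamma> 0 = \<i> * of_real s" unfolding \<gamma>_def by simp
  have d\<gamma>: "(\<gamma> has_derivative (\<lambda>h. of_real h * (\<i> * \<gamma> \<theta>))) (at \<theta>)" for \<theta>
    unfolding \<gamma>_def[abs_def]
    by (rule has_derivative_eq_rhs[OF has_derivative_mult_left[OF has_derivative_exp_line[of 0 \<i> \<theta>]]]) (simp add: mult_ac)
  have lim: "(\<gamma> \<longlongrightarrow> \<gamma> 0) (nhds 0)"
    using has_derivative_continuous[OF d\<gamma>[of 0]] by (simp add: continuous_def tendsto_at_iff_tendsto_nhds[symmetric])
  have ev: "\<forall>\<^sub>F \<theta> in nhds 0. \<gamma> \<theta> \<in> \<Omega>" using topological_tendstoD[OF lim open_dom] z \<gamma>0 by simp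
  define \<phi>' where "\<phi>' \<theta> = k * (uy (\<gamma> \<theta>) * Re (\<gamma> \<theta>) - ux (\<gamma> \<theta>) * Im (\<gamma> \<theta>))" for \<theta>
  show ?thesis
  proof (rule second_derivative_local_max[of "\<lambda>\<theta>. k * u (\<gamma> \<theta>)" \<phi>'])
    show "\<forall>\<^sub>F \<theta> in nhds 0. ((\<lambda>\<theta>. k * u (\<gamma> \<theta>)) has_real_derivative \<phi>' \<theta>) (at \<theta>)"
      using ev
    proof (rule eventually_mono)
      fix \<theta> assume "\<gamma> \<theta> \<in> \<Omega>"
      from has_derivative_mult_right[OF has_derivative_compose[OF d\<gamma> du[OF this]], of k]
      show "((\<lambda>\<theta>. k * u (\<gamma> \<theta>)) has_real_derivative \<phi>' \<theta>) (at \<theta>)"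
        unfolding has_field_derivative_def by (rule has_derivative_eq_rhs) (simp add: \<phi>'_def fun_eq_iff algebra_simps)
    qed
    have zo: "\<gamma> 0 \<in> \<Omega>" using z \<gamma>0 by simp
    have r: "((\<lambda>\<theta>. Re (\<gamma> \<theta>)) has_derivative (\<lambda>h. - s * h)) (at 0)" "((\<lambda>\<theta>. Im (\<gamma> \<theta>)) has_derivative (\<lambda>h. 0)) (at 0)"
      by (rule has_derivative_eq_rhs[OF has_derivative_Re[OF d\<gamma>]], simp add: \<gamma>0 fun_eq_iff,
          rule has_derivative_eq_rhs[OF has_derivative_Im[OF d\<gamma>]], simp add: \<gamma>0 fun_eq_iff)
    have g1: "((\<lambda>\<theta>. ux (\<gamma> \<theta>)) has_derivative (\<lambda>h. - a (\<gamma> 0) * s * h)) (at 0)"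
      by (rule has_derivative_eq_rhs[OF has_derivative_compose[OF d\<gamma> dux[OF zo]]]) (simp add: \<gamma>0 fun_eq_iff)
    have g2: "((\<lambda>\<theta>. uy (\<gamma> \<theta>)) has_derivative (\<lambda>h. - b' (\<gamma> 0) * s * h)) (at 0)"
      by (rule has_derivative_eq_rhs[OF has_derivative_compose[OF d\<gamma> duy[OF zo]]]) (simp add: \<gamma>0 fun_eq_iff)
    show "(\<phi>' has_real_derivative k * (s\<^sup>2 * a (\<i> * of_real s) - s * uy (\<i> * of_real s))) (at 0)"
      unfolding has_field_derivative_def \<phi>'_def[abs_def]
      by (rule has_derivative_eq_rhs[OF has_derivative_mult_right[OF has_derivative_diff[OF has_derivative_mult[OF g2 r(1)] has_derivative_mult[OF g1 r(2)]]]])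
         (simp add: \<gamma>0 fun_eq_iff algebra_simps power2_eq_square)
    have "\<forall>\<^sub>F \<theta> in nhds 0. cmod (\<gamma> \<theta>) = \<bar>s\<bar> \<longrightarrow> k * u (\<gamma> \<theta>) \<le> k * u (\<i> * of_real s)"
      using eventually_compose_filterlim[OF mx[folded \<gamma>0] lim] unfolding \<gamma>0 .
    then show "\<forall>\<^sub>F \<theta> in nhds 0. k * u (\<gamma> \<theta>) \<le> k * u (\<gamma> 0)"
      by (rule eventually_mono) (simp add: \<gamma>0, simp add: \<gamma>_def norm_mult norm_exp_eq_Re)
  qed
qed

end

context critical_axis begin

lemma axis_dom: "m \<le> y \<Longrightarrow> y < 1 \<Longrightarrow> \<i> * of_real y \<in> \<Omega>"
  using m(2) m(3)[of y] K(2) So_dom[of "\<i> * of_real y"] m_pos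
  by (cases "y = m") (auto simp: ellq_def power_less_one_iff)

lemma outer_axis: "m \<le> y \<Longrightarrow> outer.cap (\<i> * of_real y) = u (\<i> * of_real y)"
  using m(2) m(3)[of y] cov disj by (intro outer.cap_in) (cases "y = m", auto)

lemma u_axis_antimono: "m \<le> y1 \<Longrightarrow> y1 \<le> y2 \<Longrightarrow> u (\<i> * of_real y2) \<le> u (\<i> * of_real y1)"
  using outer_mono[of "\<i> * of_real y1" "\<i> * of_real y2"] outer_axis[of y1] outer_axis[of y2] m_pos by auto

text \<open>On horizontal lines \<open>outer.cap\<close> is largest at the axis; it dominates
  \<open>u\<close> and agrees with it there.\<close>

lemma a_axis_nonpos: assumes y: "m \<le> y" "y < 1" shows "a (\<i> * of_real y) \<le> 0"
proof -
  let ?p = "\<i> * of_real y"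
  have p: "?p \<in> \<Omega>" using axis_dom[OF y] .
  have lim: "((\<lambda>t::real. ?p + of_real t * 1) \<longlongrightarrow> ?p + of_real 0 * 1) (nhds 0)"
    by (intro tendsto_intros tendsto_of_real filterlim_ident)
  have "\<forall>\<^sub>F t::real in nhds 0. ?p + of_real t * 1 \<in> \<Omega>"
    using topological_tendstoD[OF lim open_dom] p by simp
  then have ev: "\<forall>\<^sub>F t::real in nhds 0. ((\<lambda>t. u (?p + of_real t * 1)) has_real_derivative ux (?p + of_real t * 1)) (at t)"
    by (rule eventually_mono) (drule has_derivative_line[OF du], simp)
  show ?thesis
  proof (rule second_derivative_local_max[OF ev])
    show "((\<lambda>t. ux (?p + of_real t * 1)) has_real_derivative a ?p) (at 0)"
      using has_derivative_line[of ux "\<lambda>h. a ?p * Re h + b ?p * Im h" ?p 0 1] dux[OF p] by simp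
    have "u (?p + of_real t * 1) \<le> u ?p" for t
    proof -
      have "u (?p + of_real t * 1) \<le> outer.cap (?p + of_real t * 1)" by (rule outer.u_le_cap)
      also have "\<dots> \<le> outer.cap ?p" by (rule outer_mono) auto
      finally show ?thesis using outer_axis[OF y(1)] by simp
    qed
    then show "\<forall>\<^sub>F t in nhds 0. u (?p + of_real t * 1) \<le> u (?p + of_real 0 * 1)" by simp
  qed
qed

lemma d_axis_ge: "m \<le> y \<Longrightarrow> y < 1 \<Longrightarrow> - g (u (\<i> * of_real y)) \<le> d (\<i> * of_real y)"
  using a_axis_nonpos[of y] eqn[OF axis_dom, of y] by simp

text \<open>The bound of \<open>d\<close> is integrated from \<open>m\<close>, where the gradient
  vanishes; \<open>u\<close> decreases along the axis, so \<open>g\<close> of it is largest at the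
  upper end \<open>y\<close>.\<close>

lemma uy_axis_ge:
  assumes y: "m \<le> y" "y < 1" shows "- ((y - m) * g (u (\<i> * of_real y))) \<le> uy (\<i> * of_real y)"
proof (cases "y = m")
  case True then show ?thesis using K(3)[OF m(2)] by simp
next
  case False
  have "\<exists>\<xi>>m. \<xi> < y \<and> uy (\<i> * of_real y) - uy (\<i> * of_real m) = (y - m) * d (\<i> * of_real \<xi>)"
    by (rule MVT2) (use False y in \<open>auto intro!: u_axis_derivs(2) axis_dom\<close>)
  then obtain \<xi> where \<xi>: "m < \<xi>" "\<xi> < y" "uy (\<i> * of_real y) = (y - m) * d (\<i> * of_real \<xi>)"
    using K(3)[OF m(2)] by auto
  have "- g (u (\<i> * of_real y)) \<le> - g (u (\<i> * of_real \<xi>))"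
    using \<xi> u_axis_antimono[of \<xi> y] g_antimono by simp
  also have "\<dots> \<le> d (\<i> * of_real \<xi>)" using \<xi> y by (intro d_axis_ge) auto
  finally have "(y - m) * - g (u (\<i> * of_real y)) \<le> (y - m) * d (\<i> * of_real \<xi>)" using y by (intro mult_left_mono) auto
  then show ?thesis using \<xi>(3) by simp
qed

text \<open>The profile of \<open>u\<close> on the short axis, transplanted to the level sets of \<open>\<surd>ellq\<close> and
  stretched by the factor \<open>\<eta>\<close>, is a subsolution.\<close>

lemma level_bound:
  assumes t: "0 < t" "t < m" and cond: "1 + E\<^sup>2 * (1 - t) \<le> ((1 - t) / (1 - m))\<^sup>2"
  shows "t \<le> E * n"
proof (rule ccontr)
  assume a: "\<not> t \<le> E * n"
  \<comment> \<open>The factor for which \<open>Y\<close> maps the interval from \<open>t\<close> to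
    1 affinely onto the one from \<open>m\<close> to 1: the cap begins on the level \<open>t\<close>
    and the value 0 is kept on the outer ellipse.\<close>
  define \<eta> where "\<eta> = (1 - t) / (1 - m)"
  have \<eta>: "1 < \<eta>" unfolding \<eta>_def using t m by (simp add: field_simps)
  have \<eta>2: "1 + E\<^sup>2 * (1 - t) \<le> \<eta>\<^sup>2" using cond unfolding \<eta>_def .
  define Y where "Y \<tau> = m + (\<tau> - t) / \<eta>" for \<tau>
  have Y1: "Y 1 = 1" unfolding Y_def \<eta>_def using t m by (simp add: field_simps)
  have Ymono: "Y \<tau>1 < Y \<tau>2 \<longleftrightarrow> \<tau>1 < \<tau>2" "Y \<tau>1 \<le> Y \<tau>2 \<longleftrightarrow> \<tau>1 \<le> \<tau>2" for \<tau>1 \<tau>2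
    unfolding Y_def using \<eta> by (auto simp: field_simps)
  have Yt: "Y t = m" unfolding Y_def by simp
  have Y0: "- m \<le> Y \<tau>" if "0 \<le> \<tau>" for \<tau>
  proof -
    have "t / \<eta> \<le> t / 1" using \<eta> t by (intro divide_left_mono) auto
    moreover have "0 \<le> \<tau> / \<eta>" using that \<eta> by simp
    ultimately show ?thesis unfolding Y_def using t m_pos by (simp add: diff_divide_distrib)
  qed
  define v where "v z = outer.cap (\<i> * of_real (Y (sqrt (ellq E z))))" for z
  have cY: "continuous_on A (\<lambda>z. Y (sqrt (ellq E z)))" for A
    unfolding Y_def using \<eta> by (intro continuous_intros continuous_ellq) auto
  have v_c: "v z = c" if "sqrt (ellq E z) \<le> t" for z
  proof -
    have "Y (sqrt (ellq E z)) \<le> m" using that Ymono(2)[of _ t] Yt by simp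
    then show ?thesis unfolding v_def using Y0[of "sqrt (ellq E z)"]
      by (intro outer_center) (auto simp: norm_mult ellq_def)
  qed
  have "v z \<le> outer.cap z" for z
  proof (rule outer.cap_comparison[of UNIV])
    show "continuous_on (closure UNIV) v" unfolding v_def
      by (rule continuous_on_compose2[OF outer.continuous_cap[of UNIV]]) (auto intro!: continuous_intros cY)
    show "v z \<le> 0" if "z \<in> So" "z \<notin> \<Omega>" for z
    proof -
      have "1 \<le> sqrt (ellq E z)" using So_out[OF that] by simp
      then have y: "1 \<le> Y (sqrt (ellq E z))" using Ymono(2)[of 1] Y1 by simp
      then have "1 \<le> ellq E (\<i> * of_real (Y (sqrt (ellq E z))))" by (simp add: ellq_def)
      then show ?thesis unfolding v_def using outer_axis[of "Y (sqrt (ellq E z))"] u_zero y m by simp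
    qed
    show "\<exists>v0 L. (\<forall>\<^sub>F z in nhds p. v0 z \<le> v z) \<and> v0 p = v p \<and> has_lap v0 L p \<and> - g (v p) \<le> L"
      if p: "p \<in> So" "p \<in> \<Omega>" "u p < v p" for p
    proof (cases "sqrt (ellq E p) < t")
      case True
      have "open {z. sqrt (ellq E z) < t}" by (intro open_Collect_less continuous_intros continuous_ellq)
      then have "\<forall>\<^sub>F z in nhds p. z \<in> {z. sqrt (ellq E z) < t}" using True by (intro eventually_nhds_in_open) auto
      then have "\<forall>\<^sub>F z in nhds p. c \<le> v z" by (rule eventually_mono) (simp add: v_c)
      then show ?thesis using has_lap_const[of c p] g_pos[of "v p"] v_c[of p] True
        by (intro exI[of _ "\<lambda>_. c"] exI[of _ 0]) auto
    next
      case False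
      define \<tau> where "\<tau> = sqrt (ellq E p)"
      have \<tau>: "t \<le> \<tau>" "\<tau> < 1" using False p(2) unfolding \<tau>_def dom by auto
      define y where "y = Y \<tau>"
      have y: "m \<le> y" "y < 1" using \<tau> Ymono(2)[of t \<tau>] Ymono(1)[of \<tau> 1] Yt Y1 unfolding y_def by auto
      have pnz: "p \<noteq> 0" using p(1) zero_Si disj by auto
      have vp: "v p = u (\<i> * of_real y)" unfolding v_def y_def \<tau>_def[symmetric] using outer_axis y unfolding y_def by simp
      let ?f = "\<lambda>s. u (\<i> * of_real (Y s))"
      let ?f1 = "\<lambda>s. uy (\<i> * of_real (Y s)) / \<eta>"
      have dY: "(Y has_real_derivative 1 / \<eta>) (at s)" for s
        unfolding Y_def[abs_def] using \<eta> by (auto intro!: derivative_eq_intros)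
      have "isCont (\<lambda>s. \<i> * of_real (Y s)) \<tau>" using DERIV_isCont[OF dY] by (intro continuous_intros)
      then have lim: "((\<lambda>s. \<i> * of_real (Y s)) \<longlongrightarrow> \<i> * of_real y) (nhds \<tau>)"
        unfolding isCont_def y_def tendsto_at_iff_tendsto_nhds[of "\<lambda>s. \<i> * of_real (Y s)" \<tau>] .
      have "\<forall>\<^sub>F s in nhds \<tau>. \<i> * of_real (Y s) \<in> \<Omega>" using topological_tendstoD[OF lim open_dom axis_dom[OF y]] .
      then have f: "\<forall>\<^sub>F s in nhds \<tau>. (?f has_real_derivative ?f1 s) (at s)"
      proof (rule eventually_mono)
        fix s assume "\<i> * of_real (Y s) \<in> \<Omega>"
        from DERIV_chain2[OF u_axis_derivs(1)[OF this] dY] show "(?f has_real_derivative ?f1 s) (at s)" by simp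
      qed
      have f1: "(?f1 has_real_derivative (d (\<i> * of_real y) / \<eta> / \<eta>)) (at \<tau>)"
        using DERIV_cdivide[OF DERIV_chain2[OF u_axis_derivs(2)[OF axis_dom[OF y, unfolded y_def]] dY[of \<tau>]], of \<eta>]
        by (simp add: y_def)
      define S where "S = (E ^ 4 * (Re p)\<^sup>2 + (Im p)\<^sup>2) / ellq E p"
      define L where "L = (d (\<i> * of_real y) / \<eta> / \<eta>) * S + uy (\<i> * of_real y) / \<eta> * ((1 + E\<^sup>2 - S) / \<tau>)"
      have lap: "has_lap (\<lambda>z. ?f (sqrt (ellq E z))) L p"
        using has_lap_sqrt_ellq[OF pnz E(1) f[unfolded \<tau>_def] f1[unfolded \<tau>_def]] unfolding L_def S_def \<tau>_def y_def .
      have S: "0 \<le> S" "S \<le> 1"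
      proof -
        have pos: "0 < ellq E p" using pnz E unfolding ellq_def by (auto simp: complex_eq_iff sum_power2_gt_zero_iff)
        have "E ^ 4 \<le> E\<^sup>2" using E by (intro power_decreasing) auto
        then have "E ^ 4 * (Re p)\<^sup>2 \<le> E\<^sup>2 * (Re p)\<^sup>2" by (intro mult_right_mono) auto
        then have "E ^ 4 * (Re p)\<^sup>2 + (Im p)\<^sup>2 \<le> ellq E p" unfolding ellq_def by (simp add: power_mult_distrib)
        then show "S \<le> 1" unfolding S_def using pos by simp
        show "0 \<le> S" unfolding S_def using pos E by simp
      qed
      define G0 where "G0 = g (u (\<i> * of_real y))"
      have G0: "0 < G0" unfolding G0_def by (rule g_pos)
      have D0: "0 \<le> (1 + E\<^sup>2 - S) / \<tau>" using S \<tau> t zero_le_power2[of E] by (intro divide_nonneg_nonneg) linarith+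
      have "- G0 * (S / \<eta>\<^sup>2) \<le> d (\<i> * of_real y) * (S / \<eta>\<^sup>2)"
        using d_axis_ge[OF y] S unfolding G0_def by (intro mult_right_mono) auto
      moreover have "- ((y - m) * G0) * ((1 + E\<^sup>2 - S) / \<tau> / \<eta>) \<le> uy (\<i> * of_real y) * ((1 + E\<^sup>2 - S) / \<tau> / \<eta>)"
      proof -
        have "0 \<le> (1 + E\<^sup>2 - S) / \<tau> / \<eta>" by (rule divide_nonneg_nonneg[OF D0]) (use \<eta> in simp)
        from mult_right_mono[OF uy_axis_ge[OF y] this] show ?thesis unfolding G0_def .
      qed
      moreover have ym: "y - m = (\<tau> - t) / \<eta>" unfolding y_def Y_def by simp
      moreover have "L = d (\<i> * of_real y) * (S / \<eta>\<^sup>2) + uy (\<i> * of_real y) * ((1 + E\<^sup>2 - S) / \<tau> / \<eta>)"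
        unfolding L_def by (simp add: power2_eq_square)
      moreover have "- G0 * ((S + (\<tau> - t) * ((1 + E\<^sup>2 - S) / \<tau>)) / \<eta>\<^sup>2)
          = - G0 * (S / \<eta>\<^sup>2) + - ((y - m) * G0) * ((1 + E\<^sup>2 - S) / \<tau> / \<eta>)"
      proof -
        have "- G0 * ((S + (\<tau> - t) * X) / \<eta>\<^sup>2) = - G0 * (S / \<eta>\<^sup>2) + - ((\<tau> - t) / \<eta> * G0) * (X / \<eta>)" for X
          by (simp add: add_divide_distrib power2_eq_square distrib_left)
        then show ?thesis unfolding ym .
      qed
      ultimately have "- G0 * ((S + (\<tau> - t) * ((1 + E\<^sup>2 - S) / \<tau>)) / \<eta>\<^sup>2) \<le> L"
        by linarith
      \<comment> \<open>The numerator is largest for \<open>S = 1\<close> and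
        \<open>\<tau> = 1\<close>, where the inequality becomes \<open>cond\<close>.\<close>
      moreover have "(S + (\<tau> - t) * ((1 + E\<^sup>2 - S) / \<tau>)) / \<eta>\<^sup>2 \<le> 1"
      proof -
        have "S + (\<tau> - t) * ((1 + E\<^sup>2 - S) / \<tau>) = (1 + E\<^sup>2) * (1 - t / \<tau>) + t / \<tau> * S"
          using \<tau> t by (simp add: field_simps)
        also have "\<dots> \<le> (1 + E\<^sup>2) * (1 - t / \<tau>) + t / \<tau> * 1"
          using S \<tau> t by (intro add_left_mono mult_left_mono) auto
        also have "\<dots> = 1 + E\<^sup>2 * (1 - t / \<tau>)" by (simp add: algebra_simps)
        also have "\<dots> \<le> 1 + E\<^sup>2 * (1 - t)"
          using \<tau> t by (intro add_left_mono mult_left_mono) (auto simp: field_simps)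
        finally show ?thesis using \<eta>2 \<eta> by (simp add: field_simps)
      qed
      then have "- G0 * 1 \<le> - G0 * ((S + (\<tau> - t) * ((1 + E\<^sup>2 - S) / \<tau>)) / \<eta>\<^sup>2)"
        using G0 by (intro mult_left_mono_neg) auto
      ultimately have "- g (v p) \<le> L" unfolding vp G0_def by simp
      moreover have "?f (sqrt (ellq E z)) \<le> v z" for z unfolding v_def by (rule outer.u_le_cap)
      moreover have "?f (sqrt (ellq E p)) = v p" unfolding vp y_def \<tau>_def ..
      ultimately show ?thesis using lap
        by (intro exI[of _ "\<lambda>z. ?f (sqrt (ellq E z))"] exI[of _ L]) auto
    qed
  qed (auto simp: v_def outer.cap_le)
  moreover have "open {z. sqrt (ellq E z) < t}" by (intro open_Collect_less continuous_intros continuous_ellq)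
  moreover have "of_real n \<in> {z. sqrt (ellq E z) < t}"
    using a n(1) E by (simp add: ellq_def)
  ultimately show False
    using near_K_positive_axis[OF n(2,1)] v_c outer.cap_le by (metis (mono_tags, lifting) mem_Collect_eq order_antisym less_imp_le)
qed

end

section \<open>Comparison of the two profiles on the short axis\<close>

context critical_axis begin

lemma beta_less_mi: "\<beta> < mi"
proof (rule ccontr)
  assume "\<not> \<beta> < mi"
  then have "\<i> * of_real mi \<in> Si" using mi(1) \<beta> by (intro Si(2)) (simp add: ellq_def power_mono)
  then show False using mi(2) cov by blast
qed

lemma inner_axis_dom: assumes "\<beta> < y" "y \<le> mi" shows "\<i> * of_real y \<in> \<Omega>"
proof (cases "y = mi")
  case True then show ?thesis using mi(2) K(2) by blast
next
  case False
  have "\<beta>\<^sup>2 < y\<^sup>2" using assms \<beta> by (intro power_strict_mono) auto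
  then show ?thesis using mi(3)[of y] False assms \<beta> by (intro Si_dom) (auto simp: ellq_def)
qed

lemma inner_axis: "0 \<le> y \<Longrightarrow> y \<le> mi \<Longrightarrow> inner.cap (\<i> * of_real y) = u (\<i> * of_real y)"
  using mi(2) mi(3)[of y] cov disj by (intro inner.cap_in) (cases "y = mi", auto)

lemma uy_inner_nonneg: assumes "\<beta> < y" "y \<le> mi" shows "0 \<le> uy (\<i> * of_real y)"
proof (cases "y = mi")
  case True then show ?thesis using K(3)[OF mi(2)] by simp
next
  case False
  then show ?thesis using grad_in(2)[of "\<i> * of_real y"] inner_axis_dom[OF assms] mi(3)[of y] assms \<beta> by auto
qed

text \<open>By \<open>cap_radial\<close> the short axis carries the maximum of
  \<open>inner.cap\<close> on each circle, so the second derivative in the angle is nonpositive. On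
  the other side it carries the minimum, which reverses the sign in
  \<open>a_outer_ge\<close>.\<close>

lemma a_inner_le: assumes y: "\<beta> < y" "y \<le> mi" shows "y * a (\<i> * of_real y) \<le> uy (\<i> * of_real y)"
proof -
  have "u z \<le> u (\<i> * of_real y)" if "cmod z = \<bar>y\<bar>" for z
  proof -
    have "u z \<le> inner.cap z" by (rule inner.u_le_cap)
    also have "\<dots> \<le> inner.cap (\<i> * of_real (cmod z))" by (rule cap_radial)
    finally show ?thesis using that y \<beta> inner_axis[of y] by simp
  qed
  then have "1 * (y\<^sup>2 * a (\<i> * of_real y) - y * uy (\<i> * of_real y)) \<le> 0"
    by (intro angular_second_derivative inner_axis_dom y always_eventually) auto
  then have "y * (y * a (\<i> * of_real y)) \<le> y * uy (\<i> * of_real y)" by (simp add: power2_eq_square mult.assoc)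
  then show ?thesis using y \<beta> by simp
qed

lemma a_outer_ge: assumes y: "m < y" "y < 1" shows "uy (\<i> * of_real y) \<le> y * a (\<i> * of_real y)"
proof -
  have "\<i> * of_real y \<in> So" using m(3) y by simp
  then have "\<forall>\<^sub>F z in nhds (\<i> * of_real y). z \<in> So" using So(1) by (rule eventually_nhds_in_open[rotated])
  then have "\<forall>\<^sub>F z in nhds (\<i> * of_real y). cmod z = \<bar>y\<bar> \<longrightarrow> - 1 * u z \<le> - 1 * u (\<i> * of_real y)"
  proof (rule eventually_mono, intro impI)
    fix z assume z: "z \<in> So" "cmod z = \<bar>y\<bar>"
    have "outer.cap (\<i> * of_real (cmod z)) \<le> outer.cap z" by (rule cap_radial)
    then show "- 1 * u z \<le> - 1 * u (\<i> * of_real y)"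
      using z y m_pos outer_axis[of y] by (simp add: outer.cap_def)
  qed
  from angular_second_derivative[OF axis_dom _ this] y
  have "y * uy (\<i> * of_real y) \<le> y * (y * a (\<i> * of_real y))" by (simp add: power2_eq_square mult.assoc)
  then show ?thesis using y m_pos by simp
qed

text \<open>The left side is the derivative of \<open>y * uy\<close>; the outer profile thus falls
  at least as fast as the equation for radial functions prescribes.\<close>

lemma outer_ode: assumes y: "m < y" "y < 1" 
  shows "uy (\<i> * of_real y) + y * d (\<i> * of_real y) \<le> - (y * g (u (\<i> * of_real y)))"
proof -
  have e: "d (\<i> * of_real y) = - g (u (\<i> * of_real y)) - a (\<i> * of_real y)" using eqn[OF axis_dom, of y] y by simp
  show ?thesis using a_outer_ge[OF y] unfolding e by (simp add: algebra_simps)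
qed

lemma uy_outer_neg: assumes y: "m < y" "y < 1" shows "uy (\<i> * of_real y) < 0"
proof -
  have der: "((\<lambda>y. y * uy (\<i> * of_real y)) has_real_derivative (uy (\<i> * of_real r) + r * d (\<i> * of_real r))) (at r)"
    if "m \<le> r" "r < 1" for r
    using DERIV_mult[OF DERIV_ident u_axis_derivs(2)[OF axis_dom[OF that]]] by (simp add: mult.commute)
  have "y * uy (\<i> * of_real y) < m * uy (\<i> * of_real m)"
  proof (rule DERIV_neg_imp_decreasing_open[of m y "\<lambda>y. y * uy (\<i> * of_real y)"])
    show "continuous_on {m..y} (\<lambda>y. y * uy (\<i> * of_real y))"
      by (intro continuous_at_imp_continuous_on ballI, rule DERIV_isCont, rule der) (use y in auto)
    fix r assume r: "m < r" "r < y"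
    have "uy (\<i> * of_real r) + r * d (\<i> * of_real r) < 0"
    proof -
      have "0 < r * g (u (\<i> * of_real r))" using r m_pos g_pos by simp
      then show ?thesis using outer_ode[of r] r y by simp
    qed
    then show "\<exists>k. ((\<lambda>y. y * uy (\<i> * of_real y)) has_real_derivative k) (at r) \<and> k < 0"
      using der[of r] r y by auto
  qed (use y in simp)
  then show ?thesis using K(3)[OF m(2)] y m_pos by (simp add: mult_less_0_iff)
qed

text \<open>Both profiles on the short axis start from the critical value with slope zero. In the
  logarithmic variable \<open>r = m (1 + ln (mi / s))\<close> the inner one grows at most as fast as the outer one;
  the shift by \<open>\<delta>\<close> makes the comparison strict.\<close>

definition prof :: "real \<Rightarrow> real" where "prof r = mi * exp (1 - r / m)"

lemma prof: "prof m = mi" "0 < prof r" "(prof has_real_derivative (- prof r / m)) (at r)"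
    "r1 \<le> r2 \<Longrightarrow> prof r2 \<le> prof r1" "prof (m * (1 + ln (mi / \<beta>))) = \<beta>"
proof -
  show "prof m = mi" "0 < prof r" using m_pos mi(1) unfolding prof_def by auto
  show "(prof has_real_derivative (- prof r / m)) (at r)"
    unfolding prof_def[abs_def] using m_pos by (auto intro!: derivative_eq_intros)
  show "prof r2 \<le> prof r1" if "r1 \<le> r2"
    using that m_pos mi(1) unfolding prof_def by (intro mult_left_mono) (auto simp: divide_right_mono)
  show "prof (m * (1 + ln (mi / \<beta>))) = \<beta>"
    using m_pos mi(1) \<beta> unfolding prof_def by (simp add: exp_minus field_simps)
qed

lemma prof_range: assumes "m \<le> r" "r < m * (1 + ln (mi / \<beta>))" shows "\<beta> < prof r" "prof r \<le> mi"
proof -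
  have "r / m < 1 + ln (mi / \<beta>)" using assms(2) m_pos by (simp add: field_simps)
  then have "exp (- ln (mi / \<beta>)) < exp (1 - r / m)" by simp
  then have "mi * exp (- ln (mi / \<beta>)) < mi * exp (1 - r / m)" using mi(1) by simp
  then show "\<beta> < prof r" using mi(1) \<beta> unfolding prof_def by (simp add: exp_minus)
  show "prof r \<le> mi" using prof(4)[OF assms(1)] prof(1) by simp
qed

abbreviation slope :: "real \<Rightarrow> real" where "slope r \<equiv> uy (\<i> * of_real (prof r)) * prof r / m"

abbreviation curv :: "real \<Rightarrow> real" where
  "curv r \<equiv> - d (\<i> * of_real (prof r)) * (prof r)\<^sup>2 / m\<^sup>2 - uy (\<i> * of_real (prof r)) * prof r / m\<^sup>2"

lemma prof_derivs:
  assumes r: "m \<le> r" "r < m * (1 + ln (mi / \<beta>))"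
  shows "((\<lambda>r. u (\<i> * of_real (prof r))) has_real_derivative - slope r) (at r)"
    "((\<lambda>r. slope r) has_real_derivative curv r) (at r)"
proof -
  note D = u_axis_derivs[OF inner_axis_dom[OF prof_range[OF r]]]
  show "((\<lambda>r. u (\<i> * of_real (prof r))) has_real_derivative - slope r) (at r)"
    using DERIV_chain2[OF D(1) prof(3)] by simp
  have "((\<lambda>r. uy (\<i> * of_real (prof r)) * prof r / m) has_real_derivative
      (d (\<i> * of_real (prof r)) * (- prof r / m) * prof r + (- prof r / m) * uy (\<i> * of_real (prof r))) / m) (at r)"
    by (rule DERIV_cdivide[OF DERIV_mult[OF DERIV_chain2[OF D(2) prof(3)] prof(3)]])
  then show "((\<lambda>r. slope r) has_real_derivative curv r) (at r)"
    by (rule DERIV_cong) (use m_pos in \<open>simp add: field_simps power2_eq_square\<close>)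
qed

text \<open>The term with \<open>uy\<close> from \<open>a_inner_le\<close> cancels the one created
  by the logarithmic variable, which is why this variable is used. The final estimate is
  \<open>mi \<le> m\<close>.\<close>

lemma curv_le:
  assumes r: "m \<le> r" "r < m * (1 + ln (mi / \<beta>))"
  shows "curv r \<le> g (u (\<i> * of_real (prof r))) * (exp (1 - r / m))\<^sup>2"
proof -
  let ?p = "\<i> * of_real (prof r)"
  note R = prof_range[OF r]
  have "- d ?p = g (u ?p) + a ?p" using eqn[OF inner_axis_dom[OF R]] by simp
  then have "- d ?p * (prof r)\<^sup>2 = g (u ?p) * (prof r)\<^sup>2 + prof r * (prof r * a ?p)"
    by (simp add: algebra_simps power2_eq_square)
  also have "\<dots> \<le> g (u ?p) * (prof r)\<^sup>2 + prof r * uy ?p"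
    using a_inner_le[OF R] prof(2)[of r] by (intro add_left_mono mult_left_mono) auto
  finally have "curv r \<le> (g (u ?p) * (prof r)\<^sup>2 + prof r * uy ?p) / m\<^sup>2 - uy ?p * prof r / m\<^sup>2"
    using m_pos by (intro diff_right_mono divide_right_mono) auto
  also have "\<dots> = g (u ?p) * (prof r / m)\<^sup>2" by (simp add: add_divide_distrib power_divide)
  also have "\<dots> \<le> g (u ?p) * (exp (1 - r / m))\<^sup>2"
  proof (intro mult_left_mono power_mono)
    show "prof r / m \<le> exp (1 - r / m)" unfolding prof_def using m_pos by (simp add: field_simps)
  qed (use g_pos less_imp_le prof(2)[of r] m_pos in auto)
  finally show ?thesis .
qed

lemma slope_nonneg: "m \<le> r \<Longrightarrow> r < m * (1 + ln (mi / \<beta>)) \<Longrightarrow> 0 \<le> slope r"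
  using uy_inner_nonneg[OF prof_range, of r] prof(2)[of r] m_pos by simp

text \<open>Reversed radial inequality for the inner profile in the new variable.
  \<open>(m / 2) * (1 - (e r)\<^sup>2)\<close> is the antiderivative of the square of
  \<open>e\<close> that vanishes at \<open>m\<close>, so integrating \<open>curv_le\<close> bounds
  the slope. Divided by \<open>r \<ge> m\<close>, this bound fills at most the gap that
  \<open>curv_le\<close> leaves below \<open>g\<close>.\<close>

lemma inner_ode:
  assumes r: "m \<le> r" "r < m * (1 + ln (mi / \<beta>))"
  shows "curv r + slope r / r \<le> g (u (\<i> * of_real (prof r)))"
proof -
  define G where "G = g (u (\<i> * of_real (prof r)))"
  have G: "0 < G" unfolding G_def by (rule g_pos)
  define e where "e r = exp (1 - r / m)" for r
  define H where "H r = G * (m / 2) * (1 - (e r)\<^sup>2) - slope r" for r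
  have de: "(e has_real_derivative (- e r / m)) (at r)" for r
    unfolding e_def[abs_def] using m_pos by (auto intro!: derivative_eq_intros)
  have dH: "(H has_real_derivative (G * (e s)\<^sup>2 - curv s)) (at s)" if s: "m \<le> s" "s < m * (1 + ln (mi / \<beta>))" for s
    unfolding H_def[abs_def]
  proof (rule DERIV_diff[OF _ prof_derivs(2)[OF s]])
    show "((\<lambda>r. G * (m / 2) * (1 - (e r)\<^sup>2)) has_real_derivative G * (e s)\<^sup>2) (at s)"
      using m_pos by (auto intro!: derivative_eq_intros de simp: power2_eq_square field_simps)
  qed
  have "H m \<le> H r"
  proof (rule DERIV_nonneg_imp_increasing_open[of m r H])
    show "continuous_on {m..r} H" 
      by (intro continuous_at_imp_continuous_on ballI, rule DERIV_isCont, rule dH) (use r in auto)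
    fix s assume s: "m < s" "s < r"
    have sr: "m \<le> s" "s < m * (1 + ln (mi / \<beta>))" using s r by auto
    have "u (\<i> * of_real (prof r)) \<le> u (\<i> * of_real (prof s))"
      using inner_mono[of "\<i> * of_real (prof r)" "\<i> * of_real (prof s)"] prof(4)[of s r] s
        prof_range[OF r] prof_range[OF sr] \<beta> inner_axis by simp
    then have "g (u (\<i> * of_real (prof s))) \<le> G" unfolding G_def by (rule g_antimono)
    then have "g (u (\<i> * of_real (prof s))) * (e s)\<^sup>2 \<le> G * (e s)\<^sup>2" by (intro mult_right_mono) auto
    then have "0 \<le> G * (e s)\<^sup>2 - curv s" using curv_le[OF sr] unfolding e_def by linarith
    then show "\<exists>y. (H has_real_derivative y) (at s) \<and> 0 \<le> y" using dH[OF sr] by blast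
  qed (use r in simp)
  moreover have "H m = 0" unfolding H_def e_def prof(1) using m_pos K(3)[OF mi(2)] by simp
  ultimately have sl: "slope r \<le> G * (m / 2) * (1 - (e r)\<^sup>2)" unfolding H_def by simp
  have r0: "0 < r" using r m_pos by simp
  have e1: "(e r)\<^sup>2 \<le> 1" unfolding e_def using r m_pos by (auto simp: power_le_one_iff field_simps)
  have "slope r / r \<le> G * (m / 2) * (1 - (e r)\<^sup>2) / r" using sl r0 by (intro divide_right_mono) auto
  also have "\<dots> = (G * (1 - (e r)\<^sup>2)) * (m / (2 * r))" by simp
  also have "\<dots> \<le> (G * (1 - (e r)\<^sup>2)) * 1"
    using G e1 r r0 m_pos by (intro mult_left_mono) (auto simp: field_simps)
  finally have "slope r / r \<le> G - G * (e r)\<^sup>2" by (simp add: algebra_simps)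
  then show ?thesis using curv_le[OF r] unfolding G_def e_def by linarith
qed

text \<open>\<open>R\<close> is the parameter at which the inner profile reaches the hole. The inner
  profile cannot fall to 0 before the outer one does, and the outer one is positive before 1; so
  \<open>R < 1\<close> is impossible.\<close>

lemma link_bound: "\<beta> \<le> mi * exp (1 - 1 / m)"
proof (rule ccontr)
  assume nb: "\<not> \<beta> \<le> mi * exp (1 - 1 / m)"
  define R where "R = m * (1 + ln (mi / \<beta>))"
  have lnp: "0 < ln (mi / \<beta>)" using beta_less_mi \<beta> by simp
  have Rm: "m < R" unfolding R_def using m_pos lnp by simp
  have R1: "R < 1"
  proof -
    have "exp (1 / m - 1) > mi / \<beta>"
      using nb \<beta> by (simp add: exp_diff field_simps)
    then have "ln (mi / \<beta>) < 1 / m - 1" using mi(1) \<beta> by (metis divide_pos_pos exp_gt_zero ln_exp ln_less_cancel_iff)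
    then show ?thesis unfolding R_def using m_pos by (simp add: field_simps)
  qed
  define \<delta> where "\<delta> = (1 - R) / 2"
  have \<delta>: "0 < \<delta>" "R + \<delta> < 1" using R1 unfolding \<delta>_def by (auto simp: field_simps)
  define w where "w r = u (\<i> * of_real r) - u (\<i> * of_real (prof (r - \<delta>)))" for r
  \<comment> \<open>\<open>r\<close> times the derivative of \<open>w\<close>. Its derivative
    combines both radial inequalities and is nonpositive while \<open>w < 0\<close>, since
    \<open>g\<close> is decreasing; this is the coupling that \<open>no_crossing\<close>
    requires.\<close>
  define F where "F r = r * slope (r - \<delta>) + r * uy (\<i> * of_real r)" for r
  define F' where "F' r = (slope (r - \<delta>) + r * curv (r - \<delta>)) + (uy (\<i> * of_real r) + r * d (\<i> * of_real r))" for r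
  have sh: "m \<le> r - \<delta>" "r - \<delta> < m * (1 + ln (mi / \<beta>))" "m < r" "r < 1" "0 < r"
    if "m + \<delta> \<le> r" "r < R + \<delta>" for r using that \<delta> m_pos unfolding R_def by auto
  have did: "((\<lambda>r. r - \<delta>) has_real_derivative 1) (at r)" for r by (auto intro!: derivative_eq_intros)
  have dw: "(w has_real_derivative F r / r) (at r)" if r: "m + \<delta> \<le> r" "r < R + \<delta>" for r
  proof -
    note s = sh[OF r]
    have "(w has_real_derivative (uy (\<i> * of_real r) - (- slope (r - \<delta>)) * 1)) (at r)"
      unfolding w_def[abs_def]
      by (rule DERIV_diff[OF u_axis_derivs(1)[OF axis_dom] DERIV_chain2[OF prof_derivs(1)[OF s(1,2)] did]]) (use s in auto)
    then show ?thesis by (rule DERIV_cong) (use s(5) in \<open>simp add: F_def field_simps\<close>)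
  qed
  have dF: "(F has_real_derivative F' r) (at r)" if r: "m + \<delta> \<le> r" "r < R + \<delta>" for r
  proof -
    note s = sh[OF r]
    have "(F has_real_derivative ((1 * slope (r - \<delta>) + (curv (r - \<delta>) * 1) * r) + (1 * uy (\<i> * of_real r) + d (\<i> * of_real r) * r))) (at r)"
      unfolding F_def[abs_def]
      by (rule DERIV_add[OF DERIV_mult[OF DERIV_ident DERIV_chain2[OF prof_derivs(2)[OF s(1,2)] did]]
            DERIV_mult[OF DERIV_ident u_axis_derivs(2)[OF axis_dom]]]) (use s in auto)
    then show ?thesis by (rule DERIV_cong) (simp add: F'_def mult.commute)
  qed
  have neg: "w q < 0" if q: "m + \<delta> \<le> q" "q < R + \<delta>" for q
  proof (rule no_crossing[of "m + \<delta>" q w F q])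
    show "continuous_on {m + \<delta>..q} w"
      by (intro continuous_at_imp_continuous_on ballI, rule DERIV_isCont, rule dw) (use q in auto)
    show "continuous_on {m + \<delta>..q} F"
      by (intro continuous_at_imp_continuous_on ballI, rule DERIV_isCont, rule dF) (use q in auto)
    have md: "m < m + \<delta>" "m + \<delta> < 1" using \<delta> Rm by auto
    have "u (\<i> * of_real (m + \<delta>)) < u (\<i> * of_real m)"
    proof (rule DERIV_neg_imp_decreasing_open[of m "m + \<delta>" "\<lambda>y. u (\<i> * of_real y)"])
      show "continuous_on {m..m + \<delta>} (\<lambda>y. u (\<i> * of_real y))"
        by (rule continuous_on_compose2[OF cont_u]) (auto intro!: continuous_intros)
      fix r assume r: "m < r" "r < m + \<delta>"
      then show "\<exists>y. ((\<lambda>y. u (\<i> * of_real y)) has_real_derivative y) (at r) \<and> y < 0"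
        using u_axis_derivs(1)[OF axis_dom[of r]] uy_outer_neg[of r] md by auto
    qed (use md in simp)
    then show "w (m + \<delta>) < 0" unfolding w_def using u_K[OF m(2)] u_K[OF mi(2)] by (simp add: prof)
    show "F (m + \<delta>) < 0" unfolding F_def using K(3)[OF mi(2)] uy_outer_neg[OF md] md m_pos
      by (simp add: prof mult_pos_neg del: of_real_add)
    fix r assume r: "m + \<delta> < r" "r < q"
    then have r': "m + \<delta> \<le> r" "r < R + \<delta>" using q by auto
    note s = sh[OF r']
    show "\<exists>y. (w has_real_derivative y) (at r) \<and> y \<le> 0" if "F r < 0"
      using dw[OF r'] that s(5) by (intro exI[of _ "F r / r"]) (auto simp: divide_nonpos_pos)
    show "\<exists>y. (F has_real_derivative y) (at r) \<and> y \<le> 0" if "w r < 0"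
    proof -
      \<comment> \<open>The delay only helps: the slope is nonnegative, so dividing by
        \<open>r - \<delta>\<close> instead of \<open>r\<close> makes the inner side of
        \<open>inner_ode\<close> larger.\<close>
      have "slope (r - \<delta>) * 1 \<le> slope (r - \<delta>) * (r / (r - \<delta>))"
        using slope_nonneg[OF s(1,2)] s m_pos \<delta> by (intro mult_left_mono) (auto simp: field_simps)
      then have "slope (r - \<delta>) + r * curv (r - \<delta>) \<le> r * (curv (r - \<delta>) + slope (r - \<delta>) / (r - \<delta>))"
        by (simp add: algebra_simps)
      also have "\<dots> \<le> r * g (u (\<i> * of_real (prof (r - \<delta>))))"
        using inner_ode[OF s(1,2)] s(5) by (intro mult_left_mono) auto
      also have "\<dots> \<le> r * g (u (\<i> * of_real r))"
        using that s(5) g_antimono[of "u (\<i> * of_real r)" "u (\<i> * of_real (prof (r - \<delta>)))"] unfolding w_def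
        by (intro mult_left_mono) auto
      finally have "F' r \<le> 0" using outer_ode[OF s(3,4)] unfolding F'_def by linarith
      then show ?thesis using dF[OF r'] by blast
    qed
  qed (use q in auto)
  have "0 \<le> - w (R + \<delta>)"
  proof (rule continuous_ge_on_Ioo[of "m + \<delta>" "R + \<delta>" "\<lambda>r. - w r"])
    have "continuous_on UNIV prof" using prof(3) by (intro continuous_at_imp_continuous_on ballI DERIV_isCont) blast
    then have "continuous_on {m + \<delta>..R + \<delta>} (\<lambda>r. prof (r - \<delta>))"
      by (rule continuous_on_compose2) (auto intro!: continuous_intros)
    then show "continuous_on {m + \<delta>..R + \<delta>} (\<lambda>r. - w r)"
      unfolding w_def by (intro continuous_intros continuous_on_compose2[OF cont_u]) auto
    show "0 \<le> - w x" if "x \<in> {m + \<delta><..<R + \<delta>}" for x using neg[of x] that by auto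
  qed (use Rm in auto)
  moreover have "u (\<i> * of_real (prof R)) = 0" unfolding R_def prof(5) by (intro u_zero) (simp add: ellq_def)
  moreover have "0 < u (\<i> * of_real (R + \<delta>))" using Rm \<delta> by (intro u_pos axis_dom) auto
  ultimately show False unfolding w_def by simp
qed

section \<open>Incompatibility of the four estimates\<close>

text \<open>\<open>link_bound\<close> and \<open>mi \<le> m\<close> give
  \<open>\<beta> \<le> m * \<nu>\<close>, which with \<open>n_le\<close> bounds \<open>n\<close>
  from above in terms of \<open>m\<close> and \<open>E\<close> alone. The lower bound contradicting
  it is \<open>level_bound\<close> for small \<open>E\<close> and \<open>inversion_bound\<close> for
  large \<open>E\<close>.\<close>

lemma no_critical_axis: False
proof -
  define x where "x = 1 / m - 1"
  define \<nu> where "\<nu> = exp (- x)"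
  have x: "0 < x" "m = 1 / (1 + x)" unfolding x_def using m m_pos by (auto simp: field_simps)
  have \<nu>: "0 < \<nu>" "\<nu> < 1" unfolding \<nu>_def using x by auto
  have sum_le: "\<nu> * (\<Sum>j<k. x ^ j / fact j) \<le> 1" for k
  proof -
    have "\<nu> * (\<Sum>j<k. x ^ j / fact j) \<le> \<nu> * exp x"
      using exp_partial_sum_le[of x k] x \<nu> by (intro mult_left_mono) auto
    then show ?thesis unfolding \<nu>_def by (simp flip: exp_add)
  qed
  have n_bound: "n \<le> m * (1 + \<nu> * (1 / E - 1))"
  proof -
    have EE: "0 \<le> 1 / E - 1" using E by simp
    have "\<beta> \<le> m * \<nu>"
    proof -
      have "\<beta> \<le> mi * \<nu>" using link_bound unfolding \<nu>_def x_def by simp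
      also have "\<dots> \<le> m * \<nu>" using m_pos \<nu> by (intro mult_right_mono) auto
      finally show ?thesis .
    qed
    then have "\<beta> * (1 / E - 1) \<le> m * \<nu> * (1 / E - 1)" using EE by (intro mult_right_mono)
    then have "n \<le> m + m * \<nu> * (1 / E - 1)" using n_le m_pos by linarith
    then show ?thesis by (simp add: algebra_simps)
  qed
  define \<alpha> :: real where "\<alpha> = (if x \<le> 1 then 2 else 3)"
  have \<alpha>: "x \<le> 1 \<and> \<alpha> = 2 \<or> 1 \<le> x \<and> \<alpha> = 3" unfolding \<alpha>_def by auto
  show False
  proof (cases "E * (\<alpha> + x) \<le> \<alpha>")
    case True
    define P where "P = (1 - E) * ((1 - \<nu>) / x)"
    have "\<nu> * (6 + 6 * x + 3 * x\<^sup>2 + x ^ 3) \<le> 6"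
      using sum_le[of 4] by (simp add: eval_nat_numeral algebra_simps)
    from small_E[OF x(1) this E(1) True \<alpha>]
    have cond: "E\<^sup>2 * x * (1 + P) < (1 + x) * (2 * P + P\<^sup>2)" unfolding P_def .
    \<comment> \<open>The upper bound of \<open>E * n\<close> that follows from
      \<open>n_bound\<close>. At \<open>t0\<close> the condition of \<open>level_bound\<close> is
      the inequality of \<open>small_E\<close>, since the quotient \<open>(1 - t0) / (1 - m)\<close>
      is \<open>1 + P\<close>.\<close>
    define t0 where "t0 = m * (E + (1 - E) * \<nu>)"
    have lt1: "E + (1 - E) * \<nu> < 1"
    proof -
      have "(1 - E) * \<nu> < (1 - E) * 1" using E \<nu> by (intro mult_strict_left_mono) auto
      then show ?thesis by simp
    qed
    have t0: "0 < t0" "t0 < m" unfolding t0_def using m_pos E \<nu> lt1 by (auto intro!: mult_pos_pos add_pos_pos)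
    have nt0: "E * n \<le> t0"
    proof -
      have "E * n \<le> E * (m * (1 + \<nu> * (1 / E - 1)))" using n_bound E by (intro mult_left_mono) auto
      also have "\<dots> = t0" unfolding t0_def using E by (simp add: field_simps)
      finally show ?thesis .
    qed
    define f where "f t = ((1 - t) / (1 - m))\<^sup>2 - (1 + E\<^sup>2 * (1 - t))" for t
    have tt: "(1 - t0) / (1 - m) = 1 + P" "1 - t0 = x * (1 + P) / (1 + x)"
    proof -
      have mm: "1 - m = x / (1 + x)" using x by (simp add: field_simps)
      have xP: "x * (1 + P) = x + (1 - E) * (1 - \<nu>)" unfolding P_def using x(1) by (simp add: distrib_left)
      show e: "1 - t0 = x * (1 + P) / (1 + x)"
        unfolding xP t0_def x(2) using x(1) by (simp add: field_simps)
      show "(1 - t0) / (1 - m) = 1 + P" unfolding e mm using x(1) by simp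
    qed
    have "f t0 = ((1 + x) * (2 * P + P\<^sup>2) - E\<^sup>2 * x * (1 + P)) / (1 + x)"
      unfolding f_def tt(1) unfolding tt(2) using x(1) by (simp add: field_simps power2_eq_square)
    then have f0: "0 < f t0" using cond x(1) by simp
    \<comment> \<open>\<open>level_bound\<close> at \<open>t0\<close> itself would give no
      contradiction; the strict inequality persists slightly above \<open>t0\<close>, and there it
      gives one.\<close>
    have "isCont f t0" unfolding f_def using m by (intro continuous_intros) auto
    then have "(f \<longlongrightarrow> f t0) (at_right t0)" unfolding isCont_def using tendsto_mono[OF at_le] by blast
    then have "\<forall>\<^sub>F t in at_right t0. 0 < f t" using f0 by (rule order_tendstoD)
    moreover have "\<forall>\<^sub>F t in at_right t0. t0 < t \<and> t < m"
      using t0(2) unfolding eventually_at_right[OF t0(2)] by blast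
    ultimately have "\<forall>\<^sub>F t in at_right t0. 0 < f t \<and> t0 < t \<and> t < m" by (rule eventually_conj)
    then obtain t where t: "0 < f t" "t0 < t" "t < m"
      using eventually_happens by (metis (no_types, lifting) trivial_limit_at_right_real)
    have "t \<le> E * n" by (rule level_bound) (use t t0 in \<open>auto simp: f_def\<close>)
    then show False using nt0 t by simp
  next
    case False
    then have large: "\<alpha> \<le> E * (\<alpha> + x)" by simp
    define A B where "A = 3 + 3 * m ^ 4 - 2 * m\<^sup>2" and "B = 3 * m ^ 4 + 2 * m\<^sup>2 - 1"
    have "\<nu> * (120 + 120 * x + 60 * x\<^sup>2 + 20 * x ^ 3 + 5 * x ^ 4 + x ^ 5) \<le> 120"
      using sum_le[of 6] by (simp add: eval_nat_numeral algebra_simps)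
    note L = large_E[OF x(2,1) \<nu>(1) this E large \<alpha>, folded A_def B_def]
    define \<delta> where "\<delta> = (1 + E\<^sup>2) * (1 + 3 * m ^ 4) / (1 - E\<^sup>2) + 2"
    have E2: "E\<^sup>2 < 1" using E by (simp add: power_less_one_iff)
    have \<delta>m: "\<delta> - 2 * m\<^sup>2 = (A + B * E\<^sup>2) / (1 - E\<^sup>2)"
      unfolding \<delta>_def A_def B_def using E2 by (simp add: field_simps)
    have \<delta>pos: "0 < \<delta> - 2 * m\<^sup>2" unfolding \<delta>m using L(1) E2 by simp
    define y where "y = \<nu> * (1 / E - 1)"
    have "m\<^sup>2 * (\<delta> + 6 * m\<^sup>2) / (\<delta> - 2 * m\<^sup>2) \<le> n\<^sup>2" by (rule inversion_bound[OF \<delta>_def])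
    also have "n\<^sup>2 \<le> (m * (1 + y))\<^sup>2" using n_bound n(1) unfolding y_def by (intro power_mono) auto
    finally have "m\<^sup>2 * ((\<delta> + 6 * m\<^sup>2) / (\<delta> - 2 * m\<^sup>2)) \<le> m\<^sup>2 * (1 + y)\<^sup>2" by (simp add: power_mult_distrib)
    then have "(\<delta> + 6 * m\<^sup>2) / (\<delta> - 2 * m\<^sup>2) \<le> (1 + y)\<^sup>2"
      by (rule mult_left_le_imp_le) (use m_pos in simp)
    then have "\<delta> + 6 * m\<^sup>2 \<le> (1 + y)\<^sup>2 * (\<delta> - 2 * m\<^sup>2)" using \<delta>pos by (simp add: divide_le_eq)
    then have "8 * m\<^sup>2 \<le> (2 * y + y\<^sup>2) * ((A + B * E\<^sup>2) / (1 - E\<^sup>2))"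
      unfolding \<delta>m[symmetric] by (simp add: algebra_simps power2_eq_square)
    then have 1: "8 * m\<^sup>2 * (1 - E\<^sup>2) \<le> (2 * y + y\<^sup>2) * (A + B * E\<^sup>2)" using E2 by (simp add: field_simps)
    have y2: "2 * y + y\<^sup>2 = ((1 - E) / E) * (2 * \<nu> + \<nu>\<^sup>2 * (1 / E - 1))"
      unfolding y_def using E by (simp add: field_simps power2_eq_square)
    have "(2 * y + y\<^sup>2) * (A + B * E\<^sup>2) = ((1 - E) / E) * ((2 * \<nu> + \<nu>\<^sup>2 * (1 / E - 1)) * (A + B * E\<^sup>2))"
      unfolding y2 by simp
    also have "\<dots> < ((1 - E) / E) * (8 * m\<^sup>2 * (E * (1 + E)))"
      using L(2) E by (intro mult_strict_left_mono) auto
    also have "\<dots> = 8 * m\<^sup>2 * (1 - E\<^sup>2)" using E by (simp add: field_simps power2_eq_square)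
    finally show False using 1 by simp
  qed
qed

end

text \<open>The first meeting points \<open>n\<close> and \<open>mi\<close> are exits from
  \<open>Si\<close> along rays from 0. The last one is found by descending from the outer ellipse,
  so it appears as \<open>1 - s\<close>.\<close>

lemma (in critical_ellipse) no_critical_ellipse: False
proof -
  have "of_real (1 / E) \<notin> Si" using So(2)[of "of_real (1 / E)"] disj E by (auto simp: ellq_def)
  moreover have "continuous_on {0..1 / E} (of_real :: real \<Rightarrow> complex)" by (intro continuous_intros)
  moreover have "of_real 0 \<in> Si" "0 \<le> 1 / E" using zero_Si E by auto
  ultimately obtain n where n: "0 < n" "of_real n \<notin> Si" "of_real n \<notin> So" "\<And>t. 0 \<le> t \<Longrightarrow> t < n \<Longrightarrow> of_real t \<in> Si"
    using first_exit[of "1 / E" "of_real :: real \<Rightarrow> complex" Si So] Si(1) So(1) disj by metis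
  have "\<i> * of_real 1 \<notin> Si" using So(2)[of "\<i> * of_real 1"] disj by (auto simp: ellq_def)
  moreover have "continuous_on {0..1} (\<lambda>t::real. \<i> * of_real t)" by (intro continuous_intros)
  moreover have "\<i> * of_real 0 \<in> Si" "0 \<le> (1::real)" using zero_Si by auto
  ultimately obtain mi where mi: "0 < mi" "\<i> * of_real mi \<notin> Si" "\<i> * of_real mi \<notin> So" "\<And>t. 0 \<le> t \<Longrightarrow> t < mi \<Longrightarrow> \<i> * of_real t \<in> Si"
    using first_exit[of 1 "\<lambda>t. \<i> * of_real t" Si So] Si(1) So(1) disj by metis
  have "\<i> * of_real (1 - 1) \<notin> So" using zero_Si disj by auto
  moreover have "continuous_on {0..1} (\<lambda>t::real. \<i> * of_real (1 - t))" by (intro continuous_intros)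
  moreover have "\<i> * of_real (1 - 0) \<in> So" "0 \<le> (1::real)" "So \<inter> Si = {}" using So(2)[of "\<i> * of_real 1"] disj by (auto simp: ellq_def)
  ultimately obtain s where s: "0 < s" "\<i> * of_real (1 - s) \<notin> So" "\<i> * of_real (1 - s) \<notin> Si" "\<And>t. 0 \<le> t \<Longrightarrow> t < s \<Longrightarrow> \<i> * of_real (1 - t) \<in> So"
    using first_exit[of 1 "\<lambda>t. \<i> * of_real (1 - t)" So Si] Si(1) So(1) by metis
  have above: "\<i> * of_real t \<in> So" if "1 - s < t" for t
  proof (cases "t \<le> 1")
    case True then show ?thesis using s(4)[of "1 - t"] that by simp
  next
    case False then show ?thesis by (intro So(2)) (simp add: ellq_def)
  qed
  interpret critical_axis u ux uy a b b' d g \<Omega> E \<beta> c K Si So n mi "1 - s"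
  proof unfold_locales
    show "of_real n \<in> K" "\<i> * of_real mi \<in> K" "\<i> * of_real (1 - s) \<in> K" using n mi s cov by blast+
  qed (use n mi s above in auto)
  show False by (rule no_critical_axis)
qed

section \<open>Jordan curves of critical points\<close>

lemma connected_meets_inside:
  assumes "connected T" "T \<inter> S = {}" "x \<in> T" "x \<in> inside S" shows "T \<subseteq> inside S"
proof
  fix y assume "y \<in> T"
  then have "connected_component (- S) x y" using assms unfolding connected_component_def by blast
  then show "y \<in> inside S" using assms(4) inside_same_component by blast
qed

text \<open>If \<open>G\<close> met the inside of the curve, it would lie there entirely. The
  connected, unbounded outside of the curve would then avoid \<open>G\<close>, yet it accumulates at
  the curve and so enters the inside of \<open>G\<close>, whose components are bounded.\<close>

lemma Jordan_inside_disjoint: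
  fixes c :: "real \<Rightarrow> complex"
  assumes c: "simple_path c" "pathfinish c = pathstart c" and G: "connected G" "G \<inter> path_image c = {}" "closed G"
    and cG: "path_image c \<subseteq> inside G"
  shows "G \<inter> inside (path_image c) = {}"
proof (rule ccontr)
  note J = Jordan_inside_outside[OF c]
  assume "G \<inter> inside (path_image c) \<noteq> {}"
  then have "G \<subseteq> inside (path_image c)" using connected_meets_inside[OF G(1,2)] by blast
  then have oG: "outside (path_image c) \<inter> G = {}" using J by blast
  have co: "connected (outside (path_image c))" "\<not> bounded (outside (path_image c))" using J by auto
  obtain x where x: "x \<in> path_image c" using c by auto
  have "x \<in> closure (outside (path_image c))" using J x by (auto simp: frontier_def)
  moreover have "x \<in> inside G" using x cG by blast
  moreover have "open (inside G)" using G(3) by (rule open_inside)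
  ultimately obtain y where y: "y \<in> outside (path_image c)" "y \<in> inside G"
    by (metis IntE closure_iff_nhds_not_empty disjoint_iff inf_commute open_Int_closure_eq_empty)
  have "outside (path_image c) \<subseteq> connected_component_set (- G) y"
    using connected_component_maximal[OF y(1) co(1)] oG by blast
  moreover have "bounded (connected_component_set (- G) y)" using y(2) unfolding inside_def by blast
  ultimately show False using co(2) bounded_subset by blast
qed

context elliptic_solution begin

text \<open>A critical curve that did not surround the hole would bound a region contained in the
  domain, which \<open>no_region_bounded_by_critical\<close> excludes.\<close>

lemma hole_inside_critical_curve:
  assumes \<gamma>: "simple_path \<gamma>" "pathfinish \<gamma> = pathstart \<gamma>" "path_image \<gamma> \<subseteq> \<Omega>"
      "\<And>z. z \<in> path_image \<gamma> \<Longrightarrow> ux z = 0 \<and> uy z = 0"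
    and D: "connected D" "D \<inter> \<Omega> = {}" and G: "connected G" "closed G" "G \<inter> \<Omega> = {}" "\<Omega> \<subseteq> inside G"
    and fr: "frontier \<Omega> \<subseteq> D \<union> G"
  shows "D \<subseteq> inside (path_image \<gamma>)" "G \<inter> inside (path_image \<gamma>) = {}"
proof -
  note J = Jordan_inside_outside[OF \<gamma>(1,2)]
  let ?C = "path_image \<gamma>"
  show GC: "G \<inter> inside ?C = {}"
    by (rule Jordan_inside_disjoint[OF \<gamma>(1,2) G(1) _ G(2)]) (use \<gamma>(3) G in blast)+
  have cC: "compact ?C" using \<gamma>(1) by (simp add: compact_simple_path_image)
  have "D \<inter> inside ?C \<noteq> {}"
  proof
    assume e: "D \<inter> inside ?C = {}"
    have "inside ?C \<inter> \<Omega> \<noteq> {}"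
    proof -
      obtain x where x: "x \<in> ?C" using \<gamma>(1) by auto
      then have "x \<in> closure (inside ?C)" "x \<in> \<Omega>" using J \<gamma>(3) by (auto simp: frontier_def)
      then show ?thesis using open_dom open_Int_closure_eq_empty[of \<Omega> "inside ?C"] by blast
    qed
    moreover have "inside ?C \<inter> frontier \<Omega> = {}" using e GC fr by blast
    ultimately have "inside ?C \<subseteq> \<Omega>" using connected_Int_frontier[of "inside ?C" \<Omega>] J by blast
    then show False
      using no_region_bounded_by_critical[OF cC \<gamma>(3) \<gamma>(4), of "inside ?C"] J by blast
  qed
  then show "D \<subseteq> inside ?C" using connected_meets_inside[of D ?C] D \<gamma>(3) by blast
qed

text \<open>\<open>circular_hole_forces_circle\<close> is applied to the largest annulus about
  \<open>q\<close> contained in the domain. Its outer circle then consists of frontier points, so it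
  is part of \<open>G\<close>; comparing insides shows that it is all of \<open>G\<close>.\<close>

lemma circular_hole_contradiction:
  assumes \<gamma>: "simple_path \<gamma>" "pathfinish \<gamma> = pathstart \<gamma>" "path_image \<gamma> \<subseteq> \<Omega>"
      "\<And>z. z \<in> path_image \<gamma> \<Longrightarrow> ux z = 0 \<and> uy z = 0"
    and G: "simple_path G" "pathfinish G = pathstart G" "path_image G \<inter> sphere q r = {}"
      "sphere q r \<subseteq> inside (path_image G)" "\<Omega> \<subseteq> inside (path_image G)"
    and hole: "ball q r \<inter> \<Omega> = {}" "0 < r" and fr: "frontier \<Omega> = sphere q r \<union> path_image G"
    and not_circle: "\<And>R. path_image G \<noteq> sphere q R"
    and lip: "\<And>B. \<exists>M. \<forall>s\<in>{0..B}. \<forall>t\<in>{0..B}. \<bar>g s - g t\<bar> \<le> M * \<bar>s - t\<bar>"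
  shows False
proof -
  let ?C = "path_image \<gamma>" and ?G = "path_image G"
  note J = Jordan_inside_outside[OF \<gamma>(1,2)] and JG = Jordan_inside_outside[OF G(1,2)]
  have cC: "compact ?C" "compact ?G" using \<gamma>(1) G(1) by (simp_all add: compact_simple_path_image)
  have frO: "frontier \<Omega> \<inter> \<Omega> = {}" using open_dom by (auto simp: frontier_def interior_open)
  have frcl: "frontier \<Omega> \<subseteq> closure \<Omega>" by (auto simp: frontier_def)
  have GO: "?G \<inter> \<Omega> = {}" "sphere q r \<inter> \<Omega> = {}" using frO fr by blast+
  have cbe: "cball q r = sphere q r \<union> ball q r" by auto
  have bG: "ball q r \<inter> ?G = {}"
  proof -
    have "?G \<subseteq> closure \<Omega>" using fr frcl by blast
    then show ?thesis using hole(1) open_Int_closure_eq_empty[of "ball q r" \<Omega>] by blast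
  qed
  have "cball q r \<inter> \<Omega> = {}" unfolding cbe using GO(2) hole(1) by blast
  moreover have "frontier \<Omega> \<subseteq> cball q r \<union> ?G" unfolding cbe using fr by blast
  ultimately have H: "cball q r \<subseteq> inside ?C" "?G \<inter> inside ?C = {}"
    using hole_inside_critical_curve[OF \<gamma> connected_cball _ connected_simple_path_image[OF G(1)] compact_imp_closed[OF cC(2)] GO(1) G(5)]
    by blast+
  obtain p where p: "p \<in> ?G" "\<And>z. z \<in> ?G \<Longrightarrow> dist q p \<le> dist q z"
    using distance_attains_inf[of ?G q] cC(2) G(1) compact_imp_closed by (metis path_image_nonempty)
  define R where "R = dist q p"
  have R: "r < R" 
  proof -
    have "p \<notin> cball q r" unfolding cbe using p(1) bG G(3) by blast
    then show ?thesis unfolding R_def by simp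
  qed
  have Gout: "R \<le> dist q z" if "z \<in> ?G" for z using p(2)[OF that] unfolding R_def .
  define A where "A = {z. r < dist q z \<and> dist q z < R}"
  have A\<Omega>: "A \<subseteq> \<Omega>"
  proof (rule ccontr)
    assume nA: "\<not> A \<subseteq> \<Omega>"
    have "A = {x. r < norm (x - q) \<and> norm (x - q) < R}" unfolding A_def by (auto simp: dist_norm norm_minus_commute)
    then have cA: "connected A" using connected_annulus(1)[of r q R] by simp
    have "A \<inter> \<Omega> \<noteq> {}"
    proof -
      have "q + of_real r \<in> sphere q r" using hole(2) by (simp add: dist_norm)
      then have "q + of_real r \<in> closure \<Omega>" using fr frcl by blast
      then obtain z where z: "z \<in> \<Omega>" "dist z (q + of_real r) < R - r"
        using R unfolding closure_approachable by (meson diff_gt_0_iff_gt)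
      have "dist q z \<le> dist q (q + of_real r) + dist z (q + of_real r)" by (metis dist_commute dist_triangle)
      then have "dist q z < R" using z(2) hole(2) by (simp add: dist_norm)
      moreover have "z \<notin> cball q r" unfolding cbe using z(1) hole(1) GO(2) by blast
      then have "r < dist q z" by simp
      ultimately show ?thesis using z(1) unfolding A_def by blast
    qed
    moreover have "A \<inter> frontier \<Omega> = {}" using Gout unfolding fr A_def by force
    ultimately show False using connected_Int_frontier[OF cA] nA by blast
  qed
  \<comment> \<open>A neighbourhood of the closed hole lies inside the curve, so the region
    \<open>E\<close> between hole and curve contains a thin annulus, where unique continuation can
    start.\<close>
  obtain e where e: "e > 0" "(\<Union>x\<in>cball q r. ball x e) \<subseteq> inside ?C"
    using compact_subset_open_imp_ball_epsilon_subset[OF compact_cball _ H(1)] J by blast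
  define E where "E = inside ?C \<inter> \<Omega>"
  have E: "open E" "E \<subseteq> \<Omega>" unfolding E_def using J open_dom by auto
  have frE: "frontier E \<subseteq> ?C \<union> sphere q r"
  proof
    fix x assume x: "x \<in> frontier E"
    then have "x \<in> closure E" "x \<notin> E" using E(1) by (simp_all add: frontier_def interior_open)
    moreover have "closure E \<subseteq> closure (inside ?C)" "closure E \<subseteq> closure \<Omega>" unfolding E_def by (auto intro!: closure_mono)
    ultimately have "x \<in> closure (inside ?C)" "x \<in> closure \<Omega>" "x \<notin> E" by auto
    moreover have "closure (inside ?C) = inside ?C \<union> ?C" using J closure_Un_frontier by metis
    ultimately have "x \<in> ?C \<or> x \<in> inside ?C \<and> x \<in> closure \<Omega> - \<Omega>" unfolding E_def by blast
    moreover have "closure \<Omega> - \<Omega> \<subseteq> frontier \<Omega>" using open_dom by (simp add: frontier_def interior_open)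
    ultimately show "x \<in> ?C \<union> sphere q r" using fr H(2) by blast
  qed
  have circ: "z \<notin> \<Omega>" if "dist q z = R" for z
  proof (rule circular_hole_forces_circle[OF cC(1) \<gamma>(3,4) E frE hole(2) R GO(2)])
    show "z \<in> \<Omega>" if "r < dist q z" "dist q z < R" for z using A\<Omega> that unfolding A_def by blast
    show "0 < min e (R - r)" using e(1) R by simp
    show "z \<in> E" if z: "r < dist q z" "dist q z < r + min e (R - r)" for z
    proof -
      define x where "x = q + of_real (r / dist q z) * (z - q)"
      have d0: "dist q z > 0" using z(1) hole(2) by (rule less_trans[rotated])
      have qx: "dist q x = r" unfolding x_def using d0 hole(2) by (simp add: dist_norm norm_mult norm_divide norm_minus_commute)
      have "x - z = of_real (r / dist q z - 1) * (z - q)" unfolding x_def by (simp add: algebra_simps)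
      then have "dist x z = \<bar>r / dist q z - 1\<bar> * dist q z"
        by (metis dist_norm norm_mult norm_of_real dist_commute)
      moreover have "r / dist q z < 1" using d0 z(1) by simp
      ultimately have xz: "dist x z = dist q z - r" using d0 by (simp add: left_diff_distrib)
      have "x \<in> cball q r" "z \<in> ball x e" using qx xz z(2) by auto
      then have "z \<in> inside ?C" using e(2) by blast
      moreover have "z \<in> \<Omega>" using z A\<Omega> unfolding A_def by auto
      ultimately show ?thesis unfolding E_def by blast
    qed
    show "p \<notin> \<Omega>" "dist q p = R" using p(1) GO(1) R_def by auto
    show "dist q z = R" by (rule that)
  qed (assumption | rule lip)+
  have "sphere q R \<subseteq> ?G"
  proof
    fix z assume "z \<in> sphere q R"
    then have z: "dist q z = R" by simp
    have "z \<in> closure A"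
      unfolding closure_approachable
    proof (intro allI impI)
      fix e' :: real assume e': "0 < e'"
      have R0: "R > 0" using R hole(2) by simp
      have "max (r / R) (1 - e' / R) < 1" using R R0 e' by auto
      then obtain s where "max (r / R) (1 - e' / R) < s" "s < 1" using dense by blast
      then have s: "r / R < s" "s < 1" "1 - e' / R < s" by auto
      have s0: "0 < s" using s(1) hole(2) R0 by (meson divide_pos_pos less_trans)
      have n: "norm (z - q) = R" using z by (simp add: dist_norm norm_minus_commute)
      have "dist q (q + of_real s * (z - q)) = s * R" using s0 n by (simp add: dist_norm norm_mult)
      moreover have "r < s * R" "s * R < R" using s R0 by (auto simp: field_simps)
      ultimately have "q + of_real s * (z - q) \<in> A" unfolding A_def by simp
      moreover have "dist (q + of_real s * (z - q)) z < e'"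
      proof -
        have "q + of_real s * (z - q) - z = of_real (s - 1) * (z - q)" by (simp add: algebra_simps)
        then have "dist (q + of_real s * (z - q)) z = \<bar>s - 1\<bar> * R" by (metis dist_norm norm_mult norm_of_real n)
        also have "\<dots> < e'" using s R0 by (simp add: abs_if field_simps)
        finally show ?thesis .
      qed
      ultimately show "\<exists>y\<in>A. dist y z < e'" by blast
    qed
    then have "z \<in> closure \<Omega>" using closure_mono[OF A\<Omega>] by blast
    then have "z \<in> frontier \<Omega>" using circ[OF z] open_dom by (simp add: frontier_def interior_open)
    moreover have "z \<notin> sphere q r" using z R by simp
    ultimately show "z \<in> ?G" using fr by blast
  qed
  have "ball q R \<inter> ?G = {}" using Gout by force
  have "ball q R \<subseteq> inside ?G"
  proof (rule connected_meets_inside[OF connected_ball \<open>ball q R \<inter> ?G = {}\<close>])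
    have "q + of_real r \<in> sphere q r" using hole(2) by (simp add: dist_norm)
    then show "q + of_real r \<in> inside ?G" using G(4) by blast
    show "q + of_real r \<in> ball q R" using R hole(2) by (simp add: dist_norm)
  qed
  moreover have "inside ?G \<subseteq> ball q R"
  proof (rule ccontr)
    assume "\<not> inside ?G \<subseteq> ball q R"
    then have "inside ?G \<inter> frontier (ball q R) \<noteq> {}"
      using connected_Int_frontier[of "inside ?G" "ball q R"] JG \<open>ball q R \<subseteq> inside ?G\<close> R hole(2)
      by (metis Diff_eq_empty_iff Int_absorb1 ball_eq_empty less_trans not_le)
    moreover have "frontier (ball q R) = sphere q R" using R hole(2) by (intro frontier_ball) simp
    ultimately have "inside ?G \<inter> ?G \<noteq> {}" using \<open>sphere q R \<subseteq> ?G\<close> by blast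
    then show False using inside_no_overlap by blast
  qed
  ultimately have "inside ?G = ball q R" by blast
  then have "?G = sphere q R" using JG R hole(2) by (metis frontier_ball less_trans)
  then show False using not_circle by blast
qed

end

lemma convex_ellq: "convex {z. ellq E z \<le> k}" "convex {z. ellq E z < k}"
proof -
  let ?f = "\<lambda>z. Complex (E * Re z) (Im z)"
  have lin: "linear ?f" by (rule linearI) (auto simp: complex_eq_iff algebra_simps)
  have e: "ellq E z \<le> k \<longleftrightarrow> cmod (?f z) \<le> sqrt k" "ellq E z < k \<longleftrightarrow> cmod (?f z) < sqrt k" for z
    by (simp_all add: ellq_def cmod_def)
  have "{z. ellq E z \<le> k} = ?f -` cball 0 (sqrt k)" "{z. ellq E z < k} = ?f -` ball 0 (sqrt k)"
    unfolding e by auto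
  then show "convex {z. ellq E z \<le> k}" "convex {z. ellq E z < k}"
    using convex_linear_vimage[OF lin] by auto
qed

context ellipse_solution begin

text \<open>The curve is united with its images under both reflections, because the axis arguments
  need a symmetric \<open>K\<close>. The union need not be a Jordan curve; its sides are the
  component of 0 and the outside.\<close>

lemma ellipse_contradiction:
  assumes \<gamma>: "simple_path \<gamma>" "pathfinish \<gamma> = pathstart \<gamma>" "path_image \<gamma> \<subseteq> \<Omega>"
      "\<And>z. z \<in> path_image \<gamma> \<Longrightarrow> ux z = 0 \<and> uy z = 0"
    and G: "connected {z. ellq E z = 1}"
  shows False
proof -
  let ?C = "path_image \<gamma>"
  let ?D = "{z. ellq E z \<le> \<beta>\<^sup>2}"
  note J = Jordan_inside_outside[OF \<gamma>(1,2)]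
  have b1: "\<beta>\<^sup>2 < 1" using \<beta> by (simp add: power_less_one_iff)
  have cC: "compact ?C" using \<gamma>(1) by (simp add: compact_simple_path_image)
  have clO: "closure \<Omega> \<subseteq> {z. \<beta>\<^sup>2 \<le> ellq E z} \<inter> {z. ellq E z \<le> 1}"
    by (rule closure_minimal) (auto simp: dom intro!: closed_Collect_le continuous_on_const continuous_ellq closed_Int)
  have bG: "bounded {z. ellq E z \<le> 1}"
  proof (rule boundedI)
    fix z assume "z \<in> {z. ellq E z \<le> 1}"
    then have "(E * Re z)\<^sup>2 \<le> 1" "(Im z)\<^sup>2 \<le> 1" unfolding ellq_def
      by (auto intro: order_trans[rotated] add_increasing add_increasing2)
    then have *: "\<bar>E * Re z\<bar> \<le> 1" "\<bar>Im z\<bar> \<le> 1" by (simp_all only: abs_square_le_1)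
    then have "\<bar>Re z\<bar> \<le> 1 / E" using E by (simp add: abs_mult field_simps)
    then show "cmod z \<le> 1 / E + 1" using cmod_le[of z] *(2) by linarith
  qed
  have in1: "{z. ellq E z < 1} \<subseteq> inside {z. ellq E z = 1}"
  proof
    fix z assume z: "z \<in> {z. ellq E z < 1}"
    have "connected_component_set (- {z. ellq E z = 1}) z \<subseteq> {z. ellq E z \<le> 1}"
    proof (rule ccontr)
      assume n: "\<not> ?thesis"
      have zz: "z \<in> connected_component_set (- {z. ellq E z = 1}) z" using z by simp
      have "connected_component_set (- {z. ellq E z = 1}) z \<inter> frontier {z. ellq E z < 1} \<noteq> {}"
      proof (rule connected_Int_frontier[OF connected_connected_component])
        show "connected_component_set (- {z. ellq E z = 1}) z \<inter> {z. ellq E z < 1} \<noteq> {}" using zz z by blast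
        show "connected_component_set (- {z. ellq E z = 1}) z - {z. ellq E z < 1} \<noteq> {}" using n by fastforce
      qed
      moreover have "frontier {z. ellq E z < 1} \<subseteq> {z. ellq E z = 1}"
      proof -
        have "closure {z. ellq E z < 1} \<subseteq> {z. ellq E z \<le> 1}"
          by (rule closure_minimal) (auto intro!: closed_Collect_le continuous_on_const continuous_ellq)
        moreover have "open {z. ellq E z < 1}" by (intro open_Collect_less continuous_on_const continuous_ellq)
        ultimately show ?thesis by (auto simp: frontier_def interior_open)
      qed
      ultimately show False using connected_component_subset by fastforce
    qed
    then have "bounded (connected_component_set (- {z. ellq E z = 1}) z)" by (rule bounded_subset[OF bG])
    then show "z \<in> inside {z. ellq E z = 1}" using z unfolding inside_def by simp
  qed
  have frO: "frontier \<Omega> \<subseteq> ?D \<union> {z. ellq E z = 1}"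
    using clO open_dom by (auto simp: frontier_def interior_open dom)
  have zD: "0 \<in> ?D" by (simp add: ellq_def)
  have cD: "connected ?D" using convex_ellq(1) convex_connected by blast
  have "?D \<subseteq> inside ?C"
  proof (rule hole_inside_critical_curve(1)[OF \<gamma>])
    show "closed {z. ellq E z = 1}" by (intro closed_Collect_eq continuous_on_const continuous_ellq)
    show "\<Omega> \<subseteq> inside {z. ellq E z = 1}" using in1 by (auto simp: dom)
  qed (use cD G frO in \<open>auto simp: dom\<close>)
  then have zC: "0 \<in> inside ?C" using zD by blast
  define K where "K = ?C \<union> cnj ` ?C \<union> uminus ` ?C \<union> uminus ` cnj ` ?C"
  have ccnj: "continuous_on A cnj" for A by (intro continuous_intros)
  have cK: "compact K" unfolding K_def
    by (intro compact_Un compact_continuous_image cC continuous_on_cnj continuous_on_minus continuous_on_id ccnj)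
  have grad: "z \<in> \<Omega> \<and> ux z = 0 \<and> uy z = 0 \<and> u z = u (pathstart \<gamma>)" if z: "z \<in> K" for z
  proof -
    have base: "w \<in> \<Omega> \<and> ux w = 0 \<and> uy w = 0 \<and> u w = u (pathstart \<gamma>)" if "w \<in> ?C" for w
      using \<gamma> that critical_path_constant[OF _ \<gamma>(3,4) that pathstart_in_path_image] simple_path_imp_path by blast
    have neg: "- w \<in> \<Omega> \<and> ux (- w) = 0 \<and> uy (- w) = 0 \<and> u (- w) = u (pathstart \<gamma>)"
      if "w \<in> \<Omega> \<and> ux w = 0 \<and> uy w = 0 \<and> u w = u (pathstart \<gamma>)" for w
      using that grad_neg[of w] by (simp add: u_neg dom ellq_symm)
    have cn: "cnj w \<in> \<Omega> \<and> ux (cnj w) = 0 \<and> uy (cnj w) = 0 \<and> u (cnj w) = u (pathstart \<gamma>)"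
      if "w \<in> \<Omega> \<and> ux w = 0 \<and> uy w = 0 \<and> u w = u (pathstart \<gamma>)" for w
      using that grad_cnj[of w] by (simp add: u_cnj dom ellq_symm)
    show ?thesis using z base neg cn unfolding K_def by blast
  qed
  have K_cnj: "cnj z \<in> K" if "z \<in> K" for z using that unfolding K_def by auto
  have K_neg: "- z \<in> K" if "z \<in> K" for z using that unfolding K_def by auto
  define Si where "Si = connected_component_set (- K) 0"
  define So where "So = outside K"
  have K\<Omega>: "K \<subseteq> \<Omega>" using grad by blast
  have z0: "0 \<notin> K" using K\<Omega> zD by (auto simp: dom)
  have z0i: "0 \<in> inside K" using inside_mono[of ?C K] zC z0 unfolding K_def by blast
  have clK: "closed K" using cK by (rule compact_imp_closed)
  have crit: "\<And>z. z \<in> K \<Longrightarrow> ux z = 0 \<and> uy z = 0" using grad by blast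
  have DSi: "?D \<subseteq> Si" unfolding Si_def
    by (rule connected_component_maximal[OF zD cD]) (use K\<Omega> in \<open>auto simp: dom\<close>)
  have outSo: "z \<in> So" if "1 \<le> ellq E z" for z
  proof -
    have "K \<subseteq> {z. ellq E z < 1}" using K\<Omega> by (auto simp: dom)
    from subsetD[OF outside_subset_convex[OF convex_ellq(2) this], of z] show ?thesis using that unfolding So_def by simp
  qed
  have Siin: "Si \<subseteq> inside K" unfolding Si_def using inside_same_component[OF _ z0i] by blast
  have disj: "Si \<inter> So = {}" using Siin unfolding So_def by (metis disjoint_iff inside_Int_outside subset_iff)
  have cov: "Si \<union> So = - K"
  proof
    show "Si \<union> So \<subseteq> - K" using connected_component_subset[of "- K" 0] outside_no_overlap[of K] unfolding Si_def So_def by blast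
    \<comment> \<open>A further component of the complement would lie in the domain with its
      frontier in \<open>K\<close>, which is impossible for critical points. So the complement has
      exactly two sides.\<close>
    show "- K \<subseteq> Si \<union> So"
    proof (rule ccontr)
      assume "\<not> - K \<subseteq> Si \<union> So"
      then obtain x where x: "x \<notin> K" "x \<notin> Si" "x \<notin> So" by blast
      define T where "T = connected_component_set (- K) x"
      have xT: "x \<in> T" unfolding T_def using x(1) by simp
      have "x \<in> inside K" using x unfolding So_def by (metis ComplI UnE inside_Un_outside)
      then have "T \<subseteq> inside K" unfolding T_def using inside_same_component by blast
      then have TSo: "T \<inter> So = {}" unfolding So_def using inside_Int_outside[of K] by blast
      have T1: "ellq E z < 1" if "z \<in> T" for z
        by (rule ccontr) (use outSo[of z] that TSo in auto)
      have TSi: "T \<inter> Si = {}"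
        using x(2) connected_component_disjoint[of "- K" 0 x] x(1) z0 unfolding T_def Si_def
        by (metis ComplI connected_component_nonoverlap inf_commute mem_Collect_eq connected_component_sym_eq)
      have "\<beta>\<^sup>2 < ellq E z" if "z \<in> T" for z
      proof (rule ccontr)
        assume "\<not> \<beta>\<^sup>2 < ellq E z"
        then have "z \<in> Si" using DSi by auto
        then show False using that TSi by blast
      qed
      then have "T \<subseteq> \<Omega>" using T1 unfolding dom by blast
      moreover have "open T" unfolding T_def using clK by (intro open_connected_component) auto
      moreover have "frontier T \<subseteq> K"
        unfolding T_def using frontier_of_connected_component_subset[of "- K" x] frontier_subset_closed[OF clK] by (simp add: frontier_complement)
      ultimately show False using no_region_bounded_by_critical[OF cK K\<Omega> crit, of T] xT by blast
    qed
  qed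
  \<comment> \<open>The image of the component of 0 is connected, contains 0 and avoids
    \<open>K\<close>, hence is contained in that component.\<close>
  have Si_sym: "f z \<in> Si" if z: "z \<in> Si" and f: "continuous_on UNIV f" "f 0 = 0" "\<And>w. f w \<in> K \<Longrightarrow> w \<in> K" for z and f :: "complex \<Rightarrow> complex"
  proof -
    have "connected (f ` Si)" unfolding Si_def using f(1) by (intro connected_continuous_image connected_connected_component) (auto intro: continuous_on_subset)
    moreover have "0 \<in> f ` Si" using f(2) DSi zD by (metis image_eqI subset_iff)
    moreover have "f ` Si \<subseteq> - K" using f(3) connected_component_subset[of "- K" 0] unfolding Si_def by blast
    ultimately have "f ` Si \<subseteq> Si" unfolding Si_def by (intro connected_component_maximal)
    then show ?thesis using z by blast
  qed
  interpret critical_ellipse u ux uy a b b' d g \<Omega> E \<beta> "u (pathstart \<gamma>)" K Si So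
  proof unfold_locales
    show "compact K" "K \<subseteq> \<Omega>" using cK K\<Omega> by auto
    show "0 < u (pathstart \<gamma>)" using u_pos \<gamma>(3) by auto
    show "interior K = {}"
    proof (rule ccontr)
      assume "interior K \<noteq> {}"
      moreover have "frontier (interior K) \<subseteq> K" using clK
        by (metis closure_closed closure_mono frontier_def Diff_subset interior_subset order_trans)
      moreover have "interior K \<subseteq> \<Omega>" using K\<Omega> interior_subset by blast
      ultimately show False using no_region_bounded_by_critical[OF cK K\<Omega> crit, of "interior K"] by simp
    qed
    show "open Si" unfolding Si_def using clK by (intro open_connected_component) auto
    show "open So" unfolding So_def using clK by (rule open_outside)
    show "cnj z \<in> Si" if "z \<in> Si" for z
      by (rule Si_sym[OF that ccnj]) (use K_cnj in \<open>auto dest: K_cnj\<close>)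
    show "- z \<in> Si" if "z \<in> Si" for z
      by (rule Si_sym[OF that]) (use K_neg in \<open>auto intro!: continuous_intros dest: K_neg\<close>)
  qed (use grad K_cnj K_neg DSi outSo disj cov in blast)+
  show False by (rule no_critical_ellipse)
qed

end

section \<open>Analytic nonlinearities and annular domains\<close>

lemma real_analytic_C1:
  assumes "real_analytic f"
  shows "(f has_real_derivative deriv f t) (at t)" "isCont (deriv f) t"
proof -
  obtain r a where r: "r > 0" "\<And>s. \<bar>s - t\<bar> < r \<Longrightarrow> (\<lambda>n. a n * (s - t) ^ n) sums f s"
    using assms unfolding real_analytic_def by metis
  define F where "F x = (\<Sum>n. a n * x ^ n)" for x
  define F' where "F' x = (\<Sum>n. diffs a n * x ^ n)" for x
  have sm: "summable (\<lambda>n. a n * x ^ n)" if "norm x < r" for x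
    using r(2)[of "t + x"] that by (auto simp: sums_iff)
  have f: "f s = F (s - t)" if "\<bar>s - t\<bar> < r" for s using r(2)[OF that] unfolding F_def by (simp add: sums_iff)
  have dF: "(F has_real_derivative F' x) (at x)" if x: "\<bar>x\<bar> < r" for x
    unfolding F_def[abs_def] F'_def
    by (rule termdiffs_strong[where K="(\<bar>x\<bar> + r) / 2"]) (use x sm in auto)
  have df: "(f has_real_derivative F' (s - t)) (at s)" if s: "\<bar>s - t\<bar> < r" for s
  proof -
    have "((\<lambda>s. F (s - t)) has_real_derivative F' (s - t) * 1) (at s)"
      by (rule DERIV_chain2[where f=F and g="\<lambda>s. s - t", OF dF[OF s]]) (auto intro!: derivative_eq_intros)
    then have "((\<lambda>s. F (s - t)) has_real_derivative F' (s - t)) (at s)" by simp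
    moreover have "open {s. \<bar>s - t\<bar> < r}" by (intro open_Collect_less continuous_intros)
    ultimately show ?thesis using s f
      by (elim has_field_derivative_transform_within_open[where S="{s. \<bar>s - t\<bar> < r}"]) auto
  qed
  have deq: "deriv f s = F' (s - t)" if "\<bar>s - t\<bar> < r" for s using DERIV_imp_deriv[OF df[OF that]] .
  show "(f has_real_derivative deriv f t) (at t)" using df[of t] deq[of t] r(1) by simp
  have "isCont F' 0" unfolding F'_def[abs_def]
  proof (rule isCont_powser[where K="r / 2"])
    show "summable (\<lambda>n. diffs a n * (r / 2) ^ n)" by (rule termdiff_converges[where K=r]) (use r sm in auto)
  qed (use r in simp)
  then have "isCont (\<lambda>s. F' (s - t)) t" by (intro isCont_o2[of _ "\<lambda>s. s - t" F']) (auto intro!: continuous_intros)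
  moreover have "\<forall>\<^sub>F s in nhds t. deriv f s = F' (s - t)"
    unfolding eventually_nhds_metric dist_real_def using r(1) deq by blast
  ultimately show "isCont (deriv f) t" using isCont_cong[of "deriv f" "\<lambda>s. F' (s - t)" t] by simp
qed

text \<open>The zeros of a nonnegative decreasing function form an interval unbounded to the right.
  At its left end \<open>\<xi>\<close> the power series vanishes on one side, so all its
  coefficients are 0, and the zeros extend beyond \<open>\<xi>\<close>.\<close>

lemma real_analytic_zero:
  assumes an: "real_analytic f" and anti: "\<And>s t. s \<le> t \<Longrightarrow> f t \<le> f s" and nn: "\<And>t. 0 \<le> f t"
    and z: "f t0 = 0"
  shows "f t = 0"
proof (rule ccontr)
  assume nz: "f t \<noteq> 0"
  have up: "f s = 0" if "t0 \<le> s" for s using anti[OF that] nn[of s] z by simp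
  define \<xi> where "\<xi> = Inf {s. f s = 0}"
  have lb: "t \<le> s" if "f s = 0" for s using anti[of s t] nn[of t] nz that by (cases "s \<le> t") auto
  then have bdd: "bdd_below {s. f s = 0}" by (intro bdd_belowI[of _ t]) auto
  have right: "f s = 0" if "\<xi> < s" for s
  proof -
    have "\<exists>s'\<in>{s. f s = 0}. s' < s" by (rule cInf_lessD) (use z that in \<open>auto simp: \<xi>_def\<close>)
    then obtain s' where "f s' = 0" "s' < s" by blast
    then show ?thesis using anti[of s' s] nn[of s] by simp
  qed
  have left: "\<xi> \<le> s" if "f s = 0" for s unfolding \<xi>_def using cInf_lower[OF _ bdd] that by simp
  have "isCont f \<xi>" using real_analytic_C1(1)[OF an] DERIV_isCont by blast
  then have "(f \<longlongrightarrow> f \<xi>) (at_right \<xi>)" unfolding isCont_def using tendsto_mono[OF at_le] by blast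
  moreover have "((\<lambda>_. 0) \<longlongrightarrow> (0::real)) (at_right \<xi>)" by simp
  then have "(f \<longlongrightarrow> 0) (at_right \<xi>)"
    by (rule Lim_transform_eventually) (auto simp: eventually_at_filter right)
  ultimately have f\<xi>: "f \<xi> = 0" using tendsto_unique trivial_limit_at_right_real by blast
  obtain r a where r: "r > 0" "\<And>s. \<bar>s - \<xi>\<bar> < r \<Longrightarrow> (\<lambda>n. a n * (s - \<xi>) ^ n) sums f s"
    using an unfolding real_analytic_def by metis
  have "a n = 0" for n
  proof (cases "n = 0")
    case True
    have "(\<lambda>n. a n * (\<xi> - \<xi>) ^ n) sums a 0" using powser_sums_zero[of a] by simp
    then show ?thesis using True r(2)[of \<xi>] r(1) f\<xi> sums_unique2 by fastforce
  next
    case False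
    show ?thesis
    proof (rule ccontr)
      assume "a n \<noteq> 0"
      then obtain s where s: "0 < s" "\<And>z. z \<in> cball \<xi> s - {\<xi>} \<Longrightarrow> f z \<noteq> 0"
        using powser_0_nonzero[of r \<xi> a f n] r f\<xi> False by auto
      have "\<xi> + s \<in> cball \<xi> s - {\<xi>}" using s(1) by (simp add: dist_real_def)
      then show False using s(2) right[of "\<xi> + s"] s(1) by simp
    qed
  qed
  then have "f (\<xi> - r / 2) = 0" using r(2)[of "\<xi> - r / 2"] r(1) sums_unique2[OF _ sums_zero] by simp
  then show False using left r(1) by fastforce
qed

lemma C1_lipschitz_on_interval:
  fixes f :: "real \<Rightarrow> real"
  assumes d: "\<And>t. (f has_real_derivative f' t) (at t)" and c: "\<And>t. isCont f' t"
  shows "\<exists>M. \<forall>s\<in>{0..B}. \<forall>t\<in>{0..B}. \<bar>f s - f t\<bar> \<le> M * \<bar>s - t\<bar>"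
proof -
  have "compact (f' ` {0..B})" using c by (intro compact_continuous_image continuous_at_imp_continuous_on) auto
  from compact_imp_bounded[OF this] obtain M where M: "\<And>t. t \<in> {0..B} \<Longrightarrow> norm (f' t) \<le> M"
    unfolding bounded_iff by blast
  have "norm (f s - f t) \<le> M * norm (s - t)" if "s \<in> {0..B}" "t \<in> {0..B}" for s t
    by (rule field_differentiable_bound[of "{0..B}" f f'])
       (use that d M in \<open>auto intro: has_field_derivative_at_within\<close>)
  then show ?thesis by (intro exI[of _ M]) auto
qed

text \<open>An annular domain is given only through its frontier; that it lies inside the exterior
  curve follows because it comes close to the interior one and is connected.\<close>

lemma domain_inside:
  fixes \<Omega> :: "'a::euclidean_space set"
  assumes \<Omega>: "open \<Omega>" "connected \<Omega>" and fr: "frontier \<Omega> = A \<union> G" and A: "A \<subseteq> inside G" "A \<noteq> {}" and G: "closed G"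
  shows "\<Omega> \<subseteq> inside G"
proof -
  have d: "\<Omega> \<inter> G = {}" using fr \<Omega>(1) by (auto simp: frontier_def interior_open)
  obtain x where x: "x \<in> A" using A by blast
  then have "x \<in> closure \<Omega>" using fr by (auto simp: frontier_def)
  then have "inside G \<inter> \<Omega> \<noteq> {}"
    using open_Int_closure_eq_empty[OF open_inside[OF G], of \<Omega>] x A(1) by blast
  then show ?thesis using connected_meets_inside[OF \<Omega>(2) d] by blast
qed

text \<open>If the domain met the convex hole, it would lie in it, and so would the exterior curve;
  but then the hole's boundary \<open>A\<close> would be outside that curve.\<close>

lemma hole_disjoint:
  fixes \<Omega> :: "complex set"
  assumes \<Omega>: "open \<Omega>" "connected \<Omega>" and fr: "frontier \<Omega> = A \<union> G" and A: "A \<subseteq> inside G" "A \<noteq> {}" "A \<inter> G = {}"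
    and H: "open H" "convex H" "closure H \<subseteq> H \<union> A" "H \<inter> A = {}"
  shows "H \<inter> \<Omega> = {}"
proof (rule ccontr)
  assume ne: "H \<inter> \<Omega> \<noteq> {}"
  have "\<Omega> \<inter> A = {}" using fr \<Omega>(1) by (auto simp: frontier_def interior_open)
  moreover have "frontier H \<subseteq> A" using H by (auto simp: frontier_def interior_open)
  ultimately have "\<Omega> \<subseteq> H" using connected_Int_frontier[OF \<Omega>(2), of H] ne by blast
  have "G \<subseteq> closure \<Omega>" using fr by (auto simp: frontier_def)
  also have "\<dots> \<subseteq> H \<union> A" using closure_mono[OF \<open>\<Omega> \<subseteq> H\<close>] H(3) by blast
  finally have "G \<subseteq> H" using A(3) by blast
  then have "- H \<subseteq> outside G" using outside_subset_convex[OF H(2)] by blast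
  then have "A \<subseteq> outside G" using H(4) by blast
  then show False using A(1,2) inside_Int_outside[of G] by blast
qed

section \<open>Transfer from the plane to the complex numbers\<close>

lemma inner_real2: "x \<bullet> y = x $ 1 * y $ 1 + x $ 2 * y $ 2" for x y :: "real ^ 2"
  by (simp add: inner_vec_def sum_2)

lemma vector_real2: "(vector [a, b] :: real ^ 2) = a *\<^sub>R axis 1 1 + b *\<^sub>R axis 2 1"
  by (simp add: vec_eq_iff forall_2 axis_def)

lemma Basis_real2: "(Basis :: (real ^ 2) set) = {axis 1 1, axis 2 1}"
  by (auto simp: Basis_vec_def UNIV_2)

text \<open>A square matrix with orthonormal rows has orthonormal columns.\<close>

lemma orthonormal2:
  fixes v w :: "real ^ 2"
  assumes "norm v = 1" "norm w = 1" "v \<bullet> w = 0"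
  shows "v $ 1 * v $ 1 + w $ 1 * w $ 1 = 1" "v $ 2 * v $ 2 + w $ 2 * w $ 2 = 1" "v $ 1 * v $ 2 + w $ 1 * w $ 2 = 0"
proof -
  have a: "v $ 1 * v $ 1 + v $ 2 * v $ 2 = 1" "w $ 1 * w $ 1 + w $ 2 * w $ 2 = 1" "v $ 1 * w $ 1 + v $ 2 * w $ 2 = 0"
    using assms by (simp_all add: norm_eq_1 inner_real2)
  define D where "D = v $ 1 * w $ 2 - v $ 2 * w $ 1"
  have w: "w $ 2 = D * v $ 1" "w $ 1 = - D * v $ 2" unfolding D_def using a(1,3) by algebra+
  have "D\<^sup>2 = 1" unfolding D_def power2_eq_square using a by algebra
  then have D: "D * D = 1" by (simp add: power2_eq_square)
  show "v $ 1 * v $ 1 + w $ 1 * w $ 1 = 1" "v $ 2 * v $ 2 + w $ 2 * w $ 2 = 1" "v $ 1 * v $ 2 + w $ 1 * w $ 2 = 0"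
    using a(1) w D by algebra+
qed

text \<open>A similarity \<open>J\<close> from the complex plane, with origin \<open>p\<close>, axes
  \<open>v\<close> and \<open>w\<close> and scale \<open>B\<close>. It may reverse orientation. The
  scale is used to normalise the outer ellipse and turns the nonlinearity \<open>f\<close> into its
  multiple by the square of \<open>B\<close>.\<close>

locale frame =
  fixes p v w :: "real ^ 2" and B :: real
  assumes v: "norm v = 1" and w: "norm w = 1" and vw: "v \<bullet> w = 0" and B: "0 < B"
begin

definition J :: "complex \<Rightarrow> real ^ 2" where "J z = p + B *\<^sub>R (Re z *\<^sub>R v + Im z *\<^sub>R w)"

definition J' :: "real ^ 2 \<Rightarrow> complex" where "J' x = Complex (((x - p) \<bullet> v) / B) (((x - p) \<bullet> w) / B)"

lemma unit: "v \<bullet> v = 1" "w \<bullet> w = 1" "w \<bullet> v = 0"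
  using v w vw by (simp_all add: norm_eq_1 inner_commute)

lemma J_inner: "(J z - p) \<bullet> v = B * Re z" "(J z - p) \<bullet> w = B * Im z"
  by (simp_all add: J_def inner_add_left unit vw)

lemma J'_J: "J' (J z) = z"
  unfolding J'_def J_inner using B by simp

lemma J_J': "J (J' x) = x"
proof -
  note o = orthonormal2[OF v w vw]
  have "x - p = ((x - p) \<bullet> v) *\<^sub>R v + ((x - p) \<bullet> w) *\<^sub>R w"
    unfolding vec_eq_iff forall_2 inner_real2
    using o by (simp_all only: vector_add_component vector_scaleR_component real_scaleR_def) algebra
  then have "x = p + (((x - p) \<bullet> v) *\<^sub>R v + ((x - p) \<bullet> w) *\<^sub>R w)" by (metis add.commute diff_add_cancel)
  then show ?thesis unfolding J_def J'_def using B by (simp add: scaleR_right_distrib)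
qed

lemma dist_J: "dist (J x) (J y) = B * dist x y"
proof -
  have "J x - J y = B *\<^sub>R (Re (x - y) *\<^sub>R v + Im (x - y) *\<^sub>R w)"
    by (simp add: J_def algebra_simps)
  moreover have "(norm (Re (x - y) *\<^sub>R v + Im (x - y) *\<^sub>R w))\<^sup>2 = (Re (x - y))\<^sup>2 + (Im (x - y))\<^sup>2"
    by (subst power2_norm_eq_inner) (simp add: inner_add_left inner_add_right unit vw power2_eq_square)
  then have "norm (Re (x - y) *\<^sub>R v + Im (x - y) *\<^sub>R w) = cmod (x - y)"
    unfolding cmod_power2[symmetric] by (simp only: power2_eq_iff_nonneg norm_ge_zero)
  ultimately show ?thesis using B by (simp add: dist_norm)
qed

lemma dist_J': "dist (J' x) (J' y) = dist x y / B"
  using dist_J[of "J' x" "J' y"] B by (simp add: J_J')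

lemma continuous_J: "continuous_on A J" unfolding J_def by (intro continuous_intros)

lemma continuous_J': "continuous_on A J'" unfolding J'_def Complex_eq using B by (intro continuous_intros) auto

lemma vimage_J: "J -` S = J' ` S"
proof
  show "J -` S \<subseteq> J' ` S" using J'_J by (metis image_eqI subsetI vimageE)
  show "J' ` S \<subseteq> J -` S" using J_J' by auto
qed

lemma open_vimage_J: "open S \<Longrightarrow> open (J -` S)" and closed_vimage_J: "closed S \<Longrightarrow> closed (J -` S)"
  using continuous_open_vimage[of S J] continuous_closed_vimage[of S J] continuous_J[of UNIV]
  by (simp_all add: continuous_on_eq_continuous_at)

lemma closure_vimage_J: "closure (J -` S) = J -` closure S"
proof
  show "closure (J -` S) \<subseteq> J -` closure S"
    by (intro closure_minimal closed_vimage_J vimage_mono closure_subset closed_closure)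
  show "J -` closure S \<subseteq> closure (J -` S)"
    unfolding vimage_J by (rule image_closure_subset[OF continuous_J' closed_closure closure_subset])
qed

lemma frontier_vimage_J: "frontier (J -` S) = J -` frontier S"
  by (simp only: frontier_closures closure_vimage_J vimage_Compl[symmetric] vimage_Int)

lemma connected_vimage_J: "connected S \<Longrightarrow> connected (J -` S)"
  unfolding vimage_J by (rule connected_continuous_image[OF continuous_J'])

lemma bounded_vimage_J: assumes "bounded S" shows "bounded (J -` S)"
proof -
  obtain x e where "\<And>y. y \<in> S \<Longrightarrow> dist x y \<le> e" using assms unfolding bounded_def by blast
  then have "\<And>y. y \<in> J -` S \<Longrightarrow> dist (J' x) y \<le> e / B"
    using dist_J'[of x] J'_J B by (metis divide_right_mono less_imp_le vimageE)
  then show ?thesis unfolding bounded_def by blast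
qed

lemma sphere_vimage_J: "J -` sphere q r = sphere (J' q) (r / B)"
  using dist_J[of "J' q"] B by (auto simp: J_J' field_simps)

lemma inside_vimage_J: "J -` inside S \<subseteq> inside (J -` S)"
proof
  fix z assume "z \<in> J -` inside S"
  then have z: "J z \<notin> S" "bounded (connected_component_set (- S) (J z))" unfolding inside_def by auto
  let ?T = "connected_component_set (- (J -` S)) z"
  have "J ` ?T \<subseteq> connected_component_set (- S) (J z)"
  proof (rule connected_component_maximal)
    show "J z \<in> J ` ?T" using z(1) by auto
    show "connected (J ` ?T)" by (intro connected_continuous_image continuous_J connected_connected_component)
    show "J ` ?T \<subseteq> - S" using connected_component_subset[of "- (J -` S)" z] by blast
  qed
  then have "?T \<subseteq> J -` connected_component_set (- S) (J z)" by blast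
  then have "bounded ?T" using bounded_vimage_J[OF z(2)] bounded_subset by blast
  then show "z \<in> inside (J -` S)" using z(1) unfolding inside_def by simp
qed

lemma Jordan_curve_vimage:
  assumes "Jordan_curve C"
  obtains g where "simple_path g" "pathfinish g = pathstart g" "path_image g = J -` C"
proof -
  obtain h where h: "simple_path h" "pathfinish h = pathstart h" "path_image h = C"
    using assms unfolding Jordan_curve_def by blast
  show thesis
  proof (rule that[of "J' \<circ> h"])
    show "simple_path (J' \<circ> h)"
      by (rule simple_path_continuous_image[OF h(1) continuous_J']) (metis J_J' inj_onI)
    show "pathfinish (J' \<circ> h) = pathstart (J' \<circ> h)" using h(2) by (simp add: pathfinish_compose pathstart_compose)
    show "path_image (J' \<circ> h) = J -` C" using h(3) by (simp add: path_image_compose vimage_J)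
  qed
qed

lemma annular_vimage:
  assumes "annular_domain \<Omega> \<gamma>I \<gamma>E"
  shows "open (J -` \<Omega>)" "connected (J -` \<Omega>)" "bounded (J -` \<Omega>)"
    "frontier (J -` \<Omega>) = J -` \<gamma>I \<union> J -` \<gamma>E" "J -` \<gamma>I \<inter> J -` \<gamma>E = {}" "J -` \<gamma>I \<subseteq> inside (J -` \<gamma>E)"
    "J -` \<gamma>I \<noteq> {}" "closed (J -` \<gamma>E)" "J -` \<Omega> \<subseteq> inside (J -` \<gamma>E)"
proof -
  note A = assms[unfolded annular_domain_def]
  show 1: "open (J -` \<Omega>)" "connected (J -` \<Omega>)" "bounded (J -` \<Omega>)"
    using A by (auto intro: open_vimage_J connected_vimage_J bounded_vimage_J)
  show 2: "frontier (J -` \<Omega>) = J -` \<gamma>I \<union> J -` \<gamma>E" using A by (simp add: frontier_vimage_J)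
  show "J -` \<gamma>I \<inter> J -` \<gamma>E = {}" using A by auto
  show 3: "J -` \<gamma>I \<subseteq> inside (J -` \<gamma>E)" using A inside_vimage_J[of \<gamma>E] by blast
  obtain g where "simple_path g" "path_image g = J -` \<gamma>I" using A Jordan_curve_vimage by metis
  then show 4: "J -` \<gamma>I \<noteq> {}" using path_image_nonempty by metis
  obtain h where h: "simple_path h" "path_image h = J -` \<gamma>E" using A Jordan_curve_vimage by metis
  then show 5: "closed (J -` \<gamma>E)" using compact_simple_path_image compact_imp_closed by metis
  show "J -` \<Omega> \<subseteq> inside (J -` \<gamma>E)" by (rule domain_inside[OF 1(1,2) 2 3 4 5])
qed

text \<open>\<open>X\<close> and \<open>Y\<close> are the partial derivatives of \<open>q\<close>
  composed with \<open>J\<close>, in the real and the imaginary direction.\<close>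

definition X :: "(real ^ 2 \<Rightarrow> real) \<Rightarrow> complex \<Rightarrow> real" where
  "X q z = B * (partial_deriv (axis 1 1) q (J z) * v $ 1 + partial_deriv (axis 2 1) q (J z) * v $ 2)"

definition Y :: "(real ^ 2 \<Rightarrow> real) \<Rightarrow> complex \<Rightarrow> real" where
  "Y q z = B * (partial_deriv (axis 1 1) q (J z) * w $ 1 + partial_deriv (axis 2 1) q (J z) * w $ 2)"

lemma has_derivative_compose_J:
  assumes "q differentiable (at (J z))"
  shows "((\<lambda>z. q (J z)) has_derivative (\<lambda>h. X q z * Re h + Y q z * Im h)) (at z)"
proof -
  let ?F = "frechet_derivative q (at (J z))"
  have F: "(q has_derivative ?F) (at (J z))" using assms frechet_derivative_works by blast
  have lin: "linear ?F" using F has_derivative_linear by blast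
  have e: "x = x $ 1 *\<^sub>R axis 1 1 + x $ 2 *\<^sub>R axis 2 1" for x :: "real ^ 2"
    by (simp add: vec_eq_iff forall_2 axis_def)
  have Fx: "?F x = x $ 1 * ?F (axis 1 1) + x $ 2 * ?F (axis 2 1)" for x
    using linear_add[OF lin, of "x $ 1 *\<^sub>R axis 1 1" "x $ 2 *\<^sub>R axis 2 1"] linear_scale[OF lin] e[of x] by (metis real_scaleR_def)
  have "(J has_derivative (\<lambda>h. B *\<^sub>R (Re h *\<^sub>R v + Im h *\<^sub>R w))) (at z)"
    unfolding J_def[abs_def] by (auto intro!: derivative_eq_intros)
  from has_derivative_compose[OF this F] show ?thesis
  proof (rule has_derivative_eq_rhs, intro ext)
    fix h :: complex
    show "?F (B *\<^sub>R (Re h *\<^sub>R v + Im h *\<^sub>R w)) = X q z * Re h + Y q z * Im h"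
      by (subst Fx) (simp add: X_def Y_def partial_deriv_def algebra_simps)
  qed
qed

text \<open>Invariance of the trace: with the two partial derivatives of \<open>u\<close> for
  \<open>q1\<close> and \<open>q2\<close> this is the scaling of the Laplacian under the
  similarity.\<close>

lemma XY_orthonormal:
  fixes q1 q2 :: "real ^ 2 \<Rightarrow> real"
  shows "B * (v $ 1 * X q1 z + v $ 2 * X q2 z) + B * (w $ 1 * Y q1 z + w $ 2 * Y q2 z)
    = B\<^sup>2 * (partial_deriv (axis 1 1) q1 (J z) + partial_deriv (axis 2 1) q2 (J z))"
proof -
  note o = orthonormal2[OF v w vw]
  have "B * (v $ 1 * X q1 z + v $ 2 * X q2 z) + B * (w $ 1 * Y q1 z + w $ 2 * Y q2 z) =
    B\<^sup>2 * (partial_deriv (axis 1 1) q1 (J z) * (v $ 1 * v $ 1 + w $ 1 * w $ 1)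
      + partial_deriv (axis 2 1) q2 (J z) * (v $ 2 * v $ 2 + w $ 2 * w $ 2)
      + (partial_deriv (axis 2 1) q1 (J z) + partial_deriv (axis 1 1) q2 (J z)) * (v $ 1 * v $ 2 + w $ 1 * w $ 2))"
    unfolding X_def Y_def by (simp add: algebra_simps power2_eq_square)
  then show ?thesis unfolding o by simp
qed

end

context frame begin

definition lift :: "(real ^ 2) set \<Rightarrow> (real ^ 2 \<Rightarrow> real) \<Rightarrow> complex \<Rightarrow> real" where
  "lift \<Omega> u z = (if J z \<in> \<Omega> then u (J z) else 0)"

abbreviation D1 :: "(real ^ 2 \<Rightarrow> real) \<Rightarrow> real ^ 2 \<Rightarrow> real" where "D1 u \<equiv> partial_deriv (axis 1 1) u"
abbreviation D2 :: "(real ^ 2 \<Rightarrow> real) \<Rightarrow> real ^ 2 \<Rightarrow> real" where "D2 u \<equiv> partial_deriv (axis 2 1) u"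

lemma C2_data_lift:
  assumes u: "classical_solution f \<Omega> u" and \<Omega>: "open \<Omega>"
  defines "a \<equiv> \<lambda>z. B * (v $ 1 * X (D1 u) z + v $ 2 * X (D2 u) z)" and "b \<equiv> \<lambda>z. B * (v $ 1 * Y (D1 u) z + v $ 2 * Y (D2 u) z)"
    and "b' \<equiv> \<lambda>z. B * (w $ 1 * X (D1 u) z + w $ 2 * X (D2 u) z)" and "d \<equiv> \<lambda>z. B * (w $ 1 * Y (D1 u) z + w $ 2 * Y (D2 u) z)"
  shows "C2_data (lift \<Omega> u) (X u) (Y u) a b b' d (J -` \<Omega>)"
    "\<And>z. z \<in> J -` \<Omega> \<Longrightarrow> a z + d z = - (B\<^sup>2 * f (lift \<Omega> u z))"
    "continuous_on UNIV (lift \<Omega> u)"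
proof -
  have b12: "axis 1 1 \<in> (Basis :: (real ^ 2) set)" "axis 2 1 \<in> (Basis :: (real ^ 2) set)" unfolding Basis_real2 by auto
  have C2: "C_k_on (Suc (Suc 0)) u \<Omega>" using u unfolding classical_solution_def by (simp add: numeral_2_eq_2)
  have du: "u differentiable (at x)" if "x \<in> \<Omega>" for x using C2 that by auto
  have dD: "D1 u differentiable (at x)" "D2 u differentiable (at x)" if "x \<in> \<Omega>" for x using C2 that b12 by auto
  have cD: "continuous_on \<Omega> (D1 (D1 u))" "continuous_on \<Omega> (D1 (D2 u))" "continuous_on \<Omega> (D2 (D1 u))" "continuous_on \<Omega> (D2 (D2 u))"
    using C2 b12 by auto
  have cJ: "continuous_on (J -` \<Omega>) (\<lambda>z. q (J z))" if "continuous_on \<Omega> q" for q :: "real ^ 2 \<Rightarrow> real"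
    by (rule continuous_on_compose2[OF that continuous_J]) auto
  have cXY: "continuous_on (J -` \<Omega>) (X q)" "continuous_on (J -` \<Omega>) (Y q)"
    if "continuous_on \<Omega> (D1 q)" "continuous_on \<Omega> (D2 q)" for q
    unfolding X_def[abs_def] Y_def[abs_def] using cJ[OF that(1)] cJ[OF that(2)] by (auto intro!: continuous_intros)
  have oJ: "open (J -` \<Omega>)" by (rule open_vimage_J[OF \<Omega>])
  show "C2_data (lift \<Omega> u) (X u) (Y u) a b b' d (J -` \<Omega>)"
    unfolding C2_data_def
  proof (intro conjI ballI oJ)
    fix z assume z: "z \<in> J -` \<Omega>"
    show "(lift \<Omega> u has_derivative (\<lambda>h. X u z * Re h + Y u z * Im h)) (at z)"
      by (rule has_derivative_transform_within_open[OF has_derivative_compose_J oJ z]) (use z du in \<open>auto simp: lift_def\<close>)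
    have h: "((\<lambda>z. B * (k1 * D1 u (J z) + k2 * D2 u (J z))) has_derivative
        (\<lambda>h. (B * (k1 * X (D1 u) z + k2 * X (D2 u) z)) * Re h + (B * (k1 * Y (D1 u) z + k2 * Y (D2 u) z)) * Im h)) (at z)" for k1 k2
      using z by (intro has_derivative_eq_rhs[OF has_derivative_mult_right[OF has_derivative_add[OF
            has_derivative_mult_right[OF has_derivative_compose_J[OF dD(1)]] has_derivative_mult_right[OF has_derivative_compose_J[OF dD(2)]]]]])
        (auto simp: algebra_simps)
    show "(X u has_derivative (\<lambda>h. a z * Re h + b z * Im h)) (at z)"
      using h[of "v $ 1" "v $ 2"] unfolding X_def[of u, abs_def] a_def b_def by (simp add: mult.commute)
    show "(Y u has_derivative (\<lambda>h. b' z * Re h + d z * Im h)) (at z)"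
      using h[of "w $ 1" "w $ 2"] unfolding Y_def[of u, abs_def] b'_def d_def by (simp add: mult.commute)
  qed (use cXY cD in \<open>auto simp: a_def b_def b'_def d_def intro!: continuous_intros\<close>)
  show "a z + d z = - (B\<^sup>2 * f (lift \<Omega> u z))" if z: "z \<in> J -` \<Omega>" for z
  proof -
    have "laplacian u (J z) = D1 (D1 u) (J z) + D2 (D2 u) (J z)"
      unfolding laplacian_def Basis_real2 by (simp add: axis_eq_axis)
    moreover have "laplacian u (J z) + f (u (J z)) = 0" using u z unfolding classical_solution_def by simp
    ultimately have "D1 (D1 u) (J z) + D2 (D2 u) (J z) = - f (lift \<Omega> u z)" using z by (simp add: lift_def)
    moreover have "a z + d z = B\<^sup>2 * (D1 (D1 u) (J z) + D2 (D2 u) (J z))"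
      unfolding a_def d_def by (rule XY_orthonormal)
    ultimately show ?thesis by simp
  qed
  show "continuous_on UNIV (lift \<Omega> u)"
  proof -
    have "continuous_on (closure (J -` \<Omega>) \<union> - (J -` \<Omega>)) (\<lambda>z. if J z \<in> \<Omega> then u (J z) else 0)"
    proof (rule continuous_on_cases)
      show "closed (- (J -` \<Omega>))" using oJ by (rule closed_Compl)
      show "continuous_on (closure (J -` \<Omega>)) (\<lambda>z. u (J z))"
        unfolding closure_vimage_J using u unfolding classical_solution_def
        by (intro continuous_on_compose2[OF _ continuous_J]) auto
      show "\<forall>x. x \<in> closure (J -` \<Omega>) \<and> J x \<notin> \<Omega> \<or> x \<in> - (J -` \<Omega>) \<and> J x \<in> \<Omega> \<longrightarrow> u (J x) = 0"
        unfolding closure_vimage_J using u \<Omega> unfolding classical_solution_def by (auto simp: frontier_def interior_open)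
    qed auto
    moreover have "closure (J -` \<Omega>) \<union> - (J -` \<Omega>) = UNIV" using closure_subset[of "J -` \<Omega>"] by blast
    ultimately show ?thesis by (simp add: lift_def[abs_def])
  qed
qed

lemma elliptic_lift:
  assumes u: "classical_solution f \<Omega> u" and \<Omega>: "open \<Omega>" "bounded \<Omega>"
    and f: "\<And>t. 0 < f t" "\<And>s t. s \<le> t \<Longrightarrow> f t \<le> f s"
  obtains a b b' d where "elliptic_solution (lift \<Omega> u) (X u) (Y u) a b b' d (\<lambda>t. B\<^sup>2 * f t) (J -` \<Omega>)"
proof -
  note L = C2_data_lift[OF u \<Omega>(1)]
  note D = C2_dataD[OF L(1)]
  show thesis
  proof (rule that, unfold_locales)
    show "open (J -` \<Omega>)" "bounded (J -` \<Omega>)" using open_vimage_J bounded_vimage_J \<Omega> by auto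
    show "continuous_on UNIV (lift \<Omega> u)" by (rule L(3))
    show "lift \<Omega> u z = 0" if "z \<notin> J -` \<Omega>" for z using that by (simp add: lift_def)
    show "0 < B\<^sup>2 * f t" for t using f B by simp
    show "B\<^sup>2 * f t \<le> B\<^sup>2 * f s" if "s \<le> t" for s t using f(2)[OF that] by (intro mult_left_mono) auto
  qed (rule D(2) D(3) D(4) D(5) D(6) D(7) D(8) L(2); assumption?)+
qed

lemma critical_lift:
  assumes "J z \<in> critical_points \<Omega> u" shows "X u z = 0 \<and> Y u z = 0"
proof -
  have "(u has_derivative (\<lambda>h. 0)) (at (J z))" using assms unfolding critical_points_def gderiv_def by simp
  then have "frechet_derivative u (at (J z)) = (\<lambda>h. 0)" by (metis frechet_derivative_at)
  then show ?thesis unfolding X_def Y_def partial_deriv_def by simp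
qed

lemma harmonic_zero:
  assumes u: "classical_solution (\<lambda>_. 0) \<Omega> u" and \<Omega>: "open \<Omega>" "bounded \<Omega>" and x: "x \<in> \<Omega>"
  shows "u x = 0"
proof -
  note L = C2_data_lift[OF u \<Omega>(1)]
  define U where "U = lift \<Omega> u"
  have oJ: "open (J -` \<Omega>)" "bounded (J -` \<Omega>)" using open_vimage_J bounded_vimage_J \<Omega> by auto
  have cU: "continuous_on A U" for A using L(3) continuous_on_subset unfolding U_def by blast
  have lap: "has_lap U 0 z" if "z \<in> J -` \<Omega>" for z
    using C2_data_has_lap[OF L(1) that] L(2)[OF that] unfolding U_def by simp
  have out: "U z = 0" if "z \<notin> J -` \<Omega>" for z using that by (simp add: U_def lift_def)
  have z: "J' x \<in> J -` \<Omega>" using x by (simp add: J_J')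
  have "U (J' x) \<le> 0 + 0"
  proof (rule comparison_principle[OF oJ cU continuous_on_const _ _ z])
    show "\<exists>v0 L M. (\<forall>\<^sub>F z in nhds p. v0 z \<le> U z) \<and> v0 p = U p \<and> has_lap v0 L p \<and> has_lap (\<lambda>_. 0) M p \<and> M \<le> L"
      if "p \<in> J -` \<Omega>" for p
      using lap[OF that] has_lap_const[of 0 p] by (intro exI[of _ U] exI[of _ 0]) auto
  qed (use out in auto)
  moreover have "(\<lambda>_. 0) (J' x) \<le> U (J' x) + 0"
  proof (rule comparison_principle[OF oJ continuous_on_const cU _ _ z])
    show "\<exists>v0 L M. (\<forall>\<^sub>F z in nhds p. v0 z \<le> 0) \<and> v0 p = 0 \<and> has_lap v0 L p \<and> has_lap U M p \<and> M \<le> L"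
      if "p \<in> J -` \<Omega>" for p
      using lap[OF that] has_lap_const[of 0 p] by (intro exI[of _ "\<lambda>_. 0"] exI[of _ 0]) auto
  qed (use out in auto)
  ultimately show ?thesis using x by (simp add: U_def lift_def J_J')
qed

lemma circular_hole_case:
  assumes A: "annular_domain \<Omega> (sphere q r) \<gamma>E" and r: "0 < r" and nc: "\<And>R. \<gamma>E \<noteq> sphere q R"
    and u: "classical_solution f \<Omega> u" and f: "\<And>t. 0 < f t" "\<And>s t. s \<le> t \<Longrightarrow> f t \<le> f s" "real_analytic f"
    and C: "Jordan_curve C" "C \<subseteq> critical_points \<Omega> u"
  shows False
proof -
  have \<Omega>: "open \<Omega>" "bounded \<Omega>" using A unfolding annular_domain_def by auto
  note N = annular_vimage[OF A, unfolded sphere_vimage_J]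
  obtain a b b' d where "elliptic_solution (lift \<Omega> u) (X u) (Y u) a b b' d (\<lambda>t. B\<^sup>2 * f t) (J -` \<Omega>)"
    using elliptic_lift[OF u \<Omega> f(1,2)] by blast
  then interpret elliptic_solution "lift \<Omega> u" "X u" "Y u" a b b' d "\<lambda>t. B\<^sup>2 * f t" "J -` \<Omega>" .
  obtain \<gamma> where \<gamma>: "simple_path \<gamma>" "pathfinish \<gamma> = pathstart \<gamma>" "path_image \<gamma> = J -` C"
    using Jordan_curve_vimage[OF C(1)] by blast
  obtain G where G: "simple_path G" "pathfinish G = pathstart G" "path_image G = J -` \<gamma>E"
    using Jordan_curve_vimage A unfolding annular_domain_def by metis
  have r': "0 < r / B" using r B by simp
  show False
  proof (rule circular_hole_contradiction[OF \<gamma>(1,2) _ _ G(1,2), unfolded \<gamma>(3) G(3)])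
    show "J -` C \<subseteq> J -` \<Omega>" using C(2) unfolding critical_points_def by auto
    show "X u z = 0 \<and> Y u z = 0" if "z \<in> J -` C" for z using critical_lift C(2) that by blast
    show "J -` \<gamma>E \<inter> sphere (J' q) (r / B) = {}" using N(5) by blast
    show "sphere (J' q) (r / B) \<subseteq> inside (J -` \<gamma>E)" "J -` \<Omega> \<subseteq> inside (J -` \<gamma>E)" using N by auto
    show "ball (J' q) (r / B) \<inter> J -` \<Omega> = {}"
      by (rule hole_disjoint[OF N(1,2,4) N(6,7) N(5)]) (use r' in auto)
    show "frontier (J -` \<Omega>) = sphere (J' q) (r / B) \<union> J -` \<gamma>E" by (rule N(4))
    show "J -` \<gamma>E \<noteq> sphere (J' q) R" for R
    proof
      assume "J -` \<gamma>E = sphere (J' q) R"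
      then have "J -` \<gamma>E = J -` sphere q (B * R)" unfolding sphere_vimage_J using B by simp
      then have "\<gamma>E = sphere q (B * R)" by (metis J_J' surj_def surj_image_vimage_eq)
      then show False using nc by blast
    qed
    show "\<exists>M. \<forall>s\<in>{0..B'}. \<forall>t\<in>{0..B'}. \<bar>B\<^sup>2 * f s - B\<^sup>2 * f t\<bar> \<le> M * \<bar>s - t\<bar>" for B'
    proof -
      obtain M where M: "\<forall>s\<in>{0..B'}. \<forall>t\<in>{0..B'}. \<bar>f s - f t\<bar> \<le> M * \<bar>s - t\<bar>"
        using C1_lipschitz_on_interval[OF real_analytic_C1[OF f(3)]] by blast
      show ?thesis
      proof (intro exI[of _ "B\<^sup>2 * M"] ballI)
        fix s t assume "s \<in> {0..B'}" "t \<in> {0..B'}"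
        then have "B\<^sup>2 * \<bar>f s - f t\<bar> \<le> B\<^sup>2 * (M * \<bar>s - t\<bar>)" using M by (intro mult_left_mono) auto
        moreover have "\<bar>B\<^sup>2 * f s - B\<^sup>2 * f t\<bar> = B\<^sup>2 * \<bar>f s - f t\<bar>" by (simp add: abs_mult flip: right_diff_distrib)
        ultimately show "\<bar>B\<^sup>2 * f s - B\<^sup>2 * f t\<bar> \<le> B\<^sup>2 * M * \<bar>s - t\<bar>" by simp
      qed
    qed
  qed (rule r')
qed

end

section \<open>The three kinds of domains\<close>

text \<open>The scale \<open>s * b\<close> gives the outer ellipse the short semi-axis 1; the inner
  one then has \<open>\<beta> = 1 / s\<close>, and \<open>E\<close> is the common ratio
  \<open>b / a\<close> of the semi-axes.\<close>

lemma ellipse_case: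
  fixes c v w :: "real ^ 2"
  assumes A: "annular_domain \<Omega> (ellipse c v w a b) ((\<lambda>x. c + s *\<^sub>R (x - c)) ` ellipse c v w a b)"
    and vw: "norm v = 1" "norm w = 1" "v \<bullet> w = 0" and ab: "0 < b" "b < a" and s: "1 < s"
    and u: "classical_solution f \<Omega> u" and f: "\<And>t. 0 < f t" "\<And>s t. s \<le> t \<Longrightarrow> f t \<le> f s"
    and C: "Jordan_curve C" "C \<subseteq> critical_points \<Omega> u"
  shows False
proof -
  interpret frame c v w "s * b" using vw s ab by unfold_locales auto
  define E where "E = b / a"
  define \<beta> where "\<beta> = 1 / s"
  have E: "0 < E" "E < 1" and \<beta>: "0 < \<beta>" "\<beta> < 1" unfolding E_def \<beta>_def using ab s by auto
  have inner: "J -` ellipse c v w a b = {z. ellq E z = \<beta>\<^sup>2}"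
  proof -
    have "(s * b * Re z / a)\<^sup>2 + (s * b * Im z / b)\<^sup>2 = s\<^sup>2 * ellq E z" for z
      unfolding ellq_def E_def using ab by (simp add: power_mult_distrib power_divide algebra_simps)
    moreover have "s\<^sup>2 * x = 1 \<longleftrightarrow> x = \<beta>\<^sup>2" for x unfolding \<beta>_def using s by (auto simp: power_divide field_simps)
    ultimately show ?thesis unfolding ellipse_def by (auto simp: J_inner)
  qed
  let ?GE = "(\<lambda>x. c + s *\<^sub>R (x - c)) ` ellipse c v w a b"
  have outer: "J -` ?GE = {z. ellq E z = 1}"
  proof -
    have "J z \<in> ?GE \<longleftrightarrow> c + (1 / s) *\<^sub>R (J z - c) \<in> ellipse c v w a b" for z
    proof
      assume "J z \<in> ?GE"
      then obtain x where "x \<in> ellipse c v w a b" "J z = c + s *\<^sub>R (x - c)" by blast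
      then show "c + (1 / s) *\<^sub>R (J z - c) \<in> ellipse c v w a b" using s by simp
    next
      assume "c + (1 / s) *\<^sub>R (J z - c) \<in> ellipse c v w a b"
      then show "J z \<in> ?GE" using s by (intro image_eqI[of _ _ "c + (1 / s) *\<^sub>R (J z - c)"]) auto
    qed
    moreover have "(b * Re z / a)\<^sup>2 + (b * Im z / b)\<^sup>2 = ellq E z" for z
      unfolding ellq_def E_def using ab by (simp add: power_mult_distrib power_divide algebra_simps)
    ultimately show ?thesis unfolding ellipse_def using s by (auto simp: J_inner)
  qed
  note N = annular_vimage[OF A, unfolded inner outer]
  have \<Omega>: "open \<Omega>" "bounded \<Omega>" using A unfolding annular_domain_def by auto
  have b2: "0 < \<beta>\<^sup>2" "\<beta>\<^sup>2 < 1" using \<beta> by (auto simp: power_less_one_iff)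
  have fr: "frontier (J -` \<Omega>) \<inter> J -` \<Omega> = {}" using N(1) by (auto simp: frontier_def interior_open)
  have hole: "{z. ellq E z < \<beta>\<^sup>2} \<inter> J -` \<Omega> = {}"
  proof (rule hole_disjoint[OF N(1,2,4) N(6,7) N(5) _ convex_ellq(2)])
    show "open {z. ellq E z < \<beta>\<^sup>2}" by (intro open_Collect_less continuous_on_const continuous_ellq)
    have "closure {z. ellq E z < \<beta>\<^sup>2} \<subseteq> {z. ellq E z \<le> \<beta>\<^sup>2}"
      by (rule closure_minimal) (auto intro!: closed_Collect_le continuous_on_const continuous_ellq)
    then show "closure {z. ellq E z < \<beta>\<^sup>2} \<subseteq> {z. ellq E z < \<beta>\<^sup>2} \<union> {z. ellq E z = \<beta>\<^sup>2}" by force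
  qed auto
  have "- {z. ellq E z \<le> 1} \<subseteq> outside {z. ellq E z = 1}"
    by (rule outside_subset_convex[OF convex_ellq(1)]) auto
  then have "inside {z. ellq E z = 1} \<subseteq> {z. ellq E z \<le> 1}" using inside_Int_outside[of "{z. ellq E z = 1}"] by blast
  then have sub: "J -` \<Omega> \<subseteq> {z. \<beta>\<^sup>2 < ellq E z \<and> ellq E z < 1}"
    using N(9) hole fr unfolding N(4) by force
  \<comment> \<open>Only the frontier of the domain is prescribed. The open elliptical annulus is
    connected, as the image of a round one, and avoids this frontier, so it cannot be met only
    partly.\<close>
  have dom: "J -` \<Omega> = {z. \<beta>\<^sup>2 < ellq E z \<and> ellq E z < 1}"
  proof (rule antisym[OF sub], rule ccontr)
    let ?A = "{z. \<beta>\<^sup>2 < ellq E z \<and> ellq E z < 1}"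
    assume n: "\<not> ?A \<subseteq> J -` \<Omega>"
    let ?h = "\<lambda>z. Complex (Re z / E) (Im z)"
    have "?A = ?h ` {x. \<beta> < norm (x - 0) \<and> norm (x - 0) < 1}"
    proof -
      have e: "ellq E (?h z) = (cmod z)\<^sup>2" for z using E by (simp add: ellq_def cmod_power2)
      have k: "\<beta>\<^sup>2 < x\<^sup>2 \<and> x\<^sup>2 < 1 \<longleftrightarrow> \<beta> < x \<and> x < 1" if "0 \<le> x" for x :: real
        using that \<beta> power_strict_mono[of \<beta> x 2] power2_less_imp_less[of \<beta> x] by (auto simp: power_less_one_iff)
      have inv: "z = ?h (Complex (E * Re z) (Im z))" for z using E by (simp add: complex_eq_iff)
      show ?thesis
      proof
        show "?A \<subseteq> ?h ` {x. \<beta> < norm (x - 0) \<and> norm (x - 0) < 1}"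
        proof
          fix z assume "z \<in> ?A"
          moreover have "ellq E z = (cmod (Complex (E * Re z) (Im z)))\<^sup>2" using e inv by metis
          ultimately show "z \<in> ?h ` {x. \<beta> < norm (x - 0) \<and> norm (x - 0) < 1}"
            using inv[of z] k[of "cmod (Complex (E * Re z) (Im z))"] by (intro image_eqI[of _ _ "Complex (E * Re z) (Im z)"]) auto
        qed
        show "?h ` {x. \<beta> < norm (x - 0) \<and> norm (x - 0) < 1} \<subseteq> ?A"
        proof (rule image_subsetI)
          show "?h z \<in> ?A" if "z \<in> {x. \<beta> < norm (x - 0) \<and> norm (x - 0) < 1}" for z
            unfolding mem_Collect_eq e using k[of "cmod z"] that by simp
        qed
      qed
    qed
    moreover have "connected (?h ` {x. \<beta> < norm (x - 0) \<and> norm (x - 0) < 1})"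
      using E by (intro connected_continuous_image connected_annulus) (auto simp: Complex_eq intro!: continuous_intros)
    ultimately have "connected ?A" by simp
    moreover have "J -` \<Omega> \<noteq> {}" using N(4,7) by (metis Un_empty frontier_empty)
    then have "?A \<inter> J -` \<Omega> \<noteq> {}" using sub by blast
    moreover have "?A - J -` \<Omega> \<noteq> {}" using n by blast
    ultimately have "?A \<inter> frontier (J -` \<Omega>) \<noteq> {}" by (rule connected_Int_frontier)
    then show False unfolding N(4) by auto
  qed
  obtain a' b1 b' d where "elliptic_solution (lift \<Omega> u) (X u) (Y u) a' b1 b' d (\<lambda>t. (s * b)\<^sup>2 * f t) (J -` \<Omega>)"
    using elliptic_lift[OF u \<Omega> f] by blast
  then interpret elliptic_solution "lift \<Omega> u" "X u" "Y u" a' b1 b' d "\<lambda>t. (s * b)\<^sup>2 * f t" "J -` \<Omega>" .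
  interpret ellipse_solution "lift \<Omega> u" "X u" "Y u" a' b1 b' d "\<lambda>t. (s * b)\<^sup>2 * f t" "J -` \<Omega>" E \<beta>
    using E \<beta> dom by unfold_locales auto
  obtain \<gamma> where \<gamma>: "simple_path \<gamma>" "pathfinish \<gamma> = pathstart \<gamma>" "path_image \<gamma> = J -` C"
    using Jordan_curve_vimage[OF C(1)] by blast
  obtain G where G: "simple_path G" "path_image G = J -` ?GE"
    using Jordan_curve_vimage A unfolding annular_domain_def by metis
  show False
  proof (rule ellipse_contradiction[OF \<gamma>(1,2)], unfold \<gamma>(3))
    show "J -` C \<subseteq> J -` \<Omega>" using C(2) unfolding critical_points_def by auto
    show "X u z = 0 \<and> Y u z = 0" if "z \<in> J -` C" for z using critical_lift C(2) that by blast
    show "connected {z. ellq E z = 1}" using connected_simple_path_image[OF G(1)] unfolding G(2) outer .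
  qed
qed

text \<open>The line through both centres meets the first sphere in two opposite points, and their
  distances from \<open>q'\<close> differ as soon as \<open>q'\<close> is not
  \<open>q\<close>.\<close>

lemma sphere_neq:
  fixes q q' :: "real ^ 2"
  assumes "q \<noteq> q'" "dist q q' < R" shows "sphere q R \<noteq> sphere q' R'"
proof
  assume eq: "sphere q R = sphere q' R'"
  define e where "e = (1 / norm (q' - q)) *\<^sub>R (q' - q)"
  have n: "norm (q' - q) > 0" using assms by simp
  have e1: "norm e = 1" unfolding e_def using n by simp
  have e2: "q' - q = norm (q' - q) *\<^sub>R e" unfolding e_def using n by simp
  have R: "R > 0" using assms(2) zero_le_dist[of q q'] by linarith
  have "q + R *\<^sub>R e \<in> sphere q' R'" "q + (- R) *\<^sub>R e \<in> sphere q' R'"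
    using R e1 unfolding eq[symmetric] by (auto simp: dist_norm)
  then have on: "dist q' (q + R *\<^sub>R e) = R'" "dist q' (q + (- R) *\<^sub>R e) = R'" by auto
  have dst: "dist q' (q + k *\<^sub>R e) = \<bar>norm (q' - q) - k\<bar>" for k
  proof -
    have "q' - (q + k *\<^sub>R e) = (norm (q' - q) - k) *\<^sub>R e" using e2 by (simp add: algebra_simps)
    then show ?thesis using e1 by (simp add: dist_norm)
  qed
  have "\<bar>norm (q' - q) - R\<bar> = \<bar>norm (q' - q) + R\<bar>" using on dst[of R] dst[of "- R"] by simp
  then show False using n R by (simp add: abs_if split: if_splits)
qed

lemma ellipse_swap: "ellipse c v w a b = ellipse c w v b a"
  unfolding ellipse_def by (simp add: add.commute)

theorem theoremA:
  fixes \<Omega> :: "(real ^ 2) set" and f :: "real \<Rightarrow> real" and u :: "real ^ 2 \<Rightarrow> real"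
  assumes "eccentric_circle_annular_domain \<Omega> \<or> exterior_petal_like_domain \<Omega> \<or>
           scaled_ellipses_annular_domain \<Omega>"
    and "\<And>t. 0 \<le> f t"
    and "\<And>t. deriv f t \<le> 0"
    and "real_analytic f"
    and "classical_solution f \<Omega> u"
    and "\<not> u constant_on \<Omega>"
  shows "\<not> (\<exists>C. Jordan_curve C \<and> C \<subseteq> critical_points \<Omega> u)"
proof
  assume "\<exists>C. Jordan_curve C \<and> C \<subseteq> critical_points \<Omega> u"
  then obtain C where C: "Jordan_curve C" "C \<subseteq> critical_points \<Omega> u" by blast
  interpret std: frame 0 "axis 1 1" "axis 2 1" 1
    by unfold_locales (simp_all add: inner_axis_axis)
  have anti: "f t \<le> f s" if "s \<le> t" for s t
    by (rule DERIV_nonpos_imp_nonincreasing[OF that]) (use real_analytic_C1(1)[OF assms(4)] assms(3) in blast)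
  obtain \<gamma>I \<gamma>E where "annular_domain \<Omega> \<gamma>I \<gamma>E"
    using assms(1) unfolding eccentric_circle_annular_domain_def exterior_petal_like_domain_def scaled_ellipses_annular_domain_def by blast
  then have \<Omega>: "open \<Omega>" "bounded \<Omega>" unfolding annular_domain_def by auto
  have pos: "0 < f t" for t
  proof (rule ccontr)
    assume "\<not> 0 < f t"
    then have "f t = 0" using assms(2)[of t] by simp
    then have "f = (\<lambda>_. 0)" using real_analytic_zero[OF assms(4) anti assms(2)] by blast
    then have "u x = 0" if "x \<in> \<Omega>" for x using std.harmonic_zero[OF _ \<Omega> that] assms(5) by simp
    then show False using assms(6) unfolding constant_on_def by blast
  qed
  have circle: False if "annular_domain \<Omega> (sphere q r) \<gamma>E" "0 < r" "\<And>R. \<gamma>E \<noteq> sphere q R" for q r \<gamma>E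
    by (rule std.circular_hole_case[OF that assms(5) pos anti assms(4) C])
  consider "eccentric_circle_annular_domain \<Omega>" | "exterior_petal_like_domain \<Omega>" | "scaled_ellipses_annular_domain \<Omega>"
    using assms(1) by blast
  then show False
  proof cases
    case 1
    then obtain \<gamma>I \<gamma>E p a r R and A :: "real ^ 2 \<Rightarrow> real ^ 2" where
      D: "annular_domain \<Omega> \<gamma>I \<gamma>E" and A: "orthogonal_transformation A" and h: "0 < a" "0 < r" "a + r < R"
      and \<gamma>: "\<gamma>I = (\<lambda>x. p + A x) ` sphere (vector [a, 0]) r" "\<gamma>E = (\<lambda>x. p + A x) ` sphere (vector [0, 0]) R"
      unfolding eccentric_circle_annular_domain_def by blast
    have im: "(\<lambda>x. p + A x) ` sphere q k = sphere (p + A q) k" for q k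
    proof -
      have "(\<lambda>x. p + A x) ` sphere q k = (+) p ` (A ` sphere q k)" by auto
      moreover have "A ` sphere q k = sphere (A q) k"
      proof (intro antisym subsetI)
        fix y assume y: "y \<in> sphere (A q) k"
        obtain x where x: "y = A x" using orthogonal_transformation_surj[OF A] by (metis surj_def)
        have "dist (A q) (A x) = dist q x" using A unfolding orthogonal_transformation_isometry by blast
        then show "y \<in> A ` sphere q k" using x y by auto
      next
        fix y assume "y \<in> A ` sphere q k"
        then obtain x where x: "y = A x" "x \<in> sphere q k" by blast
        have "dist (A q) (A x) = dist q x" using A unfolding orthogonal_transformation_isometry by blast
        then show "y \<in> sphere (A q) k" using x by simp
      qed
      ultimately show ?thesis by (simp add: sphere_translation)
    qed
    have dst: "dist (p + A (vector [0, 0])) (p + A (vector [a, 0])) = a"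
    proof -
      have "dist (p + A (vector [0, 0])) (p + A (vector [a, 0])) = dist (vector [0, 0] :: real ^ 2) (vector [a, 0])"
        using A unfolding orthogonal_transformation_isometry by simp
      also have "\<dots> = norm (a *\<^sub>R axis 1 1 :: real ^ 2)" by (simp add: vector_real2 dist_norm)
      finally show ?thesis using h(1) by simp
    qed
    show False
    proof (rule circle[OF D[unfolded \<gamma>(1) im] h(2)])
      show "\<gamma>E \<noteq> sphere (p + A (vector [a, 0])) R'" for R'
        unfolding \<gamma>(2) im by (rule sphere_neq) (use dst h in auto)
    qed
  next
    case 2
    then obtain \<gamma>I \<gamma>E c r where "annular_domain \<Omega> \<gamma>I \<gamma>E" "\<not> (\<exists>q \<rho>. \<gamma>E = sphere q \<rho>)" "0 < r" "\<gamma>I = sphere c r"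
      unfolding exterior_petal_like_domain_def by blast
    then show False using circle by blast
  next
    case 3
    then obtain c v w a b s where D: "annular_domain \<Omega> (ellipse c v w a b) ((\<lambda>x. c + s *\<^sub>R (x - c)) ` ellipse c v w a b)"
      and h: "norm v = 1" "norm w = 1" "v \<bullet> w = 0" "0 < a" "0 < b" "a \<noteq> b" "1 < s"
      unfolding scaled_ellipses_annular_domain_def by blast
    show False
    proof (cases "b < a")
      case True
      then show False using ellipse_case[OF D h(1-3) h(5) _ h(7) assms(5) pos anti C] by blast
    next
      \<comment> \<open>The long axis is now along \<open>w\<close>; exchanging the two axes reduces
        this to the other case.\<close>
      case False
      then have "a < b" "w \<bullet> v = 0" using h by (auto simp: inner_commute)
      then show False
        using ellipse_case[OF D[unfolded ellipse_swap[of c v w a b]] h(2,1) _ h(4) _ h(7) assms(5) pos anti C] by blast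
    qed
  qed
qed

end
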